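(* Let $V$ be an affine surface over $\mathbb{C}$ with a good $\mathbb{C}^*$-action and an isolated normal singularity $p\in V$. The surface $V$ admits a non-trivial regular $\mathbb{C}_+$-action if and only if $(V,p)$ is a cyclic quotient singularity: $V\cong\mathbb{C}^2/G$ with $G\cong\mathbb{Z}/d\mathbb{Z}$ being a small finite subgroup of $\mathrm{GL}(2,\mathbb{C})$.
   Context: A regular $\mathbb{C}^*$-action on an algebraic variety is called good if it possesses a unique attractive fixed point. $\mathbb{C}_+$ denotes the additive group of $\mathbb{C}$. A small finite subgroup $G\subseteq\mathrm{GL}(2,\mathbb{C})$ is a finite subgroup containing no pseudo-reflection, where a pseudo-reflection is a non-identity linear transformation of finite order which is the identity on a hyperplane. A cyclic quotient surface singularity arises locally as the quotient of $\mathbb{C}^2$ by the group generated by $(x,y)\mapsto(\zeta x,\zeta^e y)$, where $\zeta$ is a primitive $d$-th root of unity and $\gcd(e,d)=1$. *)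

theory Defs
  imports "HOL-Analysis.Analysis" "HOL-Algebra.Algebra" "HOL-Library.Extended_Nat"
begin

section \<open>Spaces with functions\<close>

inductive_set gen_algebra :: "('a \<Rightarrow> complex) set \<Rightarrow> ('a \<Rightarrow> complex) set"
  for S :: "('a \<Rightarrow> complex) set" where
  gen: "f \<in> S \<Longrightarrow> f \<in> gen_algebra S"
| const: "(\<lambda>_. c) \<in> gen_algebra S"
| add: "f \<in> gen_algebra S \<Longrightarrow> g \<in> gen_algebra S \<Longrightarrow> (\<lambda>x. f x + g x) \<in> gen_algebra S"
| mult: "f \<in> gen_algebra S \<Longrightarrow> g \<in> gen_algebra S \<Longrightarrow> (\<lambda>x. f x * g x) \<in> gen_algebra S"

text \<open>
  A (classical) complex variety is represented by its set of points together with its global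
  regular functions; for affine varieties these determine the variety. Regular functions are total
  HOL functions, but only their values on the points matter: every \<open>regfuns\<close> below is closed
  under changing a function off \<open>points\<close>.
\<close>

record 'a fspace =
  points :: "'a set"
  regfuns :: "('a \<Rightarrow> complex) set"

definition gen_fspace :: "'a set \<Rightarrow> ('a \<Rightarrow> complex) set \<Rightarrow> 'a fspace" where
  "gen_fspace E S = \<lparr>points = E, regfuns = {f. \<exists>h \<in> gen_algebra S. \<forall>x\<in>E. f x = h x}\<rparr>"

definition prod_fspace :: "'a fspace \<Rightarrow> 'b fspace \<Rightarrow> ('a \<times> 'b) fspace" where
  "prod_fspace A B = gen_fspace (points A \<times> points B)
     ((\<lambda>f. f \<circ> fst) ` regfuns A \<union> (\<lambda>g. g \<circ> snd) ` regfuns B)"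

definition morphism :: "'a fspace \<Rightarrow> 'b fspace \<Rightarrow> ('a \<Rightarrow> 'b) \<Rightarrow> bool" where
  "morphism A B F \<longleftrightarrow> F \<in> points A \<rightarrow> points B \<and> (\<forall>g \<in> regfuns B. g \<circ> F \<in> regfuns A)"

definition isomorphism :: "'a fspace \<Rightarrow> 'b fspace \<Rightarrow> ('a \<Rightarrow> 'b) \<Rightarrow> bool" where
  "isomorphism A B F \<longleftrightarrow> bij_betw F (points A) (points B) \<and>
     morphism A B F \<and> morphism B A (inv_into (points A) F)"


section \<open>Affine varieties\<close>

definition poly_funs :: "(complex ^ 'n \<Rightarrow> complex) set" where
  "poly_funs = gen_algebra (range (\<lambda>i x. x $ i))"

definition affine_fspace :: "(complex ^ 'n) set \<Rightarrow> (complex ^ 'n) fspace" where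
  "affine_fspace V = gen_fspace V (range (\<lambda>i x. x $ i))"

definition zariski_closed :: "(complex ^ 'n) set \<Rightarrow> bool" where
  "zariski_closed E \<longleftrightarrow> (\<exists>F \<subseteq> poly_funs. E = {x. \<forall>f\<in>F. f x = 0})"

definition irreducible_closed :: "(complex ^ 'n) set \<Rightarrow> bool" where
  "irreducible_closed E \<longleftrightarrow> zariski_closed E \<and> E \<noteq> {} \<and>
     (\<forall>Y Z. zariski_closed Y \<and> zariski_closed Z \<and> E = Y \<union> Z \<longrightarrow> E = Y \<or> E = Z)"

definition zariski_dim :: "(complex ^ 'n) set \<Rightarrow> enat" where
  "zariski_dim V = Sup {enat k | k. \<exists>Z :: nat \<Rightarrow> (complex ^ 'n) set.
     (\<forall>i\<le>k. irreducible_closed (Z i) \<and> Z i \<subseteq> V) \<and> (\<forall>i<k. Z i \<subset> Z (Suc i))}"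

definition affine_surface :: "(complex ^ 'n) set \<Rightarrow> bool" where
  "affine_surface V \<longleftrightarrow> irreducible_closed V \<and> zariski_dim V = 2"

text \<open>The common kernel of the differentials at \<open>p\<close> of the polynomials vanishing on \<open>V\<close>.\<close>

definition tangent_space :: "(complex ^ 'n) set \<Rightarrow> complex ^ 'n \<Rightarrow> (complex ^ 'n) set" where
  "tangent_space V p = {v. \<forall>f \<in> poly_funs. (\<forall>x\<in>V. f x = 0) \<longrightarrow>
     ((\<lambda>t. f (p + t *s v)) has_field_derivative 0) (at 0)}"

definition singular_locus :: "(complex ^ 'n) set \<Rightarrow> (complex ^ 'n) set" where
  "singular_locus V = {p \<in> V. zariski_dim V < enat (vec.dim (tangent_space V p))}"

text \<open>
  Let \<open>V\<close> be irreducible. An element of the function field is given by a numerator \<open>f\<close> and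
  a denominator \<open>g\<close> in the coordinate ring, \<open>g\<close> not identically zero on \<open>V\<close>. An identity
  in the function field amounts to an identity of functions on the dense open set where no
  denominator vanishes.
\<close>

definition in_local_ring ::
    "(complex ^ 'n) set \<Rightarrow> complex ^ 'n \<Rightarrow> (complex ^ 'n \<Rightarrow> complex) \<Rightarrow> (complex ^ 'n \<Rightarrow> complex) \<Rightarrow> bool" where
  "in_local_ring V p f g \<longleftrightarrow>
     (\<exists>a \<in> regfuns (affine_fspace V). \<exists>b \<in> regfuns (affine_fspace V). b p \<noteq> 0 \<and> (\<forall>x\<in>V. f x * b x = a x * g x))"

definition integral_over_local_ring ::
    "(complex ^ 'n) set \<Rightarrow> complex ^ 'n \<Rightarrow> (complex ^ 'n \<Rightarrow> complex) \<Rightarrow> (complex ^ 'n \<Rightarrow> complex) \<Rightarrow> bool" where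
  "integral_over_local_ring V p f g \<longleftrightarrow>
     (\<exists>m>0. \<exists>a b :: nat \<Rightarrow> complex ^ 'n \<Rightarrow> complex.
        (\<forall>i<m. a i \<in> regfuns (affine_fspace V) \<and> b i \<in> regfuns (affine_fspace V) \<and> b i p \<noteq> 0) \<and>
        (\<forall>x\<in>V. g x \<noteq> 0 \<and> (\<forall>i<m. b i x \<noteq> 0) \<longrightarrow>
           (f x / g x) ^ m + (\<Sum>i<m. (a i x / b i x) * (f x / g x) ^ i) = 0))"

definition normal_at :: "(complex ^ 'n) set \<Rightarrow> complex ^ 'n \<Rightarrow> bool" where
  "normal_at V p \<longleftrightarrow>
     (\<forall>f \<in> regfuns (affine_fspace V). \<forall>g \<in> regfuns (affine_fspace V). (\<exists>x\<in>V. g x \<noteq> 0) \<longrightarrow>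
        integral_over_local_ring V p f g \<longrightarrow> in_local_ring V p f g)"

text \<open>
  \<open>isolated_in\<close> refers to the Euclidean topology; since the singular locus is
  Zariski closed, a point is isolated in it for that topology iff it is for the Zariski topology.
\<close>

definition isolated_normal_singularity :: "(complex ^ 'n) set \<Rightarrow> complex ^ 'n \<Rightarrow> bool" where
  "isolated_normal_singularity V p \<longleftrightarrow> p isolated_in singular_locus V \<and> normal_at V p"


section \<open>Actions of the multiplicative and the additive group\<close>

definition Cstar :: "complex monoid" where
  "Cstar = \<lparr>carrier = UNIV - {0}, monoid.mult = (*), one = 1\<rparr>"

definition Cplus :: "complex monoid" where
  "Cplus = \<lparr>carrier = UNIV, monoid.mult = (+), one = 0\<rparr>"

definition Cstar_space :: "complex fspace" where
  "Cstar_space = gen_fspace (UNIV - {0}) {\<lambda>t. t, inverse}"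

definition Cplus_space :: "complex fspace" where
  "Cplus_space = gen_fspace UNIV {\<lambda>t. t}"

definition regular_action ::
    "'g monoid \<Rightarrow> 'g fspace \<Rightarrow> 'a fspace \<Rightarrow> ('g \<Rightarrow> 'a \<Rightarrow> 'a) \<Rightarrow> bool" where
  "regular_action K KS E \<phi> \<longleftrightarrow>
     group_action K (points E) \<phi> \<and> morphism (prod_fspace KS E) E (\<lambda>(t, x). \<phi> t x)"

definition nontrivial_action :: "'g monoid \<Rightarrow> 'a fspace \<Rightarrow> ('g \<Rightarrow> 'a \<Rightarrow> 'a) \<Rightarrow> bool" where
  "nontrivial_action K E \<phi> \<longleftrightarrow> (\<exists>t \<in> carrier K. \<exists>x \<in> points E. \<phi> t x \<noteq> x)"

text \<open>
  Attraction is as \<open>t\<close> tends to \<open>0\<close>, in the Euclidean topology. An action that attracts as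
  \<open>t\<close> tends to infinity is brought into this form by inverting \<open>t\<close>.
\<close>

definition attractive_fixed_point ::
    "(complex ^ 'n) set \<Rightarrow> (complex \<Rightarrow> complex ^ 'n \<Rightarrow> complex ^ 'n) \<Rightarrow> complex ^ 'n \<Rightarrow> bool" where
  "attractive_fixed_point V \<phi> q \<longleftrightarrow> q \<in> V \<and> (\<forall>t \<in> carrier Cstar. \<phi> t q = q) \<and>
     (\<exists>U. open U \<and> q \<in> U \<and> (\<forall>x \<in> V \<inter> U. ((\<lambda>t. \<phi> t x) \<longlongrightarrow> q) (at 0)))"

definition good_Cstar_action ::
    "(complex ^ 'n) set \<Rightarrow> (complex \<Rightarrow> complex ^ 'n \<Rightarrow> complex ^ 'n) \<Rightarrow> bool" where
  "good_Cstar_action V \<phi> \<longleftrightarrow>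
     regular_action Cstar Cstar_space (affine_fspace V) \<phi> \<and> (\<exists>!q. attractive_fixed_point V \<phi> q)"


section \<open>Small linear groups and their quotients\<close>

definition GL :: "(complex ^ 'n ^ 'n) monoid" where
  "GL = \<lparr>carrier = {A. invertible A}, monoid.mult = (**), one = mat 1\<rparr>"

definition pseudo_reflection :: "complex ^ 'n ^ 'n \<Rightarrow> bool" where
  "pseudo_reflection A \<longleftrightarrow> A \<in> carrier GL \<and> A \<noteq> mat 1 \<and>
     (\<exists>k::nat. k > 0 \<and> A [^]\<^bsub>GL\<^esub> k = mat 1) \<and>
     (\<exists>H. vec.subspace H \<and> vec.dim H + 1 = CARD('n) \<and> (\<forall>x\<in>H. A *v x = x))"

definition small_finite_subgroup :: "(complex ^ 'n ^ 'n) set \<Rightarrow> bool" where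
  "small_finite_subgroup G \<longleftrightarrow> subgroup G GL \<and> finite G \<and> (\<forall>A\<in>G. \<not> pseudo_reflection A)"

definition lin_orbit :: "(complex ^ 'n ^ 'n) set \<Rightarrow> complex ^ 'n \<Rightarrow> (complex ^ 'n) set" where
  "lin_orbit G = Group_Action.orbit (GL\<lparr>carrier := G\<rparr>) (*v)"

text \<open>
  The quotient of affine space by a finite linear group \<open>G\<close>: the orbit space, whose regular
  functions are the functions induced by \<open>G\<close>-invariant polynomials.
\<close>

definition quotient_variety :: "(complex ^ 'n ^ 'n) set \<Rightarrow> (complex ^ 'n) set fspace" where
  "quotient_variety G = \<lparr>points = orbits (GL\<lparr>carrier := G\<rparr>) UNIV (*v),
     regfuns = {f. f \<circ> lin_orbit G \<in> poly_funs}\<rparr>"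

text \<open>The isomorphism is one of pointed varieties: it takes \<open>p\<close> to the image of the origin.\<close>

definition cyclic_quotient_singularity :: "(complex ^ 'n) set \<Rightarrow> complex ^ 'n \<Rightarrow> bool" where
  "cyclic_quotient_singularity V p \<longleftrightarrow>
     (\<exists>(G :: (complex ^ 2 ^ 2) set) (d :: nat) F.
        small_finite_subgroup G \<and> d \<ge> 1 \<and> GL\<lparr>carrier := G\<rparr> \<cong> integer_mod_group d \<and>
        isomorphism (affine_fspace V) (quotient_variety G) F \<and> F p = lin_orbit G 0)"

end

theory Submission
  imports Defs "HOL-Computational_Algebra.Computational_Algebra"
begin

text \<open>
  The good action grades the coordinate ring by the natural numbers, with the attractive fixed point \<open>q\<close>
  as vertex, and an isolated singularity must be this vertex. A nontrivial additive action degenerates,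
  by passing to its leading homogeneous part, to one that is normalized by the good action. On a
  general orbit the two actions give a dominant map \<open>(t, s) \<mapsto> \<phi> t (\<psi> s x)\<close>, which embeds the coordinate
  ring as a graded subalgebra of the polynomials in \<open>t\<close> and \<open>s\<close>; invariants and a slice of positive
  degree together with normality force this subalgebra to be spanned by the monomials of a
  two-dimensional cone in a lattice. A simplicial cone in the plane is a cyclic quotient of the
  quadrant, which gives the quotient map from the affine plane.

  Conversely, let \<open>v\<close> be an eigenvector of a generator of the cyclic group and \<open>l\<close> a linear form vanishing on \<open>v\<close>.
  For a suitable exponent \<open>e\<close> the action \<open>x \<mapsto> x + s l(x)\<^sup>e v\<close> commutes with the group, because smallness
  makes the character of \<open>l\<close> faithful; hence it descends to the quotient.
\<close>

hide_const (open) up_ring.coeff up_ring.monom Polynomials.degree Polynomials.lead_coeff Coset.order module.smult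
no_notation Polynomials.var ("X\<index>")
no_notation exact_seq_arrow
  (\<open>(\<open>indent=3 notation=\<open>mixfix exact_seq\<close>\<close>_ / \<longlongrightarrow>\<index> _)\<close> [1000, 60])
no_notation fps_nth (infixl \<open>$\<close> 75)

section \<open>Polynomial functions\<close>

text \<open>Attraction is assumed only on a Euclidean neighbourhood of \<open>q\<close>, while the
  grading has to hold on all of \<open>V\<close>. The gap is bridged by the fact that such a
  neighbourhood is Zariski dense in an irreducible variety; it is proved by elimination of
  variables, with convergent sequences of zeros in place of local analytic geometry. Normality is
  likewise given at one point only. A denominator that does not vanish at the vertex has a nonzero
  constant as its component of degree zero, so comparing homogeneous components turns membership in
  the local ring into membership in the coordinate ring, but only for homogeneous fractions; every
  use of normality is therefore arranged for monomials. Singularity enters through the tangent space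
  at \<open>q\<close>: were there no invariant of positive degree, all coordinates would be
  polynomials in a single function and that space would have dimension at most one. In the converse
  direction only one eigenvector of a generator is used, so the group need not be
  diagonalized.\<close>

lemma gen_algebra_uminus: "f \<in> gen_algebra S \<Longrightarrow> (\<lambda>x. - f x) \<in> gen_algebra S"
  using gen_algebra.mult[OF gen_algebra.const[of "-1"]] by fastforce

lemma gen_algebra_diff:
  "f \<in> gen_algebra S \<Longrightarrow> g \<in> gen_algebra S \<Longrightarrow> (\<lambda>x. f x - g x) \<in> gen_algebra S"
  using gen_algebra.add[OF _ gen_algebra_uminus] by fastforce

lemma gen_algebra_sum:
  assumes "\<And>i. i \<in> I \<Longrightarrow> f i \<in> gen_algebra S"
  shows "(\<lambda>x. \<Sum>i\<in>I. f i x) \<in> gen_algebra S"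
  using assms
proof (induction I rule: infinite_finite_induct)
  case (insert i I)
  then have "(\<lambda>x. f i x + (\<Sum>i\<in>I. f i x)) \<in> gen_algebra S"
    by (intro gen_algebra.add) auto
  with insert show ?case by simp
qed (auto intro: gen_algebra.const)

lemma gen_algebra_prod:
  assumes "\<And>i. i \<in> I \<Longrightarrow> f i \<in> gen_algebra S"
  shows "(\<lambda>x. \<Prod>i\<in>I. f i x) \<in> gen_algebra S"
  using assms
proof (induction I rule: infinite_finite_induct)
  case (insert i I)
  then have "(\<lambda>x. f i x * (\<Prod>i\<in>I. f i x)) \<in> gen_algebra S"
    by (intro gen_algebra.mult) auto
  with insert show ?case by simp
qed (auto intro: gen_algebra.const)

lemma gen_algebra_power: "f \<in> gen_algebra S \<Longrightarrow> (\<lambda>x. f x ^ k) \<in> gen_algebra S"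
  using gen_algebra_prod[of "{..<k}" "\<lambda>_. f"] by simp

lemma gen_algebra_subst:
  assumes "f \<in> gen_algebra S" "\<And>g. g \<in> S \<Longrightarrow> (\<lambda>x. g (h x)) \<in> gen_algebra S'"
  shows "(\<lambda>x. f (h x)) \<in> gen_algebra S'"
  using assms(1) by induction (auto intro: gen_algebra.intros assms(2))

lemma gen_algebra_mono: "S \<subseteq> S' \<Longrightarrow> gen_algebra S \<subseteq> gen_algebra S'"
proof
  fix f assume "S \<subseteq> S'" "f \<in> gen_algebra S"
  from this(2,1) show "f \<in> gen_algebra S'" by induction (auto intro: gen_algebra.intros)
qed

lemma gen_algebra_eq_on:
  assumes "f \<in> gen_algebra S" "\<And>g. g \<in> S \<Longrightarrow> g x = g y"
  shows "f x = f y"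
  using assms(1) by induction (auto simp: assms(2))

lemma gen_algebra_tendsto:
  assumes "f \<in> gen_algebra S" "\<And>g. g \<in> S \<Longrightarrow> ((\<lambda>k. g (X k)) \<longlongrightarrow> g x) F"
  shows "((\<lambda>k. f (X k)) \<longlongrightarrow> f x) F"
  using assms(1) by induction (auto intro: tendsto_intros assms(2))

lemma poly_eq_sum_le:
  fixes p :: "'a :: comm_semiring_1 poly"
  assumes "degree p \<le> d"
  shows "poly p x = (\<Sum>i\<le>d. coeff p i * x ^ i)"
proof -
  have "(\<Sum>i\<le>d. coeff p i * x ^ i) = (\<Sum>i\<le>degree p. coeff p i * x ^ i)"
    using assms by (intro sum.mono_neutral_right) (auto simp: coeff_eq_0)
  then show ?thesis by (simp add: poly_altdef)
qed

text \<open>This is the polynomial ring \<open>A[t]\<close>, an element being stored as the map from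
  points to its specialization. The uniform degree bound makes it a polynomial; finiteness at each
  point alone would allow infinitely many coefficient functions.\<close>

definition poly_family :: "('a \<Rightarrow> complex) set \<Rightarrow> ('a \<Rightarrow> complex poly) set" where
  "poly_family A = {F. (\<forall>i. (\<lambda>x. coeff (F x) i) \<in> A) \<and> (\<exists>d. \<forall>x. degree (F x) \<le> d)}"

lemma poly_familyD: "F \<in> poly_family A \<Longrightarrow> (\<lambda>x. coeff (F x) i) \<in> A"
  by (simp add: poly_family_def)

lemma poly_family_degree: "F \<in> poly_family A \<Longrightarrow> \<exists>d. \<forall>x. degree (F x) \<le> d"
  by (simp add: poly_family_def)

lemma poly_family_mono: "A \<subseteq> B \<Longrightarrow> F \<in> poly_family A \<Longrightarrow> F \<in> poly_family B"
  by (auto simp: poly_family_def)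

lemma poly_family_eval:
  assumes "F \<in> poly_family (gen_algebra S)" "g \<in> gen_algebra S"
  shows "(\<lambda>x. poly (F x) (g x)) \<in> gen_algebra S"
proof -
  obtain d where d: "\<And>x. degree (F x) \<le> d" using poly_family_degree[OF assms(1)] by auto
  have "(\<lambda>x. \<Sum>i\<le>d. coeff (F x) i * g x ^ i) \<in> gen_algebra S"
    by (intro gen_algebra_sum gen_algebra.mult gen_algebra_power poly_familyD assms)
  then show ?thesis by (simp add: poly_eq_sum_le[OF d])
qed

lemma poly_family_monom: "f \<in> gen_algebra S \<Longrightarrow> (\<lambda>x. monom (f x) k) \<in> poly_family (gen_algebra S)"
proof -
  assume f: "f \<in> gen_algebra S"
  have "(\<lambda>x. coeff (monom (f x) k) i) \<in> gen_algebra S" for i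
    by (cases "k = i") (auto simp: f gen_algebra.const)
  then show ?thesis by (auto simp: poly_family_def degree_monom_le intro!: exI[of _ k])
qed

lemma poly_family_const: "f \<in> gen_algebra S \<Longrightarrow> (\<lambda>x. [:f x:]) \<in> poly_family (gen_algebra S)"
  using poly_family_monom[of f S 0] by (simp add: monom_0)

lemma poly_family_add:
  assumes "F \<in> poly_family (gen_algebra S)" "G \<in> poly_family (gen_algebra S)"
  shows "(\<lambda>x. F x + G x) \<in> poly_family (gen_algebra S)"
proof -
  obtain d e where "\<And>x. degree (F x) \<le> d" "\<And>x. degree (G x) \<le> e"
    using poly_family_degree[OF assms(1)] poly_family_degree[OF assms(2)] by auto
  then have "\<And>x. degree (F x + G x) \<le> max d e"
    by (intro degree_add_le) (auto intro: le_max_iff_disj[THEN iffD2])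
  moreover have "(\<lambda>x. coeff (F x + G x) i) \<in> gen_algebra S" for i
    by (simp, intro gen_algebra.add poly_familyD assms)
  ultimately show ?thesis by (auto simp: poly_family_def)
qed

lemma poly_family_mult:
  assumes "F \<in> poly_family (gen_algebra S)" "G \<in> poly_family (gen_algebra S)"
  shows "(\<lambda>x. F x * G x) \<in> poly_family (gen_algebra S)"
proof -
  obtain d e where "\<And>x. degree (F x) \<le> d" "\<And>x. degree (G x) \<le> e"
    using poly_family_degree[OF assms(1)] poly_family_degree[OF assms(2)] by auto
  then have "\<And>x. degree (F x * G x) \<le> d + e"
    by (meson add_mono degree_mult_le order_trans)
  moreover have "(\<lambda>x. coeff (F x * G x) i) \<in> gen_algebra S" for i
    by (simp add: coeff_mult, intro gen_algebra_sum gen_algebra.mult poly_familyD assms)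
  ultimately show ?thesis by (auto simp: poly_family_def)
qed

lemma poly_family_smult:
  assumes "f \<in> gen_algebra S" "F \<in> poly_family (gen_algebra S)"
  shows "(\<lambda>x. smult (f x) (F x)) \<in> poly_family (gen_algebra S)"
  using poly_family_mult[OF poly_family_const[OF assms(1)] assms(2)] by simp

lemma poly_family_diff:
  assumes "F \<in> poly_family (gen_algebra S)" "G \<in> poly_family (gen_algebra S)"
  shows "(\<lambda>x. F x - G x) \<in> poly_family (gen_algebra S)"
  using poly_family_add[OF assms(1) poly_family_smult[OF gen_algebra.const[of "-1"] assms(2)]]
  by simp

text \<open>Only generators have to be followed along the curve, since \<open>poly_family\<close> is
  closed under sums and products. The relation \<open>R\<close> carries side conditions such as
  \<open>x \<in> V\<close>.\<close>

lemma gen_algebra_curve: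
  assumes "f \<in> gen_algebra S"
    and "\<And>g. g \<in> S \<Longrightarrow> \<exists>G\<in>poly_family (gen_algebra S'). \<forall>x t. R x t \<longrightarrow> g (h x t) = poly (G x) t"
  shows "\<exists>F\<in>poly_family (gen_algebra S'). \<forall>x t. R x t \<longrightarrow> f (h x t) = poly (F x) t"
  using assms(1)
proof induction
  case (gen f) then show ?case by (rule assms(2))
next
  case (const c)
  show ?case by (rule bexI[OF _ poly_family_const[OF gen_algebra.const[of c]]]) simp
next
  case (add f g)
  then obtain F G where "F \<in> poly_family (gen_algebra S')" "G \<in> poly_family (gen_algebra S')"
    "\<forall>x t. R x t \<longrightarrow> f (h x t) = poly (F x) t" "\<forall>x t. R x t \<longrightarrow> g (h x t) = poly (G x) t" by blast
  then show ?case by (intro bexI[OF _ poly_family_add[of F _ G]]) auto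
next
  case (mult f g)
  then obtain F G where "F \<in> poly_family (gen_algebra S')" "G \<in> poly_family (gen_algebra S')"
    "\<forall>x t. R x t \<longrightarrow> f (h x t) = poly (F x) t" "\<forall>x t. R x t \<longrightarrow> g (h x t) = poly (G x) t" by blast
  then show ?case by (intro bexI[OF _ poly_family_mult[of F _ G]]) auto
qed

text \<open>Identities coming from the multiplicative group are known for
  \<open>t \<noteq> 0\<close> only, which is still an infinite set of parameters.\<close>

lemma poly_eqI_nonzero:
  fixes p q :: "complex poly"
  assumes "\<And>t. t \<noteq> 0 \<Longrightarrow> poly p t = poly q t"
  shows "p = q"
proof (rule ccontr)
  assume "p \<noteq> q"
  then have "finite {t. poly (p - q) t = 0}" by (intro poly_roots_finite) auto
  moreover have "UNIV - {0} \<subseteq> {t. poly (p - q) t = 0}" using assms by auto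
  moreover have "infinite (UNIV - {0 :: complex})" by (simp add: infinite_UNIV_char_0)
  ultimately show False using finite_subset by blast
qed

lemma poly_nonroot_near:
  fixes p :: "complex poly"
  assumes "p \<noteq> 0" "e > 0"
  obtains t where "poly p t \<noteq> 0" "t \<noteq> z" "norm (t - z) < e"
proof -
  have "infinite (ball z e - {z})"
    using assms(2) by (meson countable_finite infinite_remove uncountable_ball)
  moreover have "finite {t. poly p t = 0}" by (rule poly_roots_finite[OF assms(1)])
  ultimately have "\<not> ball z e - {z} \<subseteq> {t. poly p t = 0}" using finite_subset by blast
  then obtain t where "t \<in> ball z e - {z}" "poly p t \<noteq> 0" by blast
  then show ?thesis using that[of t] by (auto simp: dist_norm norm_minus_commute)
qed

text \<open>Points are sequences of which only the first \<open>n\<close> entries matter, so that an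
  induction on the number of variables never changes the type.\<close>

definition coord_algebra :: "nat \<Rightarrow> ((nat \<Rightarrow> complex) \<Rightarrow> complex) set" where
  "coord_algebra n = gen_algebra ((\<lambda>i x. x i) ` {..<n})"

lemma coord_algebra_eq: "f \<in> coord_algebra n \<Longrightarrow> (\<And>i. i < n \<Longrightarrow> x i = y i) \<Longrightarrow> f x = f y"
  unfolding coord_algebra_def by (erule gen_algebra_eq_on) auto

lemma coord_algebra_tendsto:
  "f \<in> coord_algebra n \<Longrightarrow> (\<And>i. i < n \<Longrightarrow> (\<lambda>k. X k i) \<longlonglongrightarrow> x i) \<Longrightarrow> (\<lambda>k. f (X k)) \<longlonglongrightarrow> f x"
  unfolding coord_algebra_def by (erule gen_algebra_tendsto) auto

lemma coord_algebra_coord: "i < n \<Longrightarrow> (\<lambda>x. x i) \<in> coord_algebra n"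
  unfolding coord_algebra_def by (rule gen_algebra.gen) auto

lemma coord_algebra_mono: "m \<le> n \<Longrightarrow> coord_algebra m \<subseteq> coord_algebra n"
  unfolding coord_algebra_def by (rule gen_algebra_mono) auto

lemma coord_algebra_subst:
  assumes "f \<in> coord_algebra m" "\<And>i. i < m \<Longrightarrow> (\<lambda>x. h x i) \<in> coord_algebra n"
  shows "(\<lambda>x. f (h x)) \<in> coord_algebra n"
  using assms unfolding coord_algebra_def by (elim gen_algebra_subst) auto

lemma coord_algebra_const: "(\<lambda>_. c) \<in> coord_algebra n"
  unfolding coord_algebra_def by (rule gen_algebra.const)

lemma coord_algebra_add:
  "f \<in> coord_algebra n \<Longrightarrow> g \<in> coord_algebra n \<Longrightarrow> (\<lambda>x. f x + g x) \<in> coord_algebra n"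
  unfolding coord_algebra_def by (rule gen_algebra.add)

lemma coord_algebra_mult:
  "f \<in> coord_algebra n \<Longrightarrow> g \<in> coord_algebra n \<Longrightarrow> (\<lambda>x. f x * g x) \<in> coord_algebra n"
  unfolding coord_algebra_def by (rule gen_algebra.mult)

lemma coord_algebra_diff:
  "f \<in> coord_algebra n \<Longrightarrow> g \<in> coord_algebra n \<Longrightarrow> (\<lambda>x. f x - g x) \<in> coord_algebra n"
  unfolding coord_algebra_def by (rule gen_algebra_diff)

lemma coord_algebra_sum:
  "(\<And>i. i \<in> I \<Longrightarrow> f i \<in> coord_algebra n) \<Longrightarrow> (\<lambda>x. \<Sum>i\<in>I. f i x) \<in> coord_algebra n"
  unfolding coord_algebra_def by (rule gen_algebra_sum)

lemma coord_algebra_power: "f \<in> coord_algebra n \<Longrightarrow> (\<lambda>x. f x ^ k) \<in> coord_algebra n"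
  unfolding coord_algebra_def by (rule gen_algebra_power)

lemma coord_algebra_curve:
  assumes "f \<in> coord_algebra m"
    and "\<And>i. i < m \<Longrightarrow> \<exists>G\<in>poly_family (coord_algebra n). \<forall>x t. h x t i = poly (G x) t"
  shows "\<exists>F\<in>poly_family (coord_algebra n). \<forall>x t. f (h x t) = poly (F x) t"
  using gen_algebra_curve[of f "(\<lambda>i x. x i) ` {..<m}" "(\<lambda>i x. x i) ` {..<n}" "\<lambda>_ _. True" h]
    assms unfolding coord_algebra_def by auto

lemma coord_algebra_line:
  assumes "f \<in> coord_algebra n"
  shows "\<exists>F\<in>poly_family (coord_algebra n). \<forall>v t. f (\<lambda>i. x i + t * v i) = poly (F v) t"
proof (rule coord_algebra_curve[OF assms])
  fix i assume "i < n"
  then have "(\<lambda>v. [:x i:] + monom (v i) 1) \<in> poly_family (coord_algebra n)"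
    using coord_algebra_coord[of i n] unfolding coord_algebra_def
    by (intro poly_family_add poly_family_const poly_family_monom gen_algebra.const)
  then show "\<exists>G\<in>poly_family (coord_algebra n). \<forall>v t. x i + t * v i = poly (G v) t"
    by (rule bexI[rotated]) (simp add: poly_monom mult.commute)
qed

lemma coord_algebra_Suc:
  assumes "f \<in> coord_algebra (Suc n)"
  shows "\<exists>F\<in>poly_family (coord_algebra n). \<forall>x. f x = poly (F x) (x n)"
proof -
  have "\<exists>F\<in>poly_family (coord_algebra n). \<forall>x t. f (x(n := t)) = poly (F x) t"
  proof (rule coord_algebra_curve[OF assms])
    fix i assume i: "i < Suc n"
    show "\<exists>G\<in>poly_family (coord_algebra n). \<forall>x t. (x(n := t)) i = poly (G x) t"
    proof (cases "i = n")
      case True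
      have "(\<lambda>v. monom 1 1) \<in> poly_family (coord_algebra n)"
        unfolding coord_algebra_def by (intro poly_family_monom gen_algebra.const)
      then show ?thesis using True by (intro bexI) (auto simp: poly_monom)
    next
      case False
      then have "(\<lambda>v. [:v i:]) \<in> poly_family (coord_algebra n)"
        using i coord_algebra_coord[of i n] unfolding coord_algebra_def by (intro poly_family_const) auto
      then show ?thesis using False by (intro bexI) (auto simp: poly_monom)
    qed
  qed
  then obtain F where F: "F \<in> poly_family (coord_algebra n)" "\<And>x t. f (x(n := t)) = poly (F x) t" by blast
  have "f x = poly (F x) (x n)" for x using F(2)[of x "x n"] by simp
  with F(1) show ?thesis by blast
qed

lemma coord_algebra_eval:
  assumes "F \<in> poly_family (coord_algebra n)"
  shows "(\<lambda>x. poly (F x) (x n)) \<in> coord_algebra (Suc n)"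
proof -
  have "F \<in> poly_family (coord_algebra (Suc n))"
    by (rule poly_family_mono[OF coord_algebra_mono assms]) simp
  then show ?thesis using coord_algebra_coord[of n "Suc n"]
    unfolding coord_algebra_def by (intro poly_family_eval) auto
qed

lemma poly_family_upd:
  assumes "F \<in> poly_family (coord_algebra n)"
  shows "F (x(n := t)) = F x"
  by (intro poly_eqI coord_algebra_eq[OF poly_familyD[OF assms]]) simp

text \<open>On the line through \<open>q\<close> and \<open>z\<close> the function is a nonzero
  polynomial in the parameter, so its zeros do not accumulate at \<open>q\<close>.\<close>

lemma coord_algebra_nonzero_near:
  assumes "f \<in> coord_algebra n" "f z \<noteq> 0"
  shows "\<exists>X. (\<forall>k. f (X k) \<noteq> 0) \<and> (\<forall>i. (\<lambda>k. X k i) \<longlonglongrightarrow> q i)"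
proof -
  obtain F where F: "\<And>v t. f (\<lambda>i. q i + t * v i) = poly (F v) t"
    using coord_algebra_line[OF assms(1), of q] by blast
  define v where "v = (\<lambda>i. z i - q i)"
  have "poly (F v) 1 \<noteq> 0" using F[of 1 v] assms(2) by (simp add: v_def)
  then have "F v \<noteq> 0" by auto
  then have "\<exists>t. poly (F v) t \<noteq> 0 \<and> norm (t - 0) < inverse (real (Suc k))" for k
    by (rule poly_nonroot_near[of "F v" "inverse (real (Suc k))" 0]) auto
  then obtain T where T: "\<And>k. poly (F v) (T k) \<noteq> 0" "\<And>k. norm (T k) < inverse (real (Suc k))"
    by (metis diff_zero)
  have T0: "T \<longlonglongrightarrow> 0"
    by (rule Lim_null_comparison[OF _ LIMSEQ_inverse_real_of_nat]) (intro always_eventually allI less_imp_le T(2))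
  show ?thesis
  proof (intro exI[of _ "\<lambda>k i. q i + T k * v i"] conjI allI)
    fix i
    have "(\<lambda>k. q i + T k * v i) \<longlonglongrightarrow> q i + 0 * v i" by (intro tendsto_intros T0)
    then show "(\<lambda>k. q i + T k * v i) \<longlonglongrightarrow> q i" by simp
  qed (use T F in auto)
qed

section \<open>Zeros of prime ideals\<close>

text \<open>The degrees are bounded formally by \<open>a\<close> and \<open>b\<close>: a leading
  coefficient function may vanish at some points, so the true degree is of no use.\<close>

lemma coeff_mult_bounded:
  fixes p q :: "'a :: comm_semiring_0 poly"
  assumes "\<And>i. i > a \<Longrightarrow> coeff p i = 0" "\<And>i. i > b \<Longrightarrow> coeff q i = 0"
  shows "coeff (p * q) (a + b) = coeff p a * coeff q b"
proof -
  have "coeff (p * q) (a + b) = (\<Sum>i\<le>a+b. coeff p i * coeff q (a + b - i))" by (rule coeff_mult)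
  also have "\<dots> = (\<Sum>i\<in>{a}. coeff p i * coeff q (a + b - i))"
  proof (rule sum.mono_neutral_right)
    show "\<forall>i\<in>{..a + b} - {a}. coeff p i * coeff q (a + b - i) = 0"
    proof
      fix i assume "i \<in> {..a + b} - {a}"
      then consider "i > a" | "a + b - i > b" by fastforce
      then show "coeff p i * coeff q (a + b - i) = 0" by cases (auto simp: assms)
    qed
  qed auto
  finally show ?thesis by simp
qed

text \<open>One division valid at all points at once: the leading coefficient function is never
  inverted, its powers are collected in \<open>k\<close> instead. The bound on \<open>H\<close> is
  recorded because the top coefficient of the quotient is compared later.\<close>

lemma pseudo_division:
  fixes S
  defines "A \<equiv> gen_algebra S"
  assumes Q: "Q \<in> poly_family A" "\<And>x i. i > m \<Longrightarrow> coeff (Q x) i = 0"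
    and R: "R \<in> poly_family A" "\<And>x i. i \<ge> N \<Longrightarrow> coeff (R x) i = 0"
  shows "\<exists>k. \<exists>H\<in>poly_family A. \<exists>R'\<in>poly_family A.
    (\<forall>x. smult (coeff (Q x) m ^ k) (R x) = H x * Q x + R' x) \<and>
    (\<forall>x i. i \<ge> m \<longrightarrow> coeff (R' x) i = 0) \<and> (\<forall>x i. i + m \<ge> N \<longrightarrow> coeff (H x) i = 0)"
  using R
proof (induction N arbitrary: R)
  case 0
  have "(\<lambda>x. [:0:]) \<in> poly_family A" unfolding A_def by (intro poly_family_const gen_algebra.const)
  with 0 show ?case
    by (intro exI[of _ 0] bexI[of _ "\<lambda>x. 0"] bexI[of _ R]) auto
next
  case (Suc N)
  note pf = poly_family_monom[of _ S, folded A_def] poly_family_smult[of _ S, folded A_def]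
    poly_family_mult[of _ S, folded A_def] poly_family_diff[of _ S, folded A_def]
    poly_family_add[of _ S, folded A_def] poly_familyD[of _ A]
    gen_algebra_power[of _ S, folded A_def] gen_algebra.mult[of _ S, folded A_def]
  show ?case
  proof (cases "N < m")
    case True
    have "(\<lambda>x. [:0:]) \<in> poly_family A" unfolding A_def by (intro poly_family_const gen_algebra.const)
    with True Suc.prems show ?thesis
      by (intro exI[of _ 0] bexI[of _ "\<lambda>x. 0"] bexI[of _ R]) auto
  next
    case False
    \<comment> \<open>\<open>M\<close> is chosen so that its product with \<open>Q\<close> has the
      top term of the rescaled \<open>R\<close>; the difference has smaller formal degree.\<close>
    define M where "M = (\<lambda>x. monom (coeff (R x) N) (N - m))"
    define R1 where "R1 = (\<lambda>x. smult (coeff (Q x) m) (R x) - M x * Q x)"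
    have M: "M \<in> poly_family A" unfolding M_def by (intro pf Suc.prems)
    have R1: "R1 \<in> poly_family A" unfolding R1_def by (intro pf Suc.prems Q M)
    have "coeff (R1 x) i = 0" if "i \<ge> N" for x i
    proof (cases "i = N")
      case True
      have "coeff (M x * Q x) ((N - m) + m) = coeff (M x) (N - m) * coeff (Q x) m"
        by (rule coeff_mult_bounded) (auto simp: M_def Q(2))
      then show ?thesis using True False by (simp add: R1_def M_def)
    next
      case False
      have "coeff (M x * Q x) i = 0"
      proof -
        have "coeff (M x * Q x) i = coeff (R x) N * coeff (Q x) (i - (N - m))"
          using that by (auto simp: M_def coeff_monom_mult)
        also have "coeff (Q x) (i - (N - m)) = 0"
          using False that \<open>\<not> N < m\<close> by (intro Q(2)) auto
        finally show ?thesis by simp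
      qed
      then show ?thesis using False that Suc.prems(2)[of i x] by (simp add: R1_def)
    qed
    from Suc.IH[OF R1 this] obtain k H R' where H: "H \<in> poly_family A" "R' \<in> poly_family A"
      "\<And>x. smult (coeff (Q x) m ^ k) (R1 x) = H x * Q x + R' x"
      "\<And>x i. i \<ge> m \<Longrightarrow> coeff (R' x) i = 0" "\<And>x i. i + m \<ge> N \<Longrightarrow> coeff (H x) i = 0" by blast
    define H' where "H' = (\<lambda>x. H x + smult (coeff (Q x) m ^ k) (M x))"
    have "H' \<in> poly_family A" unfolding H'_def by (intro pf H M Q)
    moreover have "smult (coeff (Q x) m ^ Suc k) (R x) = H' x * Q x + R' x" for x
    proof -
      have "smult (coeff (Q x) m ^ Suc k) (R x) =
        smult (coeff (Q x) m ^ k) (R1 x) + smult (coeff (Q x) m ^ k) (M x * Q x)"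
        by (simp add: R1_def smult_diff_right mult.commute)
      then show ?thesis by (simp add: H(3) H'_def algebra_simps)
    qed
    moreover have "coeff (H' x) i = 0" if "i + m \<ge> Suc N" for x i
      using that H(5)[of i x] \<open>\<not> N < m\<close> by (auto simp: H'_def M_def)
    ultimately show ?thesis using H(2,4) by blast
  qed
qed

section \<open>Prime ideals of polynomial functions and elimination of the last variable\<close>

definition zero_locus :: "('a \<Rightarrow> complex) set \<Rightarrow> 'a set" where
  "zero_locus I = {x. \<forall>f\<in>I. f x = 0}"

lemma zero_locusD: "x \<in> zero_locus I \<Longrightarrow> f \<in> I \<Longrightarrow> f x = 0"
  by (simp add: zero_locus_def)

locale coord_prime =
  fixes n :: nat and I :: "((nat \<Rightarrow> complex) \<Rightarrow> complex) set"
  assumes sub: "I \<subseteq> coord_algebra n"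
    and zero: "(\<lambda>_. 0) \<in> I"
    and one: "(\<lambda>_. 1) \<notin> I"
    and add: "f \<in> I \<Longrightarrow> g \<in> I \<Longrightarrow> (\<lambda>x. f x + g x) \<in> I"
    and mult: "f \<in> I \<Longrightarrow> g \<in> coord_algebra n \<Longrightarrow> (\<lambda>x. f x * g x) \<in> I"
    and prime: "f \<in> coord_algebra n \<Longrightarrow> g \<in> coord_algebra n \<Longrightarrow> (\<lambda>x. f x * g x) \<in> I \<Longrightarrow> f \<in> I \<or> g \<in> I"
begin

lemma mult_left: "f \<in> I \<Longrightarrow> g \<in> coord_algebra n \<Longrightarrow> (\<lambda>x. g x * f x) \<in> I"
  using mult[of f g] by (simp add: mult.commute)

lemma diff: "f \<in> I \<Longrightarrow> g \<in> I \<Longrightarrow> (\<lambda>x. f x - g x) \<in> I"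
  using add[OF _ mult[OF _ coord_algebra_const[of "-1"]]] by fastforce

lemma sum: "(\<And>i. i \<in> K \<Longrightarrow> f i \<in> I) \<Longrightarrow> (\<lambda>x. \<Sum>i\<in>K. f i x) \<in> I"
proof (induction K rule: infinite_finite_induct)
  case (insert i K)
  then have "(\<lambda>x. f i x + (\<Sum>i\<in>K. f i x)) \<in> I" by (intro add) auto
  with insert show ?case by simp
qed (auto intro: zero)

lemma power_notin: "f \<in> coord_algebra n \<Longrightarrow> f \<notin> I \<Longrightarrow> (\<lambda>x. f x ^ k) \<notin> I"
proof (induction k)
  case (Suc k)
  then show ?case using prime[of f "\<lambda>x. f x ^ k"] coord_algebra_power[of f n k] by auto
qed (simp add: one)

end

text \<open>\<open>I \<inter> B\<close> is the elimination ideal, which belongs to the projection to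
  the first \<open>n\<close> coordinates; the aim is to lift its zeros back to zeros of
  \<open>I\<close>.\<close>

locale coord_prime_Suc = coord_prime "Suc n" I for n I
begin

abbreviation "B \<equiv> coord_algebra n"

lemma B_sub: "f \<in> B \<Longrightarrow> f \<in> coord_algebra (Suc n)"
  using coord_algebra_mono[of n "Suc n"] by auto

lemma base: "coord_prime n (I \<inter> B)"
proof
  fix f g assume "f \<in> B" "g \<in> B" "(\<lambda>x. f x * g x) \<in> I \<inter> B"
  then show "f \<in> I \<inter> B \<or> g \<in> I \<inter> B" using prime[of f g] B_sub by blast
qed (simp_all add: zero one add mult B_sub coord_algebra_const coord_algebra_add coord_algebra_mult)

lemma eval_in:
  assumes R: "R \<in> poly_family B" "\<And>i. (\<lambda>x. coeff (R x) i) \<in> I"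
  shows "(\<lambda>x. poly (R x) (x n)) \<in> I"
proof -
  obtain d where d: "\<And>x. degree (R x) \<le> d" using poly_family_degree[OF R(1)] by auto
  have "(\<lambda>x. \<Sum>i\<le>d. coeff (R x) i * x n ^ i) \<in> I"
    by (intro sum mult R coord_algebra_power coord_algebra_coord) auto
  then show ?thesis by (simp add: poly_eq_sum_le[OF d])
qed

text \<open>For \<open>J = I\<close> this is a minimal polynomial of the last coordinate over the
  fraction field of \<open>B\<close> modulo \<open>I \<inter> B\<close>, with denominators cleared.
  A larger ideal \<open>J\<close> serves to eliminate the last variable from a function.\<close>

definition min_degree :: "((nat \<Rightarrow> complex) \<Rightarrow> complex) set \<Rightarrow> nat \<Rightarrow> ((nat \<Rightarrow> complex) \<Rightarrow> complex poly) \<Rightarrow> bool" where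
  "min_degree J m P \<longleftrightarrow> P \<in> poly_family B \<and> (\<lambda>x. poly (P x) (x n)) \<in> J \<and>
     (\<forall>x i. i > m \<longrightarrow> coeff (P x) i = 0) \<and> (\<lambda>x. coeff (P x) m) \<notin> I \<and>
     (\<forall>R d. R \<in> poly_family B \<and> (\<lambda>x. poly (R x) (x n)) \<in> J \<and>
       (\<forall>x i. i > d \<longrightarrow> coeff (R x) i = 0) \<and> (\<lambda>x. coeff (R x) d) \<notin> I \<longrightarrow> m \<le> d)"

lemma min_degree_exists:
  assumes "F \<in> poly_family B" "(\<lambda>x. poly (F x) (x n)) \<in> J"
    "\<And>x i. i > d \<Longrightarrow> coeff (F x) i = 0" "(\<lambda>x. coeff (F x) d) \<notin> I"
  obtains m P where "min_degree J m P" "m \<le> d"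
proof -
  define Q where "Q = (\<lambda>d. \<exists>R. R \<in> poly_family B \<and> (\<lambda>x. poly (R x) (x n)) \<in> J \<and>
       (\<forall>x i. i > d \<longrightarrow> coeff (R x) i = 0) \<and> (\<lambda>x. coeff (R x) d) \<notin> I)"
  have Qd: "Q d" using assms unfolding Q_def by blast
  then have "Q (LEAST d. Q d)" by (rule LeastI)
  then obtain R where "R \<in> poly_family B \<and> (\<lambda>x. poly (R x) (x n)) \<in> J \<and>
       (\<forall>x i. i > (LEAST d. Q d) \<longrightarrow> coeff (R x) i = 0) \<and> (\<lambda>x. coeff (R x) (LEAST d. Q d)) \<notin> I"
    unfolding Q_def by blast
  moreover have "(LEAST d. Q d) \<le> e" if "Q e" for e using that by (rule Least_le)
  ultimately have "min_degree J (LEAST d. Q d) R" unfolding min_degree_def by (auto simp: Q_def)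
  moreover have "(LEAST d. Q d) \<le> d" using Qd by (rule Least_le)
  ultimately show ?thesis using that by blast
qed

text \<open>A top coefficient outside \<open>I\<close> would contradict minimality; so the top term
  lies in \<open>I\<close> and can be split off.\<close>

lemma min_degree_coeffs:
  assumes "min_degree J m P" "I \<subseteq> J" "\<And>f g. f \<in> J \<Longrightarrow> g \<in> J \<Longrightarrow> (\<lambda>x. f x - g x) \<in> J"
    and "R \<in> poly_family B" "(\<lambda>x. poly (R x) (x n)) \<in> J" "\<And>x i. i \<ge> N \<Longrightarrow> coeff (R x) i = 0" "N \<le> m"
  shows "(\<lambda>x. coeff (R x) i) \<in> I"
  using assms(4-)
proof (induction N arbitrary: R i)
  case 0 then show ?case by (simp add: zero)
next
  case (Suc N)
  have top: "(\<lambda>x. coeff (R x) N) \<in> I"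
  proof (rule ccontr)
    assume "(\<lambda>x. coeff (R x) N) \<notin> I"
    then have "m \<le> N" using assms(1) Suc.prems unfolding min_degree_def by (meson Suc_leI)
    then show False using Suc.prems by simp
  qed
  define M where "M = (\<lambda>x. monom (coeff (R x) N) N)"
  have "M \<in> poly_family B" unfolding M_def coord_algebra_def
    by (intro poly_family_monom poly_familyD Suc.prems(1)[unfolded coord_algebra_def])
  then have R': "(\<lambda>x. R x - M x) \<in> poly_family B"
    using Suc.prems(1) unfolding coord_algebra_def by (intro poly_family_diff)
  have "(\<lambda>x. coeff (R x) N * x n ^ N) \<in> I"
    by (intro mult top coord_algebra_power coord_algebra_coord) auto
  then have "(\<lambda>x. poly (R x) (x n) - coeff (R x) N * x n ^ N) \<in> J"
    using Suc.prems(2) assms(2) by (intro assms(3)) auto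
  then have "(\<lambda>x. poly (R x - M x) (x n)) \<in> J" by (simp add: M_def poly_monom)
  moreover have "coeff (R x - M x) i = 0" if "i \<ge> N" for x i
    using that Suc.prems(3)[of i x] by (cases "i = N") (auto simp: M_def)
  ultimately have IH: "(\<lambda>x. coeff (R x - M x) i) \<in> I" for i
    using Suc.IH[OF R'] Suc.prems(4) by auto
  show ?case
  proof (cases "i = N")
    case False then show ?thesis using IH[of i] by (simp add: M_def)
  qed (use top in simp)
qed

lemma min_degreeD:
  assumes "min_degree J m P"
  shows "P \<in> poly_family B" "(\<lambda>x. poly (P x) (x n)) \<in> J" "\<And>x i. i > m \<Longrightarrow> coeff (P x) i = 0"
    "(\<lambda>x. coeff (P x) m) \<notin> I" "(\<lambda>x. coeff (P x) m) \<in> B"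
  using assms poly_familyD[of P B] unfolding min_degree_def by auto

text \<open>The remainder has degree below \<open>m\<close> and still lies in \<open>J\<close>,
  hence vanishes modulo \<open>I\<close> coefficient by coefficient.\<close>

lemma min_degree_divide:
  assumes P: "min_degree J m P" and J: "I \<subseteq> J" "\<And>f g. f \<in> J \<Longrightarrow> g \<in> J \<Longrightarrow> (\<lambda>x. f x - g x) \<in> J"
    "\<And>f g. f \<in> J \<Longrightarrow> g \<in> coord_algebra (Suc n) \<Longrightarrow> (\<lambda>x. g x * f x) \<in> J"
    and R: "R \<in> poly_family B" "(\<lambda>x. poly (R x) (x n)) \<in> J" "\<And>x i. i \<ge> N \<Longrightarrow> coeff (R x) i = 0"
  shows "\<exists>k. \<exists>H\<in>poly_family B. \<exists>R'\<in>poly_family B.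
    (\<forall>x. smult (coeff (P x) m ^ k) (R x) = H x * P x + R' x) \<and>
    (\<forall>x i. i \<ge> m \<longrightarrow> coeff (R' x) i = 0) \<and> (\<forall>x i. i + m \<ge> N \<longrightarrow> coeff (H x) i = 0) \<and>
    (\<forall>i. (\<lambda>x. coeff (R' x) i) \<in> I)"
proof -
  have "\<exists>k. \<exists>H\<in>poly_family B. \<exists>R'\<in>poly_family B.
    (\<forall>x. smult (coeff (P x) m ^ k) (R x) = H x * P x + R' x) \<and>
    (\<forall>x i. i \<ge> m \<longrightarrow> coeff (R' x) i = 0) \<and> (\<forall>x i. i + m \<ge> N \<longrightarrow> coeff (H x) i = 0)"
    unfolding coord_algebra_def
    by (rule pseudo_division) (use min_degreeD[OF P] R in \<open>auto simp: coord_algebra_def\<close>)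
  then obtain k H R' where H: "H \<in> poly_family B" "R' \<in> poly_family B"
    "\<And>x. smult (coeff (P x) m ^ k) (R x) = H x * P x + R' x"
    "\<And>x i. i \<ge> m \<Longrightarrow> coeff (R' x) i = 0" "\<And>x i. i + m \<ge> N \<Longrightarrow> coeff (H x) i = 0"
    by blast
  have "(\<lambda>x. coeff (P x) m ^ k * poly (R x) (x n) - poly (H x) (x n) * poly (P x) (x n)) \<in> J"
    by (intro J(2,3) R min_degreeD[OF P] coord_algebra_eval H coord_algebra_power B_sub)
  also have "(\<lambda>x. coeff (P x) m ^ k * poly (R x) (x n) - poly (H x) (x n) * poly (P x) (x n))
     = (\<lambda>x. poly (R' x) (x n))"
  proof
    fix x show "coeff (P x) m ^ k * poly (R x) (x n) - poly (H x) (x n) * poly (P x) (x n) = poly (R' x) (x n)"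
      using arg_cong[OF H(3)[of x], of "\<lambda>p. poly p (x n)"] by simp
  qed
  finally have "(\<lambda>x. poly (R' x) (x n)) \<in> J" .
  then have "(\<lambda>x. coeff (R' x) i) \<in> I" for i
    using min_degree_coeffs[OF P J(1,2) H(2)] H(4) by blast
  with H show ?thesis by blast
qed

text \<open>Up to a power of the leading coefficient, every \<open>g\<close> in \<open>I\<close> is
  a multiple of \<open>P\<close> plus a remainder with coefficients in \<open>I\<close>. At
  \<open>x\<close> the leading coefficient is invertible and the remainder is zero.\<close>

lemma lift_point:
  assumes P: "min_degree I m P" and x: "x \<in> zero_locus (I \<inter> B)" "coeff (P x) m \<noteq> 0" "poly (P x) t = 0"
  shows "x(n := t) \<in> zero_locus I"
  unfolding zero_locus_def
proof safe
  fix g assume g: "g \<in> I"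
  then obtain G where G: "G \<in> poly_family B" "\<And>x. g x = poly (G x) (x n)"
    using coord_algebra_Suc[of g n] sub by blast
  then have gG: "g = (\<lambda>x. poly (G x) (x n))" by auto
  obtain d where "\<And>x. degree (G x) \<le> d" using poly_family_degree[OF G(1)] by auto
  then have d: "\<And>x i. i \<ge> Suc d \<Longrightarrow> coeff (G x) i = 0"
    by (meson Suc_le_lessD coeff_eq_0 le_less_trans)
  obtain k H R' where H: "R' \<in> poly_family B"
    "\<And>x. smult (coeff (P x) m ^ k) (G x) = H x * P x + R' x" "\<And>i. (\<lambda>x. coeff (R' x) i) \<in> I"
    using min_degree_divide[OF P order_refl diff mult_left G(1) g[unfolded gG] d] by blast
  have "coeff (R' x) i = 0" for i
    using x(1) H(3)[of i] poly_familyD[OF H(1), of i] by (auto simp: zero_locus_def)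
  then have "R' x = 0" by (intro poly_eqI) auto
  then have "smult (coeff (P x) m ^ k) (G x) = H x * P x" using H(2)[of x] by simp
  then have "coeff (P x) m ^ k * poly (G x) t = 0"
    using x(3) by (metis (no_types) mult_zero_right poly_mult poly_smult)
  then have "poly (G x) t = 0" using x(2) by simp
  then show "g (x(n := t)) = 0" by (simp add: G(2) poly_family_upd[OF G(1)])
qed

text \<open>A substitute for the norm of \<open>f\<close>, obtained from a polynomial of minimal degree in the ideal generated by \<open>I\<close> and \<open>f\<close>.\<close>

lemma base_multiple:
  assumes P: "min_degree I m P" and f: "f \<in> coord_algebra (Suc n)" "f \<notin> I"
  obtains b where "b \<in> B" "b \<notin> I" "\<And>x. x \<in> zero_locus I \<Longrightarrow> b x \<noteq> 0 \<Longrightarrow> f x \<noteq> 0"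
proof -
  define J where "J = {g. \<exists>h\<in>coord_algebra (Suc n). (\<lambda>x. g x - f x * h x) \<in> I}"
  have J0: "I \<subseteq> J"
    using coord_algebra_const[of 0 "Suc n"] by (auto simp: J_def intro!: bexI[of _ "\<lambda>_. 0"])
  have J1: "(\<lambda>x. g x - g' x) \<in> J" if "g \<in> J" "g' \<in> J" for g g'
  proof -
    from that obtain h where h: "h \<in> coord_algebra (Suc n)" "(\<lambda>x. g x - f x * h x) \<in> I"
      unfolding J_def by blast
    from that obtain h' where h': "h' \<in> coord_algebra (Suc n)" "(\<lambda>x. g' x - f x * h' x) \<in> I"
      unfolding J_def by blast
    have "(\<lambda>x. (g x - f x * h x) - (g' x - f x * h' x)) \<in> I" by (intro diff h h')
    also have "(\<lambda>x. (g x - f x * h x) - (g' x - f x * h' x)) = (\<lambda>x. (g x - g' x) - f x * (h x - h' x))"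
      by (auto simp: algebra_simps)
    finally show ?thesis using coord_algebra_diff[OF h(1) h'(1)] by (auto simp: J_def)
  qed
  have J2: "(\<lambda>x. g' x * g x) \<in> J" if "g \<in> J" "g' \<in> coord_algebra (Suc n)" for g g'
  proof -
    from that obtain h where h: "h \<in> coord_algebra (Suc n)" "(\<lambda>x. g x - f x * h x) \<in> I"
      unfolding J_def by blast
    have "(\<lambda>x. g' x * (g x - f x * h x)) \<in> I" by (intro mult_left h that)
    also have "(\<lambda>x. g' x * (g x - f x * h x)) = (\<lambda>x. g' x * g x - f x * (g' x * h x))"
      by (auto simp: algebra_simps)
    finally show ?thesis using coord_algebra_mult[OF that(2) h(1)] by (auto simp: J_def)
  qed
  have fJ: "f \<in> J" using coord_algebra_const[of 1 "Suc n"] zero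
    by (auto simp: J_def intro!: bexI[of _ "\<lambda>_. 1"])
  note Pd = min_degreeD[OF P]
  have PJ: "(\<lambda>x. poly (P x) (x n)) \<in> J" using Pd J0 by auto
  obtain m' Q where Q: "min_degree J m' Q" "m' \<le> m"
    using min_degree_exists[of P J m] Pd PJ by blast
  note Qd = min_degreeD[OF Q(1)]
  \<comment> \<open>If \<open>Q\<close> had positive degree, dividing \<open>P\<close> by it would
    put the quotient or \<open>Q\<close> itself into \<open>I\<close>, by primality. The quotient
    has degree below \<open>m\<close>, so its top coefficient would lie in \<open>I\<close>,
    contrary to that of \<open>P\<close> and \<open>Q\<close>; and if \<open>Q\<close> lay in
    \<open>I\<close>, dividing \<open>f\<close> by \<open>Q\<close> would put \<open>f\<close> into
    \<open>I\<close>.\<close>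
  have "m' = 0"
  proof (rule ccontr)
    assume m': "m' \<noteq> 0"
    obtain k H R' where H: "H \<in> poly_family B" "R' \<in> poly_family B"
      "\<And>x. smult (coeff (Q x) m' ^ k) (P x) = H x * Q x + R' x"
      "\<And>x i. i \<ge> m' \<Longrightarrow> coeff (R' x) i = 0" "\<And>x i. i + m' \<ge> Suc m \<Longrightarrow> coeff (H x) i = 0"
      "\<And>i. (\<lambda>x. coeff (R' x) i) \<in> I"
      using min_degree_divide[OF Q(1) J0 J1 J2 Pd(1) PJ Pd(3)[OF Suc_le_lessD]] by blast
    have "(\<lambda>x. coeff (Q x) m' ^ k * poly (P x) (x n) - poly (R' x) (x n)) \<in> I"
      by (intro diff mult_left Pd eval_in H coord_algebra_power B_sub Qd)
    also have "(\<lambda>x. coeff (Q x) m' ^ k * poly (P x) (x n) - poly (R' x) (x n))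
       = (\<lambda>x. poly (H x) (x n) * poly (Q x) (x n))"
    proof
      fix x show "coeff (Q x) m' ^ k * poly (P x) (x n) - poly (R' x) (x n) = poly (H x) (x n) * poly (Q x) (x n)"
        using arg_cong[OF H(3)[of x], of "\<lambda>p. poly p (x n)"] by simp
    qed
    finally consider "(\<lambda>x. poly (H x) (x n)) \<in> I" | "(\<lambda>x. poly (Q x) (x n)) \<in> I"
      using prime coord_algebra_eval H(1) Qd(1) by blast
    then show False
    proof cases
      case 1
      have "(\<lambda>x. coeff (H x) (m - m')) \<in> I"
        using min_degree_coeffs[OF P order_refl diff H(1) 1, of m] H(5) m' by fastforce
      then have "(\<lambda>x. coeff (H x) (m - m') * coeff (Q x) m') \<in> I"
        by (intro mult B_sub Qd)
      also have "(\<lambda>x. coeff (H x) (m - m') * coeff (Q x) m') = (\<lambda>x. coeff (Q x) m' ^ k * coeff (P x) m)"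
      proof
        fix x
        have "coeff (H x * Q x) ((m - m') + m') = coeff (H x) (m - m') * coeff (Q x) m'"
          using Q(2) by (intro coeff_mult_bounded H Qd) auto
        then have "coeff (H x * Q x) m = coeff (H x) (m - m') * coeff (Q x) m'" using Q(2) by simp
        moreover have "coeff (R' x) m = 0" using H(4) Q(2) by simp
        ultimately show "coeff (H x) (m - m') * coeff (Q x) m' = coeff (Q x) m' ^ k * coeff (P x) m"
          using arg_cong[OF H(3)[of x], of "\<lambda>p. coeff p m"] by simp
      qed
      finally show False
        using prime[of "\<lambda>x. coeff (Q x) m' ^ k" "\<lambda>x. coeff (P x) m"] Pd(4,5) Qd(4,5)
          power_notin[of "\<lambda>x. coeff (Q x) m'" k] B_sub coord_algebra_power[of _ n k] by blast
    next
      case 2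
      then have "m \<le> m'" using P Qd unfolding min_degree_def by blast
      obtain G where G: "G \<in> poly_family B" "\<And>x. f x = poly (G x) (x n)"
        using coord_algebra_Suc[of f n] f by blast
      then have fG: "f = (\<lambda>x. poly (G x) (x n))" by auto
      obtain d where "\<And>x. degree (G x) \<le> d" using poly_family_degree[OF G(1)] by auto
      then have d: "\<And>x i. i \<ge> Suc d \<Longrightarrow> coeff (G x) i = 0"
        by (meson Suc_le_lessD coeff_eq_0 le_less_trans)
      obtain k H R' where H: "H \<in> poly_family B" "R' \<in> poly_family B"
        "\<And>x. smult (coeff (Q x) m' ^ k) (G x) = H x * Q x + R' x"
        "\<And>i. (\<lambda>x. coeff (R' x) i) \<in> I"
        using min_degree_divide[OF Q(1) J0 J1 J2 G(1) fJ[unfolded fG] d] by blast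
      have "(\<lambda>x. poly (H x) (x n) * poly (Q x) (x n) + poly (R' x) (x n)) \<in> I"
        by (intro add mult_left 2 eval_in H coord_algebra_eval)
      also have "(\<lambda>x. poly (H x) (x n) * poly (Q x) (x n) + poly (R' x) (x n))
         = (\<lambda>x. coeff (Q x) m' ^ k * f x)"
      proof
        fix x show "poly (H x) (x n) * poly (Q x) (x n) + poly (R' x) (x n) = coeff (Q x) m' ^ k * f x"
          using arg_cong[OF H(3)[of x], of "\<lambda>p. poly p (x n)"] by (simp add: G(2))
      qed
      finally show False
        using prime[of "\<lambda>x. coeff (Q x) m' ^ k" f] f Qd(4,5)
          power_notin[of "\<lambda>x. coeff (Q x) m'" k] B_sub coord_algebra_power[of _ n k] by blast
    qed
  qed
  define b where "b = (\<lambda>x. coeff (Q x) 0)"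
  have ev: "poly (Q x) (x n) = b x" for x
  proof -
    have "Q x = [:b x:]" using Qd(3) \<open>m' = 0\<close>
      by (intro poly_eqI) (auto simp: b_def coeff_pCons split: nat.split)
    then show ?thesis by simp
  qed
  \<comment> \<open>\<open>Q\<close> is the constant polynomial \<open>b\<close> and lies in the
    ideal generated by \<open>I\<close> and \<open>f\<close>, so \<open>b\<close> is a multiple of
    \<open>f\<close> modulo \<open>I\<close>.\<close>
  obtain h where h: "(\<lambda>x. b x - f x * h x) \<in> I" using Qd(2) by (auto simp: J_def ev)
  show ?thesis
  proof (rule that)
    show "b \<in> B" "b \<notin> I" using Qd(4,5) \<open>m' = 0\<close> by (auto simp: b_def)
    fix x assume "x \<in> zero_locus I" "b x \<noteq> 0"
    moreover have "b x - f x * h x = 0" by (rule zero_locusD[OF \<open>x \<in> zero_locus I\<close> h])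
    ultimately show "f x \<noteq> 0" by auto
  qed
qed

end

section \<open>Root estimates and divisibility of complex polynomials\<close>

lemma coeff_bound_roots:
  fixes p :: "complex poly"
  assumes "lead_coeff p = 1" "\<And>t. poly p t = 0 \<Longrightarrow> norm t \<le> R" "R \<ge> 0"
  shows "norm (coeff p i) \<le> (1 + R) ^ degree p"
  using assms(1,2)
proof (induction "degree p" arbitrary: p i)
  case 0
  then obtain c where "p = [:c:]" by (metis degree_eq_zeroE)
  with 0 have "p = 1" by (simp add: one_pCons)
  then show ?case by (simp add: coeff_1)
next
  case (Suc d)
  have "\<not> constant (poly p)" using Suc.hyps(2) by (simp add: constant_degree)
  then obtain t where t: "poly p t = 0" using fundamental_theorem_of_algebra by blast
  then obtain q where q: "p = [:-t, 1:] * q" by (auto simp: poly_eq_0_iff_dvd)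
  have "q \<noteq> 0" using Suc.hyps(2) q by auto
  then have deg: "degree p = Suc (degree q)" by (simp add: q degree_mult_eq del: mult_pCons_left)
  have lead: "lead_coeff q = 1" using Suc.prems(1) q by (simp only: lead_coeff_mult) simp
  have IH: "norm (coeff q j) \<le> (1 + R) ^ d" for j
    using Suc.hyps(1)[of q j] Suc.hyps(2) deg lead Suc.prems(2) q by simp
  have "coeff p i = (case i of 0 \<Rightarrow> 0 | Suc j \<Rightarrow> coeff q j) - t * coeff q i"
    by (auto simp: q coeff_pCons split: nat.split)
  then have "norm (coeff p i) \<le> norm (case i of 0 \<Rightarrow> 0 | Suc j \<Rightarrow> coeff q j) + norm t * norm (coeff q i)"
    by (metis norm_mult norm_triangle_ineq4)
  also have "\<dots> \<le> (1 + R) ^ d + R * (1 + R) ^ d"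
    using IH Suc.prems(2)[OF t] assms(3) by (intro add_mono mult_mono) (auto split: nat.split)
  also have "\<dots> = (1 + R) ^ degree p" using Suc.hyps(2) by (simp add: algebra_simps flip: Suc.hyps(2))
  finally show ?case .
qed

text \<open>The value at \<open>z\<close> is the product of the differences to the roots, so the
  nearest root satisfies the bound. This replaces continuity of roots.\<close>

lemma monic_root_near:
  fixes p :: "complex poly"
  assumes "lead_coeff p = 1" "degree p > 0"
  shows "\<exists>t. poly p t = 0 \<and> norm (z - t) ^ degree p \<le> norm (poly p z)"
  using assms
proof (induction "degree p" arbitrary: p)
  case (Suc d)
  have "\<not> constant (poly p)" using Suc.hyps(2) by (simp add: constant_degree)
  then obtain t where t: "poly p t = 0" using fundamental_theorem_of_algebra by blast
  then obtain q where q: "p = [:-t, 1:] * q" by (auto simp: poly_eq_0_iff_dvd)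
  have "q \<noteq> 0" using Suc.hyps(2) q by auto
  then have deg: "degree p = Suc (degree q)" by (simp add: q degree_mult_eq del: mult_pCons_left)
  have lead: "lead_coeff q = 1" using Suc.prems(1) q by (simp only: lead_coeff_mult) simp
  have pz: "norm (poly p z) = norm (z - t) * norm (poly q z)" by (simp add: q norm_mult flip: left_diff_distrib)
  show ?case
  proof (cases "d = 0")
    case True
    then have "degree q = 0" using deg Suc.hyps(2) by simp
    then obtain c where "q = [:c:]" by (metis degree_eq_zeroE)
    with lead have "q = 1" by (simp add: one_pCons)
    then show ?thesis using t pz deg by (intro exI[of _ t]) simp
  next
    case False
    then obtain s where s: "poly q s = 0" "norm (z - s) ^ d \<le> norm (poly q z)"
      using Suc.hyps(1)[of q] lead deg Suc.hyps(2) by auto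
    show ?thesis
    proof (cases "norm (z - s) \<le> norm (z - t)")
      case True
      have "norm (z - s) * norm (z - s) ^ d \<le> norm (poly p z)"
        unfolding pz using s True by (intro mult_mono) auto
      then show ?thesis using s deg Suc.hyps(2) by (intro exI[of _ s]) (simp add: q)
    next
      case False
      then have "norm (z - t) ^ d \<le> norm (z - s) ^ d" by (intro power_mono) auto
      then have "norm (z - t) * norm (z - t) ^ d \<le> norm (poly p z)"
        unfolding pz using s by (intro mult_left_mono) auto
      then show ?thesis using t deg Suc.hyps(2) by (intro exI[of _ t]) simp
    qed
  qed
qed simp

text \<open>The bound extends by continuity to the zeros of \<open>p\<close>, so a root of
  \<open>p\<close> is a root of \<open>q\<close> and can be cancelled from both: removable
  singularities in one variable.\<close>

lemma dvd_of_bounded_quotient: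
  fixes p q :: "complex poly"
  assumes "p \<noteq> 0" "\<And>R. \<exists>C. \<forall>t. norm t \<le> R \<and> poly p t \<noteq> 0 \<longrightarrow> norm (poly q t) \<le> C * norm (poly p t)"
  shows "p dvd q"
  using assms
proof (induction "degree p" arbitrary: p q)
  case 0
  then show ?case by (simp add: is_unit_iff_degree unit_imp_dvd)
next
  case (Suc d)
  have cont: "norm (poly q t) \<le> C * norm (poly p t)"
    if False: "p \<noteq> 0" and C: "\<forall>t. norm t \<le> R + 1 \<and> poly p t \<noteq> 0 \<longrightarrow> norm (poly q t) \<le> C * norm (poly p t)" and t: "norm t \<le> R"
    for p q :: "complex poly" and C R t
  proof -
    have "\<forall>\<^sub>F s in at t. poly p s \<noteq> 0"
    proof -
      have "finite ({s. poly p s = 0} - {t})" using poly_roots_finite[OF False] by auto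
      then have "open (- ({s. poly p s = 0} - {t}))" by (intro open_Compl finite_imp_closed)
      then show ?thesis unfolding eventually_at_topological
        by (intro exI[of _ "- ({s. poly p s = 0} - {t})"]) auto
    qed
    moreover have "\<forall>\<^sub>F s in at t. norm s \<le> R + 1"
      using t by (auto simp: eventually_at intro!: exI[of _ 1] simp: dist_norm)
         (smt (verit) norm_triangle_sub)
    ultimately have "\<forall>\<^sub>F s in at t. norm (poly q s) \<le> C * norm (poly p s)"
      by eventually_elim (use C in auto)
    moreover have "((\<lambda>s. norm (poly q s)) \<longlongrightarrow> norm (poly q t)) (at t)"
      "((\<lambda>s. C * norm (poly p s)) \<longlongrightarrow> C * norm (poly p t)) (at t)"
      by (intro tendsto_intros isContD poly_isCont)+
    ultimately show ?thesis by (intro tendsto_le[of "at t"]) auto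
  qed
  have "\<not> constant (poly p)" using Suc.hyps(2) by (simp add: constant_degree)
  then obtain r where r: "poly p r = 0" using fundamental_theorem_of_algebra by blast
  then obtain p' where p': "p = [:-r, 1:] * p'" by (auto simp: poly_eq_0_iff_dvd)
  obtain C0 where "\<forall>t. norm t \<le> norm r + 1 \<and> poly p t \<noteq> 0 \<longrightarrow> norm (poly q t) \<le> C0 * norm (poly p t)"
    using Suc.prems(2) by blast
  then have "norm (poly q r) \<le> C0 * norm (poly p r)" by (rule cont[OF Suc.prems(1)]) simp
  then have "poly q r = 0" using r by simp
  then obtain q' where q': "q = [:-r, 1:] * q'" by (auto simp: poly_eq_0_iff_dvd)
  have p'0: "p' \<noteq> 0" using Suc.prems(1) p' by auto
  have "p' dvd q'"
  proof (rule Suc.hyps(1))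
    show "d = degree p'" using Suc.hyps(2) p'0 by (simp add: p' degree_mult_eq del: mult_pCons_left)
    fix R
    obtain C where C: "\<forall>t. norm t \<le> R + 1 \<and> poly p t \<noteq> 0 \<longrightarrow> norm (poly q t) \<le> C * norm (poly p t)"
      using Suc.prems(2) by blast
    have *: "norm (poly q' t) \<le> C * norm (poly p' t)" if "norm t \<le> R + 1" "poly p' t \<noteq> 0" "t \<noteq> r" for t
    proof -
      have "norm (poly q t) \<le> C * norm (poly p t)" using C that by (simp add: p')
      moreover have "norm (poly q t) = norm (t - r) * norm (poly q' t)" "norm (poly p t) = norm (t - r) * norm (poly p' t)"
        by (simp_all add: p' q' norm_mult flip: left_diff_distrib)
      ultimately have "norm (t - r) * norm (poly q' t) \<le> norm (t - r) * (C * norm (poly p' t))"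
        by (simp add: mult.left_commute)
      then show ?thesis using that(3) by (simp add: mult_le_cancel_left)
    qed
    \<comment> \<open>At \<open>t = r\<close> the cancelled factor vanishes and the bound for
      \<open>p\<close> and \<open>q\<close> says nothing, so the ratio at \<open>r\<close> is added
      to the constant.\<close>
    show "\<exists>C. \<forall>t. norm t \<le> R \<and> poly p' t \<noteq> 0 \<longrightarrow> norm (poly q' t) \<le> C * norm (poly p' t)"
    proof (intro exI[of _ "max C (norm (poly q' r) / norm (poly p' r))"] allI impI)
      fix t assume t: "norm t \<le> R \<and> poly p' t \<noteq> 0"
      let ?D = "max C (norm (poly q' r) / norm (poly p' r))"
      show "norm (poly q' t) \<le> ?D * norm (poly p' t)"
      proof (cases "t = r")
        case True
        have "norm (poly q' r) = (norm (poly q' r) / norm (poly p' r)) * norm (poly p' r)"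
          using t True by simp
        also have "\<dots> \<le> ?D * norm (poly p' r)" by (intro mult_right_mono) auto
        finally show ?thesis using True by simp
      next
        case False
        then have "norm (poly q' t) \<le> C * norm (poly p' t)" using * t by auto
        also have "\<dots> \<le> ?D * norm (poly p' t)" by (intro mult_right_mono) auto
        finally show ?thesis .
      qed
    qed
  qed (use p'0 in auto)
  then show ?case by (simp add: p' q' mult_dvd_mono del: mult_pCons_left)
qed

lemma coord_algebra_bounded:
  assumes "f \<in> coord_algebra n"
  shows "\<exists>C\<ge>0. \<forall>x. (\<forall>i<n. norm (x i) \<le> R) \<longrightarrow> norm (f x) \<le> C"
  using assms unfolding coord_algebra_def
proof induction
  case (gen f)
  then show ?case by (intro exI[of _ "\<bar>R\<bar>"]) force
next
  case (const c) then show ?case by (intro exI[of _ "norm c"]) auto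
next
  case (add f g)
  then obtain C D where "C \<ge> 0" "D \<ge> 0" "\<forall>x. (\<forall>i<n. norm (x i) \<le> R) \<longrightarrow> norm (f x) \<le> C"
    "\<forall>x. (\<forall>i<n. norm (x i) \<le> R) \<longrightarrow> norm (g x) \<le> D" by auto
  then show ?case by (intro exI[of _ "C + D"]) (auto intro!: norm_triangle_mono)
next
  case (mult f g)
  then obtain C D where "C \<ge> 0" "D \<ge> 0" "\<forall>x. (\<forall>i<n. norm (x i) \<le> R) \<longrightarrow> norm (f x) \<le> C"
    "\<forall>x. (\<forall>i<n. norm (x i) \<le> R) \<longrightarrow> norm (g x) \<le> D" by auto
  then show ?case by (intro exI[of _ "C * D"]) (auto simp: norm_mult intro!: mult_mono)
qed

text \<open>
  Divisibility of polynomials can be tested on the lines through a point \<open>z\<close> where the divisor does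
  not vanish: the coefficients of the quotient along the line with direction \<open>w\<close> are power series
  coefficients, hence polynomial in \<open>w\<close>.
\<close>

lemma coord_algebra_divide:
  assumes a: "a \<in> coord_algebra n" and c: "c \<in> coord_algebra n" and z: "a z \<noteq> 0"
    and bnd: "\<And>R. \<exists>C. \<forall>x. (\<forall>i<n. norm (x i) \<le> R) \<and> a x \<noteq> 0 \<longrightarrow> norm (c x) \<le> C * norm (a x)"
  shows "\<exists>h\<in>coord_algebra n. \<forall>x. c x = a x * h x"
proof -
  obtain A where A: "A \<in> poly_family (coord_algebra n)" "\<And>v t. a (\<lambda>i. z i + t * v i) = poly (A v) t"
    using coord_algebra_line[OF a, of z] by blast
  obtain C where C: "C \<in> poly_family (coord_algebra n)" "\<And>v t. c (\<lambda>i. z i + t * v i) = poly (C v) t"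
    using coord_algebra_line[OF c, of z] by blast
  obtain D where D: "\<And>v. degree (C v) \<le> D" using poly_family_degree[OF C(1)] by auto
  have A0: "coeff (A v) 0 = a z" for v using A(2)[of 0 v] by (simp add: poly_0_coeff_0)
  define G where "G = (\<lambda>v. C v div A v)"
  have "A v dvd C v" for v
  proof (rule dvd_of_bounded_quotient)
    show "A v \<noteq> 0" using A0[of v] z by auto
    fix R :: real
    define M where "M = (\<Sum>i<n. norm (z i) + \<bar>R\<bar> * norm (v i))"
    obtain K where K: "\<forall>x. (\<forall>i<n. norm (x i) \<le> M) \<and> a x \<noteq> 0 \<longrightarrow> norm (c x) \<le> K * norm (a x)"
      using bnd by blast
    have "norm (z i + t * v i) \<le> M" if "norm t \<le> R" "i < n" for t i
    proof -
      have "norm (z i + t * v i) \<le> norm (z i) + norm t * norm (v i)"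
        by (metis norm_mult norm_triangle_ineq)
      also have "\<dots> \<le> norm (z i) + \<bar>R\<bar> * norm (v i)" using that by (intro add_mono mult_right_mono) auto
      also have "\<dots> \<le> M" unfolding M_def using that
        by (intro member_le_sum[of i "{..<n}" "\<lambda>i. norm (z i) + \<bar>R\<bar> * norm (v i)"]) auto
      finally show ?thesis .
    qed
    then show "\<exists>C'. \<forall>t. norm t \<le> R \<and> poly (A v) t \<noteq> 0 \<longrightarrow> norm (poly (C v) t) \<le> C' * norm (poly (A v) t)"
      using K[rule_format, of "\<lambda>i. z i + t * v i" for t] by (intro exI[of _ K]) (auto simp: A(2) C(2))
  qed
  then have G: "C v = A v * G v" for v by (simp add: G_def)
  have "A v \<noteq> 0" for v using A0[of v] z by auto
  then have degG: "degree (G v) \<le> D" for v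
    using D[of v] G[of v] by (cases "G v = 0") (auto simp: degree_mult_eq)
  have Gj: "(\<lambda>v. coeff (G v) j) \<in> coord_algebra n" for j
  proof (induction j rule: less_induct)
    case (less j)
    have "coeff (G v) j = (coeff (C v) j - (\<Sum>i<j. coeff (A v) (j - i) * coeff (G v) i)) * inverse (a z)" for v
    proof -
      have "coeff (C v) j = (\<Sum>i\<le>j. coeff (G v) i * coeff (A v) (j - i))"
        by (subst coeff_mult[symmetric]) (simp add: G[of v] mult.commute)
      also have "{..j} = insert j {..<j}" by auto
      finally show ?thesis using z A0[of v] by (simp add: field_simps)
    qed
    moreover have "(\<lambda>v. (coeff (C v) j - (\<Sum>i<j. coeff (A v) (j - i) * coeff (G v) i)) * inverse (a z)) \<in> coord_algebra n"
      by (intro coord_algebra_mult coord_algebra_diff coord_algebra_sum coord_algebra_const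
          poly_familyD[OF A(1)] poly_familyD[OF C(1)] less.IH) auto
    ultimately show ?case by simp
  qed
  define h where "h = (\<lambda>x. \<Sum>j\<le>D. coeff (G (\<lambda>i. x i - z i)) j)"
  have "h \<in> coord_algebra n" unfolding h_def
    by (intro coord_algebra_sum coord_algebra_subst[OF Gj] coord_algebra_diff coord_algebra_coord
        coord_algebra_const)
  moreover have "c x = a x * h x" for x
  proof -
    define v where "v = (\<lambda>i. x i - z i)"
    have x: "x = (\<lambda>i. z i + 1 * v i)" by (auto simp: v_def)
    have "h x = poly (G v) 1" unfolding h_def v_def[symmetric] by (simp add: poly_eq_sum_le[OF degG])
    then show ?thesis using A(2)[of 1 v] C(2)[of 1 v] G[of v] by (subst (1 2) x) simp
  qed
  ultimately show ?thesis by blast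
qed

section \<open>Leading forms and their behaviour along lines\<close>

lemma poly_div_power_tendsto:
  fixes p :: "complex poly"
  assumes "degree p \<le> d"
  shows "((\<lambda>t. poly p t / t ^ d) \<longlongrightarrow> coeff p d) at_infinity"
proof -
  have "((\<lambda>t::complex. \<Sum>j\<le>d. (inverse t) ^ (d - j) * coeff p j) \<longlongrightarrow>
    (\<Sum>j\<le>d. 0 ^ (d - j) * coeff p j)) at_infinity"
    by (intro tendsto_intros tendsto_inverse_0)
  also have "(\<Sum>j\<le>d. 0 ^ (d - j) * coeff p j) = (\<Sum>j\<in>{d}. 0 ^ (d - j) * coeff p j)"
    by (rule sum.mono_neutral_right) (auto simp: power_0_left)
  finally have "((\<lambda>t::complex. \<Sum>j\<le>d. (inverse t) ^ (d - j) * coeff p j) \<longlongrightarrow> coeff p d) at_infinity"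
    by simp
  then show ?thesis
  proof (rule Lim_transform_eventually)
    show "\<forall>\<^sub>F t in at_infinity. (\<Sum>j\<le>d. (inverse t) ^ (d - j) * coeff p j) = poly p t / t ^ d"
      using eventually_not_equal_at_infinity[of "0::complex"]
    proof eventually_elim
      case (elim t)
      have "inverse t ^ (d - j) * y = y * t ^ j / t ^ d" if "j \<le> d" for j y
        using elim that by (simp add: power_diff power_inverse field_simps)
      then show ?case by (simp add: poly_eq_sum_le[OF assms] sum_divide_distrib)
    qed
  qed
qed

text \<open>\<open>g\<close> is the homogeneous part of top degree. The clause about all lines is
  the form in which it is used: a direction \<open>v\<close> with \<open>g v \<noteq> 0\<close>
  makes \<open>f\<close> monic in that direction, up to a constant.\<close>

lemma leading_form:
  assumes f: "f \<in> coord_algebra n" "f z \<noteq> 0"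
  obtains d g y where "g \<in> coord_algebra n" "g y \<noteq> 0" "\<And>c v. g (\<lambda>i. c * v i) = c ^ d * g v"
    "\<And>x v p. \<forall>t. f (\<lambda>i. x i + t * v i) = poly p t \<Longrightarrow> degree p \<le> d \<and> coeff p d = g v"
proof -
  obtain F where F: "F \<in> poly_family (coord_algebra n)" "\<And>v t. f (\<lambda>i. 0 + t * v i) = poly (F v) t"
    using coord_algebra_line[OF f(1), of "\<lambda>_. 0"] by blast
  obtain D where D: "\<And>v. degree (F v) \<le> D" using poly_family_degree[OF F(1)] by auto
  have hom: "coeff (F (\<lambda>i. c * v i)) j = c ^ j * coeff (F v) j" for c v j
  proof -
    have "poly (F (\<lambda>i. c * v i)) t = poly (pcompose (F v) [:0, c:]) t" for t
      using F(2)[of t "\<lambda>i. c * v i"] F(2)[of "t * c" v] by (simp add: poly_pcompose mult.assoc)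
    then have "F (\<lambda>i. c * v i) = pcompose (F v) [:0, c:]" by (intro poly_eqI_nonzero) auto
    then show ?thesis by (simp add: coeff_pcompose_linear)
  qed
  have fsum: "f v = (\<Sum>j\<le>D. coeff (F v) j)" for v
    using F(2)[of 1 v] by (simp add: poly_eq_sum_le[OF D])
  define T where "T = {j. \<exists>v. coeff (F v) j \<noteq> 0}"
  have "T \<subseteq> {..D}" using D by (auto simp: T_def intro: order_trans[OF le_degree])
  then have T: "finite T" using finite_subset by blast
  have T0: "T \<noteq> {}"
  proof
    assume "T = {}"
    then have "coeff (F z) j = 0" for j by (auto simp: T_def)
    then show False using f(2) fsum[of z] by simp
  qed
  define d where "d = Max T"
  have d: "d \<in> T" "\<And>j v. j > d \<Longrightarrow> coeff (F v) j = 0"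
  proof -
    show "d \<in> T" unfolding d_def by (rule Max_in[OF T T0])
    show "coeff (F v) j = 0" if "j > d" for j v
    proof (rule ccontr)
      assume "coeff (F v) j \<noteq> 0"
      then have "j \<in> T" unfolding T_def by blast
      then have "j \<le> d" unfolding d_def by (rule Max_ge[OF T])
      then show False using that by simp
    qed
  qed
  from d(1) obtain y where y: "coeff (F y) d \<noteq> 0" unfolding T_def by blast
  show ?thesis
  proof (rule that[of "\<lambda>v. coeff (F v) d" y d])
    show "(\<lambda>v. coeff (F v) d) \<in> coord_algebra n" by (rule poly_familyD[OF F(1)])
    fix x v :: "nat \<Rightarrow> complex" and p :: "complex poly"
    assume "\<forall>t. f (\<lambda>i. x i + t * v i) = poly p t"
    then have p: "f (\<lambda>i. x i + t * v i) = poly p t" for t by blast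
    have "\<exists>Q\<in>poly_family (coord_algebra n). \<forall>w s. coeff (F (\<lambda>i. v i + s * w i)) j = poly (Q w) s" for j
      by (rule coord_algebra_line[OF poly_familyD[OF F(1)]])
    then obtain Q where Q: "\<And>j w s. coeff (F (\<lambda>i. v i + s * w i)) j = poly (Q j w) s" by metis
    have Q0: "poly (Q j x) 0 = coeff (F v) j" for j using Q[where s = 0 and w = x and j = j] by simp
    \<comment> \<open>Writing \<open>x + t v = t (v + x / t)\<close> expresses the value through the
      homogeneous parts of \<open>f\<close>, whose argument tends to \<open>v\<close> as
      \<open>t\<close> grows.\<close>
    have *: "poly p t = (\<Sum>j\<le>d. t ^ j * poly (Q j x) (inverse t))" if "t \<noteq> 0" for t
    proof -
      have "(\<lambda>i. x i + t * v i) = (\<lambda>i. 0 + t * (v i + inverse t * x i))"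
        using that by (auto simp: field_simps)
      then have "poly p t = f (\<lambda>i. 0 + t * (v i + inverse t * x i))" using p[of t] by simp
      also have "\<dots> = poly (F (\<lambda>i. v i + inverse t * x i)) t" by (rule F(2))
      also have "\<dots> = (\<Sum>j\<le>d. coeff (F (\<lambda>i. v i + inverse t * x i)) j * t ^ j)"
        by (rule poly_eq_sum_le, rule degree_le) (use d(2) in blast)
      also have "\<dots> = (\<Sum>j\<le>d. poly (Q j x) (inverse t) * t ^ j)" by (simp only: Q)
      finally show ?thesis by (simp only: mult.commute)
    qed
    have lim: "((\<lambda>t. poly p t / t ^ d) \<longlongrightarrow> coeff (F v) d) at_infinity"
    proof -
      have "((\<lambda>t::complex. \<Sum>j\<le>d. (inverse t) ^ (d - j) * poly (Q j x) (inverse t)) \<longlongrightarrow>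
        (\<Sum>j\<le>d. 0 ^ (d - j) * poly (Q j x) 0)) at_infinity"
        by (intro tendsto_intros tendsto_inverse_0 tendsto_compose[OF isContD[OF poly_isCont]])
      also have "(\<Sum>j\<le>d. 0 ^ (d - j) * poly (Q j x) 0) = (\<Sum>j\<in>{d}. 0 ^ (d - j) * poly (Q j x) 0)"
        by (rule sum.mono_neutral_right) (auto simp: power_0_left)
      also have "\<dots> = coeff (F v) d" by (simp add: Q0)
      finally show ?thesis
      proof (rule Lim_transform_eventually)
        show "\<forall>\<^sub>F t in at_infinity. (\<Sum>j\<le>d. (inverse t) ^ (d - j) * poly (Q j x) (inverse t)) = poly p t / t ^ d"
          using eventually_not_equal_at_infinity[of "0::complex"]
        proof eventually_elim
          case (elim t)
          have "inverse t ^ (d - j) * y = t ^ j * y / t ^ d" if "j \<le> d" for j y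
            using elim that by (simp add: power_diff power_inverse field_simps)
          then show ?case using elim by (simp add: * sum_divide_distrib)
        qed
      qed
    qed
    have deg: "degree p \<le> d"
    proof (rule ccontr)
      assume "\<not> degree p \<le> d"
      then have dp: "degree p > d" by simp
      have "((\<lambda>t. (poly p t / t ^ d) * inverse t ^ (degree p - d)) \<longlongrightarrow> coeff (F v) d * 0 ^ (degree p - d)) at_infinity"
        by (intro tendsto_intros lim tendsto_inverse_0)
      then have "((\<lambda>t. (poly p t / t ^ d) * inverse t ^ (degree p - d)) \<longlongrightarrow> 0) at_infinity"
        using dp by (simp add: power_0_left)
      then have "((\<lambda>t. poly p t / t ^ degree p) \<longlongrightarrow> 0) at_infinity"
      proof (rule Lim_transform_eventually)
        show "\<forall>\<^sub>F t in at_infinity. (poly p t / t ^ d) * inverse t ^ (degree p - d) = poly p t / t ^ degree p"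
          using eventually_not_equal_at_infinity[of "0::complex"]
          by eventually_elim (use dp in \<open>simp add: power_diff power_inverse field_simps\<close>)
      qed
      moreover have "((\<lambda>t. poly p t / t ^ degree p) \<longlongrightarrow> lead_coeff p) at_infinity"
        by (rule poly_div_power_tendsto) simp
      ultimately have "lead_coeff p = 0" using tendsto_unique[OF trivial_limit_at_infinity] by blast
      then show False using dp by simp
    qed
    moreover have "((\<lambda>t. poly p t / t ^ d) \<longlongrightarrow> coeff p d) at_infinity"
      by (rule poly_div_power_tendsto[OF deg])
    then have "coeff p d = coeff (F v) d" using lim tendsto_unique[OF trivial_limit_at_infinity] by blast
    ultimately show "degree p \<le> d \<and> coeff p d = coeff (F v) d" by simp
  qed (use y hom in auto)
qed

text \<open>Cauchy's bound: if \<open>norm t > 1\<close>, the top term is balanced by the lower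
  ones, each of which is at most the norm of its coefficient times
  \<open>norm t ^ (D - 1)\<close>.\<close>

lemma norm_root_le:
  fixes p :: "complex poly"
  assumes "degree p \<le> D" "coeff p D \<noteq> 0" "poly p t = 0"
  shows "norm t \<le> 1 + (\<Sum>i<D. norm (coeff p i)) / norm (coeff p D)"
proof (cases "norm t \<le> 1")
  case True
  then show ?thesis by (smt (verit) divide_nonneg_nonneg norm_ge_zero sum_nonneg)
next
  case False
  have D: "D \<noteq> 0"
  proof
    assume "D = 0"
    then have "p = [:coeff p 0:]" using assms(1) by (metis degree_0_id le_zero_eq of_nat_0_le_iff degree_eq_zeroE coeff_pCons_0)
    then show False using assms \<open>D = 0\<close> by (metis poly_pCons mult_zero_right add.right_neutral poly_0)
  qed
  have "{..D} = insert D {..<D}" by auto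
  then have "coeff p D * t ^ D = - (\<Sum>i<D. coeff p i * t ^ i)"
    using assms(3) poly_eq_sum_le[OF assms(1), of t] by (simp add: eq_neg_iff_add_eq_0)
  then have "norm (coeff p D) * norm t ^ D = norm (\<Sum>i<D. coeff p i * t ^ i)"
    by (metis norm_minus_cancel norm_mult norm_power)
  also have "\<dots> \<le> (\<Sum>i<D. norm (coeff p i) * norm t ^ (D - 1))"
    using False by (intro sum_norm_le) (auto simp: norm_mult norm_power intro!: mult_left_mono power_increasing)
  also have "\<dots> = (\<Sum>i<D. norm (coeff p i)) * norm t ^ (D - 1)" by (simp add: sum_distrib_right)
  finally have "norm (coeff p D) * norm t * norm t ^ (D - 1) \<le> (\<Sum>i<D. norm (coeff p i)) * norm t ^ (D - 1)"
    using D by (cases D) (auto simp: mult.assoc)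
  moreover have "norm t ^ (D - 1) > 0" using False by (intro zero_less_power) linarith
  ultimately have "norm (coeff p D) * norm t \<le> (\<Sum>i<D. norm (coeff p i))" by simp
  then have "norm t \<le> (\<Sum>i<D. norm (coeff p i)) / norm (coeff p D)"
    using assms(2) by (simp add: pos_le_divide_eq mult.commute)
  then show ?thesis by simp
qed

text \<open>The identity principle at \<open>q\<close> for the zero set of \<open>I\<close>, phrased
  with sequences so that compactness arguments apply. Only the first \<open>n\<close> entries
  converge, as the others carry no information.\<close>

definition dense_at :: "nat \<Rightarrow> ((nat \<Rightarrow> complex) \<Rightarrow> complex) set \<Rightarrow> (nat \<Rightarrow> complex) \<Rightarrow> bool" where
  "dense_at n I q \<longleftrightarrow> (\<forall>f\<in>coord_algebra n - I. \<exists>X. (\<forall>k. X k \<in> zero_locus I \<and> f (X k) \<noteq> 0) \<and>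
     (\<forall>i<n. (\<lambda>k. X k i) \<longlonglongrightarrow> q i))"

context coord_prime_Suc
begin

lemma const_notin: "c \<noteq> 0 \<Longrightarrow> (\<lambda>_. c) \<notin> I"
  using mult[OF _ coord_algebra_const[of "inverse c"]] one by fastforce

text \<open>The monic \<open>F\<close> makes the projection to the first \<open>n\<close>
  coordinates finite. Suitable points near the projection of \<open>q\<close> come from the
  induction hypothesis; the question is whether their lifts approach \<open>q\<close> and not
  another point of its fibre. Either \<open>q\<close> is alone in its fibre, or the base is the
  whole affine space and roots can be followed.\<close>

lemma dense_at_of_monic:
  assumes IH: "\<And>q. q \<in> zero_locus (I \<inter> B) \<Longrightarrow> dense_at n (I \<inter> B) q"
    and F: "F \<in> poly_family B" "(\<lambda>x. poly (F x) (x n)) \<in> I" "\<And>x. degree (F x) \<le> D"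
      "\<And>x. coeff (F x) D = c" "c \<noteq> 0"
    and q: "q \<in> zero_locus I"
    and alt: "I \<inter> B \<subseteq> {\<lambda>_. 0} \<or> (\<forall>x\<in>zero_locus I. (\<forall>i<n. x i = q i) \<longrightarrow> x n = q n)"
  shows "dense_at (Suc n) I q"
  unfolding dense_at_def
proof
  fix f assume "f \<in> coord_algebra (Suc n) - I"
  then have f: "f \<in> coord_algebra (Suc n)" "f \<notin> I" by auto
  have Fi: "coeff (F x) i = 0" if "i > D" for x i using F(3)[of x] that by (simp add: coeff_eq_0)
  have notin: "(\<lambda>x. coeff (F x) D) \<notin> I" using F(4) const_notin[OF F(5)] by simp
  obtain m P where P: "min_degree I m P"
    using min_degree_exists[OF F(1,2) Fi notin] by blast
  note Pd = min_degreeD[OF P]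
  define a where "a = (\<lambda>x. coeff (P x) m)"
  have a: "a \<in> B" "a \<notin> I" using Pd by (auto simp: a_def)
  obtain b where b: "b \<in> B" "b \<notin> I" "\<And>x. x \<in> zero_locus I \<Longrightarrow> b x \<noteq> 0 \<Longrightarrow> f x \<noteq> 0"
    using base_multiple[OF P f] by blast
  have degP: "degree (P x) \<le> m" for x using Pd(3) by (intro degree_le) auto
  have "m \<noteq> 0"
  proof
    assume "m = 0"
    then have "P x = [:a x:]" for x
      using degP[of x] by (intro poly_eqI) (auto simp: a_def coeff_pCons coeff_eq_0 split: nat.split)
    then show False using Pd(2) a(2) by simp
  qed
  have "(\<lambda>x. a x * b x) \<in> B" "(\<lambda>x. a x * b x) \<notin> I"
    using a b prime B_sub by (blast intro: coord_algebra_mult)+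
  moreover have "q \<in> zero_locus (I \<inter> B)" using q by (auto simp: zero_locus_def)
  ultimately have "\<exists>X. (\<forall>k. X k \<in> zero_locus (I \<inter> B) \<and> a (X k) * b (X k) \<noteq> 0) \<and>
      (\<forall>i<n. (\<lambda>k. X k i) \<longlonglongrightarrow> q i)"
    using bspec[OF IH[unfolded dense_at_def], of q "\<lambda>x. a x * b x"] by simp
  then obtain X where X: "\<And>k. X k \<in> zero_locus (I \<inter> B)" "\<And>k. a (X k) * b (X k) \<noteq> 0"
    "\<And>i. i < n \<Longrightarrow> (\<lambda>k. X k i) \<longlonglongrightarrow> q i" by blast
  have pt: "x(n := t) \<in> zero_locus I" "poly (F x) t = 0" "b x \<noteq> 0 \<Longrightarrow> f (x(n := t)) \<noteq> 0"
    if "x \<in> zero_locus (I \<inter> B)" "a x \<noteq> 0" "poly (P x) t = 0" for x t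
  proof -
    show *: "x(n := t) \<in> zero_locus I" using lift_point[OF P] that by (auto simp: a_def)
    then have "poly (F (x(n := t))) ((x(n := t)) n) = 0"
      by (rule zero_locusD[OF _ F(2)])
    then show "poly (F x) t = 0" by (simp add: poly_family_upd[OF F(1)])
    assume "b x \<noteq> 0"
    moreover have "b (x(n := t)) = b x" by (rule coord_algebra_eq[OF b(1)]) auto
    ultimately show "f (x(n := t)) \<noteq> 0" using b(3)[OF *] by simp
  qed
  show "\<exists>X. (\<forall>k. X k \<in> zero_locus I \<and> f (X k) \<noteq> 0) \<and> (\<forall>i<Suc n. (\<lambda>k. X k i) \<longlonglongrightarrow> q i)"
    using alt
  proof
    assume alt: "\<forall>x\<in>zero_locus I. (\<forall>i<n. x i = q i) \<longrightarrow> x n = q n"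
    have "\<exists>t. poly (P (X k)) t = 0" for k
    proof -
      have "m \<le> degree (P (X k))" using X(2)[of k] by (intro le_degree) (auto simp: a_def)
      then have "\<not> constant (poly (P (X k)))" using \<open>m \<noteq> 0\<close> by (simp add: constant_degree)
      then show ?thesis by (rule fundamental_theorem_of_algebra)
    qed
    then obtain T where T: "\<And>k. poly (P (X k)) (T k) = 0" by metis
    \<comment> \<open>Roots of the monic \<open>F\<close> stay bounded, so the lifted coordinates
      have a convergent subsequence. The limit is a zero of \<open>I\<close> in the fibre of
      \<open>q\<close>, hence \<open>q\<close>.\<close>
    have "(\<lambda>k. coeff (F (X k)) i) \<longlonglongrightarrow> coeff (F q) i" for i
      by (rule coord_algebra_tendsto[OF poly_familyD[OF F(1)] X(3)])
    then have "(\<lambda>k. 1 + (\<Sum>i<D. norm (coeff (F (X k)) i)) / norm c) \<longlonglongrightarrow>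
      1 + (\<Sum>i<D. norm (coeff (F q) i)) / norm c"
      using F(5) by (intro tendsto_intros) auto
    then have "Bseq (\<lambda>k. 1 + (\<Sum>i<D. norm (coeff (F (X k)) i)) / norm c)"
      by (intro convergent_imp_Bseq convergentI)
    then obtain K where K: "\<And>k. norm (1 + (\<Sum>i<D. norm (coeff (F (X k)) i)) / norm c) \<le> K"
      by (auto simp: Bseq_def)
    have "norm (T k) \<le> K" for k
    proof -
      have "poly (F (X k)) (T k) = 0" using pt(2)[of "X k" "T k"] X T by auto
      then have "norm (T k) \<le> 1 + (\<Sum>i<D. norm (coeff (F (X k)) i)) / norm c"
        using norm_root_le[of "F (X k)" D "T k"] F by simp
      also have "\<dots> \<le> K" using K[of k] by simp
      finally show ?thesis .
    qed
    then have "bounded (range T)" by (auto simp: bounded_iff)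
    then obtain l r where r: "strict_mono r" "(T \<circ> r) \<longlonglongrightarrow> l"
      using bounded_imp_convergent_subsequence by blast
    define Y where "Y = (\<lambda>k. (X (r k))(n := T (r k)))"
    have Y: "Y k \<in> zero_locus I" "f (Y k) \<noteq> 0" for k
      using pt[of "X (r k)" "T (r k)"] X T by (auto simp: Y_def)
    have lim: "(\<lambda>k. Y k i) \<longlonglongrightarrow> (q(n := l)) i" if "i < Suc n" for i
    proof (cases "i = n")
      case True then show ?thesis using r(2) by (simp add: Y_def o_def)
    next
      case False
      then have "((\<lambda>k. X k i) \<circ> r) \<longlonglongrightarrow> q i" using that by (intro LIMSEQ_subseq_LIMSEQ X r) auto
      then show ?thesis using False by (simp add: Y_def o_def)
    qed
    have "q(n := l) \<in> zero_locus I" unfolding zero_locus_def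
    proof safe
      fix g assume g: "g \<in> I"
      have "g \<in> coord_algebra (Suc n)" using sub g by blast
      then have "(\<lambda>k. g (Y k)) \<longlonglongrightarrow> g (q(n := l))" by (rule coord_algebra_tendsto) (rule lim)
      moreover have "g (Y k) = 0" for k using Y(1) g by (auto simp: zero_locus_def)
      ultimately show "g (q(n := l)) = 0" by (simp add: LIMSEQ_const_iff)
    qed
    from alt[rule_format, OF this] have "l = q n" by simp
    then have "(\<lambda>k. Y k i) \<longlonglongrightarrow> q i" if "i < Suc n" for i using lim[OF that] by simp
    with Y show ?thesis by blast
  next
    assume I0: "I \<inter> B \<subseteq> {\<lambda>_. 0}"
    then have Z: "x \<in> zero_locus (I \<inter> B)" for x by (auto simp: zero_locus_def)
    \<comment> \<open>Where \<open>a x \<noteq> 0\<close>, all roots of \<open>P x\<close> are roots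
      of the monic \<open>F x\<close>, so the coefficients of \<open>P x\<close> divided by
      \<open>a x\<close> stay bounded and \<open>a\<close> divides them. This takes the place of
      Gauss's lemma.\<close>
    have "\<exists>h\<in>B. \<forall>x. coeff (P x) i = a x * h x" for i
    proof (rule coord_algebra_divide[OF a(1) poly_familyD[OF Pd(1)]])
      show "a (X 0) \<noteq> 0" using X(2)[of 0] by auto
      fix R :: real
      have "\<exists>C\<ge>0. \<forall>x. (\<forall>i<n. norm (x i) \<le> R) \<longrightarrow> norm (coeff (F x) j) \<le> C" for j
        by (rule coord_algebra_bounded[OF poly_familyD[OF F(1)]])
      then obtain C where C: "\<And>j. C j \<ge> 0" "\<And>j x. (\<forall>i<n. norm (x i) \<le> R) \<Longrightarrow> norm (coeff (F x) j) \<le> C j"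
        by metis
      define K where "K = 1 + (\<Sum>j<D. C j) / norm c"
      have K0: "K \<ge> 0" using C(1) by (auto simp: K_def intro!: add_nonneg_nonneg divide_nonneg_nonneg sum_nonneg)
      have "norm (coeff (P x) i) \<le> (1 + K) ^ m * norm (a x)" if x: "\<forall>i<n. norm (x i) \<le> R" "a x \<noteq> 0" for x
      proof -
        define p where "p = smult (inverse (a x)) (P x)"
        have "degree (P x) = m" using degP[of x] x(2) le_degree[of "P x" m] by (simp add: a_def)
        then have p: "degree p = m" "lead_coeff p = 1" using x(2) by (auto simp: p_def a_def)
        have "norm t \<le> K" if "poly p t = 0" for t
        proof -
          have "poly (P x) t = 0" using that x(2) by (simp add: p_def)
          then have "poly (F x) t = 0" using pt(2)[OF Z x(2)] by blast
          then have "norm t \<le> 1 + (\<Sum>i<D. norm (coeff (F x) i)) / norm c"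
            using norm_root_le[of "F x" D t] F by simp
          also have "\<dots> \<le> K" unfolding K_def using C(2)[OF x(1)]
            by (intro add_left_mono divide_right_mono sum_mono) auto
          finally show ?thesis .
        qed
        then have "norm (coeff p i) \<le> (1 + K) ^ m"
          using coeff_bound_roots[OF p(2) _ K0] p(1) by auto
        then show ?thesis using x(2) by (simp add: p_def norm_mult norm_inverse norm_divide field_simps)
      qed
      then show "\<exists>C. \<forall>x. (\<forall>i<n. norm (x i) \<le> R) \<and> a x \<noteq> 0 \<longrightarrow> norm (coeff (P x) i) \<le> C * norm (a x)"
        by blast
    qed
    then obtain h where h: "\<And>i. h i \<in> B" "\<And>i x. coeff (P x) i = a x * h i x" by metis
    define P1 where "P1 = (\<lambda>x. \<Sum>i\<le>m. monom (h i x) i)"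
    have coeffP1: "coeff (P1 x) i = (if i \<le> m then h i x else 0)" for x i
      by (auto simp: P1_def coeff_sum)
    have degP1: "degree (P1 x) \<le> m" for x by (intro degree_le) (auto simp: coeffP1)
    have "(\<lambda>x. coeff (P1 x) i) \<in> B" for i
      by (cases "i \<le> m") (auto simp: coeffP1 h(1) coord_algebra_const)
    then have P1: "P1 \<in> poly_family B" using degP1 by (auto simp: poly_family_def)
    have PP1: "P x = smult (a x) (P1 x)" for x
    proof (rule poly_eqI)
      show "coeff (P x) i = coeff (smult (a x) (P1 x)) i" for i
        using h(2)[of x i] Pd(3)[of i x] by (cases "i \<le> m") (auto simp: coeffP1)
    qed
    have "(\<lambda>x. a x * poly (P1 x) (x n)) \<in> I" using Pd(2) by (simp add: PP1)
    then have "(\<lambda>x. poly (P1 x) (x n)) \<in> I"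
      using prime[of a "\<lambda>x. poly (P1 x) (x n)"] a B_sub coord_algebra_eval[OF P1] by blast
    then have P1q: "poly (P1 q) (q n) = 0" by (rule zero_locusD[OF q])
    have monic: "degree (P1 (X k)) = m" "lead_coeff (P1 (X k)) = 1" for k
    proof -
      have "a (X k) = a (X k) * h m (X k)" using h(2)[of "X k" m] by (simp add: a_def)
      then have hm: "h m (X k) = 1" using X(2)[of k] by simp
      then show "degree (P1 (X k)) = m" using degP1[of "X k"] le_degree[of "P1 (X k)" m] by (simp add: coeffP1)
      then show "lead_coeff (P1 (X k)) = 1" using hm by (simp add: coeffP1)
    qed
    \<comment> \<open>The monic polynomials \<open>P1 (X k)\<close> have values at
      \<open>q n\<close> that tend to \<open>poly (P1 q) (q n) = 0\<close>, so they have roots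
      tending to \<open>q n\<close>.\<close>
    then have "\<exists>t. poly (P1 (X k)) t = 0 \<and> norm (q n - t) ^ m \<le> norm (poly (P1 (X k)) (q n))" for k
      using monic_root_near[of "P1 (X k)" "q n"] \<open>m \<noteq> 0\<close> by simp
    then obtain T where T: "\<And>k. poly (P1 (X k)) (T k) = 0"
      "\<And>k. norm (q n - T k) ^ m \<le> norm (poly (P1 (X k)) (q n))" by metis
    have "(\<lambda>x. poly (P1 x) (q n)) \<in> B" unfolding coord_algebra_def
      by (rule poly_family_eval[OF P1[unfolded coord_algebra_def] gen_algebra.const])
    then have "(\<lambda>k. poly (P1 (X k)) (q n)) \<longlonglongrightarrow> poly (P1 q) (q n)"
      using coord_algebra_tendsto X(3) by blast
    then have "(\<lambda>k. norm (poly (P1 (X k)) (q n))) \<longlonglongrightarrow> 0" using P1q tendsto_norm_zero by fastforce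
    then have "(\<lambda>k. norm (q n - T k) ^ m) \<longlonglongrightarrow> 0"
      by (rule Lim_null_comparison[rotated]) (use T(2) in auto)
    then have "(\<lambda>k. root m (norm (q n - T k) ^ m)) \<longlonglongrightarrow> root m 0" by (rule tendsto_real_root)
    then have "(\<lambda>k. norm (q n - T k)) \<longlonglongrightarrow> 0" using \<open>m \<noteq> 0\<close> by (simp add: real_root_power_cancel)
    then have "T \<longlonglongrightarrow> q n" by (subst tendsto_dist_iff) (simp add: dist_norm norm_minus_commute)
    then have "(\<lambda>k. ((X k)(n := T k)) i) \<longlonglongrightarrow> q i" if "i < Suc n" for i
      using that X(3)[of i] by (cases "i = n") auto
    moreover have "(X k)(n := T k) \<in> zero_locus I" "f ((X k)(n := T k)) \<noteq> 0" for k
      using pt[OF Z, of "X k" "T k"] X(2)[of k] T(1)[of k] by (auto simp: PP1)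
    ultimately show ?thesis by (intro exI[of _ "\<lambda>k. (X k)(n := T k)"]) auto
  qed
qed

end

text \<open>The coordinate change of Noether normalization: in the first \<open>n + 1\<close>
  coordinates it sends the last axis to the direction \<open>w(n := 1)\<close> and fixes the other
  axes.\<close>

definition shear :: "nat \<Rightarrow> (nat \<Rightarrow> complex) \<Rightarrow> (nat \<Rightarrow> complex) \<Rightarrow> nat \<Rightarrow> complex" where
  "shear n w x = (\<lambda>i. if i < n then x i + w i * x n else x i)"

lemma shear_inverse: "shear n w (shear n (\<lambda>i. - w i) x) = x" "shear n (\<lambda>i. - w i) (shear n w x) = x"
  by (auto simp: shear_def)

lemma coord_algebra_shear:
  "f \<in> coord_algebra (Suc n) \<Longrightarrow> (\<lambda>x. f (shear n w x)) \<in> coord_algebra (Suc n)"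
proof (erule coord_algebra_subst)
  fix i assume "i < Suc n"
  then show "(\<lambda>x. shear n w x i) \<in> coord_algebra (Suc n)"
    by (cases "i < n") (auto simp: shear_def intro!: coord_algebra_add coord_algebra_mult
        coord_algebra_const coord_algebra_coord)
qed

text \<open>The ideal that belongs to the preimage of the zero set under \<open>shear n w\<close>,
  which is why the inverse shear appears.\<close>

definition shear_ideal :: "nat \<Rightarrow> (nat \<Rightarrow> complex) \<Rightarrow> ((nat \<Rightarrow> complex) \<Rightarrow> complex) set \<Rightarrow> ((nat \<Rightarrow> complex) \<Rightarrow> complex) set" where
  "shear_ideal n w I = {f \<in> coord_algebra (Suc n). (\<lambda>x. f (shear n (\<lambda>i. - w i) x)) \<in> I}"

lemma leading_form_shear:
  assumes G: "G \<in> coord_algebra (Suc n)"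
    and g: "\<And>x v p. \<forall>t. G (\<lambda>i. x i + t * v i) = poly p t \<Longrightarrow> degree p \<le> d \<and> coeff p d = g v"
  obtains P where "P \<in> poly_family (coord_algebra n)" "\<And>x. G (shear n w x) = poly (P x) (x n)"
    "\<And>x. degree (P x) \<le> d" "\<And>x. coeff (P x) d = g (w(n := 1))"
proof -
  obtain P where P: "P \<in> poly_family (coord_algebra n)" "\<And>x. G (shear n w x) = poly (P x) (x n)"
    using coord_algebra_Suc[OF coord_algebra_shear[OF G, of w]] by blast
  have "degree (P x) \<le> d \<and> coeff (P x) d = g (w(n := 1))" for x
  proof (rule g[of "x(n := 0)"], rule allI)
    fix t
    have "G (\<lambda>i. (x(n := 0)) i + t * (w(n := 1)) i) = G (shear n w (x(n := t)))"
      by (rule coord_algebra_eq[OF G]) (auto simp: shear_def)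
    then show "G (\<lambda>i. (x(n := 0)) i + t * (w(n := 1)) i) = poly (P x) t"
      by (simp add: P(2) poly_family_upd[OF P(1)])
  qed
  with P that show ?thesis by blast
qed

context coord_prime_Suc
begin

lemma shear_prime: "coord_prime_Suc n (shear_ideal n w I)"
proof
  fix f g assume "f \<in> coord_algebra (Suc n)" "g \<in> coord_algebra (Suc n)" "(\<lambda>x. f x * g x) \<in> shear_ideal n w I"
  then show "f \<in> shear_ideal n w I \<or> g \<in> shear_ideal n w I"
    using prime[of "\<lambda>x. f (shear n (\<lambda>i. - w i) x)" "\<lambda>x. g (shear n (\<lambda>i. - w i) x)"] coord_algebra_shear
    unfolding shear_ideal_def by blast
qed (auto simp: shear_ideal_def zero one add mult coord_algebra_const coord_algebra_add coord_algebra_mult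
      coord_algebra_shear)

lemma zero_locus_shear: "x \<in> zero_locus (shear_ideal n w I) \<longleftrightarrow> shear n w x \<in> zero_locus I"
proof
  assume x: "x \<in> zero_locus (shear_ideal n w I)"
  show "shear n w x \<in> zero_locus I" unfolding zero_locus_def
  proof safe
    fix f assume "f \<in> I"
    then have "(\<lambda>x. f (shear n w x)) \<in> shear_ideal n w I"
      using sub coord_algebra_shear[of f n w] by (auto simp: shear_ideal_def shear_inverse)
    then show "f (shear n w x) = 0" by (rule zero_locusD[OF x])
  qed
next
  assume x: "shear n w x \<in> zero_locus I"
  show "x \<in> zero_locus (shear_ideal n w I)" unfolding zero_locus_def
  proof safe
    fix f assume "f \<in> shear_ideal n w I"
    then have "(\<lambda>x. f (shear n (\<lambda>i. - w i) x)) \<in> I" by (simp add: shear_ideal_def)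
    then have "f (shear n (\<lambda>i. - w i) (shear n w x)) = 0" by (rule zero_locusD[OF x])
    then show "f x = 0" by (simp add: shear_inverse)
  qed
qed

lemma dense_at_shear:
  assumes "dense_at (Suc n) (shear_ideal n w I) (shear n (\<lambda>i. - w i) q)"
  shows "dense_at (Suc n) I q"
  unfolding dense_at_def
proof
  fix f assume f: "f \<in> coord_algebra (Suc n) - I"
  then have "(\<lambda>x. f (shear n w x)) \<in> coord_algebra (Suc n) - shear_ideal n w I"
    using coord_algebra_shear[of f n w] by (auto simp: shear_ideal_def shear_inverse)
  from bspec[OF assms[unfolded dense_at_def] this]
  obtain X where X: "\<And>k. X k \<in> zero_locus (shear_ideal n w I)" "\<And>k. f (shear n w (X k)) \<noteq> 0"
    "\<And>i. i < Suc n \<Longrightarrow> (\<lambda>k. X k i) \<longlonglongrightarrow> shear n (\<lambda>i. - w i) q i" by blast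
  have "(\<lambda>k. shear n w (X k) i) \<longlonglongrightarrow> q i" if "i < Suc n" for i
  proof (cases "i < n")
    case True
    have "(\<lambda>k. X k i + w i * X k n) \<longlonglongrightarrow> shear n (\<lambda>i. - w i) q i + w i * shear n (\<lambda>i. - w i) q n"
      using True by (intro tendsto_intros X) auto
    then show ?thesis using True by (simp add: shear_def)
  next
    case False
    then have "i = n" using that by simp
    then show ?thesis using X(3)[of n] by (simp add: shear_def)
  qed
  then show "\<exists>X. (\<forall>k. X k \<in> zero_locus I \<and> f (X k) \<noteq> 0) \<and> (\<forall>i<Suc n. (\<lambda>k. X k i) \<longlonglongrightarrow> q i)"
    using X(1,2) zero_locus_shear by (intro exI[of _ "\<lambda>k. shear n w (X k)"]) auto
qed

lemma dense_at_of_leading_form: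
  assumes IH: "\<And>I q. coord_prime n I \<Longrightarrow> q \<in> zero_locus I \<Longrightarrow> dense_at n I q"
    and q: "q \<in> zero_locus I" and G: "G \<in> I"
    and g: "\<And>x v p. \<forall>t. G (\<lambda>i. x i + t * v i) = poly p t \<Longrightarrow> degree p \<le> d \<and> coeff p d = g v"
      "g (w(n := 1)) \<noteq> 0"
    and alt: "shear_ideal n w I \<inter> B \<subseteq> {\<lambda>_. 0} \<or>
      (\<forall>x. shear n w x \<in> zero_locus I \<longrightarrow> (\<forall>i<n. x i = q i - w i * q n) \<longrightarrow> x n = q n)"
  shows "dense_at (Suc n) I q"
proof (rule dense_at_shear)
  interpret S: coord_prime_Suc n "shear_ideal n w I" by (rule shear_prime)
  have G': "G \<in> coord_algebra (Suc n)" using G sub by blast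
  obtain P where P: "P \<in> poly_family B" "\<And>x. G (shear n w x) = poly (P x) (x n)"
    "\<And>x. degree (P x) \<le> d" "\<And>x. coeff (P x) d = g (w(n := 1))"
    by (rule leading_form_shear[where G = G and g = g and d = d and w = w and n = n, OF G'])
      (rule g(1), assumption, rule that, assumption+)
  have "(\<lambda>x. G (shear n w x)) \<in> shear_ideal n w I"
    using G coord_algebra_shear[OF G'] by (auto simp: shear_ideal_def shear_inverse)
  then have ev: "(\<lambda>x. poly (P x) (x n)) \<in> shear_ideal n w I" by (simp add: P(2))
  have q': "shear n (\<lambda>i. - w i) q \<in> zero_locus (shear_ideal n w I)"
    using q by (simp add: zero_locus_shear shear_inverse)
  show "dense_at (Suc n) (shear_ideal n w I) (shear n (\<lambda>i. - w i) q)"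
  proof (rule S.dense_at_of_monic[OF IH P(1) ev P(3,4) g(2) q'])
    show "coord_prime n (shear_ideal n w I \<inter> B)" by (rule S.base)
    show "shear_ideal n w I \<inter> B \<subseteq> {\<lambda>_. 0} \<or> (\<forall>x\<in>zero_locus (shear_ideal n w I).
      (\<forall>i<n. x i = shear n (\<lambda>i. - w i) q i) \<longrightarrow> x n = shear n (\<lambda>i. - w i) q n)"
      using alt by (auto simp: zero_locus_shear shear_def)
  qed
qed

end

text \<open>Induction on the number of variables, after a shear that makes some element of
  \<open>I\<close> monic. If the elimination ideal is still nonzero, a second shear is chosen so
  generic that \<open>q\<close> is the only zero in its fibre.\<close>

lemma dense_at_zero_locus: "coord_prime n I \<Longrightarrow> q \<in> zero_locus I \<Longrightarrow> dense_at n I q"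
proof (induction n arbitrary: I q)
  case 0
  interpret coord_prime 0 I by (rule 0)
  have "f q \<noteq> 0" if "f \<in> coord_algebra 0" "f \<notin> I" for f
  proof
    assume "f q = 0"
    then have "f x = 0" for x using coord_algebra_eq[OF that(1), of x q] by simp
    then have "f = (\<lambda>_. 0)" by (rule ext)
    then show False using that zero by simp
  qed
  then show ?case using 0 unfolding dense_at_def by (auto intro!: exI[of _ "\<lambda>_. q"])
next
  case (Suc n)
  interpret coord_prime "Suc n" I by (rule Suc.prems)
  interpret coord_prime_Suc n I ..
  show ?case
  proof (cases "I \<subseteq> {\<lambda>_. 0}")
    case True
    then have Z: "zero_locus I = UNIV" by (auto simp: zero_locus_def)
    have "\<exists>X. (\<forall>k. f (X k) \<noteq> 0) \<and> (\<forall>i. (\<lambda>k. X k i) \<longlonglongrightarrow> q i)" if "f \<in> coord_algebra (Suc n)" "f \<notin> I" for f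
    proof -
      have "f \<noteq> (\<lambda>_. 0)" using that zero by auto
      then obtain z where "f z \<noteq> 0" by auto
      then show ?thesis by (rule coord_algebra_nonzero_near[OF that(1)])
    qed
    then show ?thesis unfolding dense_at_def Z by blast
  next
    case False
    then obtain G z where G: "G \<in> I" "G z \<noteq> 0" by fastforce
    then have G': "G \<in> coord_algebra (Suc n)" using sub by blast
    obtain d g y where g: "g \<in> coord_algebra (Suc n)" "g y \<noteq> 0" "\<And>c v. g (\<lambda>i. c * v i) = c ^ d * g v"
      "\<And>x v p. \<forall>t. G (\<lambda>i. x i + t * v i) = poly p t \<Longrightarrow> degree p \<le> d \<and> coeff p d = g v"
      by (rule leading_form[OF G' G(2)]) (rule that, assumption+)
    \<comment> \<open>The direction can be normalized to last entry \<open>1\<close> only if that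
      entry is nonzero; if \<open>y\<close> fails this, it is perturbed along the last axis.\<close>
    obtain u where u: "u n \<noteq> 0" "g u \<noteq> 0"
    proof (cases "y n = 0")
      case False then show ?thesis using g(2) that by blast
    next
      case True
      define v where "v = (\<lambda>i::nat. if i = n then 1 else 0 :: complex)"
      obtain p where p: "\<And>t. g (\<lambda>i. y i + t * v i) = poly p t" using coord_algebra_line[OF g(1), of y] by blast
      have "poly p 0 = g y" using p[of 0] by simp
      then have "p \<noteq> 0" using g(2) by auto
      then obtain t where "poly p t \<noteq> 0" "t \<noteq> 0" using poly_nonroot_near[of p 1 0] by auto
      then have "g (\<lambda>i. y i + t * v i) \<noteq> 0" "y n + t * v n \<noteq> 0"
        using p[of t] True by (simp_all add: v_def)
      then show ?thesis using that[of "\<lambda>i. y i + t * v i"] by blast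
    qed
    define w where "w = (\<lambda>i. inverse (u n) * u i)"
    have w: "w(n := 1) = w" using u by (auto simp: w_def)
    have gw: "g (w(n := 1)) \<noteq> 0" unfolding w unfolding w_def g(3) using u by simp
    show ?thesis
    proof (cases "shear_ideal n w I \<inter> B \<subseteq> {\<lambda>_. 0}")
      case True
      show ?thesis
      proof (rule dense_at_of_leading_form[where G = G and g = g and d = d and w = w])
        show "degree p \<le> d \<and> coeff p d = g v" if "\<forall>t. G (\<lambda>i. x i + t * v i) = poly p t" for x v p
          using that by (rule g(4))
      qed (use Suc.IH Suc.prems(2) G(1) gw True in auto)
    next
      case False
      then obtain G1 z1 where G1: "G1 \<in> shear_ideal n w I" "G1 \<in> B" "G1 z1 \<noteq> 0" by fastforce
      interpret S: coord_prime_Suc n "shear_ideal n w I" by (rule shear_prime)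
      define q1 where "q1 = shear n (\<lambda>i. - w i) q"
      have q1: "q1 \<in> zero_locus (shear_ideal n w I)"
        using Suc.prems(2) by (simp add: zero_locus_shear shear_inverse q1_def)
      obtain F where F: "F \<in> poly_family B" "\<And>x. G (shear n w x) = poly (F x) (x n)"
        "\<And>x. degree (F x) \<le> d" "\<And>x. coeff (F x) d = g (w(n := 1))"
        by (rule leading_form_shear[where G = G and g = g and d = d and w = w and n = n, OF G'])
          (rule g(4), assumption, rule that, assumption+)
      obtain d1 g1 y1 where g1: "g1 \<in> B" "g1 y1 \<noteq> 0" "\<And>c v. g1 (\<lambda>i. c * v i) = c ^ d1 * g1 v"
        "\<And>x v p. \<forall>t. G1 (\<lambda>i. x i + t * v i) = poly p t \<Longrightarrow> degree p \<le> d1 \<and> coeff p d1 = g1 v"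
        by (rule leading_form[OF G1(2,3)]) (rule that, assumption+)
      obtain p where p: "\<And>t. G1 (\<lambda>i. q1 i + t * y1 i) = poly p t"
        using coord_algebra_line[OF G1(2), of q1] by blast
      have "coeff p d1 = g1 y1" using g1(4)[of q1 y1 p] p by simp
      then have "p \<noteq> 0" using g1(2) by auto
      then have fin: "finite {t. poly p t = 0}" by (rule poly_roots_finite)
      \<comment> \<open>\<open>c\<close> is bad if the line through \<open>q1\<close> with direction
        \<open>y1 / c\<close> and last entry \<open>1\<close> meets the zero set again. The first
        coordinates of such a point are \<open>q1 + t y1\<close> with \<open>t\<close> a root of
        \<open>p\<close>, its last coordinate is a root of the monic \<open>F\<close> over them, and
        \<open>c\<close> is determined by these two; so only finitely many \<open>c\<close> are
        bad.\<close>
      define bad where "bad = (\<Union>t\<in>{t. poly p t = 0} - {0}.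
        (\<lambda>s. (s - q1 n) / t) ` {s. poly (F (\<lambda>i. q1 i + t * y1 i)) s = 0})"
      have "F x \<noteq> 0" for x using F(4)[of x] gw by auto
      then have "finite bad" unfolding bad_def using fin by (intro finite_UN_I finite_imageI poly_roots_finite) auto
      then have "finite (insert 0 bad)" by simp
      then obtain c where c: "c \<notin> insert 0 bad" using ex_new_if_finite infinite_UNIV_char_0 by metis
      define w1 where "w1 = (\<lambda>i. inverse c * y1 i)"
      have "g1 (w1(n := 1)) = g1 w1" by (rule coord_algebra_eq[OF g1(1)]) auto
      also have "\<dots> \<noteq> 0" unfolding w1_def g1(3) using g1(2) c by simp
      finally have gw1: "g1 (w1(n := 1)) \<noteq> 0" .
      have "x n = q1 n" if x: "shear n w1 x \<in> zero_locus (shear_ideal n w I)" "\<forall>i<n. x i = q1 i - w1 i * q1 n" for x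
      proof (rule ccontr)
        assume ne: "x n \<noteq> q1 n"
        define t where "t = (x n - q1 n) / c"
        have t: "t \<noteq> 0" using ne c by (simp add: t_def)
        have coords: "shear n w1 x i = q1 i + t * y1 i" if "i < n" for i
          using x(2) that c by (simp add: shear_def t_def w1_def field_simps)
        have "G1 (shear n w1 x) = 0" by (rule zero_locusD[OF x(1) G1(1)])
        moreover have "G1 (shear n w1 x) = G1 (\<lambda>i. q1 i + t * y1 i)"
          by (rule coord_algebra_eq[OF G1(2)]) (rule coords)
        ultimately have pt: "poly p t = 0" by (simp add: p)
        have "shear n w (shear n w1 x) \<in> zero_locus I" using x(1) by (simp add: zero_locus_shear)
        then have "G (shear n w (shear n w1 x)) = 0" by (rule zero_locusD[OF _ G(1)])
        then have "poly (F (shear n w1 x)) (x n) = 0" by (simp add: F(2)) (simp add: shear_def)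
        moreover have "F (shear n w1 x) = F (\<lambda>i. q1 i + t * y1 i)"
          by (intro poly_eqI coord_algebra_eq[OF poly_familyD[OF F(1)]] coords)
        ultimately have "x n \<in> {s. poly (F (\<lambda>i. q1 i + t * y1 i)) s = 0}" by simp
        moreover have "c = (x n - q1 n) / t" using t c by (simp add: t_def)
        ultimately have "c \<in> bad" unfolding bad_def using t pt by blast
        then show False using c by simp
      qed
      note alt = this
      have "dense_at (Suc n) (shear_ideal n w I) q1"
      proof (rule S.dense_at_of_leading_form[where G = G1 and g = g1 and d = d1 and w = w1])
        show "degree p \<le> d1 \<and> coeff p d1 = g1 v" if "\<forall>t. G1 (\<lambda>i. x i + t * v i) = poly p t" for x v p
          using that by (rule g1(4))
      qed (use Suc.IH q1 G1(1) gw1 alt in auto)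
      then show ?thesis unfolding q1_def by (rule dense_at_shear)
    qed
  qed
qed

section \<open>Affine varieties\<close>

lemma poly_funs_const: "(\<lambda>_. c) \<in> poly_funs"
  unfolding poly_funs_def by (rule gen_algebra.const)

lemma poly_funs_add: "f \<in> poly_funs \<Longrightarrow> g \<in> poly_funs \<Longrightarrow> (\<lambda>x. f x + g x) \<in> poly_funs"
  unfolding poly_funs_def by (rule gen_algebra.add)

lemma poly_funs_mult: "f \<in> poly_funs \<Longrightarrow> g \<in> poly_funs \<Longrightarrow> (\<lambda>x. f x * g x) \<in> poly_funs"
  unfolding poly_funs_def by (rule gen_algebra.mult)

lemma poly_funs_diff: "f \<in> poly_funs \<Longrightarrow> g \<in> poly_funs \<Longrightarrow> (\<lambda>x. f x - g x) \<in> poly_funs"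
  unfolding poly_funs_def by (rule gen_algebra_diff)

lemma poly_funs_sum: "(\<And>i. i \<in> I \<Longrightarrow> f i \<in> poly_funs) \<Longrightarrow> (\<lambda>x. \<Sum>i\<in>I. f i x) \<in> poly_funs"
  unfolding poly_funs_def by (rule gen_algebra_sum)

lemma poly_funs_power: "f \<in> poly_funs \<Longrightarrow> (\<lambda>x. f x ^ k) \<in> poly_funs"
  unfolding poly_funs_def by (rule gen_algebra_power)

lemma poly_funs_coord: "(\<lambda>x. x $ i) \<in> poly_funs"
  unfolding poly_funs_def by (rule gen_algebra.gen) auto

lemma poly_funs_subst:
  assumes "f \<in> poly_funs" "\<And>i. (\<lambda>x. h x $ i) \<in> poly_funs"
  shows "(\<lambda>x. f (h x)) \<in> poly_funs"
  using assms unfolding poly_funs_def by (elim gen_algebra_subst) auto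

lemma poly_funs_tendsto:
  assumes "f \<in> poly_funs" "(X \<longlongrightarrow> x) F"
  shows "((\<lambda>k. f (X k)) \<longlongrightarrow> f x) F"
  using assms unfolding poly_funs_def by (elim gen_algebra_tendsto) (auto intro: tendsto_vec_nth)

lemma poly_funs_continuous: "f \<in> poly_funs \<Longrightarrow> continuous_on S f"
  unfolding continuous_on_def by (auto intro: poly_funs_tendsto)

lemma poly_funs_determine: "(\<And>f. f \<in> poly_funs \<Longrightarrow> f x = f y) \<Longrightarrow> x = y"
  using poly_funs_coord by (auto simp: vec_eq_iff)

lemmas poly_funs_curve = gen_algebra_curve[of _ "range (\<lambda>i x. x $ i)" "range (\<lambda>i x. x $ i)",
  folded poly_funs_def]

lemmas poly_funs_family_add = poly_family_add[of _ "range (\<lambda>i x. x $ i)", folded poly_funs_def]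
lemmas poly_funs_family_mult = poly_family_mult[of _ "range (\<lambda>i x. x $ i)", folded poly_funs_def]
lemmas poly_funs_family_const = poly_family_const[of _ "range (\<lambda>i x. x $ i)", folded poly_funs_def]
lemmas poly_funs_family_monom = poly_family_monom[of _ "range (\<lambda>i x. x $ i)", folded poly_funs_def]

lemma regfuns_affine: "regfuns (affine_fspace V) = {f. \<exists>h\<in>poly_funs. \<forall>x\<in>V. f x = h x}"
  by (simp add: affine_fspace_def gen_fspace_def poly_funs_def)

lemma points_affine [simp]: "points (affine_fspace V) = V"
  by (simp add: affine_fspace_def gen_fspace_def)

lemma poly_funs_regfuns: "f \<in> poly_funs \<Longrightarrow> f \<in> regfuns (affine_fspace V)"
  by (auto simp: regfuns_affine)

lemma zariski_closed_Int_zero: 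
  assumes "zariski_closed V" "f \<in> poly_funs"
  shows "zariski_closed {x\<in>V. f x = 0}"
proof -
  obtain F where "F \<subseteq> poly_funs" "V = {x. \<forall>f\<in>F. f x = 0}" using assms(1) by (auto simp: zariski_closed_def)
  then have "insert f F \<subseteq> poly_funs \<and> {x\<in>V. f x = 0} = {x. \<forall>g\<in>insert f F. g x = 0}" using assms(2) by auto
  then show ?thesis unfolding zariski_closed_def by blast
qed

text \<open>This is primality of the vanishing ideal: two factors would split \<open>V\<close> into
  two closed parts.\<close>

lemma irreducible_closed_mult:
  assumes "irreducible_closed V" "f \<in> poly_funs" "g \<in> poly_funs" "\<And>x. x \<in> V \<Longrightarrow> f x * g x = 0"
  shows "(\<forall>x\<in>V. f x = 0) \<or> (\<forall>x\<in>V. g x = 0)"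
proof -
  have V: "zariski_closed V" using assms(1) by (simp add: irreducible_closed_def)
  have "V = {x\<in>V. f x = 0} \<union> {x\<in>V. g x = 0}" using assms(4) by fastforce
  moreover have "zariski_closed {x\<in>V. f x = 0}" "zariski_closed {x\<in>V. g x = 0}"
    by (rule zariski_closed_Int_zero[OF V assms(2)], rule zariski_closed_Int_zero[OF V assms(3)])
  ultimately have "V = {x\<in>V. f x = 0} \<or> V = {x\<in>V. g x = 0}"
    using assms(1) unfolding irreducible_closed_def by blast
  then show ?thesis by blast
qed

lemma zariski_closed_membership:
  assumes "zariski_closed V" "\<And>f. f \<in> poly_funs \<Longrightarrow> (\<And>y. y \<in> V \<Longrightarrow> f y = 0) \<Longrightarrow> f x = 0"
  shows "x \<in> V"
  using assms unfolding zariski_closed_def by blast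

lemma zariski_closed_imp_closed:
  assumes "zariski_closed V"
  shows "closed V"
proof -
  obtain F where F: "F \<subseteq> poly_funs" "V = {x. \<forall>f\<in>F. f x = 0}" using assms by (auto simp: zariski_closed_def)
  have "V = (\<Inter>f\<in>F. {x. f x = 0})" using F by auto
  moreover have "closed {x. f x = 0}" if "f \<in> F" for f
    using F that by (intro closed_Collect_eq) (auto intro: poly_funs_continuous)
  ultimately show ?thesis by auto
qed

text \<open>
  A Euclidean neighbourhood of a point of an irreducible variety is Zariski dense. The definition of an
  attractive fixed point only controls the action near that point.
\<close>

lemma irreducible_closed_identity:
  fixes V :: "(complex ^ 'n) set"
  assumes V: "irreducible_closed V" and q: "q \<in> V" "open U" "q \<in> U" and f: "f \<in> poly_funs"
    and f0: "\<And>x. x \<in> V \<inter> U \<Longrightarrow> f x = 0"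
  shows "\<forall>x\<in>V. f x = 0"
proof (rule ccontr)
  assume nz: "\<not> (\<forall>x\<in>V. f x = 0)"
  \<comment> \<open>The coordinates are numbered, so that the result on ideals of
    \<open>coord_algebra N\<close> applies; \<open>vec_of\<close> and \<open>fun_of\<close>
    translate points.\<close>
  define N where "N = CARD('n)"
  obtain e :: "nat \<Rightarrow> 'n" where e: "bij_betw e {..<N} UNIV"
    using ex_bij_betw_nat_finite[of "UNIV :: 'n set"] by (auto simp: N_def atLeast0LessThan)
  define e' where "e' = the_inv_into {..<N} e"
  have e': "e' i < N" "e (e' i) = i" for i
    using e the_inv_into_into[of e "{..<N}" i "{..<N}"] f_the_inv_into_f[of e "{..<N}" i]
    by (auto simp: e'_def bij_betw_def)
  have e'e: "e' (e k) = k" if "k < N" for k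
    using e that the_inv_into_f_f[of e "{..<N}" k] by (auto simp: e'_def bij_betw_def)
  define vec_of where "vec_of = (\<lambda>x. (\<chi> i. x (e' i)) :: complex ^ 'n)"
  define fun_of where "fun_of = (\<lambda>v::complex ^ 'n. \<lambda>k. v $ e k)"
  have vf: "vec_of (fun_of v) = v" for v by (simp add: vec_of_def fun_of_def e' vec_eq_iff)
  have to: "(\<lambda>x. g (vec_of x)) \<in> coord_algebra N" if "g \<in> poly_funs" for g
    using that unfolding poly_funs_def coord_algebra_def
    by (rule gen_algebra_subst) (auto simp: vec_of_def e' intro!: gen_algebra.gen)
  have from_vec: "(\<lambda>v. g (fun_of v)) \<in> poly_funs" if "g \<in> coord_algebra N" for g
    using that unfolding poly_funs_def coord_algebra_def
    by (rule gen_algebra_subst) (auto simp: fun_of_def intro!: gen_algebra.gen)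
  define I where "I = {g\<in>coord_algebra N. \<forall>v\<in>V. g (fun_of v) = 0}"
  have "coord_prime N I"
  proof
    fix g h assume gh: "g \<in> coord_algebra N" "h \<in> coord_algebra N" "(\<lambda>x. g x * h x) \<in> I"
    then show "g \<in> I \<or> h \<in> I"
      using irreducible_closed_mult[OF V from_vec[OF gh(1)] from_vec[OF gh(2)]] by (auto simp: I_def)
  qed (use q in \<open>auto simp: I_def coord_algebra_const coord_algebra_add coord_algebra_mult\<close>)
  moreover have "fun_of q \<in> zero_locus I" using q by (auto simp: I_def zero_locus_def)
  ultimately have "dense_at N I (fun_of q)" by (rule dense_at_zero_locus)
  moreover have "(\<lambda>x. f (vec_of x)) \<in> coord_algebra N - I" using nz to[OF f] by (auto simp: I_def vf)
  ultimately have "\<exists>X. (\<forall>k. X k \<in> zero_locus I \<and> f (vec_of (X k)) \<noteq> 0) \<and>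
      (\<forall>i<N. (\<lambda>k. X k i) \<longlonglongrightarrow> fun_of q i)"
    unfolding dense_at_def by (rule bspec)
  then obtain X where X: "\<And>k. X k \<in> zero_locus I" "\<And>k. f (vec_of (X k)) \<noteq> 0"
    "\<And>i. i < N \<Longrightarrow> (\<lambda>k. X k i) \<longlonglongrightarrow> fun_of q i" by blast
  have inV: "vec_of (X k) \<in> V" for k
  proof (rule zariski_closed_membership)
    show "zariski_closed V" using V by (simp add: irreducible_closed_def)
    fix g :: "complex ^ 'n \<Rightarrow> complex" assume "g \<in> poly_funs" "\<And>y. y \<in> V \<Longrightarrow> g y = 0"
    then have "(\<lambda>x. g (vec_of x)) \<in> I" using to by (auto simp: I_def vf)
    then show "g (vec_of (X k)) = 0" by (rule zero_locusD[OF X(1)])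
  qed
  have "(\<lambda>k. vec_of (X k)) \<longlonglongrightarrow> q"
  proof (rule vec_tendstoI)
    fix i
    show "(\<lambda>k. vec_of (X k) $ i) \<longlonglongrightarrow> q $ i" using X(3)[OF e'(1)[of i]]
      by (simp add: vec_of_def fun_of_def e')
  qed
  then have "\<forall>\<^sub>F k in sequentially. vec_of (X k) \<in> U" using q by (simp add: tendsto_def)
  then obtain k where "vec_of (X k) \<in> U" by (auto dest: eventually_happens)
  then show False using inV[of k] f0 X(2) by blast
qed

section \<open>Actions and gradings\<close>

lemma group_Cplus: "group Cplus"
proof (rule groupI)
  fix x assume "x \<in> carrier Cplus"
  then show "\<exists>y\<in>carrier Cplus. y \<otimes>\<^bsub>Cplus\<^esub> x = \<one>\<^bsub>Cplus\<^esub>"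
    by (intro bexI[of _ "- x"]) (auto simp: Cplus_def)
qed (auto simp: Cplus_def)

text \<open>Actions take values in \<open>BijGroup\<close>, hence the extensionality condition;
  bijectivity comes from the inverse group element.\<close>

lemma group_actionI:
  assumes "group K" "\<And>t. t \<in> carrier K \<Longrightarrow> f t \<in> extensional E"
    "\<And>t x. t \<in> carrier K \<Longrightarrow> x \<in> E \<Longrightarrow> f t x \<in> E" "\<And>x. x \<in> E \<Longrightarrow> f \<one>\<^bsub>K\<^esub> x = x"
    "\<And>s t x. s \<in> carrier K \<Longrightarrow> t \<in> carrier K \<Longrightarrow> x \<in> E \<Longrightarrow> f (s \<otimes>\<^bsub>K\<^esub> t) x = f s (f t x)"
  shows "group_action K E f"
proof -
  interpret K: group K by fact
  have bij: "f t \<in> Bij E" if t: "t \<in> carrier K" for t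
  proof -
    have "bij_betw (f t) E E"
    proof (rule bij_betw_byWitness[where f' = "f (inv\<^bsub>K\<^esub> t)"])
      show "\<forall>a\<in>E. f (inv\<^bsub>K\<^esub> t) (f t a) = a" "\<forall>a\<in>E. f t (f (inv\<^bsub>K\<^esub> t) a) = a"
        using t by (auto simp: assms(4) simp flip: assms(5))
      show "f t ` E \<subseteq> E" "f (inv\<^bsub>K\<^esub> t) ` E \<subseteq> E" using t assms(3) by auto
    qed
    then show ?thesis using assms(2)[OF t] by (simp add: Bij_def)
  qed
  have "f (s \<otimes>\<^bsub>K\<^esub> t) = compose E (f s) (f t)" if "s \<in> carrier K" "t \<in> carrier K" for s t
    using that assms(2)[of "s \<otimes>\<^bsub>K\<^esub> t"] assms(5)
    by (intro extensionalityI[where A = E]) (auto simp: compose_eq)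
  then have "f \<in> hom K (BijGroup E)"
    using bij by (auto simp: hom_def BijGroup_def)
  then show ?thesis
    unfolding group_action_def group_hom_def group_hom_axioms_def
    using group_BijGroup assms(1) by auto
qed

lemma Cstar_actionD:
  assumes "regular_action Cstar KS (affine_fspace V) \<phi>"
  shows "x \<in> V \<Longrightarrow> t \<noteq> 0 \<Longrightarrow> \<phi> t x \<in> V" "x \<in> V \<Longrightarrow> \<phi> 1 x = x"
    "x \<in> V \<Longrightarrow> s \<noteq> 0 \<Longrightarrow> t \<noteq> 0 \<Longrightarrow> \<phi> (s * t) x = \<phi> s (\<phi> t x)"
proof -
  have ga: "group_action Cstar V \<phi>" using assms by (simp add: regular_action_def)
  show "x \<in> V \<Longrightarrow> t \<noteq> 0 \<Longrightarrow> \<phi> t x \<in> V"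
    using group_action.element_image[OF ga, of t x] by (simp add: Cstar_def)
  show "x \<in> V \<Longrightarrow> \<phi> 1 x = x"
    using fun_cong[OF group_action.id_eq_one[OF ga], of x] by (simp add: Cstar_def)
  show "x \<in> V \<Longrightarrow> s \<noteq> 0 \<Longrightarrow> t \<noteq> 0 \<Longrightarrow> \<phi> (s * t) x = \<phi> s (\<phi> t x)"
    using group_action.composition_rule[OF ga, of x s t] by (simp add: Cstar_def)
qed

lemma Cplus_actionD:
  assumes "regular_action Cplus KS (affine_fspace V) \<psi>"
  shows "x \<in> V \<Longrightarrow> \<psi> t x \<in> V" "x \<in> V \<Longrightarrow> \<psi> 0 x = x" "x \<in> V \<Longrightarrow> \<psi> (s + t) x = \<psi> s (\<psi> t x)"
proof -
  have ga: "group_action Cplus V \<psi>" using assms by (simp add: regular_action_def)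
  show "x \<in> V \<Longrightarrow> \<psi> t x \<in> V"
    using group_action.element_image[OF ga, of t x] by (simp add: Cplus_def)
  show "x \<in> V \<Longrightarrow> \<psi> 0 x = x"
    using fun_cong[OF group_action.id_eq_one[OF ga], of x] by (simp add: Cplus_def)
  show "x \<in> V \<Longrightarrow> \<psi> (s + t) x = \<psi> s (\<psi> t x)"
    using group_action.composition_rule[OF ga, of x s t] by (simp add: Cplus_def)
qed

lemma regfuns_gen: "regfuns (gen_fspace E S) = {f. \<exists>h\<in>gen_algebra S. \<forall>x\<in>E. f x = h x}"
  by (simp add: gen_fspace_def)

lemma points_gen [simp]: "points (gen_fspace E S) = E"
  by (simp add: gen_fspace_def)

text \<open>Regular functions on the punctured line are Laurent polynomials; multiplying by a power
  of \<open>t\<close> keeps them within \<open>poly\<close>.\<close>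

lemma Cstar_regular_laurent:
  assumes "h \<in> gen_algebra {\<lambda>t. t, inverse :: complex \<Rightarrow> complex}"
  shows "\<exists>N p. \<forall>t. t \<noteq> 0 \<longrightarrow> t ^ N * h t = poly p t"
  using assms
proof induction
  case (gen f)
  then consider "f = (\<lambda>t. t)" | "f = inverse" by auto
  then show ?case
  proof cases
    case 1 then show ?thesis by (intro exI[of _ "0::nat"] exI[of _ "[:0, 1:]"]) simp
  next
    case 2 then show ?thesis by (intro exI[of _ "1::nat"] exI[of _ "[:1:]"]) simp
  qed
next
  case (const c) show ?case by (intro exI[of _ "0::nat"] exI[of _ "[:c:]"]) simp
next
  case (add f g)
  then obtain N p M r where "\<forall>t. t \<noteq> 0 \<longrightarrow> t ^ N * f t = poly p t" "\<forall>t. t \<noteq> 0 \<longrightarrow> t ^ M * g t = poly r t"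
    by blast
  moreover have "t ^ (N + M) * (f t + g t) = t ^ M * (t ^ N * f t) + t ^ N * (t ^ M * g t)" for t
    by (simp add: power_add algebra_simps)
  ultimately have "\<forall>t. t \<noteq> 0 \<longrightarrow> t ^ (N + M) * (f t + g t) = poly (monom 1 M * p + monom 1 N * r) t"
    by (simp add: poly_monom)
  then show ?case by blast
next
  case (mult f g)
  then obtain N p M r where "\<forall>t. t \<noteq> 0 \<longrightarrow> t ^ N * f t = poly p t" "\<forall>t. t \<noteq> 0 \<longrightarrow> t ^ M * g t = poly r t"
    by blast
  moreover have "t ^ (N + M) * (f t * g t) = (t ^ N * f t) * (t ^ M * g t)" for t
    by (simp add: power_add)
  ultimately have "\<forall>t. t \<noteq> 0 \<longrightarrow> t ^ (N + M) * (f t * g t) = poly (p * r) t"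
    by (simp only: poly_mult) simp
  then show ?case by blast
qed

lemma Cstar_action_laurent:
  fixes V :: "(complex ^ 'n) set"
  assumes \<phi>: "regular_action Cstar Cstar_space (affine_fspace V) \<phi>" and f: "f \<in> poly_funs"
  shows "\<exists>N. \<exists>F\<in>poly_family poly_funs. \<forall>x\<in>V. \<forall>t. t \<noteq> 0 \<longrightarrow> t ^ N * f (\<phi> t x) = poly (F x) t"
proof -
  define S where "S = (\<lambda>f. f \<circ> fst) ` regfuns Cstar_space \<union> (\<lambda>g. g \<circ> snd) ` regfuns (affine_fspace V)"
  have "f \<circ> (\<lambda>(t, x). \<phi> t x) \<in> regfuns (prod_fspace Cstar_space (affine_fspace V))"
    using \<phi> poly_funs_regfuns[OF f] unfolding regular_action_def morphism_def by blast
  then obtain h where h: "h \<in> gen_algebra S" and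
    h0: "\<forall>z\<in>points Cstar_space \<times> V. (f \<circ> (\<lambda>(t, x). \<phi> t x)) z = h z"
    unfolding prod_fspace_def regfuns_gen S_def[symmetric] points_affine by blast
  have h2: "f (\<phi> t x) = h (t, x)" if "t \<noteq> 0" "x \<in> V" for t x
    using bspec[OF h0, of "(t, x)"] that by (simp add: Cstar_space_def)
  have "\<exists>N. \<exists>F\<in>poly_family poly_funs. \<forall>x\<in>V. \<forall>t. t \<noteq> 0 \<longrightarrow> t ^ N * h (t, x) = poly (F x) t"
    using h
  proof induction
    case (gen g)
    then consider k where "g = k \<circ> fst" "k \<in> regfuns Cstar_space" | k where "g = k \<circ> snd" "k \<in> regfuns (affine_fspace V)"
      by (auto simp: S_def)
    then show ?case
    proof cases
      case 1
      then obtain k' where "k' \<in> gen_algebra {\<lambda>t. t, inverse}" "\<And>t. t \<noteq> 0 \<Longrightarrow> k t = k' t"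
        by (auto simp: Cstar_space_def regfuns_gen)
      then obtain N p where "\<And>t. t \<noteq> 0 \<Longrightarrow> t ^ N * k t = poly p t" using Cstar_regular_laurent by metis
      moreover have "(\<lambda>_. p) \<in> poly_family poly_funs" by (auto simp: poly_family_def poly_funs_const)
      ultimately show ?thesis using 1 by (intro exI[of _ N] bexI[of _ "\<lambda>_. p"]) auto
    next
      case 2
      then obtain k' where "k' \<in> poly_funs" "\<And>x. x \<in> V \<Longrightarrow> k x = k' x" by (auto simp: regfuns_affine)
      then show ?thesis using 2
        by (intro exI[of _ 0] bexI[of _ "\<lambda>x. [:k' x:]"]) (auto intro: poly_funs_family_const)
    qed
  next
    case (const c)
    show ?case by (intro exI[of _ 0] bexI[of _ "\<lambda>x. [:c:]"]) (auto intro: poly_funs_family_const poly_funs_const)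
  next
    case (add f g)
    then obtain N F M G where FG: "F \<in> poly_family poly_funs" "G \<in> poly_family poly_funs"
      "\<forall>x\<in>V. \<forall>t. t \<noteq> 0 \<longrightarrow> t ^ N * f (t, x) = poly (F x) t" "\<forall>x\<in>V. \<forall>t. t \<noteq> 0 \<longrightarrow> t ^ M * g (t, x) = poly (G x) t"
      by blast
    have "(\<lambda>x. monom 1 M * F x + monom 1 N * G x) \<in> poly_family poly_funs"
      by (intro poly_funs_family_add poly_funs_family_mult FG poly_funs_family_monom poly_funs_const)
    moreover have "t ^ (N + M) * (f (t, x) + g (t, x)) = poly (monom 1 M * F x + monom 1 N * G x) t"
      if "t \<noteq> 0" "x \<in> V" for t x
    proof -
      have "t ^ (N + M) * (f (t, x) + g (t, x)) = t ^ M * (t ^ N * f (t, x)) + t ^ N * (t ^ M * g (t, x))"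
        by (simp add: power_add algebra_simps)
      then show ?thesis using FG(3,4) that by (simp add: poly_monom)
    qed
    ultimately show ?case
      by (intro exI[of _ "N + M"] bexI[of _ "\<lambda>x. monom 1 M * F x + monom 1 N * G x"]) auto
  next
    case (mult f g)
    then obtain N F M G where FG: "F \<in> poly_family poly_funs" "G \<in> poly_family poly_funs"
      "\<forall>x\<in>V. \<forall>t. t \<noteq> 0 \<longrightarrow> t ^ N * f (t, x) = poly (F x) t" "\<forall>x\<in>V. \<forall>t. t \<noteq> 0 \<longrightarrow> t ^ M * g (t, x) = poly (G x) t"
      by blast
    have "(\<lambda>x. F x * G x) \<in> poly_family poly_funs" by (intro poly_funs_family_mult FG)
    moreover have "t ^ (N + M) * (f (t, x) * g (t, x)) = poly (F x * G x) t" if "t \<noteq> 0" "x \<in> V" for t x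
    proof -
      have "t ^ (N + M) * (f (t, x) * g (t, x)) = (t ^ N * f (t, x)) * (t ^ M * g (t, x))"
        by (simp add: power_add algebra_simps)
      then show ?thesis using FG(3,4) that by simp
    qed
    ultimately show ?case
      by (intro exI[of _ "N + M"] bexI[of _ "\<lambda>x. F x * G x"]) auto
  qed
  then show ?thesis using h2 by metis
qed

lemma Cplus_action_poly:
  fixes V :: "(complex ^ 'n) set"
  assumes \<psi>: "regular_action Cplus Cplus_space (affine_fspace V) \<psi>" and f: "f \<in> poly_funs"
  shows "\<exists>F\<in>poly_family poly_funs. \<forall>x\<in>V. \<forall>t. f (\<psi> t x) = poly (F x) t"
proof -
  define S where "S = (\<lambda>f. f \<circ> fst) ` regfuns Cplus_space \<union> (\<lambda>g. g \<circ> snd) ` regfuns (affine_fspace V)"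
  have "f \<circ> (\<lambda>(t, x). \<psi> t x) \<in> regfuns (prod_fspace Cplus_space (affine_fspace V))"
    using \<psi> poly_funs_regfuns[OF f] unfolding regular_action_def morphism_def by blast
  then obtain h where h: "h \<in> gen_algebra S" and
    h0: "\<forall>z\<in>points Cplus_space \<times> V. (f \<circ> (\<lambda>(t, x). \<psi> t x)) z = h z"
    unfolding prod_fspace_def regfuns_gen S_def[symmetric] points_affine by blast
  have h2: "f (\<psi> t x) = h (t, x)" if "x \<in> V" for t x
    using bspec[OF h0, of "(t, x)"] that by (simp add: Cplus_space_def)
  have "\<exists>F\<in>poly_family poly_funs. \<forall>x t. x \<in> V \<longrightarrow> g (t, x) = poly (F x) t" if "g \<in> S" for g
  proof -
    from that consider k where "g = k \<circ> fst" "k \<in> regfuns Cplus_space" | k where "g = k \<circ> snd" "k \<in> regfuns (affine_fspace V)"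
      by (auto simp: S_def)
    then show ?thesis
    proof cases
      case 1
      then have "k \<in> gen_algebra {\<lambda>t. t}" by (auto simp: Cplus_space_def regfuns_gen) (metis ext)
      then have "\<exists>p. \<forall>t. k t = poly p t"
      proof induction
        case (gen f)
        then show ?case by (intro exI[of _ "[:0, 1:]"]) simp
      next
        case (const c) then show ?case by (intro exI[of _ "[:c:]"]) simp
      next
        case (add f g) then show ?case by (metis poly_add)
      next
        case (mult f g) then show ?case by (metis poly_mult)
      qed
      then obtain p where "\<And>t. k t = poly p t" by blast
      moreover have "(\<lambda>_. p) \<in> poly_family poly_funs" by (auto simp: poly_family_def poly_funs_const)
      ultimately show ?thesis using 1 by (intro bexI[of _ "\<lambda>_. p"]) auto
    next
      case 2
      then obtain k' where "k' \<in> poly_funs" "\<And>x. x \<in> V \<Longrightarrow> k x = k' x" by (auto simp: regfuns_affine)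
      then show ?thesis using 2
        by (intro bexI[of _ "\<lambda>x. [:k' x:]"]) (auto intro: poly_funs_family_const)
    qed
  qed
  then have "\<exists>F\<in>poly_family poly_funs. \<forall>x t. x \<in> V \<longrightarrow> h (t, x) = poly (F x) t"
    using gen_algebra_curve[OF h, of "range (\<lambda>i x. x $ i)" "\<lambda>x t. x \<in> V" "\<lambda>x t. (t, x)", folded poly_funs_def]
    by blast
  then show ?thesis using h2 by metis
qed

text \<open>A finite limit at \<open>0\<close> excludes negative exponents from a Laurent
  polynomial. This is how attraction becomes nonnegativity of the grading.\<close>

lemma poly_quotient_limit:
  fixes p :: "complex poly"
  assumes "((\<lambda>t. poly p t / t ^ N) \<longlongrightarrow> L) (at 0)"
  shows "(\<forall>i<N. coeff p i = 0) \<and> coeff p N = L"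
  using assms
proof (induction N arbitrary: p)
  case 0
  then have "((\<lambda>t. poly p t) \<longlongrightarrow> L) (at 0)" by simp
  moreover have "((\<lambda>t. poly p t) \<longlongrightarrow> poly p 0) (at 0)" by (intro isContD poly_isCont)
  ultimately have "L = poly p 0" by (rule tendsto_unique[OF at_neq_bot])
  then show ?case by (simp add: poly_0_coeff_0)
next
  case (Suc N)
  have "((\<lambda>t. poly p t / t ^ Suc N * t ^ Suc N) \<longlongrightarrow> L * 0 ^ Suc N) (at 0)"
    by (intro tendsto_intros Suc.prems)
  then have "((\<lambda>t. poly p t) \<longlongrightarrow> L * 0 ^ Suc N) (at 0)"
    by (rule Lim_transform_eventually) (auto simp: eventually_at_filter)
  moreover have "((\<lambda>t. poly p t) \<longlongrightarrow> poly p 0) (at 0)" by (intro isContD poly_isCont)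
  ultimately have "L * 0 ^ Suc N = poly p 0" by (rule tendsto_unique[OF at_neq_bot])
  then have "poly p 0 = 0" by simp
  then obtain p' where p': "p = pCons 0 p'" by (metis pCons_cases poly_0_coeff_0 coeff_pCons_0)
  have "((\<lambda>t. poly p' t / t ^ N) \<longlongrightarrow> L) (at 0)"
    using Suc.prems by (rule Lim_transform_eventually) (auto simp: eventually_at_filter p')
  then have "(\<forall>i<N. coeff p' i = 0) \<and> coeff p' N = L" by (rule Suc.IH)
  then show ?case by (auto simp: p' coeff_pCons split: nat.split)
qed

text \<open>The last assumption encodes the grading: the coefficient of \<open>t ^ k\<close> is the
  component of degree \<open>k\<close>, no negative degrees occur, and degree zero contains just the
  constants, read off at the vertex \<open>q\<close>.\<close>

locale graded_variety =
  fixes V :: "(complex ^ 'n) set" and q :: "complex ^ 'n" and \<phi> :: "complex \<Rightarrow> complex ^ 'n \<Rightarrow> complex ^ 'n"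
  assumes irr: "irreducible_closed V"
    and q: "q \<in> V"
    and act_in: "x \<in> V \<Longrightarrow> t \<noteq> 0 \<Longrightarrow> \<phi> t x \<in> V"
    and act_1: "x \<in> V \<Longrightarrow> \<phi> 1 x = x"
    and act_mult: "x \<in> V \<Longrightarrow> s \<noteq> 0 \<Longrightarrow> t \<noteq> 0 \<Longrightarrow> \<phi> (s * t) x = \<phi> s (\<phi> t x)"
    and grading: "f \<in> poly_funs \<Longrightarrow> \<exists>F\<in>poly_family poly_funs. \<forall>x\<in>V. coeff (F x) 0 = f q \<and>
      (\<forall>t. t \<noteq> 0 \<longrightarrow> f (\<phi> t x) = poly (F x) t)"

lemma good_Cstar_action_graded:
  assumes V: "irreducible_closed V" and \<phi>: "good_Cstar_action V \<phi>"
  shows "\<exists>q. graded_variety V q \<phi>"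
proof -
  have reg: "regular_action Cstar Cstar_space (affine_fspace V) \<phi>"
    using \<phi> by (simp add: good_Cstar_action_def)
  obtain q where "attractive_fixed_point V \<phi> q" using \<phi> by (auto simp: good_Cstar_action_def)
  then obtain U where q: "q \<in> V" "open U" "q \<in> U" "\<And>x. x \<in> V \<inter> U \<Longrightarrow> ((\<lambda>t. \<phi> t x) \<longlongrightarrow> q) (at 0)"
    unfolding attractive_fixed_point_def by blast
  have "graded_variety V q \<phi>"
  proof
    fix f :: "complex ^ 'a \<Rightarrow> complex" assume f: "f \<in> poly_funs"
    obtain N F where F: "F \<in> poly_family poly_funs" "\<forall>x\<in>V. \<forall>t. t \<noteq> 0 \<longrightarrow> t ^ N * f (\<phi> t x) = poly (F x) t"
      using Cstar_action_laurent[OF reg f] by blast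
    have near: "(\<forall>i<N. coeff (F x) i = 0) \<and> coeff (F x) N = f q" if "x \<in> V \<inter> U" for x
    proof (rule poly_quotient_limit)
      have "((\<lambda>t. f (\<phi> t x)) \<longlongrightarrow> f q) (at 0)" using f q(4)[OF that] by (rule poly_funs_tendsto)
      then show "((\<lambda>t. poly (F x) t / t ^ N) \<longlongrightarrow> f q) (at 0)"
        by (rule Lim_transform_eventually)
          (use F(2) that in \<open>auto simp: eventually_at_filter field_simps\<close>)
    qed
    \<comment> \<open>The coefficients are polynomial functions, so their vanishing near
      \<open>q\<close> spreads to all of \<open>V\<close>.\<close>
    have low: "\<forall>x\<in>V. coeff (F x) i = 0" if "i < N" for i
      using near that by (intro irreducible_closed_identity[OF V q(1-3)] poly_familyD[OF F(1)]) auto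
    have "\<forall>x\<in>V. coeff (F x) N - f q = 0"
      using near by (intro irreducible_closed_identity[OF V q(1-3)] poly_funs_diff poly_funs_const poly_familyD[OF F(1)]) auto
    then have top: "\<forall>x\<in>V. coeff (F x) N = f q" by simp
    define G where "G = (\<lambda>x. poly_shift N (F x))"
    obtain d where d: "\<And>x. degree (F x) \<le> d" using poly_family_degree[OF F(1)] by blast
    have "degree (G x) \<le> d" for x
      by (intro degree_le) (use d[of x] in \<open>auto simp: G_def coeff_poly_shift intro!: coeff_eq_0\<close>)
    then have "G \<in> poly_family poly_funs"
      using poly_familyD[OF F(1)] by (auto simp: poly_family_def G_def coeff_poly_shift)
    moreover have "f (\<phi> t x) = poly (G x) t" if "x \<in> V" "t \<noteq> 0" for x t
    proof -
      have "F x = monom 1 N * G x"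
        using low that(1) by (intro poly_eqI) (auto simp: coeff_monom_mult G_def coeff_poly_shift)
      then have "t ^ N * f (\<phi> t x) = t ^ N * poly (G x) t" using F(2) that by (simp add: poly_monom)
      then show ?thesis using that by simp
    qed
    moreover have "coeff (G x) 0 = f q" if "x \<in> V" for x using top that by (simp add: G_def coeff_poly_shift)
    ultimately show "\<exists>F\<in>poly_family poly_funs. \<forall>x\<in>V. coeff (F x) 0 = f q \<and>
      (\<forall>t. t \<noteq> 0 \<longrightarrow> f (\<phi> t x) = poly (F x) t)" by blast
  qed (use V q Cstar_actionD[OF reg] in auto)
  then show ?thesis by blast
qed

section \<open>Tangent spaces\<close>

text \<open>The chain rule is stated for arbitrary curves and not just for lines, because tangent
  vectors are going to be pushed through polynomial maps.\<close>

lemma poly_funs_gradient: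
  assumes "f \<in> poly_funs"
  shows "\<exists>L :: complex ^ 'n. \<forall>c c'. c 0 = x \<and> (\<forall>i. ((\<lambda>s. c s $ i) has_field_derivative c' $ i) (at 0)) \<longrightarrow>
    ((\<lambda>s. f (c s)) has_field_derivative (\<Sum>i\<in>UNIV. L $ i * c' $ i)) (at 0)"
  using assms unfolding poly_funs_def
proof induction
  case (gen f)
  then obtain j where "f = (\<lambda>x. x $ j)" by auto
  moreover have "(\<Sum>i\<in>UNIV. axis j 1 $ i * c $ i) = c $ j" for c :: "complex ^ 'n"
  proof -
    have "(\<Sum>i\<in>UNIV. axis j 1 $ i * c $ i) = (\<Sum>i\<in>UNIV. if i = j then c $ i else 0)"
      by (intro sum.cong) (auto simp: axis_def)
    then show ?thesis by simp
  qed
  ultimately show ?case by (intro exI[of _ "axis j 1"]) simp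
next
  case (const c)
  show ?case by (intro exI[of _ 0]) simp
next
  case (add f g)
  then obtain L M :: "complex ^ 'n" where
    L: "\<forall>c c'. c 0 = x \<and> (\<forall>i. ((\<lambda>s. c s $ i) has_field_derivative c' $ i) (at 0)) \<longrightarrow>
      ((\<lambda>s. f (c s)) has_field_derivative (\<Sum>i\<in>UNIV. L $ i * c' $ i)) (at 0)"
    and M: "\<forall>c c'. c 0 = x \<and> (\<forall>i. ((\<lambda>s. c s $ i) has_field_derivative c' $ i) (at 0)) \<longrightarrow>
      ((\<lambda>s. g (c s)) has_field_derivative (\<Sum>i\<in>UNIV. M $ i * c' $ i)) (at 0)" by blast
  show ?case
  proof (intro exI[of _ "L + M"] allI impI)
    fix c c' assume c: "c 0 = x \<and> (\<forall>i. ((\<lambda>s. c s $ i) has_field_derivative c' $ i) (at 0))"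
    have "((\<lambda>s. f (c s) + g (c s)) has_field_derivative
      (\<Sum>i\<in>UNIV. L $ i * c' $ i) + (\<Sum>i\<in>UNIV. M $ i * c' $ i)) (at 0)"
      by (intro DERIV_add L[rule_format, OF c] M[rule_format, OF c])
    then show "((\<lambda>s. f (c s) + g (c s)) has_field_derivative (\<Sum>i\<in>UNIV. (L + M) $ i * c' $ i)) (at 0)"
      by (simp add: sum.distrib distrib_right)
  qed
next
  case (mult f g)
  then obtain L M :: "complex ^ 'n" where
    L: "\<forall>c c'. c 0 = x \<and> (\<forall>i. ((\<lambda>s. c s $ i) has_field_derivative c' $ i) (at 0)) \<longrightarrow>
      ((\<lambda>s. f (c s)) has_field_derivative (\<Sum>i\<in>UNIV. L $ i * c' $ i)) (at 0)"
    and M: "\<forall>c c'. c 0 = x \<and> (\<forall>i. ((\<lambda>s. c s $ i) has_field_derivative c' $ i) (at 0)) \<longrightarrow>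
      ((\<lambda>s. g (c s)) has_field_derivative (\<Sum>i\<in>UNIV. M $ i * c' $ i)) (at 0)" by blast
  show ?case
  proof (intro exI[of _ "(\<chi> i. L $ i * g x + M $ i * f x)"] allI impI)
    fix c c' assume c: "c 0 = x \<and> (\<forall>i. ((\<lambda>s. c s $ i) has_field_derivative c' $ i) (at 0))"
    have "((\<lambda>s. f (c s) * g (c s)) has_field_derivative
      (\<Sum>i\<in>UNIV. L $ i * c' $ i) * g (c 0) + (\<Sum>i\<in>UNIV. M $ i * c' $ i) * f (c 0)) (at 0)"
      by (intro DERIV_mult L[rule_format, OF c] M[rule_format, OF c])
    moreover have "(\<Sum>i\<in>UNIV. L $ i * c' $ i) * g (c 0) + (\<Sum>i\<in>UNIV. M $ i * c' $ i) * f (c 0)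
      = (\<Sum>i\<in>UNIV. (\<chi> i. L $ i * g x + M $ i * f x) $ i * c' $ i)"
      using c by (simp add: sum_distrib_left sum_distrib_right sum.distrib algebra_simps)
    ultimately show "((\<lambda>s. f (c s) * g (c s)) has_field_derivative
      (\<Sum>i\<in>UNIV. (\<chi> i. L $ i * g x + M $ i * f x) $ i * c' $ i)) (at 0)" by simp
  qed
qed

definition gradient :: "(complex ^ 'n \<Rightarrow> complex) \<Rightarrow> complex ^ 'n \<Rightarrow> complex ^ 'n" where
  "gradient f x = (SOME L. \<forall>c c'. c 0 = x \<and> (\<forall>i. ((\<lambda>s. c s $ i) has_field_derivative c' $ i) (at 0)) \<longrightarrow>
    ((\<lambda>s. f (c s)) has_field_derivative (\<Sum>i\<in>UNIV. L $ i * c' $ i)) (at 0))"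

lemma gradient:
  assumes "f \<in> poly_funs" "c 0 = x" "\<And>i. ((\<lambda>s. c s $ i) has_field_derivative c' $ i) (at 0)"
  shows "((\<lambda>s. f (c s)) has_field_derivative (\<Sum>i\<in>UNIV. gradient f x $ i * c' $ i)) (at 0)"
  using someI_ex[OF poly_funs_gradient[OF assms(1), of x], folded gradient_def] assms(2,3) by blast

lemma line_derivative: "((\<lambda>s. (x + s *s v) $ i) has_field_derivative v $ i) (at 0)"
  by (auto intro!: derivative_eq_intros)

lemma tangent_space_gradient:
  "v \<in> tangent_space V x \<longleftrightarrow>
    (\<forall>f\<in>poly_funs. (\<forall>y\<in>V. f y = 0) \<longrightarrow> (\<Sum>i\<in>UNIV. gradient f x $ i * v $ i) = 0)"
proof -
  have "((\<lambda>t. f (x + t *s v)) has_field_derivative 0) (at 0) \<longleftrightarrow> (\<Sum>i\<in>UNIV. gradient f x $ i * v $ i) = 0"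
    if "f \<in> poly_funs" for f
    using gradient[OF that, of "\<lambda>s. x + s *s v" x v] line_derivative DERIV_unique by fastforce
  then show ?thesis unfolding tangent_space_def by auto
qed

lemma tangent_spaceD:
  "v \<in> tangent_space V x \<Longrightarrow> f \<in> poly_funs \<Longrightarrow> (\<And>y. y \<in> V \<Longrightarrow> f y = 0) \<Longrightarrow>
    ((\<lambda>t. f (x + t *s v)) has_field_derivative 0) (at 0)"
  by (simp add: tangent_space_def)

lemma tangent_space_map:
  assumes P: "\<And>i. (\<lambda>x. P x $ i) \<in> poly_funs" "\<And>x. x \<in> V \<Longrightarrow> P x \<in> V" and v: "v \<in> tangent_space V x"
  shows "(\<chi> i. gradient (\<lambda>x. P x $ i) x) *v v \<in> tangent_space V (P x)"
  unfolding tangent_space_gradient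
proof (intro ballI impI)
  fix f :: "complex ^ 'a \<Rightarrow> complex" assume f: "f \<in> poly_funs" "\<forall>y\<in>V. f y = 0"
  let ?w = "(\<chi> i. gradient (\<lambda>x. P x $ i) x) *v v"
  have w: "((\<lambda>s. P (x + s *s v) $ i) has_field_derivative ?w $ i) (at 0)" for i
    using gradient[OF P(1)[of i], of "\<lambda>s. x + s *s v" x v] line_derivative[of x v]
    by (simp add: matrix_vector_mult_def)
  have "((\<lambda>s. f (P (x + s *s v))) has_field_derivative (\<Sum>i\<in>UNIV. gradient f (P x) $ i * ?w $ i)) (at 0)"
    using gradient[OF f(1), of "\<lambda>s. P (x + s *s v)" "P x" ?w] w by simp
  moreover have "(\<lambda>x. f (P x)) \<in> poly_funs" by (rule poly_funs_subst[OF f(1) P(1)])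
  then have "((\<lambda>s. f (P (x + s *s v))) has_field_derivative 0) (at 0)"
    by (rule tangent_spaceD[OF v, where f = "\<lambda>x. f (P x)"]) (simp add: f(2) P(2))
  ultimately show "(\<Sum>i\<in>UNIV. gradient f (P x) $ i * ?w $ i) = 0" by (rule DERIV_unique)
qed

text \<open>\<open>Q (P x) - x\<close> vanishes on \<open>V\<close>, so the Jacobian of
  \<open>Q\<close> undoes that of \<open>P\<close> on tangent vectors and no dimension is
  lost.\<close>

lemma tangent_space_dim_le:
  assumes P: "\<And>i. (\<lambda>x. P x $ i) \<in> poly_funs" "\<And>x. x \<in> V \<Longrightarrow> P x \<in> V"
    and Q: "\<And>i. (\<lambda>x. Q x $ i) \<in> poly_funs" "\<And>x. x \<in> V \<Longrightarrow> Q (P x) = x" and x: "x \<in> V"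
  shows "vec.dim (tangent_space V x) \<le> vec.dim (tangent_space V (P x))"
proof -
  let ?A = "\<chi> i. gradient (\<lambda>x. P x $ i) x" and ?B = "\<chi> i. gradient (\<lambda>x. Q x $ i) (P x)"
  have "?B *v (?A *v v) = v" if v: "v \<in> tangent_space V x" for v
  proof -
    have w: "((\<lambda>s. P (x + s *s v) $ i) has_field_derivative (?A *v v) $ i) (at 0)" for i
      using gradient[OF P(1)[of i], of "\<lambda>s. x + s *s v" x v] line_derivative[of x v]
      by (simp add: matrix_vector_mult_def)
    have "(?B *v (?A *v v)) $ i = v $ i" for i
    proof -
      have "((\<lambda>s. Q (P (x + s *s v)) $ i) has_field_derivative (?B *v (?A *v v)) $ i) (at 0)"
        using gradient[OF Q(1)[of i], of "\<lambda>s. P (x + s *s v)" "P x" "?A *v v"] w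
        by (simp add: matrix_vector_mult_def)
      from DERIV_diff[OF this line_derivative[of x v i]]
      have "((\<lambda>s. Q (P (x + s *s v)) $ i - (x + s *s v) $ i) has_field_derivative (?B *v (?A *v v)) $ i - v $ i) (at 0)" .
      moreover have "(\<lambda>x. Q (P x) $ i - x $ i) \<in> poly_funs"
        by (intro poly_funs_diff poly_funs_coord poly_funs_subst[OF Q(1) P(1)])
      then have "((\<lambda>s. Q (P (x + s *s v)) $ i - (x + s *s v) $ i) has_field_derivative 0) (at 0)"
        by (rule tangent_spaceD[OF v, where f = "\<lambda>x. Q (P x) $ i - x $ i"]) (simp add: Q(2))
      ultimately have "(?B *v (?A *v v)) $ i - v $ i = 0" by (rule DERIV_unique)
      then show ?thesis by simp
    qed
    then show ?thesis by (simp add: vec_eq_iff)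
  qed
  note * = this
  have "tangent_space V x \<subseteq> (*v) ?B ` tangent_space V (P x)"
  proof
    fix v assume v: "v \<in> tangent_space V x"
    have "?A *v v \<in> tangent_space V (P x)" using P v by (rule tangent_space_map)
    then have "?B *v (?A *v v) \<in> (*v) ?B ` tangent_space V (P x)" by (rule imageI)
    then show "v \<in> (*v) ?B ` tangent_space V (P x)" by (simp only: *[OF v])
  qed
  then have "vec.dim (tangent_space V x) \<le> vec.dim ((*v) ?B ` tangent_space V (P x))"
    by (rule vec.dim_subset)
  also have "\<dots> \<le> vec.dim (tangent_space V (P x))" by (rule vec.dim_image_le) simp
  finally show ?thesis .
qed

text \<open>All coordinates depend on \<open>y\<close> alone, so every tangent vector is a multiple
  of the velocity of the curve given by the polynomials \<open>g i\<close>.\<close>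

lemma tangent_space_dim_curve:
  assumes y: "y \<in> poly_funs" and g: "\<And>x i. x \<in> V \<Longrightarrow> x $ i = poly (g i) (y x)"
  shows "vec.dim (tangent_space V x) \<le> 1"
proof -
  let ?u = "\<chi> i. poly (pderiv (g i)) (y x)"
  have "v \<in> vec.span {?u}" if v: "v \<in> tangent_space V x" for v
  proof -
    let ?d = "\<Sum>i\<in>UNIV. gradient y x $ i * v $ i"
    have yd: "((\<lambda>s. y (x + s *s v)) has_field_derivative ?d) (at 0)"
      using gradient[OF y, of "\<lambda>s. x + s *s v" x v] line_derivative[of x v] by simp
    have "v $ i = (?d *s ?u) $ i" for i
    proof -
      have "((\<lambda>s. (x + s *s v) $ i - poly (g i) (y (x + s *s v))) has_field_derivative
        v $ i - poly (pderiv (g i)) (y x) * ?d) (at 0)"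
        using DERIV_chain2[OF poly_DERIV[of "g i"] yd] by (intro DERIV_diff line_derivative) simp
      moreover have "(\<lambda>_. g i) \<in> poly_family poly_funs"
        by (auto simp: poly_family_def poly_funs_const)
      then have "(\<lambda>x. x $ i - poly (g i) (y x)) \<in> poly_funs"
        using y poly_funs_coord unfolding poly_funs_def by (intro gen_algebra_diff poly_family_eval) auto
      then have "((\<lambda>s. (x + s *s v) $ i - poly (g i) (y (x + s *s v))) has_field_derivative 0) (at 0)"
        by (rule tangent_spaceD[OF v, where f = "\<lambda>x. x $ i - poly (g i) (y x)"]) (simp add: g)
      ultimately have "v $ i - poly (pderiv (g i)) (y x) * ?d = 0" by (rule DERIV_unique)
      then show ?thesis by (simp add: mult.commute)
    qed
    then have "v = ?d *s ?u" unfolding vec_eq_iff by blast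
    then show ?thesis unfolding vec.span_singleton by (rule range_eqI)
  qed
  then have "vec.dim (tangent_space V x) \<le> card {?u}" by (intro vec.dim_le_card) auto
  then show ?thesis by simp
qed

section \<open>The induced grading, its homogeneous components, and the vertex\<close>

context graded_variety
begin

definition gr :: "(complex ^ 'n \<Rightarrow> complex) \<Rightarrow> complex ^ 'n \<Rightarrow> complex poly" where
  "gr f = (SOME F. F \<in> poly_family poly_funs \<and> (\<forall>x\<in>V. coeff (F x) 0 = f q \<and>
      (\<forall>t. t \<noteq> 0 \<longrightarrow> f (\<phi> t x) = poly (F x) t)))"

lemma gr:
  assumes "f \<in> poly_funs"
  shows "gr f \<in> poly_family poly_funs" "x \<in> V \<Longrightarrow> coeff (gr f x) 0 = f q"
    "x \<in> V \<Longrightarrow> t \<noteq> 0 \<Longrightarrow> f (\<phi> t x) = poly (gr f x) t"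
proof -
  have "\<exists>F. F \<in> poly_family poly_funs \<and> (\<forall>x\<in>V. coeff (F x) 0 = f q \<and>
      (\<forall>t. t \<noteq> 0 \<longrightarrow> f (\<phi> t x) = poly (F x) t))" using grading[OF assms] by blast
  from someI_ex[OF this, folded gr_def]
  show "gr f \<in> poly_family poly_funs" "x \<in> V \<Longrightarrow> coeff (gr f x) 0 = f q"
    "x \<in> V \<Longrightarrow> t \<noteq> 0 \<Longrightarrow> f (\<phi> t x) = poly (gr f x) t" by auto
qed

lemma gr_unique:
  assumes "f \<in> poly_funs" "x \<in> V" "\<And>t. t \<noteq> 0 \<Longrightarrow> f (\<phi> t x) = poly p t"
  shows "gr f x = p"
  using gr(3)[OF assms(1,2)] assms(3) by (intro poly_eqI_nonzero) auto

text \<open>\<open>\<phi> t\<close> is controlled on \<open>V\<close> only. This polynomial map of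
  the whole space agrees with it there, so it can be differentiated and is continuous in
  \<open>t\<close> as well.\<close>

definition act_poly :: "complex \<Rightarrow> complex ^ 'n \<Rightarrow> complex ^ 'n" where
  "act_poly t x = (\<chi> i. poly (gr (\<lambda>x. x $ i) x) t)"

lemma act_poly: "x \<in> V \<Longrightarrow> t \<noteq> 0 \<Longrightarrow> act_poly t x = \<phi> t x"
  using gr(3)[OF poly_funs_coord] by (simp add: act_poly_def vec_eq_iff)

lemma act_poly_coord: "(\<lambda>x. act_poly t x $ i) \<in> poly_funs"
  using poly_family_eval[OF gr(1)[OF poly_funs_coord, of i, unfolded poly_funs_def] gen_algebra.const[of t]]
  by (simp add: act_poly_def poly_funs_def)

lemma act_inverse: "x \<in> V \<Longrightarrow> t \<noteq> 0 \<Longrightarrow> \<phi> (inverse t) (\<phi> t x) = x"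
  using act_mult[of x "inverse t" t] act_1 by simp

lemma singular_locus_act:
  assumes x: "x \<in> singular_locus V" and t: "t \<noteq> 0"
  shows "\<phi> t x \<in> singular_locus V"
proof -
  have xV: "x \<in> V" using x by (simp add: singular_locus_def)
  have "vec.dim (tangent_space V x) \<le> vec.dim (tangent_space V (act_poly t x))"
    by (rule tangent_space_dim_le[where Q = "act_poly (inverse t)"])
      (use t xV in \<open>auto simp: act_poly_coord act_poly act_in act_inverse\<close>)
  then show ?thesis
    using x t xV by (auto simp: singular_locus_def act_poly act_in intro: less_le_trans)
qed

text \<open>The action preserves the singular locus, so \<open>\<phi> t p\<close> stays at the
  isolated point \<open>p\<close> for \<open>t\<close> near \<open>1\<close>. Hence the polynomial
  \<open>f (\<phi> t p)\<close> in \<open>t\<close> is constant, and its constant term is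
  \<open>f q\<close>.\<close>

lemma isolated_singularity_eq:
  assumes "p isolated_in singular_locus V"
  shows "p = q"
proof (rule poly_funs_determine)
  fix f :: "complex ^ 'n \<Rightarrow> complex" assume f: "f \<in> poly_funs"
  obtain T where T: "open T" "T \<inter> singular_locus V = {p}" and pS: "p \<in> singular_locus V"
    using assms by (auto simp: isolated_in_def)
  have pV: "p \<in> V" using pS by (simp add: singular_locus_def)
  have "((\<lambda>t. act_poly t p) \<longlongrightarrow> act_poly 1 p) (at 1)"
    unfolding act_poly_def by (intro vec_tendstoI) (auto intro!: isContD poly_isCont)
  moreover have "act_poly 1 p = p" using pV by (simp add: act_poly act_1)
  ultimately have "\<forall>\<^sub>F t in at 1. act_poly t p \<in> T" using T by (auto simp: tendsto_def)
  then obtain d where d: "d > 0" "\<And>t. t \<noteq> 1 \<Longrightarrow> dist t 1 < d \<Longrightarrow> act_poly t p \<in> T"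
    by (auto simp: eventually_at)
  have "poly (gr f p - [:f p:]) t = 0" if "t \<noteq> 1" "dist t 1 < min d 1" for t
  proof -
    have t: "t \<noteq> 0" using that by auto
    then have "\<phi> t p \<in> T" using d(2)[of t] that pV by (simp add: act_poly)
    then have "\<phi> t p = p" using singular_locus_act[OF pS t] T by blast
    then show ?thesis using gr(3)[OF f pV t] by simp
  qed
  moreover have "\<exists>t. poly r t \<noteq> 0 \<and> t \<noteq> 1 \<and> dist t 1 < min d 1" if "r \<noteq> 0" for r :: "complex poly"
    using poly_nonroot_near[OF that, of "min d 1" 1] d(1) by (auto simp: dist_norm)
  ultimately have "gr f p - [:f p:] = 0" by blast
  then have "gr f p = [:f p:]" by simp
  then show "f p = f q" using gr(2)[OF f pV] by simp
qed

definition homogeneous :: "nat \<Rightarrow> (complex ^ 'n \<Rightarrow> complex) \<Rightarrow> bool" where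
  "homogeneous k f \<longleftrightarrow> f \<in> poly_funs \<and> (\<forall>x\<in>V. \<forall>t. t \<noteq> 0 \<longrightarrow> f (\<phi> t x) = t ^ k * f x)"

definition component :: "nat \<Rightarrow> (complex ^ 'n \<Rightarrow> complex) \<Rightarrow> complex ^ 'n \<Rightarrow> complex" where
  "component k f = (\<lambda>x. coeff (gr f x) k)"

lemma component_poly: "f \<in> poly_funs \<Longrightarrow> component k f \<in> poly_funs"
  unfolding component_def by (rule poly_familyD[OF gr(1)])

lemma component_homogeneous:
  assumes f: "f \<in> poly_funs"
  shows "homogeneous k (component k f)"
  unfolding homogeneous_def
proof (intro conjI ballI allI impI)
  show "component k f \<in> poly_funs" by (rule component_poly[OF f])
  fix x s assume x: "x \<in> V" and s: "(s::complex) \<noteq> 0"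
  have "gr f (\<phi> s x) = pcompose (gr f x) [:0, s:]"
  proof (rule gr_unique[OF f])
    show "\<phi> s x \<in> V" using x s by (rule act_in)
    fix t :: complex assume "t \<noteq> 0"
    then have "f (\<phi> t (\<phi> s x)) = poly (gr f x) (t * s)" using gr(3)[OF f x, of "t * s"] s x by (simp add: act_mult)
    then show "f (\<phi> t (\<phi> s x)) = poly (pcompose (gr f x) [:0, s:]) t" by (simp add: poly_pcompose)
  qed
  then show "component k f (\<phi> s x) = s ^ k * component k f x"
    by (simp add: component_def coeff_pcompose_linear)
qed

lemma component_bound: "f \<in> poly_funs \<Longrightarrow> \<exists>d. \<forall>k>d. \<forall>x. component k f x = 0"
  unfolding component_def using poly_family_degree[OF gr(1)] by (meson coeff_eq_0 le_less_trans)

lemma sum_component: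
  assumes "f \<in> poly_funs" "\<And>k x. k > d \<Longrightarrow> component k f x = 0" "x \<in> V"
  shows "f x = (\<Sum>k\<le>d. component k f x)"
proof -
  have "degree (gr f x) \<le> d" using assms(2) by (intro degree_le) (auto simp: component_def)
  then have "poly (gr f x) 1 = (\<Sum>k\<le>d. component k f x)"
    by (simp add: poly_eq_sum_le component_def)
  then show ?thesis using gr(3)[OF assms(1,3), of 1] act_1[OF assms(3)] by simp
qed

lemma homogeneous_gr: "homogeneous k f \<Longrightarrow> x \<in> V \<Longrightarrow> gr f x = monom (f x) k"
  by (rule gr_unique) (auto simp: homogeneous_def poly_monom)

lemma homogeneous_0: "homogeneous 0 f \<Longrightarrow> x \<in> V \<Longrightarrow> f x = f q"
  using homogeneous_gr[of 0 f x] gr(2)[of f x] by (simp add: homogeneous_def)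

end

section \<open>Homogeneous additive actions\<close>

lemma poly_funs_family_sum:
  assumes "finite K" "\<And>e. e \<in> K \<Longrightarrow> F e \<in> poly_family poly_funs"
  shows "(\<lambda>x. \<Sum>e\<in>K. F e x) \<in> poly_family poly_funs"
  using assms
proof (induction K)
  case empty
  then show ?case using poly_funs_family_const[OF poly_funs_const[of 0]] by simp
next
  case (insert e K)
  then have "(\<lambda>x. F e x + (\<Sum>e\<in>K. F e x)) \<in> poly_family poly_funs"
    by (intro poly_funs_family_add) auto
  then show ?case using insert by simp
qed

lemma at_0_neq: "\<forall>\<^sub>F t in at (0::complex). t \<noteq> 0"
  by (simp add: eventually_at_filter)

context graded_variety
begin

lemma gr_cong:
  assumes "f \<in> poly_funs" "g \<in> poly_funs" "\<And>x. x \<in> V \<Longrightarrow> f x = g x" "x \<in> V"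
  shows "gr f x = gr g x"
  using assms gr(3)[OF assms(2)] act_in by (intro gr_unique) auto

lemma act_poly_tendsto: "(X \<longlongrightarrow> x) F \<Longrightarrow> ((\<lambda>k. act_poly t (X k)) \<longlongrightarrow> act_poly t x) F"
  by (rule vec_tendstoI, rule poly_funs_tendsto[OF act_poly_coord])

text \<open>
  Conjugating the additive action by \<open>\<phi>\<close> and rescaling its parameter, one may pass to the limit along
  the steepest slope \<open>(m - k) / j\<close> occurring in it. The limit is an additive action normalized by
  \<open>\<phi>\<close>; it corresponds to the leading homogeneous part of a locally nilpotent derivation.
\<close>

lemma homogeneous_limit:
  assumes \<psi>_in: "\<And>x s. x \<in> V \<Longrightarrow> \<psi> s x \<in> V" and \<psi>_0: "\<And>x. x \<in> V \<Longrightarrow> \<psi> 0 x = x"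
    and \<psi>_add: "\<And>x s t. x \<in> V \<Longrightarrow> \<psi> (s + t) x = \<psi> s (\<psi> t x)"
    and \<psi>_poly: "\<And>f. f \<in> poly_funs \<Longrightarrow> \<exists>F\<in>poly_family poly_funs. \<forall>x\<in>V. \<forall>s. f (\<psi> s x) = poly (F x) s"
    and \<psi>_nontriv: "x0 \<in> V" "\<psi> s0 x0 \<noteq> x0"
  shows "\<exists>Ps (b::nat) (a::int). b > 0 \<and> (\<forall>x\<in>V. \<forall>s. Ps s x \<in> V) \<and> (\<forall>x\<in>V. Ps 0 x = x) \<and>
    (\<forall>x\<in>V. \<forall>s t. Ps (s + t) x = Ps s (Ps t x)) \<and>
    (\<forall>i. \<exists>F\<in>poly_family poly_funs. \<forall>x s. Ps s x $ i = poly (F x) s) \<and>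
    (\<forall>x\<in>V. \<forall>s r. r \<noteq> 0 \<longrightarrow> Ps s (\<phi> (r ^ b) x) = \<phi> (r ^ b) (Ps (s * r powi a) x)) \<and>
    (\<exists>x\<in>V. \<exists>s. Ps s x \<noteq> x)"
proof -
  define X where "X = (\<lambda>i. \<lambda>x::complex ^ 'n. x $ i)"
  have X: "X i \<in> poly_funs" for i unfolding X_def by (rule poly_funs_coord)
  define D where "D = (\<lambda>f. SOME F. F \<in> poly_family poly_funs \<and> (\<forall>x\<in>V. \<forall>s. f (\<psi> s x) = poly (F x) s))"
  have D: "D f \<in> poly_family poly_funs" "\<And>x s. x \<in> V \<Longrightarrow> f (\<psi> s x) = poly (D f x) s" if f: "f \<in> poly_funs" for f
  proof -
    have "\<exists>F. F \<in> poly_family poly_funs \<and> (\<forall>x\<in>V. \<forall>s. f (\<psi> s x) = poly (F x) s)"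
      using \<psi>_poly[OF f] by blast
    from someI_ex[OF this] have "D f \<in> poly_family poly_funs \<and> (\<forall>x\<in>V. \<forall>s. f (\<psi> s x) = poly (D f x) s)"
      unfolding D_def .
    then show "D f \<in> poly_family poly_funs" "\<And>x s. x \<in> V \<Longrightarrow> f (\<psi> s x) = poly (D f x) s" by auto
  qed
  define h where "h = (\<lambda>i k j x. coeff (D (component k (X i)) x) j)"
  have h: "h i k j \<in> poly_funs" for i k j
    unfolding h_def by (rule poly_familyD[OF D(1)[OF component_poly[OF X]]])
  \<comment> \<open>\<open>C i (k, j, m)\<close> is the coefficient of \<open>u^k s^j t^m\<close> in
    coordinate \<open>i\<close> of \<open>\<phi> u (\<psi> s (\<phi> t x))\<close>.\<close>
  define C where "C = (\<lambda>i (k, j, m). component m (h i k j))"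
  have C: "C i e \<in> poly_funs" for i e by (cases e) (auto simp: C_def intro: component_poly h)
  have Chom: "C i (k, j, m) (\<phi> t x) = t ^ m * C i (k, j, m) x" if "x \<in> V" "t \<noteq> 0" for i k j m x t
    using component_homogeneous[OF h[of i k j], of m] that by (simp add: C_def homogeneous_def)
  have "\<exists>K. \<forall>i. \<forall>k>K. \<forall>x. component k (X i) x = 0"
  proof -
    have "\<forall>i. \<exists>d. \<forall>k>d. \<forall>x. component k (X i) x = 0" using component_bound[OF X] by blast
    then obtain d where d: "\<And>i k x. k > d i \<Longrightarrow> component k (X i) x = 0" by metis
    have "d i \<le> Max (range d)" for i by (intro Max_ge) auto
    then show ?thesis using d by (meson le_less_trans)
  qed
  then obtain K where K: "\<And>i k x. k > K \<Longrightarrow> component k (X i) x = 0" by blast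
  have "\<exists>J. \<forall>i. \<forall>k\<le>K. \<forall>j>J. \<forall>x. h i k j x = 0"
  proof -
    have "\<forall>i k. \<exists>d. \<forall>j>d. \<forall>x. h i k j x = 0"
      unfolding h_def using poly_family_degree[OF D(1)[OF component_poly[OF X]]] by (meson coeff_eq_0 le_less_trans)
    then obtain d where d: "\<And>i k j x. j > d i k \<Longrightarrow> h i k j x = 0" by metis
    have "d i k \<le> Max ((\<lambda>(i, k). d i k) ` (UNIV \<times> {..K}))" if "k \<le> K" for i k
      using that by (intro Max_ge) (auto intro!: image_eqI[of _ _ "(i, k)"])
    then show ?thesis using d by (meson le_less_trans)
  qed
  then obtain J where J: "\<And>i k j x. k \<le> K \<Longrightarrow> j > J \<Longrightarrow> h i k j x = 0" by blast
  have "\<exists>M. \<forall>i. \<forall>k\<le>K. \<forall>j\<le>J. \<forall>m>M. \<forall>x. component m (h i k j) x = 0"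
  proof -
    have "\<forall>i k j. \<exists>d. \<forall>m>d. \<forall>x. component m (h i k j) x = 0" using component_bound[OF h] by blast
    then obtain d where d: "\<And>i k j m x. m > d i k j \<Longrightarrow> component m (h i k j) x = 0" by metis
    have "d i k j \<le> Max ((\<lambda>(i, k, j). d i k j) ` (UNIV \<times> {..K} \<times> {..J}))" if "k \<le> K" "j \<le> J" for i k j
      using that by (intro Max_ge) (auto intro!: image_eqI[of _ _ "(i, k, j)"])
    then show ?thesis using d by (meson le_less_trans)
  qed
  then obtain M where M: "\<And>i k j m x. k \<le> K \<Longrightarrow> j \<le> J \<Longrightarrow> m > M \<Longrightarrow> component m (h i k j) x = 0" by blast
  define Q where "Q = {..K} \<times> {..J} \<times> {..M}"
  define T where "T = (\<lambda>i. {e\<in>Q. \<exists>x\<in>V. C i e x \<noteq> 0})"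
  have finQ: "finite Q" by (simp add: Q_def)
  then have finT: "finite (T i)" for i by (simp add: T_def)
  have expand: "X i (\<phi> u (\<psi> s (\<phi> t x))) = (\<Sum>(k, j, m)\<in>T i. u ^ k * s ^ j * t ^ m * C i (k, j, m) x)"
    if x: "x \<in> V" and ut: "u \<noteq> 0" "t \<noteq> 0" for i u s t x
  proof -
    have V1: "\<phi> t x \<in> V" using act_in[OF x ut(2)] .
    have V2: "\<psi> s (\<phi> t x) \<in> V" using \<psi>_in[OF V1] .
    have "X i (\<phi> u (\<psi> s (\<phi> t x))) = poly (gr (X i) (\<psi> s (\<phi> t x))) u" by (rule gr(3)[OF X V2 ut(1)])
    also have "\<dots> = (\<Sum>k\<le>K. component k (X i) (\<psi> s (\<phi> t x)) * u ^ k)"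
      unfolding component_def using K[of _ i] by (intro poly_eq_sum_le degree_le) (auto simp: component_def)
    also have "\<dots> = (\<Sum>k\<le>K. \<Sum>j\<le>J. \<Sum>m\<le>M. u ^ k * s ^ j * t ^ m * C i (k, j, m) x)"
    proof (rule sum.cong[OF refl])
      fix k assume "k \<in> {..K}"
      then have k: "k \<le> K" by simp
      have "component k (X i) (\<psi> s (\<phi> t x)) = poly (D (component k (X i)) (\<phi> t x)) s"
        by (rule D(2)[OF component_poly[OF X] V1])
      also have "\<dots> = (\<Sum>j\<le>J. h i k j (\<phi> t x) * s ^ j)"
        unfolding h_def using J[OF k, of _ i] by (intro poly_eq_sum_le degree_le) (auto simp: h_def)
      also have "\<dots> = (\<Sum>j\<le>J. (\<Sum>m\<le>M. component m (h i k j) x * t ^ m) * s ^ j)"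
      proof (rule sum.cong[OF refl])
        fix j assume j: "j \<in> {..J}"
        have "h i k j (\<phi> t x) = poly (gr (h i k j) x) t" by (rule gr(3)[OF h x ut(2)])
        also have "\<dots> = (\<Sum>m\<le>M. component m (h i k j) x * t ^ m)"
          unfolding component_def using M[OF k, of j _ i] j by (intro poly_eq_sum_le degree_le) (auto simp: component_def)
        finally show "h i k j (\<phi> t x) * s ^ j = (\<Sum>m\<le>M. component m (h i k j) x * t ^ m) * s ^ j" by simp
      qed
      finally show "component k (X i) (\<psi> s (\<phi> t x)) * u ^ k = (\<Sum>j\<le>J. \<Sum>m\<le>M. u ^ k * s ^ j * t ^ m * C i (k, j, m) x)"
        by (simp add: C_def sum_distrib_left sum_distrib_right mult_ac)
    qed
    also have "\<dots> = (\<Sum>(k, j, m)\<in>Q. u ^ k * s ^ j * t ^ m * C i (k, j, m) x)"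
      by (simp add: Q_def sum.cartesian_product)
    also have "\<dots> = (\<Sum>(k, j, m)\<in>T i. u ^ k * s ^ j * t ^ m * C i (k, j, m) x)"
      using x by (intro sum.mono_neutral_right[OF finQ]) (auto simp: T_def)
    finally show ?thesis .
  qed
  \<comment> \<open>For \<open>s = 0\<close> the middle action is trivial and
    \<open>\<phi> u (\<phi> t x) = \<phi> (u * t) x\<close>, so \<open>u\<close> and
    \<open>t\<close> occur with equal exponents.\<close>
  have T0: "m = k" if "(k, 0, m) \<in> T i" for i k m
  proof (rule ccontr)
    assume "m \<noteq> k"
    obtain x where x: "x \<in> V" "C i (k, 0, m) x \<noteq> 0" using \<open>(k, 0, m) \<in> T i\<close> by (auto simp: T_def)
    have "h i k 0 y = component k (X i) y" if "y \<in> V" for y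
      using D(2)[OF component_poly[OF X] that, of k i 0] \<psi>_0[OF that] by (simp add: h_def poly_0_coeff_0)
    then have "gr (h i k 0) x = gr (component k (X i)) x"
      using x(1) by (intro gr_cong h component_poly X)
    also have "\<dots> = monom (component k (X i) x) k" using x(1) by (intro homogeneous_gr component_homogeneous X)
    finally show False using x(2) \<open>m \<noteq> k\<close> by (simp add: C_def component_def)
  qed
  define R where "R = {(k, j, m). j \<ge> 1 \<and> (\<exists>i. (k, j, m) \<in> T i)}"
  have finR: "finite R" by (rule finite_subset[OF _ finQ]) (auto simp: R_def T_def)
  have R0: "R \<noteq> {}"
  proof
    assume "R = {}"
    have j0: "j = 0" if "(k, j, m) \<in> T i" for i k j m
    proof (rule ccontr)
      assume "j \<noteq> 0"
      then have "(k, j, m) \<in> R" using that by (auto simp: R_def)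
      then show False using \<open>R = {}\<close> by simp
    qed
    have "X i (\<psi> s0 x0) = X i (\<psi> 0 x0)" for i
    proof -
      have e: "X i (\<psi> s x0) = (\<Sum>(k, j, m)\<in>T i. s ^ j * C i (k, j, m) x0)" for s
        using expand[OF \<psi>_nontriv(1), of 1 1 i s] \<psi>_nontriv(1) by (simp add: act_1 \<psi>_in)
      show ?thesis unfolding e by (intro sum.cong refl) (auto dest: j0)
    qed
    then have "\<psi> s0 x0 = \<psi> 0 x0" by (simp add: X_def vec_eq_iff)
    then show False using \<psi>_nontriv \<psi>_0 by simp
  qed
  define slope where "slope = (\<lambda>(k, j, m). (real m - real k) / real (j::nat))"
  have "Max (slope ` R) \<in> slope ` R" using finR R0 by (intro Max_in) auto
  then obtain k0 j0 m0 where e0: "(k0, j0, m0) \<in> R" "Max (slope ` R) = slope (k0, j0, m0)" by auto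
  have j0: "j0 \<ge> 1" using e0 by (simp add: R_def)
  define a where "a = int m0 - int k0"
  \<comment> \<open>The exponent of \<open>t\<close> after putting \<open>t ^ j0\<close>,
    \<open>s * t powi a\<close> and \<open>inverse (t ^ j0)\<close> for the outer, middle and inner
    parameter. The power \<open>j0\<close> clears the denominator of the slope, and maximality of
    the slope makes the exponent nonnegative.\<close>
  define N where "N = (\<lambda>(k, j, m). int j0 * (int k - int m) + int j * a)"
  have N0: "N e \<ge> 0" if "e \<in> T i" for e i
  proof -
    obtain k j m where e: "e = (k, j, m)" by (cases e)
    show ?thesis
    proof (cases "j = 0")
      case True then show ?thesis using T0[of k m i] that by (simp add: e N_def)
    next
      case False
      then have "(k, j, m) \<in> R" using that by (auto simp: R_def e)
      then have "slope (k, j, m) \<le> slope (k0, j0, m0)" unfolding e0(2)[symmetric] using finR by (intro Max_ge) auto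
      then have "(real m - real k) * real j0 \<le> (real m0 - real k0) * real j"
        using j0 False by (simp add: slope_def divide_simps)
      then have "real_of_int ((int m - int k) * int j0) \<le> real_of_int (a * int j)" by (simp add: a_def)
      then have "(int m - int k) * int j0 \<le> a * int j" by (simp only: of_int_le_iff)
      then show ?thesis by (simp add: N_def e algebra_simps)
    qed
  qed
  \<comment> \<open>As a polynomial in \<open>t\<close> the conjugated action makes sense at
    \<open>t = 0\<close>, where exactly the terms with \<open>N e = 0\<close> survive.\<close>
  define Om where "Om = (\<lambda>s t x. (\<chi> i. \<Sum>e\<in>T i. s ^ fst (snd e) * t ^ nat (N e) * C i e x) :: complex ^ 'n)"
  have Om: "Om s t x = \<phi> (t ^ j0) (\<psi> (s * t powi a) (\<phi> (inverse (t ^ j0)) x))" if x: "x \<in> V" and t: "t \<noteq> 0" for s t x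
  proof -
    have "Om s t x $ i = X i (\<phi> (t ^ j0) (\<psi> (s * t powi a) (\<phi> (inverse (t ^ j0)) x)))" for i
    proof -
      have "s ^ j * t ^ nat (N (k, j, m)) = (t ^ j0) ^ k * (s * t powi a) ^ j * (inverse (t ^ j0)) ^ m" if "(k, j, m) \<in> T i" for k j m
      proof -
        have "N (k, j, m) = int j0 * int k + (- (int j0 * int m)) + a * int j" by (simp add: N_def algebra_simps)
        then have "t powi (N (k, j, m)) = t powi (int j0 * int k + (- (int j0 * int m)) + a * int j)" by simp
        also have "\<dots> = t powi (int j0 * int k) * t powi (- (int j0 * int m)) * t powi (a * int j)"
          by (simp only: power_int_add[OF disjI1[OF t]])
        also have "t powi (int j0 * int k) = (t ^ j0) ^ k"
          by (simp add: power_int_mult)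
        also have "t powi (- (int j0 * int m)) = (inverse (t ^ j0)) ^ m"
          by (simp add: power_int_minus power_int_mult power_inverse)
        also have "t powi (a * int j) = (t powi a) ^ j" by (simp add: power_int_mult)
        finally have "t ^ nat (N (k, j, m)) = (t ^ j0) ^ k * inverse (t ^ j0) ^ m * (t powi a) ^ j"
          using N0[OF that] by (simp add: power_int_def)
        then show ?thesis by (simp only: power_mult_distrib mult_ac)
      qed
      then show ?thesis
        unfolding Om_def using expand[OF x, of "t ^ j0" "inverse (t ^ j0)" i "s * t powi a"] t
        by (auto intro!: sum.cong simp: mult_ac)
    qed
    then show ?thesis by (simp add: vec_eq_iff X_def)
  qed
  have Om_tendsto: "((\<lambda>t. Om s t (Y t)) \<longlongrightarrow> Om s 0 y) (at 0)" if "(Y \<longlongrightarrow> y) (at 0)" for s Y y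
    unfolding Om_def
    by (intro vec_tendstoI) (auto intro!: tendsto_sum tendsto_mult tendsto_power poly_funs_tendsto[OF C that])
  define Ps where "Ps = (\<lambda>s x. Om s 0 x)"
  have Ps_lim: "((\<lambda>t. Om s t x) \<longlongrightarrow> Ps s x) (at 0)" for s x
    unfolding Ps_def by (rule Om_tendsto) simp
  have Om_in: "Om s t x \<in> V" if "x \<in> V" "t \<noteq> 0" for s t x
    using that by (simp add: Om act_in \<psi>_in)
  have Ps_in: "Ps s x \<in> V" if "x \<in> V" for s x
  proof (rule Lim_in_closed_set[OF _ _ _ Ps_lim])
    show "closed V" using irr by (intro zariski_closed_imp_closed) (simp add: irreducible_closed_def)
    show "\<forall>\<^sub>F t in at 0. Om s t x \<in> V" using at_0_neq by eventually_elim (rule Om_in[OF that])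
  qed simp
  have Ps_0: "Ps 0 x = x" if "x \<in> V" for x
  proof (rule tendsto_unique[OF at_neq_bot])
    show "((\<lambda>t. Om 0 t x) \<longlongrightarrow> Ps 0 x) (at 0)" by (rule Ps_lim)
    show "((\<lambda>t. Om 0 t x) \<longlongrightarrow> x) (at 0)"
    proof (rule Lim_transform_eventually[OF tendsto_const])
      show "\<forall>\<^sub>F t in at 0. x = Om 0 t x"
        using at_0_neq
      proof eventually_elim
        case (elim t)
        then show ?case using that act_in[OF that, of "inverse (t ^ j0)"] act_inverse[OF that, of "inverse (t ^ j0)"]
          by (simp add: Om \<psi>_0)
      qed
    qed
  qed
  have Ps_add: "Ps (s + s') x = Ps s (Ps s' x)" if x: "x \<in> V" for s s' x
  proof (rule tendsto_unique[OF at_neq_bot])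
    show "((\<lambda>t. Om (s + s') t x) \<longlongrightarrow> Ps (s + s') x) (at 0)" by (rule Ps_lim)
    have "((\<lambda>t. Om s t (Om s' t x)) \<longlongrightarrow> Ps s (Ps s' x)) (at 0)"
      unfolding Ps_def[of] by (rule Om_tendsto[OF Ps_lim[unfolded Ps_def]])
    then show "((\<lambda>t. Om (s + s') t x) \<longlongrightarrow> Ps s (Ps s' x)) (at 0)"
    proof (rule Lim_transform_eventually)
      show "\<forall>\<^sub>F t in at 0. Om s t (Om s' t x) = Om (s + s') t x"
        using at_0_neq
      proof eventually_elim
        case (elim t)
        let ?y = "\<phi> (inverse (t ^ j0)) x" and ?z = "\<psi> (s' * t powi a) (\<phi> (inverse (t ^ j0)) x)"
        have y1: "?y \<in> V" by (rule act_in[OF x]) (use elim in simp)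
        note y = y1 \<psi>_in[OF y1, of "s' * t powi a"]
        have "\<phi> (inverse (t ^ j0)) (Om s' t x) = ?z"
          using act_inverse[OF y(2), of "t ^ j0"] elim x by (simp add: Om)
        then have "Om s t (Om s' t x) = \<phi> (t ^ j0) (\<psi> (s * t powi a) ?z)"
          using Om[OF Om_in[OF x elim] elim] by simp
        also have "\<psi> (s * t powi a) ?z = \<psi> (s * t powi a + s' * t powi a) ?y" using \<psi>_add[OF y(1)] by simp
        finally show ?case using Om[OF x elim] by (simp add: distrib_right)
      qed
    qed
  qed
  have Ps_poly: "\<exists>F\<in>poly_family poly_funs. \<forall>x s. Ps s x $ i = poly (F x) s" for i
  proof -
    have "(\<lambda>x. \<Sum>e\<in>T i. monom (0 ^ nat (N e) * C i e x) (fst (snd e))) \<in> poly_family poly_funs"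
      by (intro poly_funs_family_sum finT poly_funs_family_monom poly_funs_mult poly_funs_const C)
    moreover have "Ps s x $ i = poly (\<Sum>e\<in>T i. monom (0 ^ nat (N e) * C i e x) (fst (snd e))) s" for s x
      by (simp add: Ps_def Om_def poly_sum poly_monom mult_ac)
    ultimately show ?thesis by (intro bexI) auto
  qed
  \<comment> \<open>Replacing \<open>t\<close> by \<open>t / r\<close> in the family turns
    conjugation by \<open>\<phi> (r ^ j0)\<close> into the factor \<open>r powi a\<close> on
    \<open>s\<close>; both sides are limits of the same expression.\<close>
  have Ps_act: "Ps s (\<phi> (r ^ j0) x) = \<phi> (r ^ j0) (Ps (s * r powi a) x)" if x: "x \<in> V" and r: "r \<noteq> 0" for s r x
  proof (rule tendsto_unique[OF at_neq_bot])
    have "((\<lambda>t. inverse r * t) \<longlongrightarrow> inverse r * 0) (at 0)" by (intro tendsto_intros)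
    then have f: "filterlim (\<lambda>t. inverse r * t) (at 0) (at 0)"
      using r by (auto simp: filterlim_at eventually_at_filter)
    have "((\<lambda>t. act_poly (r ^ j0) (Om (s * r powi a) (inverse r * t) x)) \<longlongrightarrow> act_poly (r ^ j0) (Ps (s * r powi a) x)) (at 0)"
      by (intro act_poly_tendsto filterlim_compose[OF Ps_lim f])
    then show "((\<lambda>t. act_poly (r ^ j0) (Om (s * r powi a) (inverse r * t) x)) \<longlongrightarrow> \<phi> (r ^ j0) (Ps (s * r powi a) x)) (at 0)"
      using r x by (simp add: act_poly Ps_in)
    show "((\<lambda>t. act_poly (r ^ j0) (Om (s * r powi a) (inverse r * t) x)) \<longlongrightarrow> Ps s (\<phi> (r ^ j0) x)) (at 0)"
    proof (rule Lim_transform_eventually[OF Ps_lim])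
      show "\<forall>\<^sub>F t in at 0. Om s t (\<phi> (r ^ j0) x) = act_poly (r ^ j0) (Om (s * r powi a) (inverse r * t) x)"
        using at_0_neq
      proof eventually_elim
        case (elim t)
        let ?t = "inverse r * t"
        have t: "?t \<noteq> 0" using elim r by simp
        have xr: "\<phi> (r ^ j0) x \<in> V" using act_in[OF x] r by simp
        have y: "\<phi> (inverse (?t ^ j0)) x \<in> V" using act_in[OF x] t by simp
        have z: "\<psi> (s * r powi a * ?t powi a) (\<phi> (inverse (?t ^ j0)) x) \<in> V" by (rule \<psi>_in[OF y])
        have e1: "r ^ j0 * ?t ^ j0 = t ^ j0" using r by (simp add: power_mult_distrib power_inverse)
        have e2: "s * r powi a * ?t powi a = s * t powi a"
          using r by (simp add: power_int_mult_distrib power_int_inverse)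
        have e3: "inverse (t ^ j0) * r ^ j0 = inverse (?t ^ j0)"
          using r elim by (simp add: power_mult_distrib power_inverse)
        have "act_poly (r ^ j0) (Om (s * r powi a) ?t x)
            = \<phi> (r ^ j0) (\<phi> (?t ^ j0) (\<psi> (s * r powi a * ?t powi a) (\<phi> (inverse (?t ^ j0)) x)))"
          unfolding Om[OF x t, symmetric] by (rule act_poly[OF Om_in[OF x t]]) (use r in simp)
        also have "\<dots> = \<phi> (t ^ j0) (\<psi> (s * t powi a) (\<phi> (inverse (?t ^ j0)) x))"
          using act_mult[OF z, of "r ^ j0" "?t ^ j0"] r t unfolding e1 e2 by simp
        also have "\<phi> (inverse (?t ^ j0)) x = \<phi> (inverse (t ^ j0)) (\<phi> (r ^ j0) x)"
          using act_mult[OF x, of "inverse (t ^ j0)" "r ^ j0"] r elim e3 by simp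
        finally show ?case using Om[OF xr elim] by simp
      qed
    qed
  qed
  \<comment> \<open>If the limit were trivial, the terms with \<open>j = j0\<close> and
    \<open>N e = 0\<close> would cancel at every point. They have pairwise different weights
    \<open>m\<close> under \<open>\<phi>\<close>, so each would vanish, in particular the one
    attaining the maximal slope.\<close>
  have Ps_nontriv: "\<exists>x\<in>V. \<exists>s. Ps s x \<noteq> x"
  proof (rule ccontr)
    assume "\<not> (\<exists>x\<in>V. \<exists>s. Ps s x \<noteq> x)"
    then have triv: "Ps s x = x" if "x \<in> V" for s x using that by blast
    obtain i where i: "(k0, j0, m0) \<in> T i" using e0(1) by (auto simp: R_def)
    then obtain x where x: "x \<in> V" "C i (k0, j0, m0) x \<noteq> 0" by (auto simp: T_def)
    define E where "E = {e\<in>T i. fst (snd e) = j0 \<and> N e = 0}"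
    have finE: "finite E" using finT by (simp add: E_def)
    have sum0: "(\<Sum>e\<in>E. C i e y) = 0" if y: "y \<in> V" for y
    proof -
      have "poly (\<Sum>e\<in>T i. monom (0 ^ nat (N e) * C i e y) (fst (snd e))) s = poly [:y $ i:] s" for s
      proof -
        have "poly (\<Sum>e\<in>T i. monom (0 ^ nat (N e) * C i e y) (fst (snd e))) s = Ps s y $ i"
          by (simp add: Ps_def Om_def poly_sum poly_monom mult_ac)
        then show ?thesis by (simp add: triv[OF y])
      qed
      then have "(\<Sum>e\<in>T i. monom (0 ^ nat (N e) * C i e y) (fst (snd e))) = [:y $ i:]"
        by (intro poly_eqI_nonzero) auto
      then have "coeff (\<Sum>e\<in>T i. monom (0 ^ nat (N e) * C i e y) (fst (snd e))) j0 = coeff [:y $ i:] j0" by (rule arg_cong)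
      also have "coeff [:y $ i:] j0 = 0" using j0 by (simp add: coeff_pCons split: nat.split)
      also have "coeff (\<Sum>e\<in>T i. monom (0 ^ nat (N e) * C i e y) (fst (snd e))) j0
          = (\<Sum>e\<in>T i. if fst (snd e) = j0 \<and> N e = 0 then C i e y else 0)"
      proof -
        have "nat (N e) = 0 \<longleftrightarrow> N e = 0" if "e \<in> T i" for e using N0[OF that] by auto
        then show ?thesis by (auto simp: coeff_sum power_0_left intro!: sum.cong)
      qed
      also have "\<dots> = (\<Sum>e\<in>E. C i e y)" unfolding E_def using finT by (simp add: sum.inter_filter)
      finally show ?thesis .
    qed
    have Em: "snd (snd e) = m0 \<longleftrightarrow> e = (k0, j0, m0)" if "e \<in> E" for e
    proof -
      obtain k j m where e: "e = (k, j, m)" by (cases e)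
      have "j = j0" "int j0 * (int k - int m + a) = 0" using that by (auto simp: E_def N_def e algebra_simps)
      then have "int k - int m + a = 0" using j0 by simp
      then show ?thesis using \<open>j = j0\<close> by (auto simp: e a_def)
    qed
    have "(\<Sum>e\<in>E. monom (C i e x) (snd (snd e))) = 0"
    proof (rule poly_eqI_nonzero)
      fix t :: complex assume t: "t \<noteq> 0"
      have "C i e (\<phi> t x) = t ^ snd (snd e) * C i e x" for e
        using Chom[OF x(1) t] by (cases e) auto
      then have "poly (\<Sum>e\<in>E. monom (C i e x) (snd (snd e))) t = (\<Sum>e\<in>E. C i e (\<phi> t x))"
        by (simp add: poly_sum poly_monom mult.commute)
      then show "poly (\<Sum>e\<in>E. monom (C i e x) (snd (snd e))) t = poly 0 t" using sum0[OF act_in[OF x(1) t]] by simp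
    qed
    then have "coeff (\<Sum>e\<in>E. monom (C i e x) (snd (snd e))) m0 = 0" by simp
    also have "coeff (\<Sum>e\<in>E. monom (C i e x) (snd (snd e))) m0 = (\<Sum>e\<in>E. if e = (k0, j0, m0) then C i e x else 0)"
      using Em by (simp add: coeff_sum cong: sum.cong)
    also have "\<dots> = C i (k0, j0, m0) x"
    proof -
      have "N (k0, j0, m0) = 0" by (simp add: N_def a_def algebra_simps)
      then have "(k0, j0, m0) \<in> E" using i by (simp add: E_def)
      then show ?thesis using finE by simp
    qed
    finally show False using x by simp
  qed
  show ?thesis
    by (rule exI[of _ Ps], rule exI[of _ j0], rule exI[of _ a])
      (use j0 Ps_in Ps_0 Ps_add Ps_poly Ps_act Ps_nontriv in auto)
qed

end

section \<open>Taylor shifts, Zariski closures and chains of irreducible sets\<close>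

lemma coeff_pcompose_shift:
  fixes p :: "complex poly"
  assumes "degree p \<le> d"
  shows "coeff (pcompose p [:r, 1:]) j = (\<Sum>m\<le>d. coeff p m * (of_nat (m choose j) * r ^ (m - j)))"
proof -
  have "pcompose p [:r, 1:] = (\<Sum>m\<le>d. smult (coeff p m) ([:r, 1:] ^ m))"
    by (rule poly_eqI_nonzero) (simp add: poly_pcompose poly_sum poly_eq_sum_le[OF assms])
  moreover have "coeff ([:r, 1:] ^ m) j = of_nat (m choose j) * r ^ (m - j)" for m
    by (cases "j \<le> m") (auto simp: coeff_linear_poly_power coeff_eq_0 degree_linear_power binomial_eq_0)
  ultimately show ?thesis by (simp add: coeff_sum)
qed

lemma coeff_1_pcompose_shift:
  fixes p :: "complex poly"
  shows "coeff (pcompose p [:r, 1:]) 1 = poly (pderiv p) r"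
proof -
  have "coeff (pcompose p [:r, 1:]) 1 = coeff (pderiv (pcompose p [:r, 1:])) 0" by (simp add: coeff_pderiv)
  also have "\<dots> = poly (pderiv p) r"
    by (simp add: pderiv_pcompose pderiv_pCons poly_pcompose flip: poly_0_coeff_0)
  finally show ?thesis .
qed

lemma poly_poly_eqI:
  fixes F G :: "complex poly poly"
  assumes "\<And>t s. t \<noteq> 0 \<Longrightarrow> poly (poly F [:t:]) s = poly (poly G [:t:]) s"
  shows "F = G"
proof (rule ccontr)
  assume "F \<noteq> G"
  have "poly F [:t:] = poly G [:t:]" if "t \<noteq> 0" for t
    using assms[OF that] by (intro poly_eqI_nonzero) auto
  then have "(\<lambda>t. [:t:]) ` (UNIV - {0}) \<subseteq> {x. poly (F - G) x = 0}" by auto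
  moreover have "finite {x. poly (F - G) x = 0}" using \<open>F \<noteq> G\<close> by (intro poly_roots_finite) auto
  ultimately have "finite ((\<lambda>t. [:t:]) ` (UNIV - {0 :: complex}))" by (rule finite_subset)
  moreover have "inj_on (\<lambda>t. [:t:]) (UNIV - {0 :: complex})" by (auto simp: inj_on_def)
  ultimately have "finite (UNIV - {0 :: complex})" by (rule finite_imageD)
  then show False by (simp add: infinite_UNIV_char_0)
qed

definition zariski_closure :: "(complex ^ 'n) set \<Rightarrow> (complex ^ 'n) set" where
  "zariski_closure S = {x. \<forall>f\<in>poly_funs. (\<forall>y\<in>S. f y = 0) \<longrightarrow> f x = 0}"

lemma zariski_closure_subset: "S \<subseteq> zariski_closure S"
  by (auto simp: zariski_closure_def)

lemma zariski_closure_mono: "S \<subseteq> S' \<Longrightarrow> zariski_closure S \<subseteq> zariski_closure S'"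
  unfolding zariski_closure_def by blast

lemma zariski_closure_least: "zariski_closed V \<Longrightarrow> S \<subseteq> V \<Longrightarrow> zariski_closure S \<subseteq> V"
  by (rule subsetI, rule zariski_closed_membership) (auto simp: zariski_closure_def)

lemma zariski_closed_closure: "zariski_closed (zariski_closure S)"
  unfolding zariski_closed_def
  by (rule exI[of _ "{f\<in>poly_funs. \<forall>y\<in>S. f y = 0}"]) (auto simp: zariski_closure_def)

text \<open>The second hypothesis is primality of the vanishing ideal of \<open>S\<close>, which is
  easily checked when \<open>S\<close> is parametrized by polynomials.\<close>

lemma irreducible_closure:
  assumes "S \<noteq> {}"
    and "\<And>f g. f \<in> poly_funs \<Longrightarrow> g \<in> poly_funs \<Longrightarrow> \<forall>x\<in>S. f x * g x = 0 \<Longrightarrow> (\<forall>x\<in>S. f x = 0) \<or> (\<forall>x\<in>S. g x = 0)"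
  shows "irreducible_closed (zariski_closure S)"
  unfolding irreducible_closed_def
proof (intro conjI allI impI)
  show "zariski_closed (zariski_closure S)" by (rule zariski_closed_closure)
  show "zariski_closure S \<noteq> {}" using assms(1) zariski_closure_subset by blast
  fix Y Z :: "(complex ^ 'a) set" assume YZ: "zariski_closed Y \<and> zariski_closed Z \<and> zariski_closure S = Y \<union> Z"
  have "S \<subseteq> Y \<or> S \<subseteq> Z"
  proof (rule ccontr)
    assume "\<not> (S \<subseteq> Y \<or> S \<subseteq> Z)"
    then obtain y z where "y \<in> S" "y \<notin> Y" "z \<in> S" "z \<notin> Z" by blast
    then obtain f g where fg: "f \<in> poly_funs" "\<forall>x\<in>Y. f x = 0" "f y \<noteq> 0" "g \<in> poly_funs" "\<forall>x\<in>Z. g x = 0" "g z \<noteq> 0"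
      using zariski_closed_membership[of Y y] zariski_closed_membership[of Z z] YZ by metis
    have "S \<subseteq> Y \<union> Z" using YZ zariski_closure_subset by blast
    then have "\<forall>x\<in>S. f x * g x = 0" using fg by auto
    then show False using assms(2)[OF fg(1,4)] fg(3,6) \<open>y \<in> S\<close> \<open>z \<in> S\<close> by blast
  qed
  then show "zariski_closure S = Y \<or> zariski_closure S = Z"
    using YZ zariski_closure_least by blast
qed

lemma zariski_dim_2_chain:
  assumes "zariski_dim V = 2" "irreducible_closed V"
    and "irreducible_closed Z0" "irreducible_closed Z1" "irreducible_closed Z2" "Z0 \<subset> Z1" "Z1 \<subset> Z2" "Z2 \<subseteq> V"
  shows "Z2 = V"
proof (rule ccontr)
  assume "Z2 \<noteq> V"
  define Z where "Z = (\<lambda>i::nat. if i = 0 then Z0 else if i = 1 then Z1 else if i = 2 then Z2 else V)"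
  have "(\<forall>i\<le>3. irreducible_closed (Z i) \<and> Z i \<subseteq> V) \<and> (\<forall>i<3. Z i \<subset> Z (Suc i))"
  proof (intro conjI allI impI)
    fix i :: nat assume "i < 3"
    then consider "i = 0" | "i = 1" | "i = 2" by linarith
    then show "Z i \<subset> Z (Suc i)" by cases (use assms \<open>Z2 \<noteq> V\<close> in \<open>auto simp: Z_def\<close>)
  qed (use assms in \<open>auto simp: Z_def\<close>)
  then have "enat 3 \<in> {enat k | k. \<exists>Z :: nat \<Rightarrow> (complex ^ 'a) set.
     (\<forall>i\<le>k. irreducible_closed (Z i) \<and> Z i \<subseteq> V) \<and> (\<forall>i<k. Z i \<subset> Z (Suc i))}" by blast
  then have "enat 3 \<le> zariski_dim V" unfolding zariski_dim_def by (rule Sup_upper)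
  then show False using assms(1) by (simp add: numeral_eq_enat)
qed

locale additive_action = graded_variety V q \<phi>
  for V :: "(complex ^ 'n) set" and q :: "complex ^ 'n" and \<phi> :: "complex \<Rightarrow> complex ^ 'n \<Rightarrow> complex ^ 'n" +
  fixes Ps :: "complex \<Rightarrow> complex ^ 'n \<Rightarrow> complex ^ 'n"
  assumes Ps_in: "x \<in> V \<Longrightarrow> Ps s x \<in> V"
    and Ps_0: "x \<in> V \<Longrightarrow> Ps 0 x = x"
    and Ps_add: "x \<in> V \<Longrightarrow> Ps (s + t) x = Ps s (Ps t x)"
    and Ps_coord: "\<exists>F\<in>poly_family poly_funs. \<forall>x s. Ps s x $ i = poly (F x) s"
begin

text \<open>
  If \<open>\<partial>\<close> is the locally nilpotent derivation belonging to \<open>Ps\<close>, then the coefficients of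
  \<open>dps f\<close>, that is the functions \<open>dcoeff j f\<close>, are \<open>\<partial>\<^sup>j f / j!\<close>.
\<close>

definition dps :: "(complex ^ 'n \<Rightarrow> complex) \<Rightarrow> complex ^ 'n \<Rightarrow> complex poly" where
  "dps f = (SOME F. F \<in> poly_family poly_funs \<and> (\<forall>x s. f (Ps s x) = poly (F x) s))"

lemma dps:
  assumes f: "f \<in> poly_funs"
  shows "dps f \<in> poly_family poly_funs" "f (Ps s x) = poly (dps f x) s"
proof -
  have "\<exists>F\<in>poly_family poly_funs. \<forall>x s. True \<longrightarrow> f (Ps s x) = poly (F x) s"
    using f unfolding poly_funs_def
    by (rule gen_algebra_curve) (use Ps_coord in \<open>auto simp: poly_funs_def\<close>)
  then have "\<exists>F. F \<in> poly_family poly_funs \<and> (\<forall>x s. f (Ps s x) = poly (F x) s)" by blast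
  from someI_ex[OF this, folded dps_def]
  show "dps f \<in> poly_family poly_funs" "f (Ps s x) = poly (dps f x) s" by auto
qed

lemma dps_unique:
  assumes "f \<in> poly_funs" "\<And>s. f (Ps s x) = poly p s"
  shows "dps f x = p"
  by (rule poly_eqI_nonzero) (simp add: assms(2) flip: dps(2)[OF assms(1)])

definition dcoeff :: "nat \<Rightarrow> (complex ^ 'n \<Rightarrow> complex) \<Rightarrow> complex ^ 'n \<Rightarrow> complex" where
  "dcoeff j f = (\<lambda>x. coeff (dps f x) j)"

lemma dcoeff_poly: "f \<in> poly_funs \<Longrightarrow> dcoeff j f \<in> poly_funs"
  unfolding dcoeff_def by (rule poly_familyD[OF dps(1)])

lemma dps_shift:
  assumes "f \<in> poly_funs" "x \<in> V"
  shows "dps f (Ps r x) = pcompose (dps f x) [:r, 1:]"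
proof (rule dps_unique[OF assms(1)])
  fix s
  have "f (Ps s (Ps r x)) = poly (dps f x) (s + r)" using Ps_add[OF assms(2)] dps(2)[OF assms(1)] by metis
  then show "f (Ps s (Ps r x)) = poly (pcompose (dps f x) [:r, 1:]) s"
    by (simp add: poly_pcompose add.commute)
qed

lemma dcoeff_0: "f \<in> poly_funs \<Longrightarrow> x \<in> V \<Longrightarrow> dcoeff 0 f x = f x"
  using dps(2)[of f 0 x] Ps_0 by (simp add: dcoeff_def poly_0_coeff_0)

lemma dps_diff: "f \<in> poly_funs \<Longrightarrow> g \<in> poly_funs \<Longrightarrow> dps (\<lambda>x. f x - g x) x = dps f x - dps g x"
  by (rule dps_unique) (auto simp: dps poly_funs_diff)

lemma dps_mult: "f \<in> poly_funs \<Longrightarrow> g \<in> poly_funs \<Longrightarrow> dps (\<lambda>x. f x * g x) x = dps f x * dps g x"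
  by (rule dps_unique) (auto simp: dps poly_funs_mult)

lemma dps_power: "f \<in> poly_funs \<Longrightarrow> dps (\<lambda>x. f x ^ k) x = dps f x ^ k"
  by (rule dps_unique) (auto simp: dps poly_funs_power)

lemma dps_const: "dps (\<lambda>x. c) x = [:c:]"
  by (rule dps_unique) (auto simp: poly_funs_const)

lemma dps_cong: "f \<in> poly_funs \<Longrightarrow> g \<in> poly_funs \<Longrightarrow> (\<And>x. x \<in> V \<Longrightarrow> f x = g x) \<Longrightarrow> x \<in> V \<Longrightarrow> dps f x = dps g x"
  by (rule dps_unique) (auto simp: Ps_in simp flip: dps(2))

lemma dcoeff_shift:
  assumes "f \<in> poly_funs" "x \<in> V" "degree (dps f x) \<le> d"
  shows "dcoeff j f (Ps r x) = (\<Sum>m\<le>d. dcoeff m f x * (of_nat (m choose j) * r ^ (m - j)))"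
  unfolding dcoeff_def dps_shift[OF assms(1,2)] by (rule coeff_pcompose_shift[OF assms(3)])

text \<open>The coefficient in the degree bound is unchanged when the variable of a polynomial is
  translated, so it is constant along the orbit.\<close>

lemma dps_dcoeff_top:
  assumes f: "f \<in> poly_funs" and x: "x \<in> V" and d: "degree (dps f x) \<le> i"
  shows "dps (dcoeff i f) x = [:dcoeff i f x:]"
proof (rule dps_unique[OF dcoeff_poly[OF f]])
  fix s
  have "dcoeff i f (Ps s x) = (\<Sum>m\<le>i. dcoeff m f x * (of_nat (m choose i) * s ^ (m - i)))"
    by (rule dcoeff_shift[OF f x d])
  also have "\<dots> = (\<Sum>m\<in>{i}. dcoeff m f x * (of_nat (m choose i) * s ^ (m - i)))"
    by (rule sum.mono_neutral_right) (auto simp: binomial_eq_0)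
  finally show "dcoeff i f (Ps s x) = poly [:dcoeff i f x:] s" by simp
qed

text \<open>The derivative before the last is a local slice: it moves linearly along the orbit, and
  its speed is the invariant of the preceding lemma.\<close>

lemma dps_dcoeff_subtop:
  assumes f: "f \<in> poly_funs" and x: "x \<in> V" and d: "degree (dps f x) \<le> Suc i"
  shows "dps (dcoeff i f) x = [:dcoeff i f x, of_nat (Suc i) * dcoeff (Suc i) f x:]"
proof (rule dps_unique[OF dcoeff_poly[OF f]])
  fix s
  have "dcoeff i f (Ps s x) = (\<Sum>m\<le>Suc i. dcoeff m f x * (of_nat (m choose i) * s ^ (m - i)))"
    by (rule dcoeff_shift[OF f x d])
  also have "\<dots> = (\<Sum>m\<in>{i, Suc i}. dcoeff m f x * (of_nat (m choose i) * s ^ (m - i)))"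
    by (rule sum.mono_neutral_right) (auto simp: binomial_eq_0)
  finally show "dcoeff i f (Ps s x) = poly [:dcoeff i f x, of_nat (Suc i) * dcoeff (Suc i) f x:] s"
    by (simp add: algebra_simps)
qed

lemma top_degree:
  assumes f: "f \<in> poly_funs" and x: "x \<in> V" "f x \<noteq> 0"
  obtains i where "\<exists>x\<in>V. dcoeff i f x \<noteq> 0" "\<And>x. x \<in> V \<Longrightarrow> degree (dps f x) \<le> i"
proof -
  define I where "I = {i. \<exists>x\<in>V. dcoeff i f x \<noteq> 0}"
  obtain d where d: "\<And>x. degree (dps f x) \<le> d" using poly_family_degree[OF dps(1)[OF f]] by blast
  have "I \<subseteq> {..d}" using d by (auto simp: I_def dcoeff_def intro: order_trans[OF le_degree])
  then have finI: "finite I" using finite_subset by blast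
  have "0 \<in> I" using dcoeff_0[OF f x(1)] x by (auto simp: I_def intro!: bexI[of _ x])
  then have "Max I \<in> I" using finI by (intro Max_in) auto
  moreover have "degree (dps f x) \<le> Max I" if "x \<in> V" for x
  proof (rule degree_le, intro allI impI)
    fix j assume "Max I < j"
    then have "j \<notin> I" using Max_ge[OF finI] leD by blast
    then show "coeff (dps f x) j = 0" using that by (auto simp: I_def dcoeff_def)
  qed
  ultimately show ?thesis using that[of "Max I"] by (auto simp: I_def)
qed

text \<open>A moved point changes some homogeneous component of some coordinate. Its derivative
  along the orbit is nonzero at some parameter, and translating the base point brings that parameter
  to \<open>0\<close>.\<close>

lemma moved_component:
  assumes "x \<in> V" "Ps s x \<noteq> x"
  obtains k f x' where "homogeneous k f" "x' \<in> V" "dcoeff 1 f x' \<noteq> 0"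
proof -
  obtain i where i: "Ps s x $ i \<noteq> x $ i" using assms(2) by (auto simp: vec_eq_iff)
  define X where "X = (\<lambda>x::complex ^ 'n. x $ i)"
  have X: "X \<in> poly_funs" unfolding X_def by (rule poly_funs_coord)
  obtain d where d: "\<And>k x. k > d \<Longrightarrow> component k X x = 0" using component_bound[OF X] by blast
  have "\<exists>k. component k X (Ps s x) \<noteq> component k X x"
  proof (rule ccontr)
    assume "\<nexists>k. component k X (Ps s x) \<noteq> component k X x"
    then have "X (Ps s x) = X x"
      using sum_component[OF X d Ps_in[OF assms(1)]] sum_component[OF X d assms(1)] by simp
    then show False using i by (simp add: X_def)
  qed
  then obtain k where k: "component k X (Ps s x) \<noteq> component k X x" by blast
  let ?f = "component k X"
  have f: "?f \<in> poly_funs" by (rule component_poly[OF X])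
  have "pderiv (dps ?f x) \<noteq> 0"
  proof
    assume "pderiv (dps ?f x) = 0"
    then have "degree (dps ?f x) = 0" by (simp add: pderiv_eq_0_iff)
    then obtain c where "dps ?f x = [:c:]" by (metis degree_eq_zeroE)
    then have "?f (Ps s x) = ?f (Ps 0 x)" using dps(2)[OF f] by simp
    then show False using k Ps_0[OF assms(1)] by simp
  qed
  then obtain r where "poly (pderiv (dps ?f x)) r \<noteq> 0" using poly_all_0_iff_0 by blast
  then have "dcoeff 1 ?f (Ps r x) \<noteq> 0"
    by (simp only: dcoeff_def dps_shift[OF f assms(1)] coeff_1_pcompose_shift) simp
  then show ?thesis using that component_homogeneous[OF X] Ps_in[OF assms(1)] by blast
qed

text \<open>The limit construction yields an action normalized only through \<open>r ^ b\<close>.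
  The derivative \<open>g\<close> of a moved function of degree \<open>k\<close> is multiplied by
  \<open>r powi (int b * int k + a)\<close> under \<open>\<phi> (r ^ b)\<close>; this factor must be
  a polynomial in \<open>r ^ b\<close>, so its exponent is a multiple of \<open>b\<close>.\<close>

lemma weight_divides:
  fixes a :: int and b :: nat
  assumes b: "b > 0"
    and act: "\<And>x s r. x \<in> V \<Longrightarrow> r \<noteq> 0 \<Longrightarrow> Ps s (\<phi> (r ^ b) x) = \<phi> (r ^ b) (Ps (s * r powi a) x)"
    and moved: "x0 \<in> V" "Ps s0 x0 \<noteq> x0"
  shows "\<exists>e. a = int b * e"
proof -
  obtain k f x where f: "homogeneous k f" and x: "x \<in> V" "dcoeff 1 f x \<noteq> 0"
    using moved_component[OF moved] by blast
  have fp: "f \<in> poly_funs" using f by (simp add: homogeneous_def)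
  define g where "g = dcoeff 1 f"
  have g: "g \<in> poly_funs" unfolding g_def by (rule dcoeff_poly[OF fp])
  have gx: "g x \<noteq> 0" using x(2) by (simp add: g_def)
  have gact: "g (\<phi> (r ^ b) x) = r powi (int b * int k + a) * g x" if r: "r \<noteq> 0" for r
  proof -
    have "dps f (\<phi> (r ^ b) x) = smult ((r ^ b) ^ k) (pcompose (dps f x) [:0, r powi a:])"
    proof (rule dps_unique[OF fp])
      fix s
      have "f (Ps s (\<phi> (r ^ b) x)) = (r ^ b) ^ k * f (Ps (s * r powi a) x)"
        using act[OF x(1) r] f Ps_in[OF x(1)] r by (simp add: homogeneous_def)
      then show "f (Ps s (\<phi> (r ^ b) x)) = poly (smult ((r ^ b) ^ k) (pcompose (dps f x) [:0, r powi a:])) s"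
        by (simp add: dps(2)[OF fp] poly_pcompose)
    qed
    then have "g (\<phi> (r ^ b) x) = (r ^ b) ^ k * (r powi a * g x)"
      by (simp add: g_def dcoeff_def coeff_pcompose_linear)
    also have "(r ^ b) ^ k = r powi (int b * int k)" by (simp add: power_int_mult)
    finally show ?thesis using r by (simp add: power_int_add)
  qed
  define P where "P = pcompose (gr g x) (monom 1 b)"
  have P: "poly P r = r powi (int b * int k + a) * g x" if "r \<noteq> 0" for r
    using gr(3)[OF g x(1), of "r ^ b"] gact[OF that] that by (simp add: P_def poly_pcompose poly_monom)
  define e where "e = int b * int k + a"
  have "e \<ge> 0"
  proof (rule ccontr)
    assume neg: "\<not> e \<ge> 0"
    have "monom 1 (nat (- e)) * P = [:g x:]"
    proof (rule poly_eqI_nonzero)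
      fix t :: complex assume t: "t \<noteq> 0"
      have "t ^ nat (- e) * t powi e = 1" using neg t by (simp add: power_int_def field_simps)
      then show "poly (monom 1 (nat (- e)) * P) t = poly [:g x:] t"
        using P[OF t] by (simp add: poly_monom e_def mult.assoc[symmetric])
    qed
    then have "coeff (monom 1 (nat (- e)) * P) 0 = g x" by simp
    then show False using neg gx by (simp add: coeff_monom_mult)
  qed
  have Pm: "P = monom (g x) (nat e)"
    by (rule poly_eqI_nonzero) (use \<open>e \<ge> 0\<close> in \<open>simp add: P poly_monom e_def[symmetric] power_int_def mult.commute\<close>)
  define d where "d = degree (gr g x)"
  have "P = (\<Sum>m\<le>d. monom (coeff (gr g x) m) (b * m))"
  proof (rule poly_eqI_nonzero)
    fix t
    have "poly P t = poly (gr g x) (t ^ b)" by (simp add: P_def poly_pcompose poly_monom)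
    also have "\<dots> = (\<Sum>m\<le>d. coeff (gr g x) m * (t ^ b) ^ m)" by (simp add: poly_altdef d_def)
    finally show "poly P t = poly (\<Sum>m\<le>d. monom (coeff (gr g x) m) (b * m)) t"
      by (simp add: poly_sum poly_monom power_mult)
  qed
  then have sum: "(\<Sum>m\<le>d. if b * m = nat e then coeff (gr g x) m else 0) = g x"
    using arg_cong[OF Pm, of "\<lambda>p. coeff p (nat e)"] by (simp add: coeff_sum)
  have "\<exists>m. b * m = nat e"
  proof (rule ccontr)
    assume "\<nexists>m. b * m = nat e"
    then have "(\<Sum>m\<le>d. if b * m = nat e then coeff (gr g x) m else 0) = 0" by simp
    then show False using sum gx by simp
  qed
  then obtain m where "b * m = nat e" by blast
  then have "int b * int m = int b * int k + a" using \<open>e \<ge> 0\<close> by (simp add: e_def flip: of_nat_mult)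
  then have "a = int b * (int m - int k)" by (simp add: algebra_simps)
  then show ?thesis by blast
qed

end

text \<open>\<open>eps\<close> is the degree of the derivation belonging to \<open>Ps\<close>; it
  may have either sign.\<close>

locale homogeneous_additive_action = additive_action V q \<phi> Ps
  for V :: "(complex ^ 'n) set" and q \<phi> Ps +
  fixes eps :: int
  assumes Ps_act: "x \<in> V \<Longrightarrow> t \<noteq> 0 \<Longrightarrow> Ps s (\<phi> t x) = \<phi> t (Ps (s * t powi eps) x)"
    and moved: "\<exists>x\<in>V. \<exists>s. Ps s x \<noteq> x"

lemma (in graded_variety) homogeneous_additive_action_exists:
  assumes "\<And>x s. x \<in> V \<Longrightarrow> \<psi> s x \<in> V" "\<And>x. x \<in> V \<Longrightarrow> \<psi> 0 x = x"
    "\<And>x s t. x \<in> V \<Longrightarrow> \<psi> (s + t) x = \<psi> s (\<psi> t x)"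
    "\<And>f. f \<in> poly_funs \<Longrightarrow> \<exists>F\<in>poly_family poly_funs. \<forall>x\<in>V. \<forall>s. f (\<psi> s x) = poly (F x) s"
    "x0 \<in> V" "\<psi> s0 x0 \<noteq> x0"
  shows "\<exists>Ps eps. homogeneous_additive_action V q \<phi> Ps eps"
proof -
  have "\<exists>Ps (b::nat) (a::int). b > 0 \<and> (\<forall>x\<in>V. \<forall>s. Ps s x \<in> V) \<and> (\<forall>x\<in>V. Ps 0 x = x) \<and>
    (\<forall>x\<in>V. \<forall>s t. Ps (s + t) x = Ps s (Ps t x)) \<and>
    (\<forall>i. \<exists>F\<in>poly_family poly_funs. \<forall>x s. Ps s x $ i = poly (F x) s) \<and>
    (\<forall>x\<in>V. \<forall>s r. r \<noteq> 0 \<longrightarrow> Ps s (\<phi> (r ^ b) x) = \<phi> (r ^ b) (Ps (s * r powi a) x)) \<and>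
    (\<exists>x\<in>V. \<exists>s. Ps s x \<noteq> x)"
    by (rule homogeneous_limit[OF assms])
  then obtain Ps and b :: nat and a :: int where b: "b > 0" and Ps: "\<forall>x\<in>V. \<forall>s. Ps s x \<in> V" "\<forall>x\<in>V. Ps 0 x = x"
    "\<forall>x\<in>V. \<forall>s t. Ps (s + t) x = Ps s (Ps t x)"
    "\<forall>i. \<exists>F\<in>poly_family poly_funs. \<forall>x s. Ps s x $ i = poly (F x) s"
    and act: "\<forall>x\<in>V. \<forall>s r. r \<noteq> 0 \<longrightarrow> Ps s (\<phi> (r ^ b) x) = \<phi> (r ^ b) (Ps (s * r powi a) x)"
    and moved: "\<exists>x\<in>V. \<exists>s. Ps s x \<noteq> x" by blast
  interpret additive_action V q \<phi> Ps by unfold_locales (use Ps in auto)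
  obtain e where e: "a = int b * e" using weight_divides[OF b] act moved by blast
  have "homogeneous_additive_action V q \<phi> Ps e"
  proof
    fix x t s assume x: "x \<in> V" and t: "(t::complex) \<noteq> 0"
    \<comment> \<open>A \<open>b\<close>-th root of \<open>t\<close>. Any choice serves, because
      \<open>a\<close> is a multiple of \<open>b\<close>.\<close>
    define r where "r = exp (Ln t / of_nat b)"
    have r: "r \<noteq> 0" "r ^ b = t" using b t by (auto simp: r_def simp flip: exp_of_nat_mult)
    then have "r powi a = t powi e" by (simp add: e power_int_mult)
    then show "Ps s (\<phi> t x) = \<phi> t (Ps (s * t powi e) x)" using act x r by metis
  qed (rule moved)
  then show ?thesis by blast
qed

context graded_variety
begin

lemma homogeneous_polyD: "homogeneous k f \<Longrightarrow> f \<in> poly_funs"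
  by (simp add: homogeneous_def)

lemma homogeneous_power: "homogeneous k f \<Longrightarrow> homogeneous (i * k) (\<lambda>x. f x ^ i)"
  by (auto simp: homogeneous_def poly_funs_power power_mult_distrib mult.commute simp flip: power_mult)

lemma homogeneous_diff: "homogeneous k f \<Longrightarrow> homogeneous k g \<Longrightarrow> homogeneous k (\<lambda>x. f x - g x)"
  by (auto simp: homogeneous_def poly_funs_diff right_diff_distrib)

lemma homogeneous_cmult: "homogeneous k f \<Longrightarrow> homogeneous k (\<lambda>x. c * f x)"
  by (auto simp: homogeneous_def poly_funs_mult poly_funs_const)

end

section \<open>Degrees of derivatives, invariants and local slices\<close>

context homogeneous_additive_action
begin

lemma dcoeff_act:
  assumes f: "homogeneous k f" and x: "x \<in> V" and t: "t \<noteq> 0"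
  shows "dcoeff j f (\<phi> t x) = t powi (int k + int j * eps) * dcoeff j f x"
proof -
  have fp: "f \<in> poly_funs" using f by (rule homogeneous_polyD)
  have "dps f (\<phi> t x) = smult (t ^ k) (pcompose (dps f x) [:0, t powi eps:])"
  proof (rule dps_unique[OF fp])
    fix s
    have "f (Ps s (\<phi> t x)) = t ^ k * f (Ps (s * t powi eps) x)"
      using f Ps_in[OF x] Ps_act[OF x t] t by (simp add: homogeneous_def)
    then show "f (Ps s (\<phi> t x)) = poly (smult (t ^ k) (pcompose (dps f x) [:0, t powi eps:])) s"
      by (simp add: dps(2)[OF fp] poly_pcompose)
  qed
  then have "dcoeff j f (\<phi> t x) = t ^ k * ((t powi eps) ^ j * dcoeff j f x)"
    by (simp add: dcoeff_def coeff_pcompose_linear)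
  also have "t ^ k = t powi (int k)" by simp
  also have "(t powi eps) ^ j = t powi (eps * int j)" by (simp add: power_int_mult)
  finally show ?thesis using t by (simp add: power_int_add mult.commute)
qed

text \<open>The derivative is an eigenfunction, and a nonzero one cannot have negative weight
  because the grading has no negative degrees.\<close>

lemma dcoeff_homogeneous:
  assumes f: "homogeneous k f" and nz: "\<exists>x\<in>V. dcoeff j f x \<noteq> 0"
  shows "int k + int j * eps \<ge> 0 \<and> homogeneous (nat (int k + int j * eps)) (dcoeff j f)"
proof -
  have g: "dcoeff j f \<in> poly_funs" by (rule dcoeff_poly[OF homogeneous_polyD[OF f]])
  define e where "e = int k + int j * eps"
  have "e \<ge> 0"
  proof (rule ccontr)
    assume neg: "\<not> e \<ge> 0"
    obtain x where x: "x \<in> V" "dcoeff j f x \<noteq> 0" using nz by blast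
    have "monom 1 (nat (- e)) * gr (dcoeff j f) x = [:dcoeff j f x:]"
    proof (rule poly_eqI_nonzero)
      fix t :: complex assume t: "t \<noteq> 0"
      have "t ^ nat (- e) * t powi e = 1" using neg t by (simp add: power_int_def field_simps)
      moreover have "poly (gr (dcoeff j f) x) t = t powi e * dcoeff j f x"
        using gr(3)[OF g x(1) t] dcoeff_act[OF f x(1) t] by (simp add: e_def)
      ultimately show "poly (monom 1 (nat (- e)) * gr (dcoeff j f) x) t = poly [:dcoeff j f x:] t"
        by (simp add: poly_monom mult.assoc[symmetric])
    qed
    then have "coeff (monom 1 (nat (- e)) * gr (dcoeff j f) x) 0 = dcoeff j f x" by simp
    then show False using neg x(2) by (simp add: coeff_monom_mult)
  qed
  then have "t powi e = t ^ nat e" for t :: complex by (simp add: power_int_def)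
  then show ?thesis using \<open>e \<ge> 0\<close> g dcoeff_act[OF f] by (auto simp: homogeneous_def e_def)
qed

text \<open>Otherwise every top derivative has degree zero and is constant. This gives a slice
  \<open>y\<close> whose derivative is a nonzero constant, and then each homogeneous function is a
  multiple of a power of \<open>y\<close>, which leaves \<open>V\<close> with a single
  coordinate.\<close>

lemma invariant_exists:
  assumes dim: "\<not> vec.dim (tangent_space V q) \<le> 1"
  shows "\<exists>k u x. k > 0 \<and> homogeneous k u \<and> x \<in> V \<and> u x \<noteq> 0 \<and> (\<forall>x\<in>V. dps u x = [:u x:])"
proof (rule ccontr)
  assume no: "\<not> ?thesis"
  have weight: "int k + int i * eps = 0 \<and> (\<exists>c. c \<noteq> 0 \<and> (\<forall>x\<in>V. dcoeff i f x = c))"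
    if f: "homogeneous k f" and nz: "\<exists>x\<in>V. dcoeff i f x \<noteq> 0" and deg: "\<And>x. x \<in> V \<Longrightarrow> degree (dps f x) \<le> i" for k f i
  proof -
    let ?u = "dcoeff i f"
    note h = dcoeff_homogeneous[OF f nz]
    obtain x where x: "x \<in> V" "?u x \<noteq> 0" using nz by blast
    have inv: "dps ?u x = [:?u x:]" if "x \<in> V" for x
      using dps_dcoeff_top[OF homogeneous_polyD[OF f] that deg[OF that]] .
    have "nat (int k + int i * eps) = 0"
    proof (rule ccontr)
      assume "nat (int k + int i * eps) \<noteq> 0"
      then have "nat (int k + int i * eps) > 0 \<and> homogeneous (nat (int k + int i * eps)) ?u \<and> x \<in> V \<and>
          ?u x \<noteq> 0 \<and> (\<forall>x\<in>V. dps ?u x = [:?u x:])"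
        using h x inv by simp
      then show False using no by blast
    qed
    then have e: "int k + int i * eps = 0" using h by simp
    then have "homogeneous 0 ?u" using h by simp
    then have "?u y = ?u q" if "y \<in> V" for y using homogeneous_0 that by blast
    then show ?thesis using e x by metis
  qed
  obtain x0 s0 where "x0 \<in> V" "Ps s0 x0 \<noteq> x0" using moved by blast
  then obtain k f x1 where f: "homogeneous k f" and x1: "x1 \<in> V" "dcoeff 1 f x1 \<noteq> 0" by (rule moved_component)
  note fp = homogeneous_polyD[OF f]
  have "\<exists>x\<in>V. f x \<noteq> 0"
  proof (rule ccontr)
    assume "\<not> (\<exists>x\<in>V. f x \<noteq> 0)"
    then have "dps f x1 = dps (\<lambda>x. 0) x1" using fp x1(1) by (intro dps_cong) (auto simp: poly_funs_const)
    then show False using x1(2) by (simp add: dcoeff_def dps_const)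
  qed
  then obtain z where "z \<in> V" "f z \<noteq> 0" by blast
  then obtain i where i: "\<exists>x\<in>V. dcoeff i f x \<noteq> 0" "\<And>x. x \<in> V \<Longrightarrow> degree (dps f x) \<le> i"
    using top_degree[OF fp] by metis
  have "i \<noteq> 0"
  proof
    assume "i = 0"
    then have "degree (dps f x1) = 0" using i(2)[OF x1(1)] by simp
    then have "dcoeff 1 f x1 = 0" by (simp add: dcoeff_def coeff_eq_0)
    then show False using x1(2) by simp
  qed
  then obtain i' where i': "i = Suc i'" by (cases i) auto
  obtain c where c: "int k + int i * eps = 0" "c \<noteq> 0" "\<And>x. x \<in> V \<Longrightarrow> dcoeff i f x = c"
    using weight[OF f i] by blast
  define y where "y = dcoeff i' f"
  define c' where "c' = of_nat i * c"
  have c'0: "c' \<noteq> 0" using c(2) \<open>i \<noteq> 0\<close> by (simp add: c'_def)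
  have y: "y \<in> poly_funs" unfolding y_def by (rule dcoeff_poly[OF fp])
  have dy: "dps y x = [:y x, c':]" if "x \<in> V" for x
    using dps_dcoeff_subtop[OF fp that, of i'] i(2)[OF that] c(3)[OF that]
    by (simp add: y_def c'_def i')
  obtain x2 where x2: "x2 \<in> V" "y x2 \<noteq> 0"
  proof -
    have "y (Ps s x1) = y x1 + s * c'" for s using dps(2)[OF y] dy[OF x1(1)] by simp
    then have "y (Ps 0 x1) \<noteq> y (Ps 1 x1)" using c'0 by simp
    then have "y (Ps 0 x1) \<noteq> 0 \<or> y (Ps 1 x1) \<noteq> 0" by auto
    then show ?thesis using that Ps_in[OF x1(1)] by blast
  qed
  have yhom: "int k + int i' * eps \<ge> 0 \<and> homogeneous (nat (int k + int i' * eps)) y"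
    unfolding y_def using x2 by (intro dcoeff_homogeneous[OF f]) (auto simp: y_def)
  have keps: "int k + int i' * eps = - eps" using c(1) by (simp add: i' algebra_simps)
  define e where "e = nat (- eps)"
  have "e \<noteq> 0"
  proof
    assume "e = 0"
    then have "eps = 0" using yhom keps by (simp add: e_def)
    then have "k = 0" using c(1) by simp
    then have "f x = f q" if "x \<in> V" for x using homogeneous_0 f that by blast
    then have "dps f x1 = dps (\<lambda>x. f q) x1" using fp x1(1) by (intro dps_cong) (auto simp: poly_funs_const)
    then show False using x1(2) by (simp add: dcoeff_def dps_const)
  qed
  have eps: "eps = - int e" using yhom keps by (simp add: e_def)
  have yh: "homogeneous e y" using yhom keps by (simp add: e_def)
  \<comment> \<open>The degree \<open>l = j * e\<close> determines the order \<open>j\<close> of the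
    top derivative, for \<open>g\<close> and for the remainder \<open>r\<close> alike. The constant
    \<open>a\<close> is chosen to cancel the derivative of order \<open>j\<close>, so nothing of
    \<open>r\<close> is left.\<close>
  have span: "\<exists>c j. \<forall>x\<in>V. g x = c * y x ^ j" if g: "homogeneous l g" for l g
  proof (cases "\<exists>z\<in>V. g z \<noteq> 0")
    case False then show ?thesis by (intro exI[of _ 0]) auto
  next
    case True
    note gp = homogeneous_polyD[OF g]
    obtain j where j: "\<exists>x\<in>V. dcoeff j g x \<noteq> 0" "\<And>x. x \<in> V \<Longrightarrow> degree (dps g x) \<le> j"
      using top_degree[OF gp] True by metis
    obtain b where b: "int l + int j * eps = 0" "\<And>x. x \<in> V \<Longrightarrow> dcoeff j g x = b" using weight[OF g j] by blast
    have l: "l = j * e" using b(1) eps by (simp flip: of_nat_mult)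
    define a where "a = b / c' ^ j"
    define r where "r = (\<lambda>x. g x - a * y x ^ j)"
    have yj: "homogeneous (j * e) (\<lambda>x. a * y x ^ j)"
      by (intro homogeneous_cmult homogeneous_power yh)
    then have r: "homogeneous l r" unfolding r_def l using g l by (intro homogeneous_diff) auto
    note rp = homogeneous_polyD[OF r]
    have dr: "dps r x = dps g x - smult a ([:y x, c':] ^ j)" if "x \<in> V" for x
    proof -
      have "dps r x = dps g x - dps (\<lambda>x. a * y x ^ j) x"
        unfolding r_def by (intro dps_diff gp homogeneous_polyD[OF yj])
      also have "dps (\<lambda>x. a * y x ^ j) x = dps (\<lambda>x. a) x * dps (\<lambda>x. y x ^ j) x"
        by (intro dps_mult poly_funs_const poly_funs_power y)
      finally show ?thesis using that by (simp add: dps_const dps_power[OF y] dy)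
    qed
    have deg1: "degree ([:y x, c':] ^ j) = j" for x using c'0 by (simp add: degree_power_eq)
    have lead1: "coeff ([:y x, c':] ^ j) j = c' ^ j" for x
      using lead_coeff_power[of "[:y x, c':]" j] c'0 by (simp add: deg1)
    have "r x = 0" if xV: "x \<in> V" for x
    proof (rule ccontr)
      assume rx: "r x \<noteq> 0"
      then obtain j' where j': "\<exists>x\<in>V. dcoeff j' r x \<noteq> 0" "\<And>x. x \<in> V \<Longrightarrow> degree (dps r x) \<le> j'"
        using top_degree[OF rp xV rx] by metis
      then have "int l + int j' * eps = 0" using weight[OF r] by blast
      then have "l = j' * e" using eps by (simp flip: of_nat_mult)
      then have "j' = j" using l \<open>e \<noteq> 0\<close> by simp
      moreover have "dcoeff j r z = 0" if "z \<in> V" for z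
        using b(2)[OF that] c'0 by (simp add: dcoeff_def dr[OF that] lead1 a_def)
      ultimately show False using j'(1) by blast
    qed
    then show ?thesis by (auto simp: r_def)
  qed
  have "\<exists>p. \<forall>x\<in>V. x $ i = poly p (y x)" for i
  proof -
    define X where "X = (\<lambda>x::complex ^ 'n. x $ i)"
    have X: "X \<in> poly_funs" unfolding X_def by (rule poly_funs_coord)
    obtain d where d: "\<And>k x. k > d \<Longrightarrow> component k X x = 0" using component_bound[OF X] by blast
    obtain c j where "\<And>k x. x \<in> V \<Longrightarrow> component k X x = c k * y x ^ j k"
      using span[OF component_homogeneous[OF X]] by metis
    then have "X x = poly (\<Sum>k\<le>d. monom (c k) (j k)) (y x)" if "x \<in> V" for x
      using sum_component[OF X d that] that by (simp add: poly_sum poly_monom)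
    then show ?thesis unfolding X_def by blast
  qed
  then obtain p where "\<And>i x. x \<in> V \<Longrightarrow> x $ i = poly (p i) (y x)" by metis
  then have "vec.dim (tangent_space V q) \<le> 1" by (rule tangent_space_dim_curve[OF y])
  then show False using dim by simp
qed

text \<open>Along the additive orbit of \<open>x0\<close> the invariant \<open>u\<close> is a
  nonzero constant and the slice \<open>y\<close> is \<open>w0 * s\<close>. Up to constants they
  will become the monomials \<open>t ^ k\<close> and \<open>t ^ b * s\<close>.\<close>

lemma generic_point:
  assumes dim: "\<not> vec.dim (tangent_space V q) \<le> 1"
  shows "\<exists>k u b y x0 u0 w0. k > 0 \<and> homogeneous k u \<and> homogeneous b y \<and> x0 \<in> V \<and> u0 \<noteq> 0 \<and> w0 \<noteq> 0 \<and>
    dps u x0 = [:u0:] \<and> dps y x0 = [:0, w0:]"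
proof -
  obtain k u x where u: "k > 0" "homogeneous k u" "x \<in> V" "u x \<noteq> 0" and du: "\<And>x. x \<in> V \<Longrightarrow> dps u x = [:u x:]"
    using invariant_exists[OF dim] by blast
  note up = homogeneous_polyD[OF u(2)]
  obtain x0 s0 where "x0 \<in> V" "Ps s0 x0 \<noteq> x0" using moved by blast
  then obtain l f x1 where f: "homogeneous l f" and x1: "x1 \<in> V" "dcoeff 1 f x1 \<noteq> 0" by (rule moved_component)
  note fp = homogeneous_polyD[OF f]
  have "\<exists>x\<in>V. f x \<noteq> 0"
  proof (rule ccontr)
    assume "\<not> (\<exists>x\<in>V. f x \<noteq> 0)"
    then have "dps f x1 = dps (\<lambda>x. 0) x1" using fp x1(1) by (intro dps_cong) (auto simp: poly_funs_const)
    then show False using x1(2) by (simp add: dcoeff_def dps_const)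
  qed
  then obtain z where "z \<in> V" "f z \<noteq> 0" by blast
  then obtain i where i: "\<exists>x\<in>V. dcoeff i f x \<noteq> 0" "\<And>x. x \<in> V \<Longrightarrow> degree (dps f x) \<le> i"
    using top_degree[OF fp] by metis
  have "i \<noteq> 0"
  proof
    assume "i = 0"
    then have "degree (dps f x1) = 0" using i(2)[OF x1(1)] by simp
    then have "dcoeff 1 f x1 = 0" by (simp add: dcoeff_def coeff_eq_0)
    then show False using x1(2) by simp
  qed
  then obtain i' where i': "i = Suc i'" by (cases i) auto
  define y where "y = dcoeff i' f"
  define w where "w = dcoeff i f"
  have y: "y \<in> poly_funs" unfolding y_def by (rule dcoeff_poly[OF fp])
  have w: "w \<in> poly_funs" unfolding w_def by (rule dcoeff_poly[OF fp])
  have dy: "dps y x = [:y x, of_nat i * w x:]" if "x \<in> V" for x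
    using dps_dcoeff_subtop[OF fp that, of i'] i(2)[OF that] by (simp add: y_def w_def i')
  have "\<exists>x\<in>V. u x * w x \<noteq> 0"
    using irreducible_closed_mult[OF irr up w] u(3,4) i(1) unfolding w_def by blast
  then obtain x2 where x2: "x2 \<in> V" "u x2 \<noteq> 0" "w x2 \<noteq> 0" by auto
  define w0 where "w0 = of_nat i * w x2"
  have w0: "w0 \<noteq> 0" using x2(3) \<open>i \<noteq> 0\<close> by (simp add: w0_def)
  \<comment> \<open>The point of the orbit of \<open>x2\<close> where \<open>y\<close> vanishes,
    which removes the constant term of \<open>dps y\<close>.\<close>
  define x3 where "x3 = Ps (- y x2 / w0) x2"
  have x3: "x3 \<in> V" unfolding x3_def by (rule Ps_in[OF x2(1)])
  have "dps u x3 = [:u x2:]"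
    unfolding x3_def dps_shift[OF up x2(1)] by (simp add: du[OF x2(1)])
  moreover have "dps y x3 = [:0, w0:]"
    unfolding x3_def dps_shift[OF y x2(1)] using w0 by (simp add: dy[OF x2(1)] w0_def[symmetric] pcompose_pCons)
  moreover have "int l + int i' * eps \<ge> 0 \<and> homogeneous (nat (int l + int i' * eps)) y"
    unfolding y_def
  proof (rule dcoeff_homogeneous[OF f])
    have "dps y x2 \<noteq> 0" using dy[OF x2(1)] w0 by (simp add: w0_def)
    have "y (Ps s x2) = y x2 + s * w0" for s using dps(2)[OF y] dy[OF x2(1)] by (simp add: w0_def)
    then have "y (Ps 0 x2) \<noteq> y (Ps 1 x2)" using w0 by simp
    then have "y (Ps 0 x2) \<noteq> 0 \<or> y (Ps 1 x2) \<noteq> 0" by auto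
    then show "\<exists>x\<in>V. dcoeff i' f x \<noteq> 0" unfolding y_def using Ps_in[OF x2(1)] by blast
  qed
  ultimately show ?thesis using u x2 x3 w0 by blast
qed

end

section \<open>Normal graded subalgebras of polynomials in two variables\<close>

locale subring_set =
  fixes S :: "'a :: idom set"
  assumes S_1: "1 \<in> S" and S_add: "x \<in> S \<Longrightarrow> y \<in> S \<Longrightarrow> x + y \<in> S"
    and S_mult: "x \<in> S \<Longrightarrow> y \<in> S \<Longrightarrow> x * y \<in> S" and S_uminus: "x \<in> S \<Longrightarrow> - x \<in> S"
begin

lemma S_diff: "x \<in> S \<Longrightarrow> y \<in> S \<Longrightarrow> x - y \<in> S"
  using S_add[OF _ S_uminus] by fastforce

lemma S_0: "0 \<in> S"
  using S_diff[OF S_1 S_1] by simp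

lemma S_sum: "(\<And>i. i \<in> I \<Longrightarrow> f i \<in> S) \<Longrightarrow> sum f I \<in> S"
  by (induction I rule: infinite_finite_induct) (auto simp: S_0 S_add)

lemma S_power: "x \<in> S \<Longrightarrow> x ^ n \<in> S"
  by (induction n) (auto simp: S_1 S_mult)

text \<open>Fraction-free elimination: the diagonal entries stay monic and dominate the other entries.\<close>

lemma integral_of_system:
  fixes m :: "nat \<Rightarrow> nat \<Rightarrow> 'a poly"
  assumes "n \<ge> 1" "D \<ge> 1" "\<And>i j l. i < n \<Longrightarrow> j < n \<Longrightarrow> coeff (m i j) l \<in> S"
    and "\<And>i. i < n \<Longrightarrow> degree (m i i) = D \<and> lead_coeff (m i i) = 1"
    and "\<And>i j. i < n \<Longrightarrow> j < n \<Longrightarrow> i \<noteq> j \<Longrightarrow> degree (m i j) < D"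
    and "\<And>i. i < n \<Longrightarrow> (\<Sum>j<n. poly (m i j) z * e j) = 0" "e 0 \<noteq> 0"
  shows "\<exists>p. (\<forall>i. coeff p i \<in> S) \<and> lead_coeff p = 1 \<and> degree p > 0 \<and> poly p z = 0"
  using assms
proof (induction n arbitrary: m D rule: nat_induct_at_least)
  case base
  then show ?case by (intro exI[of _ "m 0 0"]) auto
next
  case (Suc n)
  define m' where "m' = (\<lambda>i j. m n n * m i j - m i n * m n j)"
  have lt: "degree (p * r) < D + D" if "degree p \<le> D" "degree r < D" for p r :: "'a poly"
    using degree_mult_le[of p r] that by linarith
  show ?case
  proof (rule Suc.IH[where D = "D + D" and m = m'])
    show "coeff (m' i j) l \<in> S" if "i < n" "j < n" for i j l
      unfolding m'_def coeff_diff coeff_mult using that Suc.prems(2)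
      by (intro S_diff S_sum S_mult) auto
    show "degree (m' i j) < D + D" if "i < n" "j < n" "i \<noteq> j" for i j
      unfolding m'_def using that Suc.prems(3,4)
      by (intro degree_diff_less lt) (auto simp: less_imp_le)
    show "degree (m' i i) = D + D \<and> lead_coeff (m' i i) = 1" if "i < n" for i
    proof -
      have 1: "degree (m n n) = D" "lead_coeff (m n n) = 1" "degree (m i i) = D" "lead_coeff (m i i) = 1"
        using Suc.prems(3)[of n] Suc.prems(3)[of i] that by auto
      then have "m n n \<noteq> 0" "m i i \<noteq> 0" by auto
      then have 2: "degree (m n n * m i i) = D + D" using 1 by (simp add: degree_mult_eq)
      have 3: "degree (m i n * m n i) < D + D"
        using Suc.prems(4)[of i n] Suc.prems(4)[of n i] that by (intro lt) auto
      then have "degree (m' i i) = D + D" unfolding m'_def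
        using degree_add_eq_left[of "- (m i n * m n i)" "m n n * m i i"] 2 by simp
      moreover have "coeff (m' i i) (D + D) = lead_coeff (m n n * m i i)"
        unfolding m'_def using 2 3 by (simp add: coeff_eq_0)
      then have "coeff (m' i i) (D + D) = 1" using 1 by (simp add: lead_coeff_mult)
      ultimately show ?thesis by simp
    qed
    show "(\<Sum>j<n. poly (m' i j) z * e j) = 0" if "i < n" for i
    proof -
      have a: "(\<Sum>j<n. poly (m i j) z * e j) = - (poly (m i n) z * e n)"
        using Suc.prems(5)[of i] that by (simp add: eq_neg_iff_add_eq_0)
      have b: "(\<Sum>j<n. poly (m n j) z * e j) = - (poly (m n n) z * e n)"
        using Suc.prems(5)[of n] by (simp add: eq_neg_iff_add_eq_0)
      have "(\<Sum>j<n. poly (m' i j) z * e j)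
        = poly (m n n) z * (\<Sum>j<n. poly (m i j) z * e j) - poly (m i n) z * (\<Sum>j<n. poly (m n j) z * e j)"
        by (simp add: m'_def sum_distrib_left sum_subtractf algebra_simps)
      then show ?thesis unfolding a b by simp
    qed
  qed (use Suc.prems in auto)
qed

text \<open>The determinant trick, with elimination instead of a determinant: \<open>z\<close> acts
  on the \<open>e i\<close> by a matrix over \<open>S\<close>. Elimination ends with one monic
  polynomial in \<open>z\<close> times \<open>e 0\<close>, hence the condition on
  \<open>e 0\<close>.\<close>

lemma integral_of_finite_module:
  fixes n :: nat
  assumes "n \<ge> 1" "\<And>i j. i < n \<Longrightarrow> j < n \<Longrightarrow> r i j \<in> S"
    and "\<And>i. i < n \<Longrightarrow> z * e i = (\<Sum>j<n. r i j * e j)" "e 0 \<noteq> 0"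
  shows "\<exists>p. (\<forall>i. coeff p i \<in> S) \<and> lead_coeff p = 1 \<and> degree p > 0 \<and> poly p z = 0"
proof (rule integral_of_system[where n = n and D = 1 and e = e and m = "\<lambda>i j. if i = j then [:- r i j, 1:] else [:- r i j:]"])
  fix i assume i: "i < n"
  have "(\<Sum>j<n. poly (if i = j then [:- r i j, 1:] else [:- r i j:]) z * e j)
    = (\<Sum>j<n. (if i = j then z * e j else 0) - r i j * e j)"
    by (intro sum.cong) (auto simp: algebra_simps)
  also have "\<dots> = z * e i - (\<Sum>j<n. r i j * e j)" using i by (simp add: sum_subtractf)
  finally show "(\<Sum>j<n. poly (if i = j then [:- r i j, 1:] else [:- r i j:]) z * e j) = 0"
    using assms(3)[OF i] by simp
qed (use assms in \<open>auto simp: coeff_pCons S_0 S_1 S_uminus split: nat.split\<close>)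

end

definition lmon :: "nat \<Rightarrow> nat \<Rightarrow> complex poly poly" where
  "lmon l i = monom (monom 1 i) l"

lemma lmon_mult: "lmon l i * lmon l' i' = lmon (l + l') (i + i')"
  by (simp add: lmon_def mult_monom)

lemma lmon_00: "lmon 0 0 = 1"
  by (simp add: lmon_def)

lemma lmon_power: "lmon l i ^ n = lmon (n * l) (n * i)"
  by (induction n) (simp_all add: lmon_00 lmon_mult)

text \<open>
  \<open>lmon l i\<close> is the monomial \<open>t^l s^i\<close>. The algebra \<open>A\<close> is graded by the degree in the outer
  variable \<open>t\<close>; the last assumption is integral closedness, restricted to homogeneous elements.
\<close>

locale graded_subalgebra = subring_set A for A :: "complex poly poly set" +
  fixes eps :: int and b k0 k j :: nat and F0 :: "complex poly poly"
  assumes A_const: "[:[:z:]:] \<in> A"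
    and A_graded: "F \<in> A \<Longrightarrow> monom (coeff F l) l \<in> A"
    and A_0: "F \<in> A \<Longrightarrow> degree (coeff F 0) = 0"
    and A_top: "monom c l \<in> A \<Longrightarrow> c \<noteq> 0 \<Longrightarrow>
      int l + int (degree c) * eps \<ge> 0 \<and> lmon (nat (int l + int (degree c) * eps)) 0 \<in> A"
    and A_slice: "lmon b 1 \<in> A"
    and A_inv: "k0 > 0" "lmon k0 0 \<in> A"
    and extremal: "j > 0" "F0 \<in> A" "coeff (coeff F0 k) j \<noteq> 0"
      "\<And>F l i. F \<in> A \<Longrightarrow> coeff (coeff F l) i \<noteq> 0 \<Longrightarrow> i * k \<le> j * l"
    and A_normal: "lmon m 0 \<in> A \<Longrightarrow> monom c (l + m) \<in> A \<Longrightarrow> (\<And>i. coeff p i \<in> A) \<Longrightarrow> lead_coeff p = 1 \<Longrightarrow>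
      degree p > 0 \<Longrightarrow> poly p (monom c l) = 0 \<Longrightarrow> monom c l \<in> A"
begin

text \<open>Pure powers of \<open>t\<close> are the homogeneous invariants; \<open>K\<close> is the
  semigroup of their degrees and turns out to be generated by \<open>a\<close>.\<close>

definition "K = {l. lmon l 0 \<in> A}"

lemma K_0: "0 \<in> K" using S_1 by (simp add: K_def lmon_00)

lemma K_add: "l \<in> K \<Longrightarrow> l' \<in> K \<Longrightarrow> l + l' \<in> K"
  using S_mult[of "lmon l 0" "lmon l' 0"] by (simp add: K_def lmon_mult)

lemma K_mult: "l \<in> K \<Longrightarrow> n * l \<in> K"
  by (induction n) (auto simp: K_0 K_add)

text \<open>The generator of the group spanned by \<open>K\<close>. That \<open>t ^ a\<close> itself
  lies in \<open>A\<close> needs normality.\<close>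

definition "a = (LEAST n. n > 0 \<and> (\<exists>l\<in>K. l + n \<in> K))"

lemma a: "a > 0" "\<exists>l\<in>K. l + a \<in> K" "\<And>n l. n > 0 \<Longrightarrow> l \<in> K \<Longrightarrow> l + n \<in> K \<Longrightarrow> a \<le> n"
proof -
  have "k0 > 0 \<and> (\<exists>l\<in>K. l + k0 \<in> K)" using A_inv K_0 by (auto simp: K_def intro!: bexI[of _ 0])
  then have "a > 0 \<and> (\<exists>l\<in>K. l + a \<in> K)" unfolding a_def by (rule LeastI)
  then show "a > 0" "\<exists>l\<in>K. l + a \<in> K" by auto
  show "\<And>n l. n > 0 \<Longrightarrow> l \<in> K \<Longrightarrow> l + n \<in> K \<Longrightarrow> a \<le> n" unfolding a_def by (rule Least_le) blast
qed

lemma a_dvd: assumes "l \<in> K" shows "a dvd l"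
proof (rule ccontr)
  assume "\<not> a dvd l"
  then have r: "l mod a > 0" by (simp add: dvd_eq_mod_eq_0)
  obtain l1 where l1: "l1 \<in> K" "l1 + a \<in> K" using a(2) by blast
  have "(l div a) * (l1 + a) + l mod a = l + (l div a) * l1"
    by (simp add: algebra_simps)
  then have "(l div a) * (l1 + a) + l mod a \<in> K" using K_add[OF assms K_mult[OF l1(1)]] by simp
  then have "a \<le> l mod a" using a(3)[OF r K_mult[OF l1(2)]] by blast
  then show False using mod_less_divisor[OF a(1), of l] by linarith
qed

text \<open>\<open>t ^ a\<close> is a quotient of two invariants, and a power of it is the invariant
  \<open>t ^ k0\<close>, since \<open>a\<close> divides \<open>k0\<close>. So it is integral over
  \<open>A\<close> and normality applies.\<close>

lemma a_K: "a \<in> K"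
proof -
  obtain l1 where l1: "l1 \<in> K" "l1 + a \<in> K" using a(2) by blast
  obtain n where n: "k0 = a * n" using a_dvd[of k0] A_inv by (auto simp: K_def)
  then have n0: "n > 0" using A_inv(1) by (cases n) auto
  define p where "p = monom 1 n - [:lmon k0 0:]"
  have deg: "degree p = n" unfolding p_def diff_conv_add_uminus
    by (subst degree_add_eq_left) (use n0 in \<open>auto simp: degree_monom_eq\<close>)
  have "lmon a 0 \<in> A" unfolding lmon_def
  proof (rule A_normal[where p = p and m = l1])
    show "lmon l1 0 \<in> A" "monom (monom 1 0) (a + l1) \<in> A" using l1 by (auto simp: K_def lmon_def add.commute)
    show "coeff p i \<in> A" for i
      unfolding p_def using A_inv(2) S_0 S_1 by (auto simp: coeff_pCons S_uminus S_diff split: nat.split)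
    show "lead_coeff p = 1" unfolding deg using n0 by (simp add: p_def coeff_pCons split: nat.split)
    show "degree p > 0" using deg n0 by simp
    show "poly p (monom (monom 1 0) a) = 0"
      unfolding lmon_def[symmetric] by (simp add: p_def poly_monom lmon_power n mult.commute)
  qed
  then show ?thesis by (simp add: K_def)
qed

lemma K_iff: "l \<in> K \<longleftrightarrow> a dvd l"
  using a_dvd K_mult[OF a_K] by (auto simp: dvd_def mult.commute)

lemma A_smult: "F \<in> A \<Longrightarrow> smult [:c:] F \<in> A"
  using S_mult[OF A_const[of c], of F] by simp

lemma slice_eps: "int a dvd int b + eps"
proof -
  have "int b + eps \<ge> 0 \<and> nat (int b + eps) \<in> K" using A_top[OF A_slice[unfolded lmon_def]]
    by (simp add: degree_monom_eq K_def)
  then show ?thesis by (metis K_iff int_dvd_int_iff int_nat_eq)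
qed

text \<open>The top derivative of an element of degree \<open>l\<close> is an invariant of degree
  \<open>l + degree c * eps\<close>, and modulo \<open>a\<close> the slice allows \<open>eps\<close>
  to be replaced by \<open>- b\<close>.\<close>

lemma top_cong:
  assumes "monom c l \<in> A" "c \<noteq> 0"
  shows "int a dvd int l - int (degree c) * int b"
proof -
  have "int l + int (degree c) * eps \<ge> 0 \<and> nat (int l + int (degree c) * eps) \<in> K"
    using A_top[OF assms] by (simp add: K_def)
  then have "int a dvd int l + int (degree c) * eps" by (metis K_iff int_dvd_int_iff int_nat_eq)
  moreover have "int a dvd int (degree c) * (int b + eps)" using slice_eps by (rule dvd_mult)
  ultimately have "int a dvd (int l + int (degree c) * eps) - int (degree c) * (int b + eps)" by (rule dvd_diff)
  then show ?thesis by (simp add: algebra_simps)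
qed

lemma lmon_mem:
  assumes "i * b \<le> l" "int a dvd int l - int i * int b"
  shows "lmon l i \<in> A"
proof -
  have "int a dvd int (l - i * b)" using assms by (simp add: of_nat_diff)
  then have "lmon (l - i * b) 0 \<in> A" using K_iff[of "l - i * b"] by (simp add: K_def)
  then have "lmon (l - i * b) 0 * lmon b 1 ^ i \<in> A" by (intro S_mult S_power A_slice)
  then show ?thesis using assms(1) by (simp add: lmon_power lmon_mult)
qed

text \<open>So far the congruence is known for the top term. Multiplication by a large invariant
  moves this term into the region where all admissible monomials belong to \<open>A\<close>; it is
  subtracted there, and the degree in \<open>s\<close> drops.\<close>

lemma support_cong:
  assumes "monom c l \<in> A" "coeff c i \<noteq> 0"
  shows "int a dvd int l - int i * int b"
  using assms
proof (induction "degree c" arbitrary: c l rule: less_induct)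
  case less
  have c0: "c \<noteq> 0" using less.prems by auto
  define n where "n = degree c"
  note top = top_cong[OF less.prems(1) c0]
  show ?case
  proof (cases "i = n")
    case True then show ?thesis using top by (simp add: n_def)
  next
    case False
    define l' where "l' = l + a * (n * b)"
    define c' where "c' = c - monom (coeff c n) n"
    have cong: "int a dvd int l' - int n * int b"
    proof -
      have eq: "int l' - int n * int b = (int l - int n * int b) + int a * (int n * int b)"
        by (simp add: l'_def)
      show ?thesis unfolding eq unfolding n_def by (rule dvd_add[OF top dvd_triv_left])
    qed
    have "n * b \<le> l'" using a(1) by (cases a) (auto simp: l'_def)
    then have "lmon l' n \<in> A" using cong by (rule lmon_mem)
    moreover have "lmon (a * (n * b)) 0 * monom c l \<in> A"
      using K_iff[of "a * (n * b)"] less.prems(1) by (intro S_mult) (auto simp: K_def)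
    ultimately have "lmon (a * (n * b)) 0 * monom c l - smult [:coeff c n:] (lmon l' n) \<in> A"
      by (intro S_diff A_smult)
    also have "lmon (a * (n * b)) 0 * monom c l - smult [:coeff c n:] (lmon l' n) = monom c' l'"
      by (simp add: lmon_def mult_monom smult_monom c'_def l'_def add.commute diff_monom)
    finally have A': "monom c' l' \<in> A" .
    have i: "coeff c' i \<noteq> 0" using less.prems(2) False by (simp add: c'_def)
    have "degree c' < degree c"
    proof -
      have "degree c' \<le> n" unfolding c'_def n_def by (intro degree_diff_le degree_monom_le) auto
      moreover have "coeff c' n = 0" by (simp add: c'_def)
      moreover have "c' \<noteq> 0" using i by auto
      ultimately have "degree c' \<noteq> n" by (metis leading_coeff_0_iff)
      then show ?thesis using \<open>degree c' \<le> n\<close> by (simp add: n_def)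
    qed
    then have "int a dvd int l' - int i * int b" using A' i by (rule less.hyps)
    moreover have "int l - int i * int b = (int l' - int i * int b) - int a * (int n * int b)"
      by (simp add: l'_def)
    ultimately show ?thesis by (metis dvd_diff dvd_triv_left)
  qed
qed

lemma k_pos: "k > 0"
proof (rule ccontr)
  assume "\<not> k > 0"
  then have "coeff (coeff F0 0) j \<noteq> 0" using extremal(3) by simp
  then show False using A_0[OF extremal(2)] extremal(1) by (metis coeff_eq_0)
qed

text \<open>The points of the cone between the \<open>t\<close>-axis and the ray through
  \<open>(k, j)\<close> that lie in a sublattice of index \<open>a\<close>.\<close>

definition lattice :: "nat \<Rightarrow> nat \<Rightarrow> bool" where
  "lattice l i \<longleftrightarrow> i * k \<le> j * l \<and> int a dvd int l - int i * int b"

lemma support_lattice: "F \<in> A \<Longrightarrow> coeff (coeff F l) i \<noteq> 0 \<Longrightarrow> lattice l i"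
  using extremal(4) support_cong[OF A_graded] by (auto simp: lattice_def)

lemma lattice_add: "lattice l i \<Longrightarrow> lattice l' i' \<Longrightarrow> lattice (l + l') (i + i')"
proof -
  assume *: "lattice l i" "lattice l' i'"
  then have "int a dvd (int l - int i * int b) + (int l' - int i' * int b)"
    by (intro dvd_add) (auto simp: lattice_def)
  then show "lattice (l + l') (i + i')" using * by (simp add: lattice_def algebra_simps)
qed

lemma lattice_b: "lattice b 1"
  using support_lattice[OF A_slice, of b 1] by (simp add: lmon_def)

lemma lattice_kj: "lattice k j"
  using support_lattice[OF extremal(2,3)] .

text \<open>In outer degree \<open>k\<close> extremality allows no exponent of \<open>s\<close>
  above \<open>j\<close>, so \<open>s ^ j\<close> is the top term there and can be scaled to have
  coefficient one.\<close>

lemma monic_extremal: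
  obtains c where "monom c k \<in> A" "degree c = j" "coeff c j = 1"
proof -
  define c0 where "c0 = coeff F0 k"
  have c0: "monom c0 k \<in> A" "coeff c0 j \<noteq> 0" using A_graded[OF extremal(2)] extremal(3) by (auto simp: c0_def)
  have "c0 \<noteq> 0" using c0 by auto
  then have "coeff (coeff (monom c0 k) k) (degree c0) \<noteq> 0" by simp
  then have "degree c0 * k \<le> j * k" by (rule extremal(4)[OF c0(1)])
  then have "degree c0 \<le> j" using k_pos by simp
  then have d: "degree c0 = j" using c0(2) le_degree[of c0 j] by simp
  show ?thesis
  proof (rule that[of "smult (inverse (coeff c0 j)) c0"])
    show "monom (smult (inverse (coeff c0 j)) c0) k \<in> A"
      using A_smult[OF c0(1), of "inverse (coeff c0 j)"] by (simp add: smult_monom)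
  qed (use c0 d in auto)
qed

definition l0 :: "nat \<Rightarrow> nat" where "l0 i = (LEAST l. lattice l i)"

lemma l0: "lattice (l0 i) i" "lattice l i \<Longrightarrow> l0 i \<le> l"
proof -
  have "lattice (i * b) i" using lattice_b by (simp add: lattice_def mult.assoc mult_le_mono)
  then show "lattice (l0 i) i" unfolding l0_def by (rule LeastI)
  show "lattice l i \<Longrightarrow> l0 i \<le> l" unfolding l0_def by (rule Least_le)
qed

definition "e i = lmon (l0 i) i"

text \<open>A finitely generated \<open>A\<close>-module. It will contain all lattice monomials, and
  this makes each of them integral over \<open>A\<close>.\<close>

definition "M = {\<Sum>i<j. r i * e i | r. \<forall>i<j. r i \<in> A}"

lemma M_I: "(\<And>i. i < j \<Longrightarrow> r i \<in> A) \<Longrightarrow> (\<Sum>i<j. r i * e i) \<in> M"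
  unfolding M_def by blast

lemma M_diff: "x \<in> M \<Longrightarrow> y \<in> M \<Longrightarrow> x - y \<in> M"
proof -
  assume "x \<in> M" "y \<in> M"
  then obtain r r' where "x = (\<Sum>i<j. r i * e i)" "y = (\<Sum>i<j. r' i * e i)" "\<forall>i<j. r i \<in> A" "\<forall>i<j. r' i \<in> A"
    unfolding M_def by blast
  moreover from this have "(\<Sum>i<j. (r i - r' i) * e i) \<in> M" by (intro M_I S_diff) auto
  ultimately show ?thesis by (simp add: left_diff_distrib sum_subtractf)
qed

lemma M_mult: "x \<in> M \<Longrightarrow> y \<in> A \<Longrightarrow> y * x \<in> M"
proof -
  assume "x \<in> M" "y \<in> A"
  then obtain r where "x = (\<Sum>i<j. r i * e i)" "\<forall>i<j. r i \<in> A"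
    unfolding M_def by blast
  moreover from this have "(\<Sum>i<j. (y * r i) * e i) \<in> M" using \<open>y \<in> A\<close> by (intro M_I S_mult) auto
  ultimately show ?thesis by (simp add: sum_distrib_left mult.assoc)
qed

lemma M_0: "0 \<in> M"
  using M_I[of "\<lambda>_. 0"] S_0 by simp

lemma M_sum: "finite I \<Longrightarrow> (\<And>i. i \<in> I \<Longrightarrow> f i \<in> M) \<Longrightarrow> sum f I \<in> M"
proof (induction I rule: finite_induct)
  case (insert i I)
  have "f i - (0 - sum f I) \<in> M" using insert by (intro M_diff M_0) auto
  then show ?case using insert by simp
qed (simp add: M_0)

lemma M_e: "i < j \<Longrightarrow> e i \<in> M"
proof -
  assume i: "i < j"
  have "(\<Sum>i'<j. (if i' = i then 1 else 0) * e i') \<in> M" by (intro M_I) (auto simp: S_0 S_1)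
  also have "(\<Sum>i'<j. (if i' = i then 1 else 0) * e i') = (\<Sum>i'<j. if i' = i then e i' else 0)"
    by (intro sum.cong) auto
  finally show ?thesis using i by simp
qed

text \<open>For \<open>i < j\<close> the monomial is \<open>e i\<close> times an invariant. For
  \<open>i \<ge> j\<close> the extremal element supplies the factor \<open>s ^ j\<close>; its lower
  terms lead to lattice monomials with smaller exponent of \<open>s\<close>, which are treated by
  induction.\<close>

lemma lattice_M: "lattice l i \<Longrightarrow> lmon l i \<in> M"
proof (induction i arbitrary: l rule: less_induct)
  case (less i)
  show ?case
  proof (cases "i < j")
    case True
    have le: "l0 i \<le> l" using l0(2)[OF less.prems] .
    have "int a dvd (int l - int i * int b) - (int (l0 i) - int i * int b)"
      by (rule dvd_diff) (use less.prems l0(1)[of i] in \<open>auto simp: lattice_def\<close>)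
    then have "int a dvd int (l - l0 i)" using le by (simp add: of_nat_diff)
    then have "lmon (l - l0 i) 0 \<in> A" using K_iff[of "l - l0 i"] by (simp add: K_def)
    from M_mult[OF M_e[OF True] this] show ?thesis using le by (simp add: e_def lmon_mult)
  next
    case False
    obtain c where c: "monom c k \<in> A" "degree c = j" "coeff c j = 1" by (rule monic_extremal)
    have ik: "i * k \<le> j * l" using less.prems by (simp add: lattice_def)
    have "j * k \<le> j * l" using ik False by (meson le_trans mult_le_mono1 not_less)
    then have kl: "k \<le> l" using extremal(1) by simp
    have kjb: "int a dvd int k - int j * int b" using lattice_kj by (simp add: lattice_def)
    have lib: "int a dvd int l - int i * int b" using less.prems by (simp add: lattice_def)
    have "lattice (l - k) (i - j)"
      unfolding lattice_def
    proof
      show "(i - j) * k \<le> j * (l - k)" using ik by (simp add: diff_mult_distrib diff_mult_distrib2)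
      have "int a dvd (int l - int i * int b) - (int k - int j * int b)" using lib kjb by (rule dvd_diff)
      then show "int a dvd int (l - k) - int (i - j) * int b"
        using kl False by (simp add: of_nat_diff algebra_simps)
    qed
    then have 1: "lmon (l - k) (i - j) \<in> M" using less.IH[of "i - j"] False extremal(1) by simp
    have 2: "smult [:coeff c j':] (lmon l (i - j + j')) \<in> M" if j': "j' < j" for j'
    proof (cases "coeff c j' = 0")
      case True then show ?thesis using M_0 by simp
    next
      case nz: False
      have kj'b: "int a dvd int k - int j' * int b" by (rule support_cong[OF c(1) nz])
      have "lattice l (i - j + j')"
        unfolding lattice_def
      proof
        have "(i - j + j') * k \<le> i * k" using j' False by (intro mult_le_mono1) simp
        then show "(i - j + j') * k \<le> j * l" by (rule le_trans[OF _ ik])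
        have "int a dvd (int l - int i * int b) - (int k - int j * int b) + (int k - int j' * int b)"
          by (rule dvd_add[OF dvd_diff[OF lib kjb] kj'b])
        then show "int a dvd int l - int (i - j + j') * int b"
          using False by (simp add: of_nat_diff algebra_simps)
      qed
      then have "lmon l (i - j + j') \<in> M" using less.IH j' False by simp
      from M_mult[OF this A_const[of "coeff c j'"]] show ?thesis by simp
    qed
    have "monom c k * lmon (l - k) (i - j) - (\<Sum>j'<j. smult [:coeff c j':] (lmon l (i - j + j'))) \<in> M"
      by (intro M_diff M_mult 1 c M_sum 2) auto
    also have "monom c k * lmon (l - k) (i - j) - (\<Sum>j'<j. smult [:coeff c j':] (lmon l (i - j + j'))) = lmon l i"
    proof -
      have "c = (\<Sum>j'\<le>j. monom (coeff c j') j')" using poly_as_sum_of_monoms[of c] c(2) by simp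
      also have "\<dots> = monom 1 j + (\<Sum>j'<j. monom (coeff c j') j')"
      proof -
        have "{..j} = insert j {..<j}" by auto
        then show ?thesis using c(3) by simp
      qed
      finally have cs: "c = monom 1 j + (\<Sum>j'<j. monom (coeff c j') j')" .
      have "c * monom 1 (i - j) = monom 1 i + (\<Sum>j'<j. monom (coeff c j') (i - j + j'))"
        using False by (subst cs) (simp add: distrib_right mult_monom sum_distrib_right add.commute)
      then have "monom c k * lmon (l - k) (i - j) = monom (monom 1 i + (\<Sum>j'<j. monom (coeff c j') (i - j + j'))) l"
        using kl by (simp add: lmon_def mult_monom)
      also have "\<dots> = lmon l i + (\<Sum>j'<j. smult [:coeff c j':] (lmon l (i - j + j')))"
        by (simp add: lmon_def add_monom[symmetric] monom_sum smult_monom)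
      finally show ?thesis by simp
    qed
    finally show ?thesis .
  qed
qed

text \<open>Multiplication by a lattice monomial maps each generator of \<open>M\<close> into
  \<open>M\<close>, so the monomial is integral over \<open>A\<close>. It is a fraction with a power
  of \<open>t\<close> as denominator, because far out in the direction of \<open>t\<close> all
  admissible monomials are products of invariants and slices.\<close>

lemma lmon_lattice: "lattice l i \<Longrightarrow> lmon l i \<in> A"
proof -
  assume li: "lattice l i"
  have "\<exists>r. (\<forall>i'<j. r i' \<in> A) \<and> lmon l i * e n = (\<Sum>i'<j. r i' * e i')" for n
  proof -
    have "lmon l i * e n \<in> M"
      unfolding e_def lmon_mult by (intro lattice_M lattice_add li l0(1))
    then show ?thesis unfolding M_def by blast
  qed
  then obtain r where r: "\<And>n i'. i' < j \<Longrightarrow> r n i' \<in> A" "\<And>n. lmon l i * e n = (\<Sum>i'<j. r n i' * e i')" by metis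
  have "l0 0 = 0" using l0(2)[of 0 0] by (simp add: lattice_def)
  then have "e 0 \<noteq> 0" by (simp add: e_def lmon_def)
  then obtain p where p: "\<And>i. coeff p i \<in> A" "lead_coeff p = 1" "degree p > 0" "poly p (lmon l i) = 0"
    using integral_of_finite_module[of j r "lmon l i" e] r extremal(1) by auto
  show "lmon l i \<in> A" unfolding lmon_def
  proof (rule A_normal[OF _ _ p(1-3) p(4)[unfolded lmon_def]])
    show "lmon (a * (i * b)) 0 \<in> A" using K_iff[of "a * (i * b)"] by (simp add: K_def)
    show "monom (monom 1 i) (l + a * (i * b)) \<in> A" unfolding lmon_def[symmetric]
    proof (rule lmon_mem)
      show "i * b \<le> l + a * (i * b)" using a(1) by (cases a) auto
      have "int a dvd (int l - int i * int b) + int a * (int i * int b)"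
        using li by (simp add: lattice_def)
      then show "int a dvd int (l + a * (i * b)) - int i * int b" by (simp add: algebra_simps)
    qed
  qed
qed

lemma mem_iff_lattice: "F \<in> A \<longleftrightarrow> (\<forall>l i. coeff (coeff F l) i \<noteq> 0 \<longrightarrow> lattice l i)"
proof
  assume F: "\<forall>l i. coeff (coeff F l) i \<noteq> 0 \<longrightarrow> lattice l i"
  have "F = (\<Sum>l\<le>degree F. monom (coeff F l) l)" by (simp add: poly_as_sum_of_monoms)
  also have "\<dots> = (\<Sum>l\<le>degree F. \<Sum>i\<le>degree (coeff F l). smult [:coeff (coeff F l) i:] (lmon l i))"
  proof (rule sum.cong[OF refl])
    fix l
    have "coeff F l = (\<Sum>i\<le>degree (coeff F l). monom (coeff (coeff F l) i) i)" by (simp add: poly_as_sum_of_monoms)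
    then have "monom (coeff F l) l = monom (\<Sum>i\<le>degree (coeff F l). monom (coeff (coeff F l) i) i) l" by simp
    then show "monom (coeff F l) l = (\<Sum>i\<le>degree (coeff F l). smult [:coeff (coeff F l) i:] (lmon l i))"
      by (simp add: lmon_def monom_sum smult_monom)
  qed
  also have "\<dots> \<in> A"
  proof (intro S_sum)
    fix l i show "smult [:coeff (coeff F l) i:] (lmon l i) \<in> A"
      using F lmon_lattice[of l i] S_0 by (cases "coeff (coeff F l) i = 0") (auto intro: A_smult)
  qed
  finally show "F \<in> A" .
qed (auto intro: support_lattice)

end

section \<open>The orbit map of a general point\<close>

abbreviation ev2 :: "complex poly poly \<Rightarrow> complex \<Rightarrow> complex \<Rightarrow> complex" where
  "ev2 F t s \<equiv> poly (poly F [:t:]) s"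

lemma ev2_monom: "ev2 (monom c l) t s = t ^ l * poly c s"
  by (simp add: poly_monom poly_power mult.commute)

lemma coeff_coeff_mult_nonzero:
  fixes F G :: "complex poly poly"
  assumes "coeff (coeff (F * G) l) i \<noteq> 0"
  obtains l1 l2 i1 i2 where "l = l1 + l2" "i = i1 + i2" "coeff (coeff F l1) i1 \<noteq> 0" "coeff (coeff G l2) i2 \<noteq> 0"
proof -
  have "coeff (coeff (F * G) l) i = (\<Sum>l1\<le>l. \<Sum>i1\<le>i. coeff (coeff F l1) i1 * coeff (coeff G (l - l1)) (i - i1))"
    by (simp add: coeff_mult coeff_sum)
  then have "\<exists>l1\<le>l. \<exists>i1\<le>i. coeff (coeff F l1) i1 * coeff (coeff G (l - l1)) (i - i1) \<noteq> 0"
    using assms by (metis (no_types, lifting) atMost_iff sum.neutral)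
  then obtain l1 i1 where "l1 \<le> l" "i1 \<le> i" "coeff (coeff F l1) i1 \<noteq> 0" "coeff (coeff G (l - l1)) (i - i1) \<noteq> 0" by auto
  then show ?thesis using that[of l1 "l - l1" i1 "i - i1"] by simp
qed

locale generic_surface = homogeneous_additive_action V q \<phi> Ps eps
  for V :: "(complex ^ 'n) set" and q \<phi> Ps eps +
  fixes k0 b :: nat and u y :: "complex ^ 'n \<Rightarrow> complex" and x0 :: "complex ^ 'n" and u0 w0 :: complex
  assumes dim2: "zariski_dim V = 2" and normal: "normal_at V q"
    and u: "k0 > 0" "homogeneous k0 u" "dps u x0 = [:u0:]" "u0 \<noteq> 0"
    and y: "homogeneous b y" "dps y x0 = [:0, w0:]" "w0 \<noteq> 0"
    and x0: "x0 \<in> V"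
begin

text \<open>
  The pull-back of \<open>f\<close> along \<open>(t, s) \<mapsto> \<phi> t (Ps s x0)\<close>, a polynomial with outer variable \<open>t\<close>
  and inner variable \<open>s\<close>.
\<close>

definition T :: "(complex ^ 'n \<Rightarrow> complex) \<Rightarrow> complex poly poly" where
  "T f = (SOME F. \<forall>t s. t \<noteq> 0 \<longrightarrow> f (\<phi> t (Ps s x0)) = ev2 F t s)"

lemma T_ev:
  assumes f: "f \<in> poly_funs" and t: "t \<noteq> 0"
  shows "f (\<phi> t (Ps s x0)) = ev2 (T f) t s"
proof -
  obtain d where d: "\<And>k x. k > d \<Longrightarrow> component k f x = 0" using component_bound[OF f] by blast
  have "f (\<phi> t (Ps s x0)) = ev2 (\<Sum>k\<le>d. monom (dps (component k f) x0) k) t s" if t: "t \<noteq> 0" for t s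
  proof -
    have "f (\<phi> t (Ps s x0)) = (\<Sum>k\<le>d. component k f (Ps s x0) * t ^ k)"
      unfolding gr(3)[OF f Ps_in[OF x0] t] component_def
      using d by (intro poly_eq_sum_le degree_le) (auto simp: component_def)
    then show ?thesis by (simp add: poly_sum ev2_monom dps(2)[OF component_poly[OF f]] mult.commute)
  qed
  then have "\<exists>F. \<forall>t s. t \<noteq> 0 \<longrightarrow> f (\<phi> t (Ps s x0)) = ev2 F t s" by blast
  from someI_ex[OF this, folded T_def] t show ?thesis by blast
qed

lemma T_unique:
  assumes "f \<in> poly_funs" "\<And>t s. t \<noteq> 0 \<Longrightarrow> f (\<phi> t (Ps s x0)) = ev2 F t s"
  shows "T f = F"
  by (rule poly_poly_eqI) (use assms T_ev[OF assms(1)] in auto)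

lemma T_add: "f \<in> poly_funs \<Longrightarrow> g \<in> poly_funs \<Longrightarrow> T (\<lambda>x. f x + g x) = T f + T g"
  by (rule T_unique) (auto simp: T_ev poly_funs_add)

lemma T_diff: "f \<in> poly_funs \<Longrightarrow> g \<in> poly_funs \<Longrightarrow> T (\<lambda>x. f x - g x) = T f - T g"
  by (rule T_unique) (auto simp: T_ev poly_funs_diff)

lemma T_mult: "f \<in> poly_funs \<Longrightarrow> g \<in> poly_funs \<Longrightarrow> T (\<lambda>x. f x * g x) = T f * T g"
  by (rule T_unique) (auto simp: T_ev poly_funs_mult)

lemma T_power: "f \<in> poly_funs \<Longrightarrow> T (\<lambda>x. f x ^ m) = T f ^ m"
  by (rule T_unique) (auto simp: T_ev poly_funs_power)

lemma T_const: "T (\<lambda>x. c) = [:[:c:]:]"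
  by (rule T_unique) (auto simp: poly_funs_const)

lemma T_sum: "finite I \<Longrightarrow> (\<And>i. i \<in> I \<Longrightarrow> f i \<in> poly_funs) \<Longrightarrow> T (\<lambda>x. \<Sum>i\<in>I. f i x) = (\<Sum>i\<in>I. T (f i))"
  by (rule T_unique) (auto simp: T_ev poly_sum poly_funs_sum)

lemma T_homogeneous: "homogeneous l f \<Longrightarrow> T f = monom (dps f x0) l"
  by (rule T_unique) (auto simp: homogeneous_def ev2_monom Ps_in[OF x0] dps(2))

lemma coeff_T: "f \<in> poly_funs \<Longrightarrow> coeff (T f) k = dps (component k f) x0"
proof -
  assume f: "f \<in> poly_funs"
  obtain d where d: "\<And>k x. k > d \<Longrightarrow> component k f x = 0" using component_bound[OF f] by blast
  have "T f = (\<Sum>k\<le>d. monom (dps (component k f) x0) k)"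
  proof (rule T_unique[OF f])
    fix t s assume t: "(t::complex) \<noteq> 0"
    have "f (\<phi> t (Ps s x0)) = (\<Sum>k\<le>d. component k f (Ps s x0) * t ^ k)"
      unfolding gr(3)[OF f Ps_in[OF x0] t] component_def
      using d by (intro poly_eq_sum_le degree_le) (auto simp: component_def)
    then show "f (\<phi> t (Ps s x0)) = ev2 (\<Sum>k\<le>d. monom (dps (component k f) x0) k) t s"
      by (simp add: poly_sum ev2_monom dps(2)[OF component_poly[OF f]] mult.commute)
  qed
  then have *: "coeff (T f) k = (if k \<le> d then dps (component k f) x0 else 0)" by (simp add: coeff_sum)
  show ?thesis
  proof (cases "k \<le> d")
    case False
    then have "component k f = (\<lambda>x. 0)" using d by auto
    then show ?thesis using * False by (simp add: dps_const)
  qed (use * in simp)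
qed

lemma T_component: "f \<in> poly_funs \<Longrightarrow> T (component k f) = monom (coeff (T f) k) k"
  by (simp add: T_homogeneous[OF component_homogeneous] coeff_T)

lemma coeff_T_0: "f \<in> poly_funs \<Longrightarrow> coeff (T f) 0 = [:f q:]"
proof -
  assume f: "f \<in> poly_funs"
  have "dps (component 0 f) x0 = dps (\<lambda>x. f q) x0"
    using f gr(2)[OF f] by (intro dps_cong x0 component_poly poly_funs_const) (auto simp: component_def)
  then show ?thesis using f by (simp add: coeff_T dps_const)
qed

lemma vanish_iff_T: "f \<in> poly_funs \<Longrightarrow> (\<forall>t s. t \<noteq> 0 \<longrightarrow> f (\<phi> t (Ps s x0)) = 0) \<longleftrightarrow> T f = 0"
  using T_unique[of f 0] T_ev[of f] by auto

text \<open>A point, the closure of its additive orbit and the closure of the image form a strict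
  chain of irreducible closed sets; in dimension two the last must be \<open>V\<close>.\<close>

lemma dense: "zariski_closure {\<phi> t (Ps s x0) | t s. t \<noteq> 0} = V"
proof -
  define Z0 where "Z0 = zariski_closure {x0}"
  define Z1 where "Z1 = zariski_closure {Ps s x0 | s. True}"
  define Z2 where "Z2 = zariski_closure {\<phi> t (Ps s x0) | t s. t \<noteq> 0}"
  have Vc: "zariski_closed V" using irr by (simp add: irreducible_closed_def)
  have up: "u \<in> poly_funs" and yp: "y \<in> poly_funs" using u y by (auto dest: homogeneous_polyD)
  have Z0: "irreducible_closed Z0" unfolding Z0_def by (rule irreducible_closure) auto
  have Z1: "irreducible_closed Z1" unfolding Z1_def
  proof (rule irreducible_closure)
    fix f g :: "complex ^ 'n \<Rightarrow> complex"
    assume fg: "f \<in> poly_funs" "g \<in> poly_funs" "\<forall>x\<in>{Ps s x0 | s. True}. f x * g x = 0"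
    then have "f (Ps s x0) * g (Ps s x0) = 0" for s by blast
    then have "poly (dps f x0 * dps g x0) s = poly 0 s" for s using dps(2) fg by simp
    then have "dps f x0 * dps g x0 = 0" by (intro poly_eqI_nonzero)
    then have "dps f x0 = 0 \<or> dps g x0 = 0" by simp
    then show "(\<forall>x\<in>{Ps s x0 | s. True}. f x = 0) \<or> (\<forall>x\<in>{Ps s x0 | s. True}. g x = 0)"
      using dps(2)[OF fg(1), of _ x0] dps(2)[OF fg(2), of _ x0] by auto
  qed auto
  have Z2: "irreducible_closed Z2" unfolding Z2_def
  proof (rule irreducible_closure)
    show "{\<phi> t (Ps s x0) | t s. t \<noteq> 0} \<noteq> {}" by (auto intro: exI[of _ 1])
    fix f g :: "complex ^ 'n \<Rightarrow> complex"
    assume fg: "f \<in> poly_funs" "g \<in> poly_funs" "\<forall>x\<in>{\<phi> t (Ps s x0) | t s. t \<noteq> 0}. f x * g x = 0"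
    then have "T (\<lambda>x. f x * g x) = 0" using vanish_iff_T[OF poly_funs_mult[OF fg(1,2)]] by blast
    then have "T f = 0 \<or> T g = 0" using T_mult[OF fg(1,2)] by simp
    then show "(\<forall>x\<in>{\<phi> t (Ps s x0) | t s. t \<noteq> 0}. f x = 0) \<or> (\<forall>x\<in>{\<phi> t (Ps s x0) | t s. t \<noteq> 0}. g x = 0)"
      using vanish_iff_T[OF fg(1)] vanish_iff_T[OF fg(2)] by blast
  qed
  have "Z0 \<subset> Z1"
  proof
    show "Z0 \<subseteq> Z1" unfolding Z0_def Z1_def by (rule zariski_closure_mono) (use Ps_0[OF x0] in \<open>auto intro: exI[of _ 0]\<close>)
    have "y (Ps 1 x0) \<noteq> y x0" using dps(2)[OF yp, of 1 x0] dps(2)[OF yp, of 0 x0] y(2,3) Ps_0[OF x0] by simp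
    moreover have "(\<lambda>x. y x - y x0) \<in> poly_funs" by (intro poly_funs_diff yp poly_funs_const)
    ultimately have "Ps 1 x0 \<notin> Z0" unfolding Z0_def zariski_closure_def by force
    moreover have "Ps 1 x0 \<in> {Ps s x0 | s. True}" by blast
    then have "Ps 1 x0 \<in> Z1" unfolding Z1_def by (rule subsetD[OF zariski_closure_subset])
    ultimately show "Z0 \<noteq> Z1" by blast
  qed
  moreover have "Z1 \<subset> Z2"
  proof
    show "Z1 \<subseteq> Z2" unfolding Z1_def Z2_def
      by (rule zariski_closure_mono) (use act_1[OF Ps_in[OF x0]] in \<open>force intro: exI[of _ 1]\<close>)
    \<comment> \<open>The invariant \<open>u\<close> is constant on the additive orbit, while
      \<open>\<phi> 2\<close> multiplies it by \<open>2 ^ k0\<close>, which differs from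
      \<open>1\<close> as \<open>k0 > 0\<close>.\<close>
    have "u (Ps s x0) = u0" for s using dps(2)[OF up, of s x0] u(3) by simp
    then have uZ1: "u x = u0" if "x \<in> Z1" for x
      using that poly_funs_diff[OF up poly_funs_const[of u0]] unfolding Z1_def zariski_closure_def by force
    have "u (\<phi> 2 x0) = 2 ^ k0 * u0" using u(2) x0 dps(2)[OF up, of 0 x0] u(3) Ps_0[OF x0] by (simp add: homogeneous_def)
    moreover have "(2::complex) ^ k0 \<noteq> 1"
    proof -
      have "norm ((2::complex) ^ k0) > 1" using u(1) by (simp add: norm_power one_less_power)
      then show ?thesis by auto
    qed
    ultimately have "\<phi> 2 x0 \<notin> Z1" using uZ1 u(4) by auto
    moreover have "\<phi> 2 (Ps 0 x0) \<in> {\<phi> t (Ps s x0) | t s. t \<noteq> 0}" by (rule CollectI, rule exI[of _ 2], rule exI[of _ 0]) simp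
    then have "\<phi> 2 (Ps 0 x0) \<in> Z2" unfolding Z2_def by (rule subsetD[OF zariski_closure_subset])
    then have "\<phi> 2 x0 \<in> Z2" by (simp add: Ps_0[OF x0])
    ultimately show "Z1 \<noteq> Z2" by blast
  qed
  moreover have "Z2 \<subseteq> V" unfolding Z2_def
    by (rule zariski_closure_least[OF Vc]) (auto intro: act_in Ps_in x0)
  ultimately have "Z2 = V" using zariski_dim_2_chain[OF dim2 irr Z0 Z1 Z2] by blast
  then show ?thesis by (simp add: Z2_def)
qed

lemma T_zero: "f \<in> poly_funs \<Longrightarrow> T f = 0 \<Longrightarrow> x \<in> V \<Longrightarrow> f x = 0"
  using vanish_iff_T[of f] dense unfolding zariski_closure_def by blast

lemma T_eq: "f \<in> poly_funs \<Longrightarrow> g \<in> poly_funs \<Longrightarrow> T f = T g \<Longrightarrow> x \<in> V \<Longrightarrow> f x = g x"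
  using T_zero[OF poly_funs_diff[of f g], of x] T_diff[of f g] by simp

text \<open>By density \<open>T\<close> identifies this algebra with the coordinate ring of
  \<open>V\<close>.\<close>

definition A :: "complex poly poly set" where "A = T ` poly_funs"

lemma A_I: "f \<in> poly_funs \<Longrightarrow> T f \<in> A" by (simp add: A_def)

lemma A_E: assumes "F \<in> A" obtains f where "f \<in> poly_funs" "F = T f" using assms by (auto simp: A_def)

lemma A_subring: "subring_set A"
proof
  show "1 \<in> A" using A_I[OF poly_funs_const[of 1]] by (simp add: T_const one_pCons)
  fix F G assume "F \<in> A" "G \<in> A"
  then obtain f g where fg: "f \<in> poly_funs" "F = T f" "g \<in> poly_funs" "G = T g" by (metis A_E)
  show "F + G \<in> A" "F * G \<in> A"
    using A_I[OF poly_funs_add[OF fg(1,3)]] A_I[OF poly_funs_mult[OF fg(1,3)]] fg by (auto simp: T_add T_mult)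
next
  fix F assume "F \<in> A"
  then obtain f where f: "f \<in> poly_funs" "F = T f" by (rule A_E)
  have "T (\<lambda>x. 0 - f x) = - F" using T_diff[OF poly_funs_const[of 0] f(1)] f(2) by (simp add: T_const)
  then show "- F \<in> A" using A_I[OF poly_funs_diff[OF poly_funs_const[of 0] f(1)]] by simp
qed

lemma A_scale:
  assumes "monom (smult c d) l \<in> A" "c \<noteq> 0"
  shows "monom d l \<in> A"
proof -
  interpret subring_set A by (rule A_subring)
  have "[:[:inverse c:]:] \<in> A" using A_I[OF poly_funs_const] by (simp add: T_const)
  then have "[:[:inverse c:]:] * monom (smult c d) l \<in> A" using assms(1) by (rule S_mult)
  then show ?thesis using assms(2) by (simp add: smult_monom)
qed

lemma A_homogeneous:
  assumes "monom c l \<in> A"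
  obtains f where "homogeneous l f" "dps f x0 = c"
proof -
  obtain f where f: "f \<in> poly_funs" "monom c l = T f" using assms by (rule A_E)
  have "coeff (monom c l) l = dps (component l f) x0" unfolding f(2) by (rule coeff_T[OF f(1)])
  then have "dps (component l f) x0 = c" by simp
  then show ?thesis using that component_homogeneous[OF f(1)] by blast
qed

text \<open>The monomial is the fraction \<open>f / g\<close> on \<open>V\<close>. Normality at
  \<open>q\<close> gives \<open>f b1 = a1 g\<close> with \<open>b1 q \<noteq> 0\<close>, so
  \<open>monom c l * T b1 = T a1\<close>. The constant term of \<open>T b1\<close> is
  \<open>b1 q\<close>; in degree \<open>l\<close> this exhibits \<open>c\<close> as a component of
  \<open>T a1\<close>, up to a nonzero constant.\<close>

lemma A_normal:
  assumes m: "lmon m 0 \<in> A" and c: "monom c (l + m) \<in> A" and p: "\<And>i. coeff p i \<in> A" "lead_coeff p = 1"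
    "degree p > 0" "poly p (monom c l) = 0"
  shows "monom c l \<in> A"
proof -
  define d where "d = degree p"
  obtain g where g: "g \<in> poly_funs" "lmon m 0 = T g" using m by (rule A_E)
  obtain f where f: "f \<in> poly_funs" "monom c (l + m) = T f" using c by (rule A_E)
  have Tf: "T f = T g * monom c l" by (simp add: lmon_def mult_monom add.commute flip: f(2) g(2))
  have "\<exists>a. a \<in> poly_funs \<and> coeff p i = T a" for i using p(1)[of i] by (metis A_E)
  then obtain a where a: "\<And>i. a i \<in> poly_funs" "\<And>i. coeff p i = T (a i)" by metis
  \<comment> \<open>The integral equation for \<open>f / g\<close>, cleared of denominators by
    \<open>g ^ d\<close>.\<close>
  define h where "h = (\<lambda>x. f x ^ d + (\<Sum>i<d. a i x * (f x ^ i * g x ^ (d - i))))"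
  have h: "h \<in> poly_funs" unfolding h_def
    by (intro poly_funs_add poly_funs_sum poly_funs_mult poly_funs_power f g a)
  have "T h = T f ^ d + (\<Sum>i<d. coeff p i * (T f ^ i * T g ^ (d - i)))"
    unfolding h_def a(2)
    by (subst T_add, (intro poly_funs_power poly_funs_sum poly_funs_mult f g a)+)
      (simp add: T_sum T_mult T_power f g a poly_funs_mult poly_funs_power)
  also have "\<dots> = T g ^ d * (monom c l ^ d + (\<Sum>i<d. coeff p i * monom c l ^ i))"
  proof -
    have eq: "coeff p i * (T f ^ i * T g ^ (d - i)) = T g ^ d * (coeff p i * monom c l ^ i)" if "i < d" for i
    proof -
      have "T g ^ d = T g ^ i * T g ^ (d - i)" using that by (simp flip: power_add)
      then show ?thesis by (simp add: Tf power_mult_distrib mult_ac)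
    qed
    have "(\<Sum>i<d. coeff p i * (T f ^ i * T g ^ (d - i))) = (\<Sum>i<d. T g ^ d * (coeff p i * monom c l ^ i))"
      by (rule sum.cong[OF refl], rule eq, simp)
    then show ?thesis by (simp add: Tf power_mult_distrib distrib_left sum_distrib_left)
  qed
  also have "monom c l ^ d + (\<Sum>i<d. coeff p i * monom c l ^ i) = poly p (monom c l)"
  proof -
    have "{..d} = insert d {..<d}" by auto
    then show ?thesis using p(2) by (simp add: poly_altdef d_def)
  qed
  finally have "T h = 0" using p(4) by simp
  then have h0: "h x = 0" if "x \<in> V" for x using T_zero[OF h] that by blast
  have "\<exists>x\<in>V. g x \<noteq> 0"
  proof (rule ccontr)
    assume "\<not> (\<exists>x\<in>V. g x \<noteq> 0)"
    then have "T g = 0" using vanish_iff_T[OF g(1)] act_in Ps_in x0 by blast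
    then show False using g(2) by (simp add: lmon_def)
  qed
  moreover have "integral_over_local_ring V q f g"
    unfolding integral_over_local_ring_def
  proof (intro exI conjI allI impI ballI)
    show "d > 0" using p(3) by (simp add: d_def)
    show "a i \<in> regfuns (affine_fspace V)" for i by (rule poly_funs_regfuns[OF a(1)])
    show "(\<lambda>x. 1) \<in> regfuns (affine_fspace V)" by (rule poly_funs_regfuns[OF poly_funs_const])
    show "(1::complex) \<noteq> 0" by simp
    fix x assume x: "x \<in> V" "g x \<noteq> 0 \<and> (\<forall>i<d. (1::complex) \<noteq> 0)"
    have "g x ^ d * ((f x / g x) ^ d + (\<Sum>i<d. a i x / 1 * (f x / g x) ^ i)) = h x"
    proof -
      have eq: "g x ^ d * (a i x / 1 * (f x / g x) ^ i) = a i x * (f x ^ i * g x ^ (d - i))" if "i < d" for i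
      proof -
        have "g x ^ d = g x ^ i * g x ^ (d - i)" using that by (simp flip: power_add)
        then show ?thesis using x(2) by (simp add: power_divide)
      qed
      have "(\<Sum>i<d. g x ^ d * (a i x / 1 * (f x / g x) ^ i)) = (\<Sum>i<d. a i x * (f x ^ i * g x ^ (d - i)))"
        by (rule sum.cong[OF refl], rule eq, simp)
      moreover have "g x ^ d * (f x / g x) ^ d = f x ^ d" using x(2) by (simp add: power_divide)
      ultimately show ?thesis by (simp only: h_def distrib_left sum_distrib_left)
    qed
    then show "(f x / g x) ^ d + (\<Sum>i<d. a i x / 1 * (f x / g x) ^ i) = 0" using h0[OF x(1)] x(2) by simp
  qed
  ultimately have "in_local_ring V q f g"
    using normal poly_funs_regfuns[OF f(1)] poly_funs_regfuns[OF g(1)] unfolding normal_at_def by blast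
  then obtain a0 b0 where ab: "a0 \<in> regfuns (affine_fspace V)" "b0 \<in> regfuns (affine_fspace V)" "b0 q \<noteq> 0"
    "\<forall>x\<in>V. f x * b0 x = a0 x * g x" unfolding in_local_ring_def by blast
  obtain a1 b1 where ab1: "a1 \<in> poly_funs" "b1 \<in> poly_funs" "\<forall>x\<in>V. a0 x = a1 x" "\<forall>x\<in>V. b0 x = b1 x"
    using ab(1,2) unfolding regfuns_affine by blast
  have "T (\<lambda>x. f x * b1 x) = T (\<lambda>x. a1 x * g x)"
    by (rule T_unique[OF poly_funs_mult[OF f(1) ab1(2)]])
      (use ab(4) ab1 act_in Ps_in x0 in \<open>simp add: poly_funs_mult g(1) flip: T_ev\<close>)
  then have "T g * (monom c l * T b1) = T g * T a1"
    using f g ab1 by (simp add: T_mult Tf mult_ac)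
  moreover have "T g \<noteq> 0" using g(2) by (simp add: lmon_def flip: g(2))
  ultimately have "monom c l * T b1 = T a1" by simp
  then have "coeff (monom c l * T b1) l = coeff (T a1) l" by simp
  then have "c * [:b1 q:] = coeff (T a1) l" by (simp add: coeff_monom_mult coeff_T_0[OF ab1(2)])
  then have "monom (smult (b1 q) c) l \<in> A"
    using A_I[OF component_poly[OF ab1(1)], of l] by (simp add: T_component[OF ab1(1)])
  moreover have "b1 q \<noteq> 0" using ab(3) ab1(4) q by simp
  ultimately show ?thesis by (rule A_scale)
qed

definition bounded_slope :: "nat \<Rightarrow> nat \<Rightarrow> complex poly poly \<Rightarrow> bool" where
  "bounded_slope k j F \<longleftrightarrow> (\<forall>l i. coeff (coeff F l) i \<noteq> 0 \<longrightarrow> i * k \<le> j * l)"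

text \<open>The exponents allowed form a half-plane through the origin, which is closed under
  addition; so it is enough to test the coordinate functions.\<close>

lemma bounded_slope_T:
  assumes "\<And>n. bounded_slope k j (T (\<lambda>x. x $ n))" "f \<in> poly_funs"
  shows "bounded_slope k j (T f)"
  using assms(2) unfolding poly_funs_def
proof induction
  case (gen f) then show ?case using assms(1) by auto
next
  case (const c)
  then show ?case by (auto simp: bounded_slope_def T_const coeff_pCons split: nat.splits)
next
  case (add f g)
  then have fg: "f \<in> poly_funs" "g \<in> poly_funs" by (auto simp: poly_funs_def)
  show ?case unfolding bounded_slope_def T_add[OF fg]
  proof (intro allI impI)
    fix l i assume "coeff (coeff (T f + T g) l) i \<noteq> 0"
    then have "coeff (coeff (T f) l) i \<noteq> 0 \<or> coeff (coeff (T g) l) i \<noteq> 0" by auto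
    then show "i * k \<le> j * l" using add.IH by (auto simp: bounded_slope_def)
  qed
next
  case (mult f g)
  then have fg: "f \<in> poly_funs" "g \<in> poly_funs" by (auto simp: poly_funs_def)
  show ?case unfolding bounded_slope_def T_mult[OF fg]
  proof (intro allI impI)
    fix l i assume "coeff (coeff (T f * T g) l) i \<noteq> 0"
    then obtain l1 l2 i1 i2 where li: "l = l1 + l2" "i = i1 + i2" "coeff (coeff (T f) l1) i1 \<noteq> 0" "coeff (coeff (T g) l2) i2 \<noteq> 0"
      by (rule coeff_coeff_mult_nonzero)
    then have "i1 * k \<le> j * l1" "i2 * k \<le> j * l2" using mult.IH by (auto simp: bounded_slope_def)
    then show "i * k \<le> j * l" by (simp add: li algebra_simps)
  qed
qed

lemma slice_mem: "lmon b 1 \<in> A"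
proof -
  have "monom [:0, w0:] b \<in> A" using A_I[OF homogeneous_polyD[OF y(1)]] T_homogeneous[OF y(1)] y(2) by simp
  moreover have "[:0, w0:] = smult w0 (monom 1 1)" by (simp add: monom_altdef)
  ultimately show ?thesis using A_scale y(3) unfolding lmon_def by metis
qed

text \<open>The slope \<open>l / i\<close> takes a minimum on the finitely many monomials of the
  coordinate functions, and the half-plane bound carries it over to \<open>A\<close>. The slice
  guarantees that some monomial has \<open>i > 0\<close>.\<close>

lemma extremal_exists:
  "\<exists>k j F. j > 0 \<and> F \<in> A \<and> coeff (coeff F k) j \<noteq> 0 \<and> (\<forall>F\<in>A. \<forall>l i. coeff (coeff F l) i \<noteq> 0 \<longrightarrow> i * k \<le> j * l)"
proof -
  define X where "X = (\<lambda>n. T (\<lambda>x::complex ^ 'n. x $ n))"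
  have X: "X n \<in> A" for n unfolding X_def by (rule A_I[OF poly_funs_coord])
  define R where "R = (\<Union>n. {(l, i). i > 0 \<and> coeff (coeff (X n) l) i \<noteq> 0})"
  have fin: "finite R" unfolding R_def
  proof (intro finite_UN_I)
    fix n
    have "{(l, i). i > 0 \<and> coeff (coeff (X n) l) i \<noteq> 0} \<subseteq> (SIGMA l:{..degree (X n)}. {..degree (coeff (X n) l)})"
      by (auto intro: le_degree)
    then show "finite {(l, i). i > 0 \<and> coeff (coeff (X n) l) i \<noteq> 0}" by (rule finite_subset) auto
  qed simp
  have "R \<noteq> {}"
  proof
    assume "R = {}"
    then have "bounded_slope 1 0 (X n)" for n by (auto simp: bounded_slope_def R_def)
    then have "bounded_slope 1 0 F" if "F \<in> A" for F
      using that bounded_slope_T[of 1 0] unfolding X_def by (metis A_E)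
    then have "bounded_slope 1 0 (lmon b 1)" using slice_mem by blast
    moreover have "coeff (coeff (lmon b 1) b) 1 \<noteq> 0" by (simp add: lmon_def)
    ultimately show False unfolding bounded_slope_def by fastforce
  qed
  define slope where "slope = (\<lambda>(l::nat, i::nat). real l / real i)"
  have "Min (slope ` R) \<in> slope ` R" using fin \<open>R \<noteq> {}\<close> by (intro Min_in) auto
  then obtain k j where kj: "(k, j) \<in> R" "Min (slope ` R) = slope (k, j)" by auto
  have j: "j > 0" using kj(1) by (auto simp: R_def)
  have "bounded_slope k j (X n)" for n
    unfolding bounded_slope_def
  proof (intro allI impI)
    fix l i assume nz: "coeff (coeff (X n) l) i \<noteq> 0"
    show "i * k \<le> j * l"
    proof (cases "i = 0")
      case False
      then have "(l, i) \<in> R" using nz by (auto simp: R_def)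
      then have "slope (k, j) \<le> slope (l, i)" unfolding kj(2)[symmetric] using fin by (intro Min_le) auto
      then have "real i * real k \<le> real j * real l" using j False by (simp add: slope_def divide_simps mult.commute)
      then show ?thesis by (simp flip: of_nat_mult)
    qed simp
  qed
  then have "bounded_slope k j F" if "F \<in> A" for F
    using that bounded_slope_T[of k j] unfolding X_def by (metis A_E)
  moreover obtain n where "coeff (coeff (X n) k) j \<noteq> 0" using kj(1) by (auto simp: R_def)
  ultimately show ?thesis using j X unfolding bounded_slope_def by blast
qed

lemma graded_subalgebra_A: "\<exists>k j F0. graded_subalgebra A eps b k0 k j F0"
proof -
  interpret subring_set A by (rule A_subring)
  obtain k j F0 where kj: "j > 0" "F0 \<in> A" "coeff (coeff F0 k) j \<noteq> 0"
    "\<forall>F\<in>A. \<forall>l i. coeff (coeff F l) i \<noteq> 0 \<longrightarrow> i * k \<le> j * l" using extremal_exists by blast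
  have "graded_subalgebra A eps b k0 k j F0"
  proof
    show "[:[:z:]:] \<in> A" for z using A_I[OF poly_funs_const[of z]] by (simp add: T_const)
    show "monom (coeff F l) l \<in> A" if "F \<in> A" for F l
      using that by (metis A_E A_I T_component component_poly)
    show "degree (coeff F 0) = 0" if "F \<in> A" for F using that by (metis A_E coeff_T_0 degree_pCons_0)
    show "int l + int (degree c) * eps \<ge> 0 \<and> lmon (nat (int l + int (degree c) * eps)) 0 \<in> A"
      if cA: "monom c l \<in> A" and c0: "c \<noteq> 0" for c l
    proof -
      obtain f where f: "homogeneous l f" "dps f x0 = c" using cA by (rule A_homogeneous)
      have nz: "dcoeff (degree c) f x0 \<noteq> 0" using c0 f(2) by (simp add: dcoeff_def)
      then have h: "int l + int (degree c) * eps \<ge> 0 \<and> homogeneous (nat (int l + int (degree c) * eps)) (dcoeff (degree c) f)"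
        using x0 by (intro dcoeff_homogeneous[OF f(1)]) auto
      have "dps (dcoeff (degree c) f) x0 = [:lead_coeff c:]"
        using dps_dcoeff_top[OF homogeneous_polyD[OF f(1)] x0, of "degree c"] f(2) by (simp add: dcoeff_def)
      then have "monom [:lead_coeff c:] (nat (int l + int (degree c) * eps)) \<in> A"
        using A_I[OF homogeneous_polyD] T_homogeneous h by metis
      moreover have "[:lead_coeff c:] = smult (lead_coeff c) (monom 1 0)" by simp
      ultimately show ?thesis using h A_scale c0 unfolding lmon_def by (metis leading_coeff_0_iff)
    qed
    show "lmon b 1 \<in> A" by (rule slice_mem)
    show "k0 > 0" by (rule u(1))
    have "monom [:u0:] k0 \<in> A" using A_I[OF homogeneous_polyD[OF u(2)]] T_homogeneous[OF u(2)] u(3) by simp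
    moreover have "[:u0:] = smult u0 (monom 1 0)" by simp
    ultimately show "lmon k0 0 \<in> A" using A_scale u(4) unfolding lmon_def by metis
    show "monom c l \<in> A" if "lmon m 0 \<in> A" "monom c (l + m) \<in> A" "\<And>i. coeff p i \<in> A"
      "lead_coeff p = 1" "degree p > 0" "poly p (monom c l) = 0" for m c l p
      using that by (rule A_normal)
  qed (use kj in auto)
  then show ?thesis by blast
qed

end

section \<open>Diagonal cyclic groups\<close>

lemma carrier_GL: "carrier GL = {A. invertible A}" and mult_GL: "A \<otimes>\<^bsub>GL\<^esub> B = A ** B" and one_GL: "\<one>\<^bsub>GL\<^esub> = mat 1"
  by (simp_all add: GL_def)

lemma group_GL: "group (GL :: (complex ^ 'n ^ 'n) monoid)"
proof (rule groupI)
  fix A :: "complex ^ 'n ^ 'n" assume "A \<in> carrier GL"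
  then obtain B where B: "A ** B = mat 1" "B ** A = mat 1" by (auto simp: carrier_GL invertible_def)
  then have "invertible B" unfolding invertible_def by blast
  then show "\<exists>B\<in>carrier GL. B \<otimes>\<^bsub>GL\<^esub> A = \<one>\<^bsub>GL\<^esub>" using B by (auto simp: carrier_GL mult_GL one_GL)
qed (auto simp: carrier_GL mult_GL one_GL invertible_mult matrix_mul_assoc invertible_def[of "mat 1"] intro: exI[of _ "mat 1"])

lemma lin_orbit_def': "lin_orbit G v = {A *v v | A. A \<in> G}"
  by (simp add: lin_orbit_def Group_Action.orbit_def)

lemma lin_orbit_eq_iff:
  assumes "subgroup G GL"
  shows "lin_orbit G v = lin_orbit G w \<longleftrightarrow> (\<exists>A\<in>G. w = A *v v)"
proof
  interpret GL: group "GL :: (complex ^ 'a ^ 'a) monoid" by (rule group_GL)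
  have 1: "mat 1 \<in> G" using subgroup.one_closed[OF assms] by (simp add: one_GL)
  then have "w \<in> lin_orbit G w" unfolding lin_orbit_def' by (metis (mono_tags, lifting) CollectI matrix_vector_mul_lid)
  moreover assume "lin_orbit G v = lin_orbit G w"
  ultimately show "\<exists>A\<in>G. w = A *v v" unfolding lin_orbit_def' by blast
next
  interpret GL: group "GL :: (complex ^ 'a ^ 'a) monoid" by (rule group_GL)
  assume "\<exists>A\<in>G. w = A *v v"
  then obtain A where A: "A \<in> G" "w = A *v v" by blast
  define A' where "A' = inv\<^bsub>GL\<^esub> A"
  have A': "A' \<in> G" unfolding A'_def using assms A(1) by (rule subgroup.m_inv_closed)
  have "A' ** A = mat 1"
    using GL.l_inv[of A] subgroup.subset[OF assms] A(1) by (auto simp: A'_def mult_GL one_GL)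
  then have v: "v = A' *v w" using A(2) by (simp add: matrix_vector_mul_assoc)
  have mult: "B ** C \<in> G" if "B \<in> G" "C \<in> G" for B C
    using subgroup.m_closed[OF assms that] by (simp add: mult_GL)
  show "lin_orbit G v = lin_orbit G w"
  proof
    show "lin_orbit G v \<subseteq> lin_orbit G w"
      unfolding lin_orbit_def' using v mult[OF _ A'] by (auto simp: matrix_vector_mul_assoc)
    show "lin_orbit G w \<subseteq> lin_orbit G v"
      unfolding lin_orbit_def' using A(2) mult[OF _ A(1)] by (auto simp: matrix_vector_mul_assoc)
  qed
qed

text \<open>It is enough to have a polynomial map from the plane onto \<open>V\<close> whose fibres
  are the orbits and through which every invariant polynomial factors. The isomorphism then sends a
  point to its fibre.\<close>

lemma cyclic_quotient_of_parametrization: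
  fixes V :: "(complex ^ 'n) set" and G :: "(complex ^ 2 ^ 2) set" and \<theta> :: "complex ^ 2 \<Rightarrow> complex ^ 'n"
  assumes G: "small_finite_subgroup G" "d \<ge> 1" "GL\<lparr>carrier := G\<rparr> \<cong> integer_mod_group d"
    and \<theta>_poly: "\<And>i. (\<lambda>v. \<theta> v $ i) \<in> poly_funs" and \<theta>_in: "\<And>v. \<theta> v \<in> V"
    and \<theta>_surj: "\<And>x. x \<in> V \<Longrightarrow> \<exists>v. \<theta> v = x"
    and \<theta>_inv: "\<And>A v. A \<in> G \<Longrightarrow> \<theta> (A *v v) = \<theta> v" and \<theta>_orbit: "\<And>v w. \<theta> v = \<theta> w \<Longrightarrow> \<exists>A\<in>G. w = A *v v"
    and inv_poly: "\<And>h. h \<in> poly_funs \<Longrightarrow> (\<And>A v. A \<in> G \<Longrightarrow> h (A *v v) = h v) \<Longrightarrow> \<exists>f\<in>poly_funs. \<forall>v. h v = f (\<theta> v)"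
    and \<theta>_0: "\<theta> 0 = p"
  shows "cyclic_quotient_singularity V p"
proof -
  have sub: "subgroup G GL" using G by (simp add: small_finite_subgroup_def)
  define F where "F = (\<lambda>x. lin_orbit G (SOME v. \<theta> v = x))"
  have F\<theta>: "F (\<theta> v) = lin_orbit G v" for v
  proof -
    have "\<theta> (SOME w. \<theta> w = \<theta> v) = \<theta> v" by (rule someI[of "\<lambda>w. \<theta> w = \<theta> v" v]) simp
    then show ?thesis unfolding F_def lin_orbit_eq_iff[OF sub] by (rule \<theta>_orbit)
  qed
  have orb: "lin_orbit G v = lin_orbit G w \<longleftrightarrow> \<theta> v = \<theta> w" for v w
    using lin_orbit_eq_iff[OF sub, of v w] \<theta>_orbit[of v w] \<theta>_inv by auto
  have pts: "points (quotient_variety G) = range (lin_orbit G)"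
    by (auto simp: quotient_variety_def orbits_def lin_orbit_def)
  have inj: "inj_on F V"
  proof (rule inj_onI)
    fix x x' assume "x \<in> V" "x' \<in> V" "F x = F x'"
    then show "x = x'" using \<theta>_surj[of x] \<theta>_surj[of x'] F\<theta> orb by metis
  qed
  have img: "F ` V = range (lin_orbit G)"
  proof
    show "F ` V \<subseteq> range (lin_orbit G)" by (auto simp: F_def)
    show "range (lin_orbit G) \<subseteq> F ` V" using F\<theta> \<theta>_in by (metis image_eqI image_subsetI)
  qed
  have m1: "morphism (affine_fspace V) (quotient_variety G) F"
    unfolding morphism_def
  proof (intro conjI ballI)
    show "F \<in> points (affine_fspace V) \<rightarrow> points (quotient_variety G)" using img by (auto simp: pts)
    fix g assume "g \<in> regfuns (quotient_variety G)"
    then have h: "g \<circ> lin_orbit G \<in> poly_funs" by (simp add: quotient_variety_def)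
    have "\<exists>f\<in>poly_funs. \<forall>v. (g \<circ> lin_orbit G) v = f (\<theta> v)"
    proof (rule inv_poly[OF h])
      fix A v assume "A \<in> G"
      then have "lin_orbit G (A *v v) = lin_orbit G v" using orb \<theta>_inv by blast
      then show "(g \<circ> lin_orbit G) (A *v v) = (g \<circ> lin_orbit G) v" by simp
    qed
    then obtain f where f: "f \<in> poly_funs" "\<And>v. g (lin_orbit G v) = f (\<theta> v)" by auto
    have "(g \<circ> F) x = f x" if "x \<in> V" for x using \<theta>_surj[OF that] F\<theta> f(2) by auto
    then show "g \<circ> F \<in> regfuns (affine_fspace V)" using f(1) by (auto simp: regfuns_affine)
  qed
  have m2: "morphism (quotient_variety G) (affine_fspace V) (inv_into V F)"
    unfolding morphism_def
  proof (intro conjI ballI)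
    show "inv_into V F \<in> points (quotient_variety G) \<rightarrow> points (affine_fspace V)"
      using inv_into_into[of _ F V] by (auto simp: pts img)
    fix g assume "g \<in> regfuns (affine_fspace V)"
    then obtain f where f: "f \<in> poly_funs" "\<And>x. x \<in> V \<Longrightarrow> g x = f x" by (auto simp: regfuns_affine)
    have "(g \<circ> inv_into V F) (lin_orbit G v) = f (\<theta> v)" for v
      using inv_into_f_f[OF inj \<theta>_in[of v]] f(2)[OF \<theta>_in[of v]] by (simp add: F\<theta>)
    then have "(g \<circ> inv_into V F) \<circ> lin_orbit G = (\<lambda>v. f (\<theta> v))" by auto
    then show "g \<circ> inv_into V F \<in> regfuns (quotient_variety G)"
      using poly_funs_subst[OF f(1) \<theta>_poly] by (simp add: quotient_variety_def)
  qed
  have "isomorphism (affine_fspace V) (quotient_variety G) F"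
    unfolding isomorphism_def using m1 m2 inj img by (simp add: bij_betw_def pts)
  moreover have "F p = lin_orbit G 0" using F\<theta>[of 0] \<theta>_0 by simp
  ultimately show ?thesis unfolding cyclic_quotient_singularity_def using G by blast
qed

section \<open>Finite cyclic groups of diagonal matrices\<close>

definition diag2 :: "complex \<Rightarrow> complex \<Rightarrow> complex ^ 2 ^ 2" where
  "diag2 c d = (\<chi> i j. if i = j then (if i = 1 then c else d) else 0)"

lemma diag2_mult_vec: "(diag2 c d *v v) $ 1 = c * v $ 1" "(diag2 c d *v v) $ 2 = d * v $ 2"
  by (simp_all add: diag2_def matrix_vector_mult_def sum_2)

lemma diag2_mult: "diag2 c d ** diag2 c' d' = diag2 (c * c') (d * d')"
  by (simp add: diag2_def matrix_matrix_mult_def vec_eq_iff forall_2 sum_2)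

lemma diag2_1: "diag2 1 1 = mat 1"
  by (simp add: diag2_def mat_def vec_eq_iff forall_2)

lemma diag2_eq: "diag2 c d = diag2 c' d' \<longleftrightarrow> c = c' \<and> d = d'"
  by (auto simp: diag2_def vec_eq_iff forall_2)

lemma invertible_diag2: "c \<noteq> 0 \<Longrightarrow> d \<noteq> 0 \<Longrightarrow> invertible (diag2 c d)"
  unfolding invertible_def
  by (rule exI[of _ "diag2 (inverse c) (inverse d)"]) (simp add: diag2_mult diag2_1)

text \<open>The weights are \<open>1\<close> and \<open>-b\<close>, so that for \<open>a > 0\<close>
  the monomial \<open>x^p y^i\<close> is invariant exactly when \<open>p\<close> is congruent to
  \<open>b * i\<close> modulo \<open>a\<close>.\<close>

definition cyclic_diag :: "nat \<Rightarrow> nat \<Rightarrow> (complex ^ 2 ^ 2) set" where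
  "cyclic_diag a b = {diag2 w (inverse w ^ b) | w. w ^ a = 1}"

lemma root_of_unity_nonzero: "w ^ n = 1 \<Longrightarrow> n > 0 \<Longrightarrow> w \<noteq> (0 :: complex)"
  by (metis zero_power zero_neq_one)

lemma root_of_unity_coprime:
  fixes w :: complex
  assumes "w ^ a = 1" "w ^ b = 1" "coprime a b" "a > 0"
  shows "w = 1"
proof -
  obtain d x y where xy: "d dvd a" "d dvd b" "a * x - b * y = d \<or> b * x - a * y = d"
    using bezout1_nat[of a b] by blast
  have "d = 1" using coprime_common_divisor_nat[OF assms(3) xy(1,2)] .
  then have "a * x = b * y + 1 \<or> b * x = a * y + 1" using xy(3) by arith
  moreover have "w ^ (a * x) = 1" "w ^ (b * y) = 1" "w ^ (b * x) = 1" "w ^ (a * y) = 1"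
    using assms(1,2) by (simp_all add: power_mult)
  ultimately show ?thesis by (metis mult_1 power_add power_one_right)
qed

text \<open>An element fixing a nonzero vector has \<open>w = 1\<close> or \<open>w ^ b = 1\<close>;
  as \<open>b\<close> is prime to \<open>a\<close>, it is the identity in both cases.\<close>

lemma cyclic_diag_small:
  assumes a: "a > 0" and ab: "coprime a b"
  shows "small_finite_subgroup (cyclic_diag a b)"
  unfolding small_finite_subgroup_def
proof (intro conjI ballI notI)
  interpret GL: group "GL :: (complex ^ 2 ^ 2) monoid" by (rule group_GL)
  note w0 = root_of_unity_nonzero[OF _ a]
  show "subgroup (cyclic_diag a b) GL"
  proof (rule GL.subgroupI)
    show "cyclic_diag a b \<subseteq> carrier GL"
      by (auto simp: cyclic_diag_def carrier_GL zero_power[OF a] intro!: invertible_diag2)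
    show "cyclic_diag a b \<noteq> {}" by (auto simp: cyclic_diag_def intro: exI[of _ 1])
    fix A assume "A \<in> cyclic_diag a b"
    then obtain w where w: "A = diag2 w (inverse w ^ b)" "w ^ a = 1" by (auto simp: cyclic_diag_def)
    have "inv\<^bsub>GL\<^esub> A = diag2 (inverse w) (inverse (inverse w) ^ b)"
    proof (rule GL.inv_equality)
      show "diag2 (inverse w) (inverse (inverse w) ^ b) \<otimes>\<^bsub>GL\<^esub> A = \<one>\<^bsub>GL\<^esub>"
        using w0[OF w(2)] by (simp add: mult_GL one_GL w(1) diag2_mult diag2_1[symmetric] power_inverse)
    qed (use w0[OF w(2)] in \<open>auto simp: carrier_GL w(1) intro!: invertible_diag2\<close>)
    moreover have "inverse w ^ a = 1" using w(2) by (simp add: power_inverse)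
    ultimately show "inv\<^bsub>GL\<^esub> A \<in> cyclic_diag a b" unfolding cyclic_diag_def by blast
  next
    fix A B assume "A \<in> cyclic_diag a b" "B \<in> cyclic_diag a b"
    then obtain w z where w: "A = diag2 w (inverse w ^ b)" "w ^ a = 1" "B = diag2 z (inverse z ^ b)" "z ^ a = 1"
      by (auto simp: cyclic_diag_def)
    then have "A \<otimes>\<^bsub>GL\<^esub> B = diag2 (w * z) (inverse (w * z) ^ b)" "(w * z) ^ a = 1"
      by (simp_all add: mult_GL diag2_mult power_mult_distrib)
    then show "A \<otimes>\<^bsub>GL\<^esub> B \<in> cyclic_diag a b" unfolding cyclic_diag_def by blast
  qed
  have "finite {w::complex. w ^ a = 1}" by (rule finite_roots_unity) (use a in simp)
  then have "finite ((\<lambda>w. diag2 w (inverse w ^ b)) ` {w. w ^ a = 1})" by (rule finite_imageI)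
  then show "finite (cyclic_diag a b)" by (simp add: cyclic_diag_def setcompr_eq_image)
  fix A assume A: "A \<in> cyclic_diag a b" "pseudo_reflection A"
  then obtain w where w: "A = diag2 w (inverse w ^ b)" "w ^ a = 1" by (auto simp: cyclic_diag_def)
  obtain H where H: "vec.dim H + 1 = CARD(2)" "\<forall>x\<in>H. A *v x = x" and A1: "A \<noteq> mat 1"
    using A(2) by (auto simp: pseudo_reflection_def)
  have "\<not> H \<subseteq> {0}"
  proof
    assume "H \<subseteq> {0}"
    then have "H \<subseteq> vec.span {}" by simp
    then have "vec.dim H \<le> card ({} :: (complex ^ 2) set)" by (rule vec.dim_le_card) simp
    then have "vec.dim H = 0" by (simp only: card.empty le_zero_eq)
    then show False using H(1) by (simp del: vec.dim_eq_0)
  qed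
  then obtain h where h: "h \<in> H" "h \<noteq> 0" by auto
  have fx: "w * h $ 1 = h $ 1" "inverse w ^ b * h $ 2 = h $ 2"
    using H(2) h(1) diag2_mult_vec[of w "inverse w ^ b" h] w(1) by auto
  have "w = 1"
  proof (cases "h $ 1 = 0")
    case False then show ?thesis using fx(1) by simp
  next
    case True
    then have "h $ 2 \<noteq> 0" using h(2) by (auto simp: vec_eq_iff forall_2)
    then have "inverse w ^ b = 1" using fx(2) by simp
    then have "w ^ b = 1" by (simp add: power_inverse)
    then show ?thesis using root_of_unity_coprime[OF w(2) _ ab a] by blast
  qed
  then show False using A1 w(1) by (simp add: diag2_1)
qed

lemma cyclic_diag_iso:
  assumes a: "a > 0"
  shows "GL\<lparr>carrier := cyclic_diag a b\<rparr> \<cong> integer_mod_group a"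
proof -
  define r where "r = (\<lambda>k::nat. cis (2 * pi * real k / real a))"
  have r: "bij_betw r {..<a} {z. z ^ a = 1}" unfolding r_def by (rule Complex.bij_betw_roots_unity[OF a])
  have radd: "r ((k + l) mod a) = r k * r l" for k l
  proof -
    have "r (k + l) = r ((k + l) mod a) * r (a * ((k + l) div a))"
    proof -
      have "real (k + l) = real ((k + l) mod a) + real (a * ((k + l) div a))"
        by (metis mod_mult_div_eq of_nat_add)
      then show ?thesis by (simp add: r_def cis_mult distrib_left add_divide_distrib)
    qed
    also have "r (a * ((k + l) div a)) = cis (2 * pi * real ((k + l) div a))" unfolding r_def by (rule arg_cong[of _ _ cis]) (use a in simp)
    also have "\<dots> = 1" by (intro cis_multiple_2pi Ints_of_nat)
    also have "r (k + l) = r k * r l" by (simp add: r_def cis_mult distrib_left add_divide_distrib)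
    finally show ?thesis by simp
  qed
  define h where "h = (\<lambda>n::int. diag2 (r (nat n)) (inverse (r (nat n)) ^ b))"
  have "h \<in> iso (integer_mod_group a) (GL\<lparr>carrier := cyclic_diag a b\<rparr>)"
    unfolding iso_def hom_def
  proof (intro CollectI conjI ballI)
    have ra: "r (nat n) ^ a = 1" if "n \<in> {0..<int a}" for n
    proof -
      have "nat n \<in> {..<a}" using that by auto
      then show ?thesis using bij_betw_apply[OF r] by blast
    qed
    show "h \<in> carrier (integer_mod_group a) \<rightarrow> carrier (GL\<lparr>carrier := cyclic_diag a b\<rparr>)"
      using ra a by (auto simp: carrier_integer_mod_group h_def cyclic_diag_def)
    show "h (x \<otimes>\<^bsub>integer_mod_group a\<^esub> y) = h x \<otimes>\<^bsub>GL\<lparr>carrier := cyclic_diag a b\<rparr>\<^esub> h y"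
      if "x \<in> carrier (integer_mod_group a)" "y \<in> carrier (integer_mod_group a)" for x y
    proof -
      have "nat ((x + y) mod int a) = (nat x + nat y) mod a"
        using that a by (simp add: carrier_integer_mod_group nat_mod_distrib nat_add_distrib)
      then show ?thesis by (simp add: h_def radd mult_GL diag2_mult power_mult_distrib)
    qed
    show "bij_betw h (carrier (integer_mod_group a)) (carrier (GL\<lparr>carrier := cyclic_diag a b\<rparr>))"
      unfolding bij_betw_def
    proof
      show "inj_on h (carrier (integer_mod_group a))"
      proof (rule inj_onI)
        fix x y assume xy: "x \<in> carrier (integer_mod_group a)" "y \<in> carrier (integer_mod_group a)" "h x = h y"
        then have "r (nat x) = r (nat y)" by (simp add: h_def diag2_eq)
        then have "nat x = nat y" using xy a inj_onD[OF bij_betw_imp_inj_on[OF r], of "nat x" "nat y"]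
          by (auto simp: carrier_integer_mod_group)
        then show "x = y" using xy a by (auto simp: carrier_integer_mod_group)
      qed
      show "h ` carrier (integer_mod_group a) = carrier (GL\<lparr>carrier := cyclic_diag a b\<rparr>)"
      proof
        show "h ` carrier (integer_mod_group a) \<subseteq> carrier (GL\<lparr>carrier := cyclic_diag a b\<rparr>)"
          using ra a by (auto simp: carrier_integer_mod_group h_def cyclic_diag_def)
        show "carrier (GL\<lparr>carrier := cyclic_diag a b\<rparr>) \<subseteq> h ` carrier (integer_mod_group a)"
        proof
          fix A assume "A \<in> carrier (GL\<lparr>carrier := cyclic_diag a b\<rparr>)"
          then obtain w where w: "A = diag2 w (inverse w ^ b)" "w ^ a = 1" by (auto simp: cyclic_diag_def)
          then obtain k where "k < a" "w = r k" using bij_betw_imp_surj_on[OF r] by blast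
          then have "A = h (int k)" "int k \<in> carrier (integer_mod_group a)"
            using w(1) by (auto simp: h_def carrier_integer_mod_group)
          then show "A \<in> h ` carrier (integer_mod_group a)" by (rule image_eqI)
        qed
      qed
    qed
  qed
  then have "integer_mod_group a \<cong> GL\<lparr>carrier := cyclic_diag a b\<rparr>" unfolding is_iso_def by blast
  then show ?thesis by (rule group.iso_sym[OF group_integer_mod_group])
qed

section \<open>The toric parametrization\<close>

lemma ev2_sum: "ev2 F t s = (\<Sum>l\<le>degree F. \<Sum>i\<le>degree (coeff F l). coeff (coeff F l) i * t ^ l * s ^ i)"
proof -
  have "ev2 F t s = (\<Sum>l\<le>degree F. poly (coeff F l) s * t ^ l)"
    by (simp add: poly_altdef[of F] poly_sum poly_power)
  also have "\<dots> = (\<Sum>l\<le>degree F. \<Sum>i\<le>degree (coeff F l). coeff (coeff F l) i * t ^ l * s ^ i)"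
    by (simp add: poly_altdef sum_distrib_left sum_distrib_right mult_ac)
  finally show ?thesis .
qed

lemma poly_funs_ev2:
  assumes "h \<in> (poly_funs :: (complex ^ 2 \<Rightarrow> complex) set)"
  shows "\<exists>H. \<forall>v. h v = ev2 H (v $ 1) (v $ 2)"
  using assms unfolding poly_funs_def
proof induction
  case (gen f)
  then obtain i :: 2 where f: "f = (\<lambda>x. x $ i)" by auto
  have "i = 1 \<or> i = 2" by (rule exhaust_2)
  then show ?case
  proof
    assume "i = 1" then show ?thesis by (intro exI[of _ "[:0, 1:]"]) (simp add: f)
  next
    assume "i = 2" then show ?thesis by (intro exI[of _ "[:[:0, 1:]:]"]) (simp add: f)
  qed
next
  case (const c) then show ?case by (intro exI[of _ "[:[:c:]:]"]) simp
next
  case (add f g)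
  then obtain F G where "\<forall>v. f v = ev2 F (v $ 1) (v $ 2)" "\<forall>v. g v = ev2 G (v $ 1) (v $ 2)" by blast
  then show ?case by (intro exI[of _ "F + G"]) simp
next
  case (mult f g)
  then obtain F G where "\<forall>v. f v = ev2 F (v $ 1) (v $ 2)" "\<forall>v. g v = ev2 G (v $ 1) (v $ 2)" by blast
  then show ?case by (intro exI[of _ "F * G"]) simp
qed

text \<open>A diagonal substitution rescales each coefficient separately, so only invariant
  monomials can occur.\<close>

lemma ev2_invariant_support:
  assumes inv: "\<And>t s. ev2 H (w * t) (z * s) = ev2 H t s" and nz: "coeff (coeff H l) i \<noteq> 0"
  shows "w ^ l * z ^ i = 1"
proof -
  define H1 where "H1 = (\<Sum>l\<le>degree H. monom (\<Sum>i\<le>degree (coeff H l). monom (coeff (coeff H l) i * w ^ l * z ^ i) i) l)"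
  have "H1 = H"
  proof (rule poly_poly_eqI)
    fix t s :: complex
    have "ev2 H1 t s = ev2 H (w * t) (z * s)"
      unfolding H1_def ev2_sum[of H]
      by (simp add: poly_sum poly_monom poly_power power_mult_distrib sum_distrib_left sum_distrib_right mult_ac)
    then show "ev2 H1 t s = ev2 H t s" using inv by simp
  qed
  moreover have "coeff (coeff H1 l) i = coeff (coeff H l) i * w ^ l * z ^ i"
  proof -
    have l: "l \<le> degree H" using nz by (metis coeff_0 le_degree)
    have i: "i \<le> degree (coeff H l)" using nz by (rule le_degree)
    have "coeff H1 l = (\<Sum>i\<le>degree (coeff H l). monom (coeff (coeff H l) i * w ^ l * z ^ i) i)"
      using l by (simp add: H1_def coeff_sum)
    then show ?thesis using i by (simp add: coeff_sum)
  qed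
  ultimately show ?thesis using nz by simp
qed

section \<open>From the lattice cone to the quotient map of the plane\<close>

locale toric_surface = generic_surface V q \<phi> Ps eps k0 b u y x0 u0 w0
  for V :: "(complex ^ 'n) set" and q \<phi> Ps eps k0 b u y x0 u0 w0 +
  fixes a k j :: nat
  assumes a_pos: "a > 0" and j_pos: "j > 0" and k_le: "k \<le> j * b" and a_dvd: "int a dvd int k - int j * int b"
    and A_iff: "\<And>F. F \<in> A \<longleftrightarrow> (\<forall>l i. coeff (coeff F l) i \<noteq> 0 \<longrightarrow> i * k \<le> j * l \<and> int a dvd int l - int i * int b)"
begin

text \<open>
  The monomials \<open>t\<^sup>l s\<^sup>i\<close> of \<open>A\<close> become \<open>X\<^sup>p Y\<^sup>i\<close> with \<open>p = (j l - i k) / dl\<close>, after the substitution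
  \<open>t = \<xi>\<^sup>j\<close>, \<open>s = \<xi> powi (-k) Y\<close>, \<open>X = \<xi> ^ dl\<close>. The resulting monomials are exactly those with
  \<open>p \<equiv> be * i\<close> modulo \<open>al\<close>, the invariants of the cyclic group of order \<open>al\<close> acting with weights \<open>1, -be\<close>.
\<close>

definition "dl = gcd (j * a) (j * b - k)"
definition "al = j * a div dl"
definition "be = (j * b - k) div dl"

lemma dl: "dl > 0" "dl * al = j * a" "dl * be = j * b - k" "al > 0" "coprime al be"
proof -
  show "dl > 0" using a_pos j_pos by (simp add: dl_def)
  show al: "dl * al = j * a" and "dl * be = j * b - k" by (simp_all add: dl_def al_def be_def)
  show "al > 0" using al a_pos j_pos by (metis nat_0_less_mult_iff)
  show "coprime al be" unfolding al_def be_def dl_def by (rule div_gcd_coprime) (use a_pos j_pos in simp)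
qed

lemma dl_int: "int dl * int al = int j * int a" "int dl * int be = int j * int b - int k"
proof -
  have "int (dl * al) = int (j * a)" "int (dl * be) = int (j * b - k)" using dl(2,3) by simp_all
  then show "int dl * int al = int j * int a" "int dl * int be = int j * int b - int k"
    using k_le by (simp_all add: of_nat_diff)
qed

definition lat :: "nat \<Rightarrow> nat \<Rightarrow> bool" where
  "lat l i \<longleftrightarrow> i * k \<le> j * l \<and> int a dvd int l - int i * int b"

definition inv_mon :: "nat \<Rightarrow> nat \<Rightarrow> bool" where "inv_mon p i \<longleftrightarrow> int al dvd int p - int be * int i"

definition ex :: "nat \<Rightarrow> nat \<Rightarrow> nat" where "ex l i = (j * l - i * k) div dl"

lemma lat_ex:
  assumes "lat l i"
  shows "dl * ex l i + i * k = j * l" "inv_mon (ex l i) i"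
proof -
  obtain n where n: "int l - int i * int b = int a * n" using assms by (auto simp: lat_def)
  \<comment> \<open>Splitting off the slice direction shows the divisibility by \<open>dl\<close>
    and the residue modulo \<open>al\<close> at once.\<close>
  have "int (j * l - i * k) = int j * (int l - int i * int b) + int i * (int j * int b - int k)"
    using assms by (simp add: lat_def of_nat_diff algebra_simps)
  also have "\<dots> = (int j * int a) * n + int i * (int j * int b - int k)" by (simp add: n)
  also have "\<dots> = int dl * (int al * n + int be * int i)" unfolding dl_int[symmetric] by (simp add: algebra_simps)
  finally have e: "int (j * l - i * k) = int dl * (int al * n + int be * int i)" .
  have "int (ex l i) = int (j * l - i * k) div int dl" by (simp add: ex_def zdiv_int)
  then have ex: "int (ex l i) = int al * n + int be * int i" using e dl(1) by simp
  then show "inv_mon (ex l i) i" by (simp add: inv_mon_def)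
  have "int (dl * ex l i) = int (j * l - i * k)" using e ex by simp
  then have "dl * ex l i = j * l - i * k" by presburger
  then show "dl * ex l i + i * k = j * l" using assms by (simp add: lat_def)
qed

text \<open>With \<open>lat_ex\<close> this makes \<open>(l, i) \<mapsto> (ex l i, i)\<close> a
  bijection from the lattice points of the cone to the invariant exponents; it is injective because
  \<open>j > 0\<close>.\<close>

lemma inv_mon_lat:
  assumes "inv_mon p i"
  shows "\<exists>l. lat l i \<and> ex l i = p"
proof -
  obtain n where n: "int p - int be * int i = int al * n" using assms by (auto simp: inv_mon_def)
  define m where "m = int i * int b + int a * n"
  have "int dl * int p = int dl * (int al * n + int be * int i)" using n by (simp add: algebra_simps)
  also have "\<dots> = (int dl * int al) * n + int i * (int dl * int be)" by (simp add: algebra_simps)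
  also have "\<dots> = int j * m - int i * int k" unfolding dl_int m_def by (simp add: algebra_simps)
  finally have jm: "int j * m = int dl * int p + int i * int k" by simp
  then have "int j * m \<ge> 0" by simp
  then have "m \<ge> 0" using j_pos by (simp add: zero_le_mult_iff)
  then obtain l where l: "m = int l" using nonneg_int_cases by blast
  have "int (j * l) = int (dl * p + i * k)" using jm l by simp
  then have jl: "j * l = dl * p + i * k" by presburger
  have "int l - int i * int b = int a * n" using l m_def by simp
  then have "lat l i" using jl by (simp add: lat_def)
  moreover have "ex l i = p" using jl dl(1) by (simp add: ex_def)
  ultimately show ?thesis by blast
qed

text \<open>The result of the monomial substitution, written with the exponents
  \<open>ex l i\<close> so that no roots of the variables occur.\<close>

definition S :: "complex poly poly \<Rightarrow> complex ^ 2 \<Rightarrow> complex" where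
  "S F v = (\<Sum>l\<le>degree F. \<Sum>i\<le>degree (coeff F l). coeff (coeff F l) i * (v $ 1 ^ ex l i * v $ 2 ^ i))"

lemma S_poly: "S F \<in> poly_funs"
  unfolding S_def by (intro poly_funs_sum poly_funs_mult poly_funs_const poly_funs_power poly_funs_coord)

lemma A_lat: "F \<in> A \<Longrightarrow> coeff (coeff F l) i \<noteq> 0 \<Longrightarrow> lat l i"
  using A_iff by (simp add: lat_def)

lemma S_ev:
  assumes F: "F \<in> A" and xi: "xi \<noteq> 0" "v $ 1 = xi ^ dl"
  shows "S F v = ev2 F (xi ^ j) (inverse xi ^ k * v $ 2)"
  unfolding S_def ev2_sum
proof (intro sum.cong refl)
  fix l i
  show "coeff (coeff F l) i * (v $ 1 ^ ex l i * v $ 2 ^ i) = coeff (coeff F l) i * (xi ^ j) ^ l * (inverse xi ^ k * v $ 2) ^ i"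
  proof (cases "coeff (coeff F l) i = 0")
    case False
    have "(xi ^ j) ^ l = xi ^ (dl * ex l i) * xi ^ (i * k)"
      using lat_ex(1)[OF A_lat[OF F False]] by (simp flip: power_mult power_add)
    moreover have "xi ^ (i * k) * (inverse xi ^ k) ^ i = 1"
    proof -
      have "(inverse xi ^ k) ^ i = inverse (xi ^ (i * k))" by (simp add: power_inverse mult.commute flip: power_mult)
      then show ?thesis using xi(1) by simp
    qed
    ultimately have "(xi ^ j) ^ l * (inverse xi ^ k) ^ i = v $ 1 ^ ex l i" by (simp add: xi(2) power_mult mult.assoc)
    then show ?thesis by (simp add: power_mult_distrib mult.assoc flip: mult.assoc[of "(xi ^ j) ^ l" "(inverse xi ^ k) ^ i"])
  qed simp
qed

definition \<theta> :: "complex ^ 2 \<Rightarrow> complex ^ 'n" where "\<theta> v = (\<chi> n. S (T (\<lambda>x. x $ n)) v)"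

lemma \<theta>_poly: "(\<lambda>v. \<theta> v $ n) \<in> poly_funs"
  by (simp add: \<theta>_def S_poly)

text \<open>Off the axis \<open>v $ 1 = 0\<close> the map is the orbit map of \<open>x0\<close>,
  once a root \<open>xi\<close> is chosen; the left-hand side shows that the choice does not
  matter.\<close>

lemma \<theta>_ev:
  assumes "xi \<noteq> 0" "v $ 1 = xi ^ dl"
  shows "\<theta> v = \<phi> (xi ^ j) (Ps (inverse xi ^ k * v $ 2) x0)"
  unfolding vec_eq_iff
proof
  fix n
  have "\<theta> v $ n = ev2 (T (\<lambda>x. x $ n)) (xi ^ j) (inverse xi ^ k * v $ 2)"
    by (simp add: \<theta>_def S_ev[OF A_I[OF poly_funs_coord] assms])
  then show "\<theta> v $ n = \<phi> (xi ^ j) (Ps (inverse xi ^ k * v $ 2) x0) $ n"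
    using T_ev[OF poly_funs_coord[of n], of "xi ^ j" "inverse xi ^ k * v $ 2"] assms(1) by simp
qed

text \<open>Off the axis \<open>v $ 1 = 0\<close> both sides are the value of \<open>f\<close> at a
  point of the orbit; the axis is reached by continuity.\<close>

lemma \<theta>_S:
  assumes f: "f \<in> poly_funs"
  shows "f (\<theta> v) = S (T f) v"
proof -
  have nz: "f (\<theta> v) = S (T f) v" if v: "v $ 1 \<noteq> 0" for v
  proof -
    obtain xi where xi: "v $ 1 = xi ^ dl" using exists_complex_root[of dl "v $ 1"] dl(1) by auto
    then have "xi \<noteq> 0" using v dl(1) by (auto simp: power_0_left)
    then show ?thesis using S_ev[OF A_I[OF f] _ xi] \<theta>_ev[OF _ xi] T_ev[OF f] by simp
  qed
  define X where "X = (\<lambda>m::nat. (v + axis 1 (inverse (of_nat (Suc m)))) :: complex ^ 2)"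
  show ?thesis
  proof (cases "v $ 1 = 0")
    case True
    have "(\<lambda>m. axis 1 (inverse (of_nat (Suc m))) :: complex ^ 2) \<longlonglongrightarrow> 0"
    proof (rule vec_tendstoI)
      fix i :: 2
      have "(\<lambda>m. inverse (of_nat (Suc m)) :: complex) \<longlonglongrightarrow> 0" by (rule LIMSEQ_Suc[OF lim_inverse_n])
      then show "(\<lambda>m. axis 1 (inverse (of_nat (Suc m)) :: complex) $ i) \<longlonglongrightarrow> (0 :: complex ^ 2) $ i"
        by (cases "i = 1") (simp_all add: axis_def)
    qed
    then have X: "X \<longlonglongrightarrow> v" using tendsto_add[OF tendsto_const[of v]] unfolding X_def by fastforce
    have "X m $ 1 \<noteq> 0" for m using True by (simp add: X_def axis_def del: of_nat_Suc)
    then have "f (\<theta> (X m)) = S (T f) (X m)" for m by (rule nz)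
    then have "(\<lambda>m. f (\<theta> (X m))) \<longlonglongrightarrow> S (T f) v" using poly_funs_tendsto[OF S_poly X] by simp
    moreover have "(\<lambda>m. f (\<theta> (X m))) \<longlonglongrightarrow> f (\<theta> v)"
      by (rule poly_funs_tendsto[OF poly_funs_subst[OF f \<theta>_poly] X])
    ultimately show ?thesis using LIMSEQ_unique by blast
  qed (rule nz)
qed

lemma \<theta>_in: "\<theta> v \<in> V"
proof (rule zariski_closed_membership)
  show "zariski_closed V" using irr by (simp add: irreducible_closed_def)
  fix f :: "complex ^ 'n \<Rightarrow> complex" assume f: "f \<in> poly_funs" "\<And>y. y \<in> V \<Longrightarrow> f y = 0"
  then have "T f = 0" using vanish_iff_T[OF f(1)] act_in Ps_in x0 by blast
  then show "f (\<theta> v) = 0" using \<theta>_S[OF f(1)] by (simp add: S_def)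
qed

text \<open>As \<open>j\<close>-th roots of \<open>t\<close> exist, the image of
  \<open>\<theta>\<close> contains the dense image of the orbit map, and \<open>T\<close> detects
  equality on \<open>V\<close>.\<close>

lemma \<theta>_separates:
  assumes fg: "f \<in> poly_funs" "g \<in> poly_funs" and eq: "\<And>v. f (\<theta> v) = g (\<theta> v)" and x: "x \<in> V"
  shows "f x = g x"
proof -
  have "T f = T g"
  proof (rule T_unique[OF fg(1)])
    fix t s :: complex assume t: "t \<noteq> 0"
    obtain xi where xi: "t = xi ^ j" using exists_complex_root[of j t] j_pos by auto
    then have xi0: "xi \<noteq> 0" using t j_pos by (auto simp: power_0_left)
    define v :: "complex ^ 2" where "v = vector [xi ^ dl, xi ^ k * s]"
    have "inverse xi ^ k * (xi ^ k * s) = (inverse xi * xi) ^ k * s" by (simp only: power_mult_distrib mult.assoc)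
    also have "\<dots> = s" using xi0 by simp
    finally have e: "inverse xi ^ k * (xi ^ k * s) = s" .
    have "\<theta> v = \<phi> (xi ^ j) (Ps (inverse xi ^ k * (xi ^ k * s)) x0)" using \<theta>_ev[of xi v] xi0 by (simp add: v_def)
    then have "\<theta> v = \<phi> t (Ps s x0)" by (simp only: e xi)
    then show "f (\<phi> t (Ps s x0)) = ev2 (T g) t s" using eq[of v] T_ev[OF fg(2) t] by simp
  qed
  then show ?thesis using T_eq[OF fg _ x] by simp
qed

lemma \<theta>_expand:
  assumes f: "f \<in> poly_funs"
  shows "\<exists>I c. finite I \<and> (\<forall>(p, i)\<in>I. inv_mon p i) \<and> (\<forall>v. f (\<theta> v) = (\<Sum>z\<in>I. c z * (v $ 1 ^ fst z * v $ 2 ^ snd z)))"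
proof -
  define R where "R = {(l, i). l \<le> degree (T f) \<and> i \<le> degree (coeff (T f) l) \<and> coeff (coeff (T f) l) i \<noteq> 0}"
  have sub: "R \<subseteq> (SIGMA l:{..degree (T f)}. {..degree (coeff (T f) l)})" by (auto simp: R_def)
  have R: "finite R" by (rule finite_subset[OF sub]) auto
  define e where "e = (\<lambda>(l, i). (ex l i, i))"
  have lat: "lat l i" if "(l, i) \<in> R" for l i using that A_lat[OF A_I[OF f]] by (auto simp: R_def)
  have inj: "inj_on e R"
  proof (rule inj_onI)
    fix z z' assume z: "z \<in> R" "z' \<in> R" "e z = e z'"
    obtain l i l' where zl: "z = (l, i)" "z' = (l', i)" "ex l i = ex l' i" using z(3) by (auto simp: e_def split: prod.splits)
    then have "j * l = j * l'" using lat_ex(1)[OF lat] z(1,2) by metis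
    then show "z = z'" using zl j_pos by simp
  qed
  define c where "c = (\<lambda>z. case inv_into R e z of (l, i) \<Rightarrow> coeff (coeff (T f) l) i)"
  have e: "fst (e z) = ex (fst z) (snd z)" "snd (e z) = snd z" for z by (simp_all add: e_def split: prod.splits)
  have c: "c (e z) = coeff (coeff (T f) (fst z)) (snd z)" if "z \<in> R" for z
    using inv_into_f_f[OF inj that] by (simp add: c_def split: prod.splits)
  have "f (\<theta> v) = (\<Sum>z\<in>e ` R. c z * (v $ 1 ^ fst z * v $ 2 ^ snd z))" for v
  proof -
    have "f (\<theta> v) = (\<Sum>(l, i)\<in>(SIGMA l:{..degree (T f)}. {..degree (coeff (T f) l)}). coeff (coeff (T f) l) i * (v $ 1 ^ ex l i * v $ 2 ^ i))"
      unfolding \<theta>_S[OF f] S_def by (subst sum.Sigma) auto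
    also have "\<dots> = (\<Sum>(l, i)\<in>R. coeff (coeff (T f) l) i * (v $ 1 ^ ex l i * v $ 2 ^ i))"
      by (rule sum.mono_neutral_right) (use sub in \<open>auto simp: R_def\<close>)
    also have "\<dots> = (\<Sum>z\<in>R. c (e z) * (v $ 1 ^ fst (e z) * v $ 2 ^ snd (e z)))"
      by (rule sum.cong[OF refl]) (simp add: c e case_prod_beta)
    also have "\<dots> = (\<Sum>z\<in>e ` R. c z * (v $ 1 ^ fst z * v $ 2 ^ snd z))" by (simp add: sum.reindex[OF inj])
    finally show ?thesis .
  qed
  moreover have "\<forall>(p, i)\<in>e ` R. inv_mon p i" using lat lat_ex(2) by (auto simp: e_def)
  ultimately show ?thesis using R by blast
qed

lemma \<theta>_monomial:
  assumes "inv_mon p i"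
  shows "\<exists>f\<in>poly_funs. \<forall>v. f (\<theta> v) = v $ 1 ^ p * v $ 2 ^ i"
proof -
  obtain l where l: "lat l i" "ex l i = p" using inv_mon_lat[OF assms] by blast
  have "lmon l i \<in> A" unfolding A_iff using l(1) by (simp add: lmon_def lat_def)
  then obtain f where f: "f \<in> poly_funs" "lmon l i = T f" by (rule A_E)
  have "S (lmon l i) v = v $ 1 ^ p * v $ 2 ^ i" for v
  proof -
    have "degree (lmon l i) = l" "degree (coeff (lmon l i) l) = i" by (simp_all add: lmon_def degree_monom_eq)
    then have "S (lmon l i) v = (\<Sum>l'\<le>l. if l' = l then v $ 1 ^ ex l i * v $ 2 ^ i else 0)"
      unfolding S_def by (intro sum.cong) (auto simp: lmon_def if_distrib[of "\<lambda>x. x * _"] cong: if_cong)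
    then show ?thesis using l(2) by simp
  qed
  then show ?thesis using f \<theta>_S[OF f(1)] by auto
qed

text \<open>For invariant exponents, a polynomial that pulls back to the given monomial. Its
  restriction to \<open>V\<close> is determined by that, its values elsewhere are not, hence the
  choice.\<close>

definition mon :: "nat \<Rightarrow> nat \<Rightarrow> complex ^ 'n \<Rightarrow> complex" where
  "mon p i = (SOME f. f \<in> poly_funs \<and> (\<forall>v. f (\<theta> v) = v $ 1 ^ p * v $ 2 ^ i))"

lemma mon: assumes "inv_mon p i" shows "mon p i \<in> poly_funs" "mon p i (\<theta> v) = v $ 1 ^ p * v $ 2 ^ i"
  using someI_ex[of "\<lambda>f. f \<in> poly_funs \<and> (\<forall>v. f (\<theta> v) = v $ 1 ^ p * v $ 2 ^ i)"] \<theta>_monomial[OF assms]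
  unfolding mon_def[symmetric] by blast+

lemma inv_mon_add: "inv_mon p i \<Longrightarrow> inv_mon p' i' \<Longrightarrow> inv_mon (p + p') (i + i')"
  using dvd_add[of "int al" "int p - int be * int i" "int p' - int be * int i'"] by (simp add: inv_mon_def algebra_simps)

lemma inv_mon_basic: "inv_mon 0 0" "inv_mon al 0" "inv_mon 0 al" "inv_mon be 1" "inv_mon (n * al) 0" "inv_mon 0 (n * al)" "inv_mon (i * be) i"
  by (simp_all add: inv_mon_def)

lemma mon_0: "x \<in> V \<Longrightarrow> mon 0 0 x = 1"
  using \<theta>_separates[OF mon(1)[OF inv_mon_basic(1)] poly_funs_const[of 1]] mon(2)[OF inv_mon_basic(1)] by simp

lemma mon_add:
  assumes "inv_mon p i" "inv_mon p' i'" "x \<in> V"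
  shows "mon (p + p') (i + i') x = mon p i x * mon p' i' x"
proof -
  note i = inv_mon_add[OF assms(1,2)]
  show ?thesis
    by (rule \<theta>_separates[OF mon(1)[OF i] poly_funs_mult[OF mon(1)[OF assms(1)] mon(1)[OF assms(2)]] _ assms(3)])
      (simp add: mon(2) i assms power_add mult_ac)
qed

lemma mon_power:
  assumes "inv_mon p i" "x \<in> V"
  shows "inv_mon (n * p) (n * i) \<and> mon (n * p) (n * i) x = mon p i x ^ n"
proof (induction n)
  case 0 then show ?case using mon_0 assms inv_mon_basic(1) by simp
next
  case (Suc n)
  then show ?case using inv_mon_add[OF assms(1), of "n * p" "n * i"] mon_add[OF assms(1) _ assms(2), of "n * p" "n * i"] by simp
qed

text \<open>The congruence with natural numbers on both sides, so that powers can be compared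
  without dividing.\<close>

lemma inv_mon_cases:
  assumes "inv_mon p i"
  obtains m n where "p + m * al = i * be + n * al"
proof -
  obtain z where z: "int p - int be * int i = int al * z" using assms by (auto simp: inv_mon_def)
  define m n where "m = nat (- z)" and "n = nat z"
  have nm: "z = int n - int m" by (auto simp: m_def n_def)
  have "int (p + m * al) = int (i * be + n * al)" using z unfolding nm by (simp add: algebra_simps)
  then have "p + m * al = i * be + n * al" by (simp only: of_nat_eq_iff)
  then show ?thesis by (rule that)
qed

text \<open>A point of \<open>V\<close> assigns values multiplicatively to the invariant monomials,
  and these values determine the point. So it suffices to find a point of the plane with the same
  monomial values.\<close>

lemma \<theta>_surj:
  assumes x: "x \<in> V"
  shows "\<exists>v. \<theta> v = x"
proof -
  have "\<exists>v :: complex ^ 2. \<forall>p i. inv_mon p i \<longrightarrow> mon p i x = v $ 1 ^ p * v $ 2 ^ i"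
  proof (cases "mon al 0 x = 0")
    case False
    \<comment> \<open>If the value of \<open>X ^ al\<close> is nonzero, a root of it serves as
      \<open>X\<close>, and \<open>Y\<close> is then read off from the value of
      \<open>X ^ be * Y\<close>.\<close>
    define M N where "M = mon al 0 x" and "N = mon be 1 x"
    obtain X where X: "M = X ^ al" using exists_complex_root[of al M] dl(4) by auto
    then have X0: "X \<noteq> 0" using False dl(4) by (auto simp: M_def power_0_left)
    define Y where "Y = N / X ^ be"
    have "mon p i x = X ^ p * Y ^ i" if pi: "inv_mon p i" for p i
    proof -
      obtain m n where mn: "p + m * al = i * be + n * al" using inv_mon_cases[OF pi] by blast
      have "mon p i x * M ^ m = mon (p + m * al) (i + m * 0) x"
        using mon_power[OF inv_mon_basic(2) x, of m] mon_add[OF pi _ x, of "m * al" "m * 0"] by (simp add: M_def)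
      also have "\<dots> = mon (i * be + n * al) (i * 1 + n * 0) x" by (simp add: mn)
      also have "\<dots> = N ^ i * M ^ n"
        using mon_power[OF inv_mon_basic(2) x, of n] mon_power[OF inv_mon_basic(4) x, of i]
          mon_add[OF _ _ x, of "i * be" "i * 1" "n * al" "n * 0"] by (simp add: M_def N_def)
      also have "\<dots> = X ^ (i * be + n * al) * Y ^ i"
      proof -
        have "N = X ^ be * Y" using X0 by (simp add: Y_def)
        then show ?thesis by (simp add: X power_mult_distrib power_add mult_ac flip: power_mult)
      qed
      also have "\<dots> = X ^ p * Y ^ i * M ^ m" unfolding mn[symmetric] by (simp add: X power_add mult_ac flip: power_mult)
      finally show ?thesis using False by (simp add: M_def)
    qed
    then show ?thesis by (intro exI[of _ "vector [X, Y]"]) simp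
  next
    case True
    \<comment> \<open>A monomial with \<open>p > 0\<close> has a power divisible by
      \<open>X ^ al\<close>, so it vanishes at \<open>x\<close>. The remaining ones are powers of
      \<open>Y ^ al\<close>, because \<open>be\<close> is prime to \<open>al\<close>.\<close>
    obtain Y where Y: "mon 0 al x = Y ^ al" using exists_complex_root[of al "mon 0 al x"] dl(4) by auto
    have "mon p i x = 0 ^ p * Y ^ i" if pi: "inv_mon p i" for p i
    proof (cases "p = 0")
      case False
      have "mon p i x ^ al = mon (al * p) (al * i) x" using mon_power[OF pi x, of al] by simp
      also have "\<dots> = mon (p * al + i * 0) (p * 0 + i * al) x" by (simp add: mult.commute)
      also have "\<dots> = mon (p * al) (p * 0) x * mon (i * 0) (i * al) x"
        by (rule mon_add[OF _ _ x]) (use inv_mon_basic(5,6) in auto)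
      also have "\<dots> = 0" using mon_power[OF inv_mon_basic(2) x, of p] True False by (simp add: power_0_left)
      finally show ?thesis using False by (simp add: power_0_left)
    next
      case p: True
      have "al dvd i * be" using pi by (simp add: inv_mon_def p mult.commute flip: of_nat_mult)
      then have "al dvd i" using dl(5) by (simp add: coprime_dvd_mult_left_iff)
      then obtain m' where "i = al * m'" by (rule dvdE)
      then obtain m where "i = m * al" by (metis mult.commute)
      then show ?thesis using mon_power[OF inv_mon_basic(3) x, of m] Y by (simp add: p mult.commute flip: power_mult)
    qed
    then show ?thesis by (intro exI[of _ "vector [0, Y]"]) simp
  qed
  then obtain v :: "complex ^ 2" where v: "\<And>p i. inv_mon p i \<Longrightarrow> mon p i x = v $ 1 ^ p * v $ 2 ^ i" by blast
  have "\<theta> v = x"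
  proof (rule poly_funs_determine)
    fix f :: "complex ^ 'n \<Rightarrow> complex" assume f: "f \<in> poly_funs"
    obtain I c where I: "finite I" "\<And>z. z \<in> I \<Longrightarrow> inv_mon (fst z) (snd z)"
      "\<And>v. f (\<theta> v) = (\<Sum>z\<in>I. c z * (v $ 1 ^ fst z * v $ 2 ^ snd z))" using \<theta>_expand[OF f] by fastforce
    have g: "(\<lambda>x. \<Sum>z\<in>I. c z * mon (fst z) (snd z) x) \<in> poly_funs"
      by (intro poly_funs_sum poly_funs_mult poly_funs_const mon I(2))
    have "f x = (\<Sum>z\<in>I. c z * mon (fst z) (snd z) x)"
      by (rule \<theta>_separates[OF f g _ x]) (simp add: I(3) mon(2)[OF I(2)])
    also have "\<dots> = f (\<theta> v)" unfolding I(3) by (intro sum.cong refl) (simp add: v[OF I(2)])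
    finally show "f (\<theta> v) = f x" by simp
  qed
  then show ?thesis by blast
qed

lemma \<theta>_invariant:
  assumes "M \<in> cyclic_diag al be"
  shows "\<theta> (M *v v) = \<theta> v"
proof (rule poly_funs_determine)
  obtain w where w: "M = diag2 w (inverse w ^ be)" "w ^ al = 1" using assms by (auto simp: cyclic_diag_def)
  have w0: "w \<noteq> 0" by (rule root_of_unity_nonzero[OF w(2) dl(4)])
  fix f :: "complex ^ 'n \<Rightarrow> complex" assume f: "f \<in> poly_funs"
  obtain I c where I: "finite I" "\<And>z. z \<in> I \<Longrightarrow> inv_mon (fst z) (snd z)"
    "\<And>v. f (\<theta> v) = (\<Sum>z\<in>I. c z * (v $ 1 ^ fst z * v $ 2 ^ snd z))" using \<theta>_expand[OF f] by fastforce
  have "(w * X) ^ p * (inverse w ^ be * Y) ^ i = X ^ p * Y ^ i" if pi: "inv_mon p i" for p i X Y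
  proof -
    obtain m n where mn: "p + m * al = i * be + n * al" using inv_mon_cases[OF pi] by blast
    have "w ^ p = w ^ (p + m * al)" using w(2) by (simp add: power_add power_mult mult.commute[of _ al])
    also have "\<dots> = w ^ (i * be)" unfolding mn using w(2) by (simp add: power_add power_mult mult.commute[of n al])
    finally have "w ^ p = w ^ (i * be)" .
    moreover have "(inverse w ^ be) ^ i = inverse (w ^ (i * be))"
      by (simp add: power_inverse mult.commute flip: power_mult)
    ultimately have "w ^ p * (inverse w ^ be) ^ i = 1" using w0 by simp
    then show ?thesis by (simp add: power_mult_distrib mult_ac flip: mult.assoc[of "w ^ p" "(inverse w ^ be) ^ i"])
  qed
  then show "f (\<theta> (M *v v)) = f (\<theta> v)" unfolding I(3) w(1) diag2_mult_vec by (intro sum.cong refl) (simp add: I(2))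
qed

text \<open>The three monomials \<open>X ^ al\<close>, \<open>Y ^ al\<close> and
  \<open>X ^ be * Y\<close> already separate the orbits.\<close>

lemma \<theta>_orbit:
  assumes eq: "\<theta> v = \<theta> v'"
  shows "\<exists>M\<in>cyclic_diag al be. v' = M *v v"
proof -
  have m: "v $ 1 ^ p * v $ 2 ^ i = v' $ 1 ^ p * v' $ 2 ^ i" if "inv_mon p i" for p i
    using mon(2)[OF that, of v] mon(2)[OF that, of v'] eq by simp
  have X: "v $ 1 ^ al = v' $ 1 ^ al" and Y: "v $ 2 ^ al = v' $ 2 ^ al" and XY: "v $ 1 ^ be * v $ 2 = v' $ 1 ^ be * v' $ 2"
    using m[OF inv_mon_basic(2)] m[OF inv_mon_basic(3)] m[OF inv_mon_basic(4)] by simp_all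
  have "\<exists>w. w ^ al = 1 \<and> v' $ 1 = w * v $ 1 \<and> v' $ 2 = inverse w ^ be * v $ 2"
  proof (cases "v $ 1 = 0")
    case False
    define w where "w = v' $ 1 / v $ 1"
    have w: "w ^ al = 1" unfolding w_def power_divide X[symmetric] using False by simp
    have w0: "w \<noteq> 0" by (rule root_of_unity_nonzero[OF w dl(4)])
    have v1: "v' $ 1 = w * v $ 1" using False by (simp add: w_def)
    then have "v $ 1 ^ be * v $ 2 = v $ 1 ^ be * (w ^ be * v' $ 2)" using XY by (simp add: power_mult_distrib mult_ac)
    then have "v $ 2 = w ^ be * v' $ 2" using False by simp
    then have "v' $ 2 = inverse w ^ be * v $ 2" using w0 by (simp add: power_inverse)
    then show ?thesis using w v1 by blast
  next
    case True
    then have v1: "v' $ 1 = 0" using X dl(4) by (simp add: power_0_left)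
    show ?thesis
    proof (cases "v $ 2 = 0")
      case y: True
      then have "v' $ 2 = 0" using Y dl(4) by (simp add: power_0_left)
      then show ?thesis using True v1 y by (intro exI[of _ 1]) simp
    next
      case y: False
      define z where "z = v' $ 2 / v $ 2"
      have z: "z ^ al = 1" unfolding z_def power_divide Y[symmetric] using y by simp
      have z0: "z \<noteq> 0" by (rule root_of_unity_nonzero[OF z dl(4)])
      \<comment> \<open>On the axis \<open>v $ 1 = 0\<close> the group element shows in the second
        coordinate only. Bezout gives a root of unity \<open>w\<close> for which
        \<open>w ^ be\<close> is inverse to the ratio \<open>z\<close>.\<close>
      obtain d e g where g: "d dvd al" "d dvd be" "al * e - be * g = d \<or> be * e - al * g = d"
        using bezout1_nat[of al be] by blast
      have "d = 1" using coprime_common_divisor_nat[OF dl(5) g(1,2)] .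
      then have eg: "al * e = be * g + 1 \<or> be * e = al * g + 1" using g(3) by arith
      have za: "z ^ (al * n) = 1" for n using z by (simp add: power_mult)
      have "\<exists>w. w ^ al = 1 \<and> w ^ be * z = 1"
        using eg
      proof
        assume *: "al * e = be * g + 1"
        have "(z ^ g) ^ be * z = z ^ (be * g + 1)" by (simp add: mult.commute flip: power_mult)
        also have "\<dots> = 1" unfolding *[symmetric] by (rule za)
        finally have "(z ^ g) ^ be * z = 1" .
        moreover have "(z ^ g) ^ al = 1" using za[of g] by (simp add: mult.commute flip: power_mult)
        ultimately show ?thesis by blast
      next
        assume *: "be * e = al * g + 1"
        have "z ^ (be * e) = z" unfolding * using za[of g] by simp
        then have "(inverse z ^ e) ^ be * z = 1" using z0 by (simp add: power_inverse mult.commute flip: power_mult)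
        moreover have "(inverse z ^ e) ^ al = 1" using za[of e] by (simp add: power_inverse mult.commute flip: power_mult)
        ultimately show ?thesis by blast
      qed
      then obtain w where w: "w ^ al = 1" "w ^ be * z = 1" by blast
      have "inverse w ^ be = z" using w(2) by (simp add: power_inverse inverse_unique)
      then have "v' $ 2 = inverse w ^ be * v $ 2" using y by (simp add: z_def)
      then show ?thesis using w(1) v1 True by auto
    qed
  qed
  then obtain w where w: "w ^ al = 1" "v' $ 1 = w * v $ 1" "v' $ 2 = inverse w ^ be * v $ 2" by blast
  have "v' = diag2 w (inverse w ^ be) *v v" by (simp add: vec_eq_iff forall_2 diag2_mult_vec w)
  then show ?thesis using w(1) by (auto simp: cyclic_diag_def)
qed

lemma \<theta>_invariant_poly:
  assumes h: "h \<in> poly_funs" and inv: "\<And>M v. M \<in> cyclic_diag al be \<Longrightarrow> h (M *v v) = h v"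
  shows "\<exists>f\<in>poly_funs. \<forall>v. h v = f (\<theta> v)"
proof -
  obtain H where H: "\<And>v. h v = ev2 H (v $ 1) (v $ 2)" using poly_funs_ev2[OF h] by blast
  \<comment> \<open>A primitive root of unity, so that equality of powers gives back the congruence
    of exponents.\<close>
  define w where "w = exp (2 * of_real pi * \<i> / of_nat al)"
  have w_power: "w ^ n = exp (2 * of_real pi * \<i> * of_nat n / of_nat al)" for n
    unfolding w_def exp_of_nat_mult[symmetric] by (simp add: mult_ac)
  have w1: "w ^ al = 1" unfolding w_power using dl(4) by simp
  have w_eq: "m mod al = n mod al" if "w ^ m = w ^ n" for m n
    using that dl(4) unfolding w_power by (subst (asm) complex_root_unity_eq) auto
  have w0: "w \<noteq> 0" by (simp add: w_def)
  have supp: "inv_mon p i" if nz: "coeff (coeff H p) i \<noteq> 0" for p i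
  proof -
    have "w ^ p * (inverse w ^ be) ^ i = 1"
    proof (rule ev2_invariant_support[OF _ nz])
      fix t s
      have "diag2 w (inverse w ^ be) \<in> cyclic_diag al be" using w1 by (auto simp: cyclic_diag_def)
      from inv[OF this, of "vector [t, s]"]
      show "ev2 H (w * t) (inverse w ^ be * s) = ev2 H t s" by (simp add: H diag2_mult_vec)
    qed
    moreover have "(inverse w ^ be) ^ i = inverse (w ^ (be * i))" by (simp add: power_inverse flip: power_mult)
    ultimately have "w ^ p = w ^ (be * i)" using w0 by (simp add: field_simps)
    then have "p mod al = (be * i) mod al" by (rule w_eq)
    then have "int p mod int al = int (be * i) mod int al" by (simp only: flip: zmod_int)
    then show ?thesis by (simp add: inv_mon_def mod_eq_dvd_iff)
  qed
  define f where "f = (\<lambda>x. \<Sum>p\<le>degree H. \<Sum>i\<le>degree (coeff H p). coeff (coeff H p) i * (if inv_mon p i then mon p i x else 0))"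
  have "f \<in> poly_funs" unfolding f_def
  proof (intro poly_funs_sum poly_funs_mult poly_funs_const)
    show "(\<lambda>x. if inv_mon p i then mon p i x else 0) \<in> poly_funs" for p i
      using mon(1) poly_funs_const[of 0] by (cases "inv_mon p i") simp_all
  qed
  moreover have "h v = f (\<theta> v)" for v
    unfolding H ev2_sum f_def
  proof (intro sum.cong refl)
    fix p i
    show "coeff (coeff H p) i * v $ 1 ^ p * v $ 2 ^ i = coeff (coeff H p) i * (if inv_mon p i then mon p i (\<theta> v) else 0)"
      using supp[of p i] by (cases "coeff (coeff H p) i = 0") (simp_all add: mon(2))
  qed
  ultimately show ?thesis by blast
qed

text \<open>Only the constant monomial survives at the origin, since
  \<open>dl * ex l 0 = j * l\<close> is positive for \<open>l > 0\<close>.\<close>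

lemma \<theta>_0: "\<theta> 0 = q"
proof (rule poly_funs_determine)
  fix f :: "complex ^ 'n \<Rightarrow> complex" assume f: "f \<in> poly_funs"
  have "S (T f) 0 = (\<Sum>l\<le>degree (T f). if l = 0 then f q else 0)"
    unfolding S_def
  proof (intro sum.cong refl)
    fix l
    have "(\<Sum>i\<le>degree (coeff (T f) l). coeff (coeff (T f) l) i * (0 $ 1 ^ ex l i * (0 :: complex ^ 2) $ 2 ^ i))
      = (\<Sum>i\<le>degree (coeff (T f) l). if i = 0 then (if l = 0 then f q else 0) else 0)"
    proof (intro sum.cong refl)
      fix i
      show "coeff (coeff (T f) l) i * (0 $ 1 ^ ex l i * (0 :: complex ^ 2) $ 2 ^ i)
        = (if i = 0 then (if l = 0 then f q else 0) else 0)"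
      proof (cases "i = 0 \<and> l > 0 \<and> coeff (coeff (T f) l) i \<noteq> 0")
        case True
        then have "lat l i" using A_lat[OF A_I[OF f]] by blast
        then have "dl * ex l 0 = j * l" using lat_ex(1) True by fastforce
        then have "ex l 0 \<noteq> 0" using True j_pos by (metis mult_0_right mult_is_0 not_less_zero)
        then show ?thesis using True by (simp add: power_0_left)
      next
        case False
        then show ?thesis by (auto simp: power_0_left coeff_T_0[OF f] ex_def)
      qed
    qed
    then show "(\<Sum>i\<le>degree (coeff (T f) l). coeff (coeff (T f) l) i * (0 $ 1 ^ ex l i * (0 :: complex ^ 2) $ 2 ^ i))
      = (if l = 0 then f q else 0)" by simp
  qed
  then show "f (\<theta> 0) = f q" using \<theta>_S[OF f] by simp
qed

lemma cyclic_quotient_singularity: "cyclic_quotient_singularity V q"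
  by (rule cyclic_quotient_of_parametrization[of "cyclic_diag al be" al \<theta>])
    (use cyclic_diag_small[OF dl(4,5)] cyclic_diag_iso[OF dl(4)] dl(4) \<theta>_poly \<theta>_in \<theta>_surj \<theta>_invariant \<theta>_orbit
      \<theta>_invariant_poly \<theta>_0 in auto)

end

lemma (in generic_surface) cyclic_quotient: "cyclic_quotient_singularity V q"
proof -
  obtain k j F0 where "graded_subalgebra A eps b k0 k j F0" using graded_subalgebra_A by blast
  then interpret L: graded_subalgebra A eps b k0 k j F0 .
  have "k \<le> j * b" using L.lattice_b by (simp add: L.lattice_def)
  moreover have "int L.a dvd int k - int j * int b" using L.lattice_kj by (simp add: L.lattice_def)
  ultimately interpret toric_surface V q \<phi> Ps eps k0 b u y x0 u0 w0 L.a k j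
    by unfold_locales (use L.a(1) L.extremal(1) L.mem_iff_lattice in \<open>auto simp: L.lattice_def\<close>)
  show ?thesis by (rule cyclic_quotient_singularity)
qed

section \<open>Additive actions on cyclic quotients\<close>

text \<open>The hypothesis says that \<open>m\<close> is a root of the characteristic polynomial. A
  nonzero row of the matrix minus \<open>m\<close> gives the eigenvector that this row
  annihilates.\<close>

lemma eigenvector_2:
  fixes A :: "complex ^ 2 ^ 2"
  assumes "(A $ 1 $ 1 - m) * (A $ 2 $ 2 - m) = A $ 1 $ 2 * A $ 2 $ 1"
  shows "\<exists>x. x \<noteq> 0 \<and> A *v x = m *s x"
proof -
  have *: "A *v x = m *s x" if "(A $ 1 $ 1 - m) * x $ 1 + A $ 1 $ 2 * x $ 2 = 0" "A $ 2 $ 1 * x $ 1 + (A $ 2 $ 2 - m) * x $ 2 = 0" for x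
  proof -
    have "A $ 1 $ 1 * x $ 1 + A $ 1 $ 2 * x $ 2 = m * x $ 1" "A $ 2 $ 1 * x $ 1 + A $ 2 $ 2 * x $ 2 = m * x $ 2"
      using that by (simp_all add: algebra_simps)
    then show ?thesis by (simp add: vec_eq_iff forall_2 matrix_vector_mult_def sum_2)
  qed
  consider "A $ 1 $ 1 - m \<noteq> 0 \<or> A $ 1 $ 2 \<noteq> 0" | "A $ 2 $ 1 \<noteq> 0 \<or> A $ 2 $ 2 - m \<noteq> 0"
    | "A $ 1 $ 1 - m = 0" "A $ 1 $ 2 = 0" "A $ 2 $ 1 = 0" "A $ 2 $ 2 - m = 0" by blast
  then show ?thesis
  proof cases
    case 1
    then have "(vector [- A $ 1 $ 2, A $ 1 $ 1 - m] :: complex ^ 2) \<noteq> 0" by (auto simp: vec_eq_iff forall_2)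
    moreover have "A *v vector [- A $ 1 $ 2, A $ 1 $ 1 - m] = m *s vector [- A $ 1 $ 2, A $ 1 $ 1 - m]"
      by (rule *) (use assms in \<open>simp_all add: algebra_simps\<close>)
    ultimately show ?thesis by blast
  next
    case 2
    then have "(vector [- (A $ 2 $ 2 - m), A $ 2 $ 1] :: complex ^ 2) \<noteq> 0" by (auto simp: vec_eq_iff forall_2)
    moreover have "A *v vector [- (A $ 2 $ 2 - m), A $ 2 $ 1] = m *s vector [- (A $ 2 $ 2 - m), A $ 2 $ 1]"
      by (rule *) (use assms in \<open>simp_all add: algebra_simps\<close>)
    ultimately show ?thesis by blast
  next
    case 3
    have "(vector [1, 0] :: complex ^ 2) \<noteq> 0" by (simp add: vec_eq_iff forall_2)
    moreover have "A *v vector [1, 0] = m *s vector [1, 0]" by (rule *) (use 3 in simp_all)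
    ultimately show ?thesis by blast
  qed
qed

lemma eigenvector_2_exists:
  fixes A :: "complex ^ 2 ^ 2"
  shows "\<exists>m x. x \<noteq> 0 \<and> A *v x = m *s x"
proof -
  define D where "D = (A $ 1 $ 1 - A $ 2 $ 2)\<^sup>2 + 4 * (A $ 1 $ 2 * A $ 2 $ 1)"
  define m where "m = (A $ 1 $ 1 + A $ 2 $ 2 + csqrt D) / 2"
  have "4 * ((A $ 1 $ 1 - m) * (A $ 2 $ 2 - m)) = (2 * A $ 1 $ 1 - 2 * m) * (2 * A $ 2 $ 2 - 2 * m)" by (simp add: algebra_simps)
  also have "2 * m = A $ 1 $ 1 + A $ 2 $ 2 + csqrt D" by (simp add: m_def)
  also have "(2 * A $ 1 $ 1 - (A $ 1 $ 1 + A $ 2 $ 2 + csqrt D)) * (2 * A $ 2 $ 2 - (A $ 1 $ 1 + A $ 2 $ 2 + csqrt D))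
    = (csqrt D)\<^sup>2 - (A $ 1 $ 1 - A $ 2 $ 2)\<^sup>2" by (simp add: algebra_simps power2_eq_square)
  also have "\<dots> = 4 * (A $ 1 $ 2 * A $ 2 $ 1)" by (simp add: D_def)
  finally have "(A $ 1 $ 1 - m) * (A $ 2 $ 2 - m) = A $ 1 $ 2 * A $ 2 $ 1" by simp
  then show ?thesis using eigenvector_2 by blast
qed

lemma cyclic_group_generator:
  assumes iso: "H \<cong> integer_mod_group d" and H: "group H" and d: "d \<ge> 1"
  shows "\<exists>M\<in>carrier H. \<forall>A\<in>carrier H. \<exists>n::nat. A = M [^]\<^bsub>H\<^esub> n"
proof -
  interpret group H by (rule H)
  obtain h where h: "h \<in> iso (integer_mod_group d) H"
    using iso_sym[OF iso] unfolding is_iso_def by blast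
  define M where "M = h (1 mod int d)"
  have one: "1 mod int d \<in> carrier (integer_mod_group d)" using d by (simp add: carrier_integer_mod_group)
  have hom: "h \<in> hom (integer_mod_group d) H" and surj: "h ` carrier (integer_mod_group d) = carrier H"
    using h by (auto simp: iso_def bij_betw_def)
  have M: "M \<in> carrier H" unfolding M_def using surj one by blast
  have "h (int n mod int d) = M [^]\<^bsub>H\<^esub> n" for n
  proof (induction n)
    case 0 then show ?case using hom_one[OF hom group_integer_mod_group H] by simp
  next
    case (Suc n)
    have "int n mod int d \<in> carrier (integer_mod_group d)" using d by (simp add: carrier_integer_mod_group)
    then have "h ((int n mod int d) \<otimes>\<^bsub>integer_mod_group d\<^esub> (1 mod int d)) = h (int n mod int d) \<otimes>\<^bsub>H\<^esub> M"
      unfolding M_def using one by (rule hom_mult[OF hom])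
    moreover have "(int n mod int d) \<otimes>\<^bsub>integer_mod_group d\<^esub> (1 mod int d) = int (Suc n) mod int d"
      unfolding mult_integer_mod_group mod_add_eq by (simp add: add.commute)
    ultimately show ?case using Suc.IH by simp
  qed
  moreover have "\<exists>n. A = h (int n mod int d)" if A: "A \<in> carrier H" for A
  proof -
    have "A \<in> h ` carrier (integer_mod_group d)" using A surj by simp
    then obtain z where z: "z \<in> carrier (integer_mod_group d)" "A = h z" by blast
    then have "z = int (nat z) mod int d" using d by (simp add: carrier_integer_mod_group)
    then show ?thesis using z(2) by metis
  qed
  ultimately show ?thesis using M by metis
qed

text \<open>The order of \<open>z\<close> divides the order \<open>D\<close> of \<open>c\<close>,
  and by counting, the powers of \<open>c\<close> are all the \<open>D\<close>-th roots of
  unity.\<close>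

lemma primitive_root_powers:
  fixes c z :: complex
  assumes c: "c ^ n = 1" "n > 0" and z: "\<And>k. c ^ k = 1 \<Longrightarrow> z ^ k = 1"
  shows "\<exists>e. z = c ^ e"
proof -
  define D where "D = (LEAST k. k > 0 \<and> c ^ k = 1)"
  have "D > 0 \<and> c ^ D = 1" unfolding D_def by (rule LeastI[of _ n]) (use c in simp)
  then have D: "D > 0" "c ^ D = 1" by auto
  have least: "D \<le> k" if "k > 0" "c ^ k = 1" for k unfolding D_def by (rule Least_le) (use that in simp)
  have c0: "c \<noteq> 0" by (rule root_of_unity_nonzero[OF c])
  have inj: "inj_on ((^) c) {..<D}"
  proof (rule linorder_inj_onI)
    fix i j assume ij: "i < j" "i \<in> {..<D}" "j \<in> {..<D}"
    show "c ^ i \<noteq> c ^ j"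
    proof
      assume "c ^ i = c ^ j"
      also have "c ^ j = c ^ i * c ^ (j - i)" using ij(1) by (simp flip: power_add)
      finally have "c ^ (j - i) = 1" using c0 by simp
      then show False using least[of "j - i"] ij by simp
    qed
  qed auto
  have "(^) c ` {..<D} = {z. z ^ D = 1}"
  proof (rule card_subset_eq)
    show "finite {z::complex. z ^ D = 1}" by (rule finite_roots_unity) (use D(1) in simp)
    have "(c ^ i) ^ D = 1" for i using D(2) by (simp add: mult.commute flip: power_mult) (simp add: power_mult)
    then show "(^) c ` {..<D} \<subseteq> {z. z ^ D = 1}" by auto
    show "card ((^) c ` {..<D}) = card {z::complex. z ^ D = 1}"
      using card_image[OF inj] bij_betw_same_card[OF Complex.bij_betw_roots_unity[OF D(1)]] by simp
  qed
  moreover have "z ^ D = 1" by (rule z[OF D(2)])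
  ultimately show ?thesis by blast
qed

text \<open>
  The coordinate \<open>l\<close> vanishing on an eigenvector \<open>v\<close> of a generator is an eigenfunction; if the group is
  small its character is faithful, so \<open>v\<close> transforms like some power \<open>l ^ e\<close>.
\<close>

lemma small_cyclic_semi_invariant:
  assumes G: "small_finite_subgroup G" "d \<ge> 1" "GL\<lparr>carrier := G\<rparr> \<cong> integer_mod_group d"
  shows "\<exists>(v :: complex ^ 2) w (l :: complex ^ 2 \<Rightarrow> complex) e::nat. v \<noteq> 0 \<and> l \<in> poly_funs \<and> l w = 1 \<and> l v = 0 \<and>
    (\<forall>x y c. l (x + c *s y) = l x + c * l y) \<and> (\<forall>A\<in>G. \<forall>x. l (A *v x) ^ e *s v = l x ^ e *s (A *v v))"
proof -
  have sub: "subgroup G GL" and fin: "finite G" and small: "\<And>A. A \<in> G \<Longrightarrow> \<not> pseudo_reflection A"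
    using G(1) by (auto simp: small_finite_subgroup_def)
  interpret GL: group "GL :: (complex ^ 2 ^ 2) monoid" by (rule group_GL)
  interpret H: group "GL\<lparr>carrier := G\<rparr>" by (rule subgroup.subgroup_is_group[OF sub group_GL])
  have "\<exists>M\<in>G. \<forall>A\<in>G. \<exists>n::nat. A = M [^]\<^bsub>GL\<^esub> n"
    using cyclic_group_generator[OF G(3) H.is_group G(2)] by (simp flip: GL.nat_pow_consistent)
  then obtain M where M: "M \<in> G" "\<And>A. A \<in> G \<Longrightarrow> \<exists>n::nat. A = M [^]\<^bsub>GL\<^esub> n" by blast
  have pow: "M [^]\<^bsub>GL\<^esub> n \<in> G" for n :: nat
    using H.nat_pow_closed[of M n] M(1) by (simp flip: GL.nat_pow_consistent)
  define N where "N = Coset.order (GL\<lparr>carrier := G\<rparr>)"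
  have N: "N > 0" unfolding N_def Coset.order_def using fin M(1) by (auto simp: card_gt_0_iff)
  have N1: "A [^]\<^bsub>GL\<^esub> N = mat 1" if "A \<in> G" for A
    using H.pow_order_eq_1[of A] that by (simp add: N_def one_GL flip: GL.nat_pow_consistent)
  obtain mu v where v: "v \<noteq> 0" "M *v v = mu *s v" using eigenvector_2_exists by blast
  define l where "l = (\<lambda>x::complex ^ 2. v $ 1 * x $ 2 - v $ 2 * x $ 1)"
  have l_lin: "l (x + c *s y) = l x + c * l y" for x y c by (simp add: l_def algebra_simps)
  have l_poly: "l \<in> poly_funs" unfolding l_def by (intro poly_funs_diff poly_funs_mult poly_funs_const poly_funs_coord)
  have lv: "l v = 0" by (simp add: l_def mult.commute)
  have l0: "\<exists>c. x = c *s v" if lx: "l x = 0" for x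
  proof (cases "v $ 1 = 0")
    case False
    have "x = (x $ 1 / v $ 1) *s v" using False lx by (simp add: vec_eq_iff forall_2 l_def field_simps)
    then show ?thesis by blast
  next
    case True
    then have "v $ 2 \<noteq> 0" using v(1) by (auto simp: vec_eq_iff forall_2)
    then have "x = (x $ 2 / v $ 2) *s v" using True lx by (simp add: vec_eq_iff forall_2 l_def field_simps)
    then show ?thesis by blast
  qed
  have "\<exists>w. l w = 1"
  proof (cases "v $ 1 = 0")
    case False then show ?thesis by (intro exI[of _ "vector [0, 1 / v $ 1]"]) (simp add: l_def)
  next
    case True
    then have "v $ 2 \<noteq> 0" using v(1) by (auto simp: vec_eq_iff forall_2)
    then show ?thesis by (intro exI[of _ "vector [- 1 / v $ 2, 0]"]) (simp add: l_def)
  qed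
  then obtain w where w: "l w = 1" by blast
  \<comment> \<open>\<open>w\<close> completes \<open>v\<close> to a basis, and \<open>lam\<close>
    is the eigenvalue of \<open>M\<close> on the plane modulo the line of \<open>v\<close>.\<close>
  define lam where "lam = l (M *v w)"
  have decomp: "\<exists>c. x = l x *s w + c *s v" for x
  proof -
    have "l (x + (- l x) *s w) = 0" unfolding l_lin w by simp
    then obtain c where c: "x + (- l x) *s w = c *s v" using l0 by blast
    have "x = l x *s w + (x + (- l x) *s w)" by (simp add: vec_eq_iff)
    then show ?thesis unfolding c by blast
  qed
  have lM: "l (M *v x) = lam * l x" for x
  proof -
    obtain c where c: "x = l x *s w + c *s v" using decomp by blast
    have "M *v x = l x *s (M *v w) + (c * mu) *s v"
      by (subst c) (simp add: matrix_vector_right_distrib vector_scalar_commute v(2))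
    then have "l (M *v x) = l (l x *s (M *v w)) + c * mu * l v" by (simp only: l_lin)
    also have "l (l x *s (M *v w)) = lam * l x" using l_lin[of 0 "l x" "M *v w"] by (simp add: lam_def l_def)
    finally show ?thesis using lv by simp
  qed
  have pow_Suc: "M [^]\<^bsub>GL\<^esub> Suc n = M [^]\<^bsub>GL\<^esub> n ** M" for n by (simp add: mult_GL)
  have Mn: "l ((M [^]\<^bsub>GL\<^esub> n) *v x) = lam ^ n * l x \<and> (M [^]\<^bsub>GL\<^esub> n) *v v = mu ^ n *s v" for n :: nat and x
  proof (induction n arbitrary: x)
    case 0 then show ?case by (simp add: one_GL)
  next
    case (Suc n)
    show ?case unfolding pow_Suc using Suc.IH[of "M *v x"] Suc.IH[of x]
      by (simp add: lM v(2) vector_scalar_commute mult_ac flip: matrix_vector_mul_assoc)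
  qed
  \<comment> \<open>If \<open>lam ^ n = 1\<close>, the power of \<open>M\<close> acts trivially
    modulo the line of \<open>v\<close>, so \<open>1\<close> is one of its eigenvalues. It fixes a
    nonzero vector, and smallness leaves only the identity.\<close>
  have faithful: "M [^]\<^bsub>GL\<^esub> n = mat 1" if lam: "lam ^ n = 1" for n :: nat
  proof (rule ccontr)
    define A where "A = M [^]\<^bsub>GL\<^esub> n"
    assume "M [^]\<^bsub>GL\<^esub> n \<noteq> mat 1"
    then have A1: "A \<noteq> mat 1" by (simp add: A_def)
    have AG: "A \<in> G" unfolding A_def by (rule pow)
    have lA: "l (A *v x) = l x" for x using Mn[of n x] lam by (simp add: A_def)
    have "v $ 1 * A $ 2 $ 1 - v $ 2 * A $ 1 $ 1 = - v $ 2" "v $ 1 * A $ 2 $ 2 - v $ 2 * A $ 1 $ 2 = v $ 1"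
      using lA[of "vector [1, 0]"] lA[of "vector [0, 1]"] by (simp_all add: l_def matrix_vector_mult_def sum_2)
    then have e1: "v $ 1 * A $ 2 $ 1 = v $ 2 * (A $ 1 $ 1 - 1)" and e2: "v $ 1 * (A $ 2 $ 2 - 1) = v $ 2 * A $ 1 $ 2"
      by (simp_all add: algebra_simps)
    have "v $ 1 * ((A $ 1 $ 1 - 1) * (A $ 2 $ 2 - 1)) = v $ 1 * (A $ 1 $ 2 * A $ 2 $ 1)"
    proof -
      have "v $ 1 * ((A $ 1 $ 1 - 1) * (A $ 2 $ 2 - 1)) = (A $ 1 $ 1 - 1) * (v $ 1 * (A $ 2 $ 2 - 1))" by (simp only: mult_ac)
      also have "\<dots> = A $ 1 $ 2 * (v $ 2 * (A $ 1 $ 1 - 1))" unfolding e2 by (simp only: mult_ac)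
      also have "\<dots> = v $ 1 * (A $ 1 $ 2 * A $ 2 $ 1)" unfolding e1[symmetric] by (simp only: mult_ac)
      finally show ?thesis .
    qed
    moreover have "v $ 2 * ((A $ 1 $ 1 - 1) * (A $ 2 $ 2 - 1)) = v $ 2 * (A $ 1 $ 2 * A $ 2 $ 1)"
    proof -
      have "v $ 2 * ((A $ 1 $ 1 - 1) * (A $ 2 $ 2 - 1)) = (v $ 2 * (A $ 1 $ 1 - 1)) * (A $ 2 $ 2 - 1)" by (simp only: mult_ac)
      also have "\<dots> = A $ 2 $ 1 * (v $ 1 * (A $ 2 $ 2 - 1))" unfolding e1[symmetric] by (simp only: mult_ac)
      also have "\<dots> = v $ 2 * (A $ 1 $ 2 * A $ 2 $ 1)" unfolding e2 by (simp only: mult_ac)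
      finally show ?thesis .
    qed
    moreover have "v $ 1 \<noteq> 0 \<or> v $ 2 \<noteq> 0" using v(1) by (auto simp: vec_eq_iff forall_2)
    ultimately have "(A $ 1 $ 1 - 1) * (A $ 2 $ 2 - 1) = A $ 1 $ 2 * A $ 2 $ 1" by auto
    then obtain h where h: "h \<noteq> 0" "A *v h = h" using eigenvector_2[of A 1] by auto
    have "pseudo_reflection A"
      unfolding pseudo_reflection_def
    proof (intro conjI exI[of _ N] exI[of _ "vec.span {h}"] ballI)
      show "A \<in> carrier GL" using subgroup.subset[OF sub] AG by blast
      show "A [^]\<^bsub>GL\<^esub> N = mat 1" by (rule N1[OF AG])
      show "vec.dim (vec.span {h}) + 1 = CARD(2)" using h(1) by (simp only: vec.dim_span vec.dim_singleton) simp
      fix x assume "x \<in> vec.span {h}"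
      then obtain c where "x = c *s h" by (auto simp: vec.span_singleton)
      then show "A *v x = x" using h(2) by (simp add: vector_scalar_commute)
    qed (use A1 N in auto)
    then show False using small AG by blast
  qed
  have "lam ^ N = 1" using Mn[of N w] N1[OF M(1)] w by simp
  moreover have "mu ^ n = 1" if "lam ^ n = 1" for n
  proof -
    have "mu ^ n *s v = 1 *s v" using Mn[of n v] faithful[OF that] by simp
    then show ?thesis using v(1) by (auto simp: vec_eq_iff)
  qed
  ultimately obtain e where e: "mu = lam ^ e" using primitive_root_powers[of lam N mu] N by blast
  have "l (A *v x) ^ e *s v = l x ^ e *s (A *v v)" if "A \<in> G" for A x
  proof -
    obtain n :: nat where n: "A = M [^]\<^bsub>GL\<^esub> n" using M(2)[OF \<open>A \<in> G\<close>] by blast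
    show ?thesis using Mn[of n x] by (simp add: n e power_mult_distrib mult.commute flip: power_mult)
  qed
  then show ?thesis using v(1) l_poly w lv l_lin by blast
qed

text \<open>A converse of \<open>cyclic_quotient_of_parametrization\<close>: \<open>\<theta>\<close>
  is the quotient map followed by the inverse of the given isomorphism.\<close>

lemma parametrization_of_cyclic_quotient:
  fixes V :: "(complex ^ 'n) set"
  assumes "cyclic_quotient_singularity V p"
  obtains G :: "(complex ^ 2 ^ 2) set" and d :: nat and \<theta> :: "complex ^ 2 \<Rightarrow> complex ^ 'n" where
    "small_finite_subgroup G" "d \<ge> 1" "GL\<lparr>carrier := G\<rparr> \<cong> integer_mod_group d"
    "\<And>f. f \<in> poly_funs \<Longrightarrow> (\<lambda>v. f (\<theta> v)) \<in> poly_funs" "\<And>v. \<theta> v \<in> V" "\<And>x. x \<in> V \<Longrightarrow> \<exists>v. \<theta> v = x"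
    "\<And>v w. \<theta> v = \<theta> w \<longleftrightarrow> (\<exists>A\<in>G. w = A *v v)"
    "\<And>h. h \<in> poly_funs \<Longrightarrow> (\<And>A v. A \<in> G \<Longrightarrow> h (A *v v) = h v) \<Longrightarrow> \<exists>f\<in>poly_funs. \<forall>v. h v = f (\<theta> v)"
proof -
  obtain G :: "(complex ^ 2 ^ 2) set" and d F where
    G: "small_finite_subgroup G" "d \<ge> 1" "GL\<lparr>carrier := G\<rparr> \<cong> integer_mod_group d"
    and F: "isomorphism (affine_fspace V) (quotient_variety G) F"
    using assms unfolding cyclic_quotient_singularity_def by blast
  have sub: "subgroup G GL" using G by (simp add: small_finite_subgroup_def)
  have pts: "points (quotient_variety G) = range (lin_orbit G)"
    by (auto simp: quotient_variety_def orbits_def lin_orbit_def)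
  have bij: "bij_betw F V (range (lin_orbit G))" and m1: "morphism (affine_fspace V) (quotient_variety G) F"
    and m2: "morphism (quotient_variety G) (affine_fspace V) (inv_into V F)"
    using F by (auto simp: isomorphism_def pts)
  define \<theta> where "\<theta> = (\<lambda>v. inv_into V F (lin_orbit G v))"
  have F\<theta>: "F (\<theta> v) = lin_orbit G v" and \<theta>V: "\<theta> v \<in> V" for v
    using bij f_inv_into_f[of "lin_orbit G v" F V] inv_into_into[of "lin_orbit G v" F V] by (auto simp: \<theta>_def bij_betw_def)
  have orb: "\<theta> v = \<theta> w \<longleftrightarrow> (\<exists>A\<in>G. w = A *v v)" for v w
  proof -
    have "\<theta> v = \<theta> w \<longleftrightarrow> lin_orbit G v = lin_orbit G w" using F\<theta> by (metis \<theta>_def)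
    then show ?thesis using lin_orbit_eq_iff[OF sub] by simp
  qed
  show ?thesis
  proof (rule that[OF G, of \<theta>])
    show "(\<lambda>v. f (\<theta> v)) \<in> poly_funs" if "f \<in> poly_funs" for f
    proof -
      have "f \<circ> inv_into V F \<in> regfuns (quotient_variety G)"
        using m2 poly_funs_regfuns[OF that] unfolding morphism_def by blast
      then show ?thesis by (simp add: quotient_variety_def \<theta>_def comp_def)
    qed
    show "\<exists>v. \<theta> v = x" if x: "x \<in> V" for x
    proof -
      have "F x \<in> range (lin_orbit G)" by (rule bij_betw_apply[OF bij x])
      then obtain v where "F x = lin_orbit G v" by blast
      then have "\<theta> v = inv_into V F (F x)" by (simp add: \<theta>_def)
      then show ?thesis using inv_into_f_f[OF bij_betw_imp_inj_on[OF bij] x] by metis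
    qed
    show "\<exists>f\<in>poly_funs. \<forall>v. h v = f (\<theta> v)"
      if h: "h \<in> poly_funs" and inv: "\<And>A v. A \<in> G \<Longrightarrow> h (A *v v) = h v" for h
    proof -
      define g where "g = (\<lambda>O'. h (SOME v. lin_orbit G v = O'))"
      have g: "g (lin_orbit G v) = h v" for v
      proof -
        have "lin_orbit G (SOME w. lin_orbit G w = lin_orbit G v) = lin_orbit G v" by (rule someI[of _ v]) simp
        then obtain A where "A \<in> G" "v = A *v (SOME w. lin_orbit G w = lin_orbit G v)"
          unfolding lin_orbit_eq_iff[OF sub] by blast
        then show ?thesis unfolding g_def using inv by metis
      qed
      then have "g \<circ> lin_orbit G = h" by auto
      then have "g \<in> regfuns (quotient_variety G)" using h by (simp add: quotient_variety_def)
      then have "g \<circ> F \<in> regfuns (affine_fspace V)" using m1 unfolding morphism_def by blast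
      then obtain f where f: "f \<in> poly_funs" "\<And>x. x \<in> V \<Longrightarrow> g (F x) = f x" by (auto simp: regfuns_affine)
      have "h v = f (\<theta> v)" for v using f(2)[OF \<theta>V[of v]] F\<theta>[of v] g by simp
      then show ?thesis using f(1) by blast
    qed
  qed (rule \<theta>V, rule orb)
qed

lemma cyclic_quotient_imp_Cplus_action:
  fixes V :: "(complex ^ 'n) set"
  assumes "cyclic_quotient_singularity V p"
  shows "\<exists>\<psi>. regular_action Cplus Cplus_space (affine_fspace V) \<psi> \<and> nontrivial_action Cplus (affine_fspace V) \<psi>"
  using assms
proof (rule parametrization_of_cyclic_quotient)
  fix G :: "(complex ^ 2 ^ 2) set" and d :: nat and \<theta> :: "complex ^ 2 \<Rightarrow> complex ^ 'n"
  assume G: "small_finite_subgroup G" "d \<ge> 1" "GL\<lparr>carrier := G\<rparr> \<cong> integer_mod_group d"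
    and \<theta>: "\<And>f. f \<in> poly_funs \<Longrightarrow> (\<lambda>v. f (\<theta> v)) \<in> poly_funs" "\<And>v. \<theta> v \<in> V" "\<And>x. x \<in> V \<Longrightarrow> \<exists>v. \<theta> v = x"
    and orb: "\<And>v w. \<theta> v = \<theta> w \<longleftrightarrow> (\<exists>A\<in>G. w = A *v v)"
    and inv: "\<And>h. h \<in> poly_funs \<Longrightarrow> (\<And>A v. A \<in> G \<Longrightarrow> h (A *v v) = h v) \<Longrightarrow> \<exists>f\<in>poly_funs. \<forall>v. h v = f (\<theta> v)"
  obtain v w l and e :: nat where v0: "v \<noteq> 0" and l: "l \<in> poly_funs" "l w = 1" "l v = 0"
    and l_lin: "\<And>x y c. l (x + c *s y) = l x + c * l y"
    and semi: "\<And>A x. A \<in> G \<Longrightarrow> l (A *v x) ^ e *s v = l x ^ e *s (A *v v)"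
    using small_cyclic_semi_invariant[OF G] by metis
  \<comment> \<open>A translation along \<open>v\<close> by an amount that depends on
    \<open>l\<close> only. As \<open>l v = 0\<close>, it leaves \<open>l\<close> unchanged and is
    therefore additive in \<open>s\<close>; the exponent \<open>e\<close> makes the displacement
    transform like a vector under the group.\<close>
  define Psi where "Psi = (\<lambda>s x. x + (s * l x ^ e) *s v)"
  have Psi: "Psi s x = x + (s * l x ^ e) *s v" for s x by (simp add: Psi_def)
  have Psi_G: "Psi s (A *v x) = A *v Psi s x" if "A \<in> G" for A s x
  proof -
    have "(s * l (A *v x) ^ e) *s v = s *s (l x ^ e *s (A *v v))" by (simp flip: semi[OF that])
    then show ?thesis by (simp add: Psi_def matrix_vector_right_distrib vector_scalar_commute)
  qed
  have l_Psi: "l (Psi s x) = l x" for s x unfolding Psi_def l_lin using l(3) by simp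
  have Psi_add: "Psi (s + t) x = Psi s (Psi t x)" for s t x
  proof -
    have "Psi s (Psi t x) = Psi t x + (s * l x ^ e) *s v" by (simp only: Psi[of s "Psi t x"] l_Psi)
    also have "\<dots> = Psi (s + t) x" by (simp add: Psi vec_eq_iff algebra_simps)
    finally show ?thesis ..
  qed
  \<comment> \<open>The value \<open>undefined\<close> off \<open>V\<close> is forced by the
    extensionality that group actions require.\<close>
  define \<psi> where "\<psi> = (\<lambda>s x. if x \<in> V then \<theta> (Psi s (SOME v. \<theta> v = x)) else undefined)"
  have \<psi>: "\<psi> s (\<theta> x) = \<theta> (Psi s x)" for s x
  proof -
    have "\<theta> (SOME w. \<theta> w = \<theta> x) = \<theta> x" by (rule someI[of _ x]) simp
    then obtain A where A: "A \<in> G" "x = A *v (SOME w. \<theta> w = \<theta> x)" unfolding orb by blast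
    have "\<theta> (Psi s (SOME w. \<theta> w = \<theta> x)) = \<theta> (A *v Psi s (SOME w. \<theta> w = \<theta> x))" using orb A(1) by blast
    then show ?thesis using A \<theta>(2)[of x] unfolding \<psi>_def by (simp flip: Psi_G)
  qed
  have act: "group_action Cplus V \<psi>"
  proof (rule group_actionI)
    show "group Cplus" by (rule group_Cplus)
    show "\<psi> t \<in> extensional V" for t by (auto simp: \<psi>_def extensional_def)
    show "\<psi> t x \<in> V" if "x \<in> V" for t x using that \<theta>(2) by (simp add: \<psi>_def)
    fix x assume "x \<in> V"
    then obtain u where u: "x = \<theta> u" using \<theta>(3) by blast
    show "\<psi> \<one>\<^bsub>Cplus\<^esub> x = x" by (simp add: u \<psi> Cplus_def) (simp add: Psi_def)
    show "\<psi> (s \<otimes>\<^bsub>Cplus\<^esub> t) x = \<psi> s (\<psi> t x)" for s t by (simp add: u \<psi> Cplus_def Psi_add)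
  qed
  define S where "S = (\<lambda>f. f \<circ> fst) ` regfuns Cplus_space \<union> (\<lambda>g. g \<circ> snd) ` regfuns (affine_fspace V)"
  have reg: "\<exists>k\<in>gen_algebra S. \<forall>s. \<forall>x\<in>V. f (\<psi> s x) = k (s, x)" if f: "f \<in> poly_funs" for f
  proof -
    have "\<exists>P\<in>poly_family poly_funs. \<forall>x s. True \<longrightarrow> f (\<theta> (Psi s x)) = poly (P x) s"
    proof (rule poly_funs_curve[OF \<theta>(1)[OF f]])
      fix g assume "g \<in> range (\<lambda>i x. (x :: complex ^ 2) $ i)"
      then obtain i where g: "g = (\<lambda>x. x $ i)" by auto
      have "(\<lambda>x. [:x $ i:] + monom (l x ^ e * v $ i) 1) \<in> poly_family poly_funs"
        by (intro poly_funs_family_add poly_funs_family_const poly_funs_family_monom poly_funs_mult poly_funs_power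
            poly_funs_const poly_funs_coord l)
      then show "\<exists>P\<in>poly_family poly_funs. \<forall>x s. True \<longrightarrow> g (Psi s x) = poly (P x) s"
        by (rule bexI[rotated]) (simp add: g Psi_def poly_monom mult_ac)
    qed
    then obtain P where P: "P \<in> poly_family poly_funs" "\<And>x s. f (\<theta> (Psi s x)) = poly (P x) s" by blast
    obtain N where N: "\<And>x. degree (P x) \<le> N" using poly_family_degree[OF P(1)] by blast
    \<comment> \<open>The coefficients in \<open>s\<close> are invariant polynomials on the plane,
      hence descend to \<open>V\<close>; this is the regularity of the action.\<close>
    have "\<exists>c\<in>poly_funs. \<forall>x. coeff (P x) i = c (\<theta> x)" for i
    proof (rule inv[OF poly_familyD[OF P(1)]])
      fix A x assume A: "A \<in> G"
      have "\<theta> (A *v y) = \<theta> y" for y using orb[of y "A *v y"] A by metis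
      then have "poly (P (A *v x)) s = poly (P x) s" for s by (simp add: Psi_G[OF A] flip: P(2))
      then have "P (A *v x) = P x" by (intro poly_eqI_nonzero)
      then show "coeff (P (A *v x)) i = coeff (P x) i" by simp
    qed
    then obtain c where c: "\<And>i. c i \<in> poly_funs" "\<And>i x. coeff (P x) i = c i (\<theta> x)" by metis
    define k where "k = (\<lambda>z. \<Sum>i\<le>N. c i (snd z) * fst z ^ i)"
    have "(\<lambda>t. t) \<in> regfuns Cplus_space"
      unfolding Cplus_space_def regfuns_gen
      by (intro CollectI bexI[of _ "\<lambda>t. t"] gen_algebra.gen) auto
    then have "(\<lambda>t. t) \<circ> fst \<in> S" unfolding S_def by (intro UnI1 imageI)
    then have 1: "fst \<in> gen_algebra S" using gen_algebra.gen by (fastforce simp: comp_def)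
    have "c i \<circ> snd \<in> S" for i unfolding S_def by (intro UnI2 imageI poly_funs_regfuns c)
    then have 2: "(\<lambda>z. c i (snd z)) \<in> gen_algebra S" for i using gen_algebra.gen by (fastforce simp: comp_def)
    have "k \<in> gen_algebra S" unfolding k_def
      by (intro gen_algebra_sum gen_algebra.mult gen_algebra_power 1 2)
    moreover have "f (\<psi> s x) = k (s, x)" if x: "x \<in> V" for s x
    proof -
      obtain u where u: "x = \<theta> u" using \<theta>(3)[OF x] by blast
      show ?thesis unfolding u \<psi> P(2) k_def poly_eq_sum_le[OF N] by (simp add: c(2))
    qed
    ultimately show ?thesis by blast
  qed
  have "morphism (prod_fspace Cplus_space (affine_fspace V)) (affine_fspace V) (\<lambda>(t, x). \<psi> t x)"
    unfolding morphism_def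
  proof (intro conjI ballI)
    show "(\<lambda>(t, x). \<psi> t x) \<in> points (prod_fspace Cplus_space (affine_fspace V)) \<rightarrow> points (affine_fspace V)"
      using \<theta>(2) by (auto simp: prod_fspace_def \<psi>_def)
    fix g assume "g \<in> regfuns (affine_fspace V)"
    then obtain f where f: "f \<in> poly_funs" "\<And>x. x \<in> V \<Longrightarrow> g x = f x" by (auto simp: regfuns_affine)
    obtain k where k: "k \<in> gen_algebra S" "\<And>s x. x \<in> V \<Longrightarrow> f (\<psi> s x) = k (s, x)" using reg[OF f(1)] by blast
    have "g (\<psi> s x) = k (s, x)" if "x \<in> V" for s x
      using k(2)[OF that, of s] f(2)[of "\<psi> s x"] \<theta>(2) that by (simp add: \<psi>_def)
    then show "g \<circ> (\<lambda>(t, x). \<psi> t x) \<in> regfuns (prod_fspace Cplus_space (affine_fspace V))"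
      unfolding prod_fspace_def regfuns_gen S_def[symmetric] using k(1) by (auto simp: points_affine)
  qed
  then have "regular_action Cplus Cplus_space (affine_fspace V) \<psi>"
    unfolding regular_action_def using act by simp
  \<comment> \<open>Since \<open>l w = 1\<close>, the orbit of \<open>w\<close> in the plane is
    infinite and cannot lie in a single orbit of the finite group.\<close>
  moreover have "\<exists>s. \<psi> s (\<theta> w) \<noteq> \<theta> w"
  proof (rule ccontr)
    assume "\<not> (\<exists>s. \<psi> s (\<theta> w) \<noteq> \<theta> w)"
    then have "\<theta> w = \<theta> (Psi s w)" for s unfolding \<psi> by metis
    then have "Psi s w \<in> (\<lambda>A. A *v w) ` G" for s unfolding orb by blast
    then have "range (\<lambda>s. Psi s w) \<subseteq> (\<lambda>A. A *v w) ` G" by blast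
    moreover have "finite G" using G(1) by (simp add: small_finite_subgroup_def)
    ultimately have "finite (range (\<lambda>s. Psi s w))" by (meson finite_imageI finite_subset)
    moreover have "inj (\<lambda>s. Psi s w)"
    proof (rule injI)
      fix s t assume "Psi s w = Psi t w"
      then have "s *s v = t *s v" by (simp add: Psi_def l(2))
      then show "s = t" using v0 by (auto simp: vec_eq_iff)
    qed
    ultimately have "finite (UNIV :: complex set)" by (rule finite_imageD)
    then show False using infinite_UNIV_char_0 by blast
  qed
  then have "nontrivial_action Cplus (affine_fspace V) \<psi>"
    unfolding nontrivial_action_def using \<theta>(2) by (auto simp: Cplus_def)
  ultimately show ?thesis by blast
qed

theorem theorem2p13:
  fixes V :: "(complex ^ 'n) set"
    and p :: "complex ^ 'n"
    and \<phi> :: "complex \<Rightarrow> complex ^ 'n \<Rightarrow> complex ^ 'n"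
  assumes "affine_surface V"
    and "good_Cstar_action V \<phi>"
    and "isolated_normal_singularity V p"
  shows "(\<exists>\<psi>. regular_action Cplus Cplus_space (affine_fspace V) \<psi> \<and>
              nontrivial_action Cplus (affine_fspace V) \<psi>)
         \<longleftrightarrow> cyclic_quotient_singularity V p"
proof
  assume "cyclic_quotient_singularity V p"
  then show "\<exists>\<psi>. regular_action Cplus Cplus_space (affine_fspace V) \<psi> \<and> nontrivial_action Cplus (affine_fspace V) \<psi>"
    by (rule cyclic_quotient_imp_Cplus_action)
next
  assume "\<exists>\<psi>. regular_action Cplus Cplus_space (affine_fspace V) \<psi> \<and> nontrivial_action Cplus (affine_fspace V) \<psi>"
  then obtain \<psi> where \<psi>: "regular_action Cplus Cplus_space (affine_fspace V) \<psi>" "nontrivial_action Cplus (affine_fspace V) \<psi>"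
    by blast
  have irr: "irreducible_closed V" and dim: "zariski_dim V = 2" using assms(1) by (auto simp: affine_surface_def)
  obtain q where "graded_variety V q \<phi>" using good_Cstar_action_graded[OF irr assms(2)] by blast
  then interpret graded_variety V q \<phi> .
  have iso: "p isolated_in singular_locus V" and normal: "normal_at V p"
    using assms(3) by (auto simp: isolated_normal_singularity_def)
  \<comment> \<open>Normality is given at \<open>p\<close>, while the grading has its vertex at
    \<open>q\<close>.\<close>
  have p: "p = q" by (rule isolated_singularity_eq[OF iso])
  have "p \<in> singular_locus V" using iso by (simp add: isolated_in_def)
  then have "2 < enat (vec.dim (tangent_space V q))" by (simp add: singular_locus_def dim p)
  then have tangent: "\<not> vec.dim (tangent_space V q) \<le> 1" by (simp add: numeral_eq_enat)
  obtain s0 x0 where x0: "x0 \<in> V" "\<psi> s0 x0 \<noteq> x0" using \<psi>(2) by (auto simp: nontrivial_action_def)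
  obtain Ps eps where "homogeneous_additive_action V q \<phi> Ps eps"
    using homogeneous_additive_action_exists[OF Cplus_actionD[OF \<psi>(1)] Cplus_action_poly[OF \<psi>(1)] x0] by blast
  then interpret homogeneous_additive_action V q \<phi> Ps eps .
  obtain k0 u b y x1 u0 w0 where gp: "k0 > 0" "homogeneous k0 u" "homogeneous b y" "x1 \<in> V" "u0 \<noteq> 0" "w0 \<noteq> 0"
    "dps u x1 = [:u0:]" "dps y x1 = [:0, w0:]" using generic_point[OF tangent] by blast
  interpret generic_surface V q \<phi> Ps eps k0 b u y x1 u0 w0
    by unfold_locales (use gp dim normal p in auto)
  show "cyclic_quotient_singularity V p" unfolding p by (rule cyclic_quotient)
qed

end
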